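(* Assume $\mathrm{RP}_{\mathrm{internal}}$. Let $R$ be a ring with $|R|\le\aleph_1$ and $\mathcal{C}$ a collection of countably-presented $R$-modules. Then the class of $\sigma$-closed potentially $\mathcal{C}$-filtered $R$-modules is $\aleph_2$-club-compact.
   Context: $M$ is $\mathcal{C}$-filtered if it has a filtration $\langle M_i:i<\eta\rangle$ (increasing, continuous at limits, union $M$) with $M_0=\{0\}$ and each $M_{i+1}/M_i$ ($i+1<\eta$) isomorphic to a member of $\mathcal{C}$. $M$ is $\sigma$-closed potentially $\mathcal{C}$-filtered if some $\sigma$-closed forcing poset forces that $M$ is $\mathcal{C}$-filtered ($\mathcal{C}$ the ground-model class). For a class $\Gamma$ of $R$-modules and module $M$, $\wp^\Gamma_{\omega_2}(M)=\{W\subseteq M: |W|<\aleph_2,\ \langle W\rangle\in\Gamma\}$. $\Gamma$ is $\aleph_2$-club-compact if for every $R$-module $M$: whenever $\wp^\Gamma_{\omega_2}(M)$ contains a closed unbounded subset of $\wp_{\omega_2}(M)$ (the set of subsets of $M$ of size $<\aleph_2$; club means $\subseteq$-cofinal and closed under unions of increasing chains of length $<\omega_2$), then $M\in\Gamma$. $\mathrm{RP}_{\mathrm{internal}}$: for every uncountable $X$, stationary $S\subseteq[X]^\omega$, regular $\theta$ with $X\in H_\theta$, and first-order structure $\mathfrak{A}$ in a countable language expanding $(H_\theta,\in,X,S)$, there is $W\prec\mathfrak{A}$ with $|W|=\omega_1\subseteq W$ such that $S\cap W\cap[W\cap X]^\omega$ is stationary in $[W\cap X]^\omega$. *)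

theory Defs
  imports "HOL-Algebra.Module" "HOL-Library.Countable_Set"
begin

unbundle cardinal_syntax

section \<open>The set-theoretic universe\<close>

text \<open>
  The development takes place in a universe of sets: a type \<open>'v\<close> satisfying the axioms of
  ZFC, with replacement stated for arbitrary functions on \<open>'v\<close> (choice is inherited from HOL).
  Elements of \<open>'v\<close> are the sets, HOL sets of type \<open>'v set\<close> are the classes. Separation follows
  from replacement; it is listed for convenience.
\<close>

class zfc =
  fixes elts :: "'a \<Rightarrow> 'a set"
  assumes extensionality: "elts x = elts y \<Longrightarrow> x = y"
    and foundation: "wf {(x, y). x \<in> elts y}"
    and pairing: "\<exists>z. elts z = {x, y}"
    and union: "\<exists>z. elts z = (\<Union>y \<in> elts x. elts y)"
    and powerset: "\<exists>z. elts z = {y. elts y \<subseteq> elts x}"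
    and separation: "\<exists>z. elts z = {y \<in> elts x. \<phi> y}"
    and replacement: "\<exists>z. elts z = F ` elts x"
    and infinity: "\<exists>x. (\<exists>z \<in> elts x. elts z = {}) \<and>
                       (\<forall>y \<in> elts x. \<exists>z \<in> elts x. elts z = insert y (elts y))"

definition small :: "'v::zfc set \<Rightarrow> bool"
  where "small A \<longleftrightarrow> A \<in> range elts"

text \<open>The set with a given (small) extension.\<close>

definition vset :: "'v::zfc set \<Rightarrow> 'v"
  where "vset A = (THE x. elts x = A)"

definition opair :: "'v::zfc \<Rightarrow> 'v \<Rightarrow> 'v"
  where "opair x y = vset {vset {x}, vset {x, y}}"

definition Ord :: "'v::zfc \<Rightarrow> bool"
  where "Ord \<alpha> \<longleftrightarrow> (\<forall>\<beta> \<in> elts \<alpha>. elts \<beta> \<subseteq> elts \<alpha>) \<and>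
                 (\<forall>\<beta> \<in> elts \<alpha>. \<forall>\<gamma> \<in> elts \<beta>. elts \<gamma> \<subseteq> elts \<beta>)"

definition omega1 :: "'v::zfc set"
  where "omega1 = {\<alpha>. Ord \<alpha> \<and> countable (elts \<alpha>)}"

text \<open>Infinite regular cardinals, as initial von Neumann ordinals.\<close>

definition regular_cardinal :: "'v::zfc \<Rightarrow> bool"
  where "regular_cardinal \<theta> \<longleftrightarrow> Ord \<theta> \<and> infinite (elts \<theta>) \<and>
           (\<forall>\<alpha> \<in> elts \<theta>. |elts \<alpha>| <o |elts \<theta>| ) \<and> regularCard |elts \<theta>|"

definition tr_closure :: "'v::zfc \<Rightarrow> 'v set"
  where "tr_closure x = {y. (y, x) \<in> {(u, v). u \<in> elts v}\<^sup>+}"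

definition H :: "'v::zfc \<Rightarrow> 'v set"
  where "H \<theta> = {x. |tr_closure x| <o |elts \<theta>| }"

abbreviation aleph1 :: "nat set rel"
  where "aleph1 \<equiv> cardSuc natLeq"

abbreviation aleph2 :: "nat set set rel"
  where "aleph2 \<equiv> cardSuc aleph1"

section \<open>Clubs and stationary sets\<close>

text \<open>
  \<open>club \<kappa> \<P> D\<close>: \<open>D\<close> is a \<open>\<subseteq>\<close>-cofinal subset of the family \<open>\<P>\<close>, closed under unions of
  nonempty \<open>\<subseteq>\<close>-increasing sequences whose length is an ordinal \<open>\<alpha> < \<kappa>\<close> (equivalently, for a
  cardinal \<open>\<kappa>\<close>, an ordinal of cardinality less than \<open>\<kappa>\<close>).
\<close>

definition club :: "'k rel \<Rightarrow> 'v::zfc set set \<Rightarrow> 'v set set \<Rightarrow> bool"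
  where "club \<kappa> \<P> D \<longleftrightarrow> D \<subseteq> \<P> \<and> (\<forall>A \<in> \<P>. \<exists>B \<in> D. A \<subseteq> B) \<and>
           (\<forall>\<alpha> (W :: 'v \<Rightarrow> 'v set).
              Ord \<alpha> \<and> elts \<alpha> \<noteq> {} \<and> |elts \<alpha>| <o \<kappa> \<and>
              (\<forall>i \<in> elts \<alpha>. W i \<in> D) \<and>
              (\<forall>j \<in> elts \<alpha>. \<forall>i \<in> elts j. W i \<subseteq> W j)
              \<longrightarrow> (\<Union>i \<in> elts \<alpha>. W i) \<in> D)"

text \<open>\<open>[A]\<^sup>\<omega>\<close> consists of the countably infinite subsets of \<open>A\<close>.\<close>

definition ctbl_subsets :: "'v set \<Rightarrow> 'v set set"
  where "ctbl_subsets A = {a. a \<subseteq> A \<and> infinite a \<and> countable a}"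

definition stationary :: "'v::zfc set \<Rightarrow> 'v set set \<Rightarrow> bool"
  where "stationary A S \<longleftrightarrow> S \<subseteq> ctbl_subsets A \<and>
           (\<forall>D. club aleph1 (ctbl_subsets A) D \<longrightarrow> S \<inter> D \<noteq> {})"

section \<open>First-order structures and the reflection principle\<close>

text \<open>
  Symbols are numbers, and each number may be used with any number of arguments; so a countable
  language is encoded by the pairs (symbol, arity), and a structure consists of a domain together
  with interpretations \<open>F\<close> of the function symbols and \<open>P\<close> of the relation symbols.
  Smaller languages are obtained by interpreting the remaining symbols trivially.
\<close>

datatype tm = Var nat | Fun nat "tm list"

datatype fm = Eq tm tm | Rel nat "tm list" | Neg fm | Conj fm fm | Exists nat fm

primrec tm_val :: "(nat \<Rightarrow> 'a list \<Rightarrow> 'a) \<Rightarrow> (nat \<Rightarrow> 'a) \<Rightarrow> tm \<Rightarrow> 'a"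
  where
    "tm_val F e (Var n) = e n"
  | "tm_val F e (Fun f ts) = F f (map (tm_val F e) ts)"

primrec sat :: "'a set \<Rightarrow> (nat \<Rightarrow> 'a list \<Rightarrow> 'a) \<Rightarrow> (nat \<Rightarrow> 'a list \<Rightarrow> bool) \<Rightarrow>
                (nat \<Rightarrow> 'a) \<Rightarrow> fm \<Rightarrow> bool"
  where
    "sat A F P e (Eq s t) \<longleftrightarrow> tm_val F e s = tm_val F e t"
  | "sat A F P e (Rel r ts) \<longleftrightarrow> P r (map (tm_val F e) ts)"
  | "sat A F P e (Neg \<phi>) \<longleftrightarrow> \<not> sat A F P e \<phi>"
  | "sat A F P e (Conj \<phi> \<psi>) \<longleftrightarrow> sat A F P e \<phi> \<and> sat A F P e \<psi>"
  | "sat A F P e (Exists n \<phi>) \<longleftrightarrow> (\<exists>a \<in> A. sat A F P (e(n := a)) \<phi>)"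

definition fo_structure :: "'a set \<Rightarrow> (nat \<Rightarrow> 'a list \<Rightarrow> 'a) \<Rightarrow> bool"
  where "fo_structure A F \<longleftrightarrow> A \<noteq> {} \<and> (\<forall>f xs. set xs \<subseteq> A \<longrightarrow> F f xs \<in> A)"

definition elementary_substructure ::
    "'a set \<Rightarrow> 'a set \<Rightarrow> (nat \<Rightarrow> 'a list \<Rightarrow> 'a) \<Rightarrow> (nat \<Rightarrow> 'a list \<Rightarrow> bool) \<Rightarrow> bool"
  where "elementary_substructure W A F P \<longleftrightarrow>
           W \<subseteq> A \<and> fo_structure W F \<and>
           (\<forall>\<phi> e. range e \<subseteq> W \<longrightarrow> (sat W F P e \<phi> \<longleftrightarrow> sat A F P e \<phi>))"

text \<open>
  The structure expands \<open>(H\<^bsub>\<theta>\<^esub>, \<in>, X, S)\<close>: the constant \<open>0\<close> denotes \<open>X\<close>, the binary relation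
  symbol \<open>0\<close> denotes membership, and the unary relation symbol \<open>1\<close> denotes \<open>S\<close>.
\<close>

definition RP_internal :: "'v::zfc itself \<Rightarrow> bool"
  where "RP_internal (_ :: 'v itself) \<longleftrightarrow>
    (\<forall>(X :: 'v) (S :: 'v set) \<theta> F P.
       uncountable (elts X) \<and> stationary (elts X) (elts ` S) \<and>
       regular_cardinal \<theta> \<and> X \<in> H \<theta> \<and>
       fo_structure (H \<theta>) F \<and> F 0 [] = X \<and>
       (\<forall>x \<in> H \<theta>. \<forall>y \<in> H \<theta>. P 0 [x, y] \<longleftrightarrow> x \<in> elts y) \<and>
       (\<forall>x \<in> H \<theta>. P 1 [x] \<longleftrightarrow> x \<in> S)
       \<longrightarrow> (\<exists>W. elementary_substructure W (H \<theta>) F P \<and> |W| =o aleph1 \<and> omega1 \<subseteq> W \<and>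
                stationary (W \<inter> elts X)
                  (elts ` (S \<inter> W) \<inter> ctbl_subsets (W \<inter> elts X))))"

section \<open>Modules\<close>

text \<open>
  Left modules over a not necessarily commutative ring; the locale \<^locale>\<open>module\<close> of the
  library requires commutativity.
\<close>

locale left_module = R?: ring R + M?: abelian_group M
  for R :: "('r, 'x) ring_scheme" (structure) and M :: "('r, 'm, 'y) module_scheme" (structure) +
  assumes smult_closed:
      "\<lbrakk>a \<in> carrier R; x \<in> carrier M\<rbrakk> \<Longrightarrow> a \<odot>\<^bsub>M\<^esub> x \<in> carrier M"
    and smult_l_distr:
      "\<lbrakk>a \<in> carrier R; b \<in> carrier R; x \<in> carrier M\<rbrakk> \<Longrightarrow>
       (a \<oplus>\<^bsub>R\<^esub> b) \<odot>\<^bsub>M\<^esub> x = a \<odot>\<^bsub>M\<^esub> x \<oplus>\<^bsub>M\<^esub> b \<odot>\<^bsub>M\<^esub> x"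
    and smult_r_distr:
      "\<lbrakk>a \<in> carrier R; x \<in> carrier M; y \<in> carrier M\<rbrakk> \<Longrightarrow>
       a \<odot>\<^bsub>M\<^esub> (x \<oplus>\<^bsub>M\<^esub> y) = a \<odot>\<^bsub>M\<^esub> x \<oplus>\<^bsub>M\<^esub> a \<odot>\<^bsub>M\<^esub> y"
    and smult_assoc1:
      "\<lbrakk>a \<in> carrier R; b \<in> carrier R; x \<in> carrier M\<rbrakk> \<Longrightarrow>
       (a \<otimes>\<^bsub>R\<^esub> b) \<odot>\<^bsub>M\<^esub> x = a \<odot>\<^bsub>M\<^esub> (b \<odot>\<^bsub>M\<^esub> x)"
    and smult_one:
      "x \<in> carrier M \<Longrightarrow> \<one>\<^bsub>R\<^esub> \<odot>\<^bsub>M\<^esub> x = x"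

definition span :: "('r, 'x) ring_scheme \<Rightarrow> ('r, 'm, 'y) module_scheme \<Rightarrow> 'm set \<Rightarrow> 'm set"
  where "span R M W = \<Inter>{N. submodule N R M \<and> W \<subseteq> N}"

definition module_hom ::
    "('r, 'x) ring_scheme \<Rightarrow> ('r, 'm, 'y) module_scheme \<Rightarrow> ('r, 'n, 'z) module_scheme \<Rightarrow>
     ('m \<Rightarrow> 'n) set"
  where "module_hom R M N = {h \<in> carrier M \<rightarrow> carrier N.
           (\<forall>x \<in> carrier M. \<forall>y \<in> carrier M. h (x \<oplus>\<^bsub>M\<^esub> y) = h x \<oplus>\<^bsub>N\<^esub> h y) \<and>
           (\<forall>a \<in> carrier R. \<forall>x \<in> carrier M. h (a \<odot>\<^bsub>M\<^esub> x) = a \<odot>\<^bsub>N\<^esub> h x)}"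

text \<open>\<open>R\<^bsup>(I)\<^esup>\<close>; the fields \<open>mult\<close> and \<open>one\<close> of the record are irrelevant for modules.\<close>

definition free_module :: "('r, 'x) ring_scheme \<Rightarrow> 'i set \<Rightarrow> ('r, 'i \<Rightarrow> 'r) module"
  where "free_module R I =
    \<lparr>carrier = {c. (\<forall>i \<in> I. c i \<in> carrier R) \<and> (\<forall>i. i \<notin> I \<longrightarrow> c i = \<zero>\<^bsub>R\<^esub>) \<and>
                   finite {i. c i \<noteq> \<zero>\<^bsub>R\<^esub>}},
     mult = undefined, one = undefined,
     zero = (\<lambda>i. \<zero>\<^bsub>R\<^esub>), add = (\<lambda>c d i. c i \<oplus>\<^bsub>R\<^esub> d i),
     smult = (\<lambda>a c i. a \<otimes>\<^bsub>R\<^esub> c i)\<rparr>"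

definition countably_presented ::
    "('r, 'x) ring_scheme \<Rightarrow> ('r, 'm, 'y) module_scheme \<Rightarrow> bool"
  where "countably_presented R M \<longleftrightarrow>
    (\<exists>(I :: nat set) K h. let F = free_module R I in
       K \<subseteq> carrier F \<and> countable K \<and>
       h \<in> module_hom R F M \<and> h ` carrier F = carrier M \<and>
       {x \<in> carrier F. h x = \<zero>\<^bsub>M\<^esub>} = span R F K)"

text \<open>Modules in the universe: the elements are sets and form a set.\<close>

definition is_module :: "'v::zfc ring \<Rightarrow> ('v, 'v) module \<Rightarrow> bool"
  where "is_module R M \<longleftrightarrow> left_module R M \<and> small (carrier M)"

definition add_graph :: "('v::zfc, 'v) module \<Rightarrow> 'v"
  where "add_graph M =
           vset {opair (opair x y) (x \<oplus>\<^bsub>M\<^esub> y) | x y. x \<in> carrier M \<and> y \<in> carrier M}"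

definition smult_graph :: "'v::zfc ring \<Rightarrow> ('v, 'v) module \<Rightarrow> 'v"
  where "smult_graph R M =
           vset {opair (opair a x) (a \<odot>\<^bsub>M\<^esub> x) | a x. a \<in> carrier R \<and> x \<in> carrier M}"

section \<open>Forcing\<close>

text \<open>
  A forcing poset is a nonempty partially ordered set in the universe; \<open>(q, p) \<in> r\<close> means that
  \<open>q\<close> is a stronger condition than \<open>p\<close>.
\<close>

locale forcing_poset =
  fixes P :: "'v::zfc set" and r :: "'v rel"
  assumes small: "small P"
    and nonempty: "P \<noteq> {}"
    and partial_order: "partial_order_on P r"

definition sigma_closed :: "'v::zfc set \<Rightarrow> 'v rel \<Rightarrow> bool"
  where "sigma_closed P r \<longleftrightarrow>
           (\<forall>c :: nat \<Rightarrow> 'v. (\<forall>n. c n \<in> P \<and> (c (Suc n), c n) \<in> r)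
              \<longrightarrow> (\<exists>q \<in> P. \<forall>n. (q, c n) \<in> r))"

text \<open>
  A name is a set of pairs \<open>(\<sigma>, s)\<close> with \<open>\<sigma>\<close> a name and \<open>s\<close> a condition. Every set is used as a
  name; elements not of this form are ignored by the forcing relation.

  A formula of the forcing language is represented by the set of conditions forcing it
  (as a predicate on conditions): \<open>\<phi> p\<close> is read as \<open>p\<close> forces \<open>\<phi>\<close>.
\<close>

context forcing_poset
begin

text \<open>
  The usual recursion for \<open>p\<close> forcing \<open>\<sigma> = \<tau>\<close>: for each \<open>(\<pi>, s) \<in> \<sigma>\<close>, each \<open>q\<close> below \<open>p\<close> and
  \<open>s\<close> forces \<open>\<pi> \<in> \<tau>\<close>, and symmetrically; with the clause for membership (see \<open>fmem\<close>) unfolded.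
  The recursion is well-founded, so the inductive predicate is the unique solution.
\<close>

inductive feq :: "'v \<Rightarrow> 'v \<Rightarrow> 'v \<Rightarrow> bool"  (infix "\<^bold>=" 50)
  where feqI:
    "p \<in> P \<Longrightarrow>
     (\<forall>\<pi> s. opair \<pi> s \<in> elts \<sigma> \<longrightarrow>
        (\<forall>q. (q, p) \<in> r \<and> (q, s) \<in> r \<longrightarrow>
           (\<exists>q' \<rho> t. (q', q) \<in> r \<and> opair \<rho> t \<in> elts \<tau> \<and> (q', t) \<in> r \<and> feq \<pi> \<rho> q'))) \<Longrightarrow>
     (\<forall>\<rho> t. opair \<rho> t \<in> elts \<tau> \<longrightarrow>
        (\<forall>q. (q, p) \<in> r \<and> (q, t) \<in> r \<longrightarrow>
           (\<exists>q' \<pi> s. (q', q) \<in> r \<and> opair \<pi> s \<in> elts \<sigma> \<and> (q', s) \<in> r \<and> feq \<pi> \<rho> q'))) \<Longrightarrow>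
     feq \<sigma> \<tau> p"

definition fmem :: "'v \<Rightarrow> 'v \<Rightarrow> 'v \<Rightarrow> bool"  (infix "\<^bold>\<in>" 50)
  where "(\<pi> \<^bold>\<in> \<tau>) p \<longleftrightarrow>
    (\<forall>q. (q, p) \<in> r \<longrightarrow>
       (\<exists>q' \<rho> t. (q', q) \<in> r \<and> opair \<rho> t \<in> elts \<tau> \<and> (q', t) \<in> r \<and> (\<pi> \<^bold>= \<rho>) q'))"

definition fnot :: "('v \<Rightarrow> bool) \<Rightarrow> 'v \<Rightarrow> bool"  ("\<^bold>\<not> _" [40] 40)
  where "(\<^bold>\<not> \<phi>) p \<longleftrightarrow> (\<forall>q. (q, p) \<in> r \<longrightarrow> \<not> \<phi> q)"

definition fand :: "('v \<Rightarrow> bool) \<Rightarrow> ('v \<Rightarrow> bool) \<Rightarrow> 'v \<Rightarrow> bool"  (infixr "\<^bold>\<and>" 35)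
  where "(\<phi> \<^bold>\<and> \<psi>) p \<longleftrightarrow> \<phi> p \<and> \<psi> p"

text \<open>Quantification over all names, i.e.\ over the elements of the forcing extension.\<close>

definition fall :: "('v \<Rightarrow> 'v \<Rightarrow> bool) \<Rightarrow> 'v \<Rightarrow> bool"  (binder "\<^bold>\<forall>" 10)
  where "(\<^bold>\<forall>\<tau>. \<Phi> \<tau>) p \<longleftrightarrow> (\<forall>\<tau>. \<Phi> \<tau> p)"

definition fdisj :: "('v \<Rightarrow> bool) \<Rightarrow> ('v \<Rightarrow> bool) \<Rightarrow> 'v \<Rightarrow> bool"  (infixr "\<^bold>\<or>" 30)
  where "(\<phi> \<^bold>\<or> \<psi>) = (\<^bold>\<not> ((\<^bold>\<not> \<phi>) \<^bold>\<and> (\<^bold>\<not> \<psi>)))"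

definition fimp :: "('v \<Rightarrow> bool) \<Rightarrow> ('v \<Rightarrow> bool) \<Rightarrow> 'v \<Rightarrow> bool"  (infixr "\<^bold>\<longrightarrow>" 25)
  where "(\<phi> \<^bold>\<longrightarrow> \<psi>) = (\<^bold>\<not> (\<phi> \<^bold>\<and> (\<^bold>\<not> \<psi>)))"

definition fiff :: "('v \<Rightarrow> bool) \<Rightarrow> ('v \<Rightarrow> bool) \<Rightarrow> 'v \<Rightarrow> bool"  (infixr "\<^bold>\<longleftrightarrow>" 25)
  where "(\<phi> \<^bold>\<longleftrightarrow> \<psi>) = ((\<phi> \<^bold>\<longrightarrow> \<psi>) \<^bold>\<and> (\<psi> \<^bold>\<longrightarrow> \<phi>))"

definition fex :: "('v \<Rightarrow> 'v \<Rightarrow> bool) \<Rightarrow> 'v \<Rightarrow> bool"  (binder "\<^bold>\<exists>" 10)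
  where "(\<^bold>\<exists>\<tau>. \<Phi> \<tau>) = (\<^bold>\<not> (\<^bold>\<forall>\<tau>. \<^bold>\<not> \<Phi> \<tau>))"

text \<open>
  Existential quantification over a class \<open>\<C>\<close> of the ground model: \<open>p\<close> forces it iff the conditions
  \<open>q\<close> forcing \<open>\<Phi> C\<close> for some \<open>C \<in> \<C>\<close> are dense below \<open>p\<close>.
\<close>

definition fex_ground :: "'c set \<Rightarrow> ('c \<Rightarrow> 'v \<Rightarrow> bool) \<Rightarrow> 'v \<Rightarrow> bool"
  where "fex_ground \<C> \<Phi> = (\<^bold>\<not> (\<lambda>p. \<forall>C \<in> \<C>. (\<^bold>\<not> \<Phi> C) p))"

text \<open>Every condition is used in canonical names, since the poset need not have a largest element.\<close>

definition check :: "'v \<Rightarrow> 'v"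
  where "check = wfrec {(x, y). x \<in> elts y}
           (\<lambda>f x. vset {opair (f y) p | y p. y \<in> elts x \<and> p \<in> P})"

definition fpair :: "'v \<Rightarrow> 'v \<Rightarrow> 'v \<Rightarrow> 'v \<Rightarrow> bool"
  where "fpair z x y = (\<^bold>\<forall>w. w \<^bold>\<in> z \<^bold>\<longleftrightarrow>
           ((\<^bold>\<forall>u. u \<^bold>\<in> w \<^bold>\<longleftrightarrow> u \<^bold>= x) \<^bold>\<or> (\<^bold>\<forall>u. u \<^bold>\<in> w \<^bold>\<longleftrightarrow> (u \<^bold>= x \<^bold>\<or> u \<^bold>= y))))"

text \<open>\<open>(x, y) \<in> f\<close>\<close>

definition fapp :: "'v \<Rightarrow> 'v \<Rightarrow> 'v \<Rightarrow> 'v \<Rightarrow> bool"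
  where "fapp f x y = (\<^bold>\<exists>z. z \<^bold>\<in> f \<^bold>\<and> fpair z x y)"

definition fsubset :: "'v \<Rightarrow> 'v \<Rightarrow> 'v \<Rightarrow> bool"
  where "fsubset A B = (\<^bold>\<forall>x. x \<^bold>\<in> A \<^bold>\<longrightarrow> x \<^bold>\<in> B)"

definition ffunction_on :: "'v \<Rightarrow> 'v \<Rightarrow> 'v \<Rightarrow> bool"
  where "ffunction_on f A =
    ((\<^bold>\<forall>z. z \<^bold>\<in> f \<^bold>\<longrightarrow> (\<^bold>\<exists>x. x \<^bold>\<in> A \<^bold>\<and> (\<^bold>\<exists>y. fpair z x y))) \<^bold>\<and>
     (\<^bold>\<forall>x. x \<^bold>\<in> A \<^bold>\<longrightarrow> (\<^bold>\<exists>y. fapp f x y \<^bold>\<and> (\<^bold>\<forall>y'. fapp f x y' \<^bold>\<longrightarrow> y' \<^bold>= y))))"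

definition fbijection :: "'v \<Rightarrow> 'v \<Rightarrow> 'v \<Rightarrow> 'v \<Rightarrow> bool"
  where "fbijection f A B =
    (ffunction_on f A \<^bold>\<and>
     (\<^bold>\<forall>x y. fapp f x y \<^bold>\<longrightarrow> y \<^bold>\<in> B) \<^bold>\<and>
     (\<^bold>\<forall>x x' y. fapp f x y \<^bold>\<and> fapp f x' y \<^bold>\<longrightarrow> x \<^bold>= x') \<^bold>\<and>
     (\<^bold>\<forall>y. y \<^bold>\<in> B \<^bold>\<longrightarrow> (\<^bold>\<exists>x. fapp f x y)))"

definition ford :: "'v \<Rightarrow> 'v \<Rightarrow> bool"
  where "ford \<alpha> = ((\<^bold>\<forall>\<beta>. \<beta> \<^bold>\<in> \<alpha> \<^bold>\<longrightarrow> fsubset \<beta> \<alpha>) \<^bold>\<and>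
                  (\<^bold>\<forall>\<beta> \<gamma>. \<beta> \<^bold>\<in> \<alpha> \<^bold>\<and> \<gamma> \<^bold>\<in> \<beta> \<^bold>\<longrightarrow> fsubset \<gamma> \<beta>))"

definition fempty :: "'v \<Rightarrow> 'v \<Rightarrow> bool"
  where "fempty i = (\<^bold>\<not> (\<^bold>\<exists>u. u \<^bold>\<in> i))"

text \<open>\<open>j = i + 1\<close>\<close>

definition fsucc :: "'v \<Rightarrow> 'v \<Rightarrow> 'v \<Rightarrow> bool"
  where "fsucc j i = (\<^bold>\<forall>u. u \<^bold>\<in> j \<^bold>\<longleftrightarrow> (u \<^bold>\<in> i \<^bold>\<or> u \<^bold>= i))"

text \<open>A ground-model module \<open>M\<close>, viewed in the extension: \<open>z = x + y\<close> and \<open>z = a x\<close> in \<open>M\<close>.\<close>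

definition fcarrier :: "('v, 'v) module \<Rightarrow> 'v"
  where "fcarrier M = check (vset (carrier M))"

definition fadd :: "('v, 'v) module \<Rightarrow> 'v \<Rightarrow> 'v \<Rightarrow> 'v \<Rightarrow> 'v \<Rightarrow> bool"
  where "fadd M x y z = (\<^bold>\<exists>u. fpair u x y \<^bold>\<and> fapp (check (add_graph M)) u z)"

definition fsmult :: "'v ring \<Rightarrow> ('v, 'v) module \<Rightarrow> 'v \<Rightarrow> 'v \<Rightarrow> 'v \<Rightarrow> 'v \<Rightarrow> bool"
  where "fsmult R M a x z = (\<^bold>\<exists>u. fpair u a x \<^bold>\<and> fapp (check (smult_graph R M)) u z)"

definition fsubmodule :: "'v ring \<Rightarrow> ('v, 'v) module \<Rightarrow> 'v \<Rightarrow> 'v \<Rightarrow> bool"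
  where "fsubmodule R M N =
    (fsubset N (fcarrier M) \<^bold>\<and>
     check \<zero>\<^bsub>M\<^esub> \<^bold>\<in> N \<^bold>\<and>
     (\<^bold>\<forall>x y z. x \<^bold>\<in> N \<^bold>\<and> y \<^bold>\<in> N \<^bold>\<and> fadd M x y z \<^bold>\<longrightarrow> z \<^bold>\<in> N) \<^bold>\<and>
     (\<^bold>\<forall>a x z. a \<^bold>\<in> check (vset (carrier R)) \<^bold>\<and> x \<^bold>\<in> N \<^bold>\<and> fsmult R M a x z \<^bold>\<longrightarrow> z \<^bold>\<in> N))"

text \<open>\<open>K = a + N\<close>\<close>

definition fcoset :: "('v, 'v) module \<Rightarrow> 'v \<Rightarrow> 'v \<Rightarrow> 'v \<Rightarrow> 'v \<Rightarrow> bool"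
  where "fcoset M N a K = (\<^bold>\<forall>x. x \<^bold>\<in> K \<^bold>\<longleftrightarrow> (\<^bold>\<exists>n. n \<^bold>\<in> N \<^bold>\<and> fadd M a n x))"

text \<open>
  For submodules \<open>N \<subseteq> N'\<close> of \<open>M\<close>: some \<open>h\<close> is an isomorphism from \<open>Q = N'/N\<close> onto \<open>C\<close>, where the
  operations of the quotient are given by
  \<open>(a + N) + (b + N) = (a + b) + N\<close> and \<open>c (a + N) = c a + N\<close>.
\<close>

definition fquotient_iso ::
    "'v ring \<Rightarrow> ('v, 'v) module \<Rightarrow> 'v \<Rightarrow> 'v \<Rightarrow> ('v, 'v) module \<Rightarrow> 'v \<Rightarrow> bool"
  where "fquotient_iso R M N' N C =
    (\<^bold>\<exists>Q h.
       (\<^bold>\<forall>K. K \<^bold>\<in> Q \<^bold>\<longleftrightarrow> (\<^bold>\<exists>a. a \<^bold>\<in> N' \<^bold>\<and> fcoset M N a K)) \<^bold>\<and>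
       fbijection h Q (fcarrier C) \<^bold>\<and>
       (\<^bold>\<forall>a b s K L J x y z.
          a \<^bold>\<in> N' \<^bold>\<and> b \<^bold>\<in> N' \<^bold>\<and> fadd M a b s \<^bold>\<and>
          fcoset M N a K \<^bold>\<and> fcoset M N b L \<^bold>\<and> fcoset M N s J \<^bold>\<and>
          fapp h K x \<^bold>\<and> fapp h L y \<^bold>\<and> fapp h J z \<^bold>\<longrightarrow> fadd C x y z) \<^bold>\<and>
       (\<^bold>\<forall>c a s K J x z.
          c \<^bold>\<in> check (vset (carrier R)) \<^bold>\<and> a \<^bold>\<in> N' \<^bold>\<and> fsmult R M c a s \<^bold>\<and>
          fcoset M N a K \<^bold>\<and> fcoset M N s J \<^bold>\<and>
          fapp h K x \<^bold>\<and> fapp h J z \<^bold>\<longrightarrow> fsmult R C c x z))"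

text \<open>\<open>M\<close> has a filtration \<open>f\<close>, a function on some nonzero ordinal \<open>\<eta>\<close>.\<close>

definition ffiltered :: "'v ring \<Rightarrow> ('v, 'v) module set \<Rightarrow> ('v, 'v) module \<Rightarrow> 'v \<Rightarrow> bool"
  where "ffiltered R \<C> M =
    (\<^bold>\<exists>\<eta> f.
       ford \<eta> \<^bold>\<and> (\<^bold>\<not> fempty \<eta>) \<^bold>\<and> ffunction_on f \<eta> \<^bold>\<and>
       (\<^bold>\<forall>i N. fapp f i N \<^bold>\<longrightarrow> fsubmodule R M N) \<^bold>\<and>
       (\<^bold>\<forall>i j N N'. i \<^bold>\<in> j \<^bold>\<and> fapp f i N \<^bold>\<and> fapp f j N' \<^bold>\<longrightarrow> fsubset N N') \<^bold>\<and>
       (\<^bold>\<forall>j N'. fapp f j N' \<^bold>\<and> (\<^bold>\<not> fempty j) \<^bold>\<and> (\<^bold>\<not> (\<^bold>\<exists>i. fsucc j i)) \<^bold>\<longrightarrow>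
          (\<^bold>\<forall>x. x \<^bold>\<in> N' \<^bold>\<longleftrightarrow> (\<^bold>\<exists>i N. i \<^bold>\<in> j \<^bold>\<and> fapp f i N \<^bold>\<and> x \<^bold>\<in> N))) \<^bold>\<and>
       (\<^bold>\<forall>x. x \<^bold>\<in> fcarrier M \<^bold>\<longleftrightarrow> (\<^bold>\<exists>i N. fapp f i N \<^bold>\<and> x \<^bold>\<in> N)) \<^bold>\<and>
       (\<^bold>\<forall>i N. fapp f i N \<^bold>\<and> fempty i \<^bold>\<longrightarrow> (\<^bold>\<forall>x. x \<^bold>\<in> N \<^bold>\<longleftrightarrow> x \<^bold>= check \<zero>\<^bsub>M\<^esub>)) \<^bold>\<and>
       (\<^bold>\<forall>i j N N'. fsucc j i \<^bold>\<and> fapp f i N \<^bold>\<and> fapp f j N' \<^bold>\<longrightarrow>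
          fex_ground \<C> (\<lambda>C. fquotient_iso R M N' N C)))"

end

definition sigma_closed_potentially_filtered ::
    "'v::zfc ring \<Rightarrow> ('v, 'v) module set \<Rightarrow> ('v, 'v) module \<Rightarrow> bool"
  where "sigma_closed_potentially_filtered R \<C> M \<longleftrightarrow>
    (\<exists>P r. forcing_poset P r \<and> sigma_closed P r \<and>
           (\<forall>p \<in> P. forcing_poset.ffiltered P r R \<C> M p))"

section \<open>Club-compactness\<close>

definition P_omega2 :: "'v set \<Rightarrow> 'v set set"
  where "P_omega2 A = {W. W \<subseteq> A \<and> |W| <o aleph2}"

definition aleph2_club_compact :: "'v::zfc ring \<Rightarrow> ('v, 'v) module set \<Rightarrow> bool"
  where "aleph2_club_compact R \<Gamma> \<longleftrightarrow>
    (\<forall>M. is_module R M \<longrightarrow>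
       (\<exists>D. club aleph2 (P_omega2 (carrier M)) D \<and>
            D \<subseteq> {W \<in> P_omega2 (carrier M). M\<lparr>carrier := span R M W\<rparr> \<in> \<Gamma>})
       \<longrightarrow> M \<in> \<Gamma>)"

end

(* The relation "M is filtered after some sigma-closed forcing" is turned into a combinatorial
   property of the countable subsets of M. Say that Y extends X if every countable C-filtration
   ending in X can be prolonged to one ending in Y.

   Sufficiency: suppose that a club Q of countable sets a is such that <a> extends 0 and, for
   stationarily many b containing a, <b> extends <a>. Then the conditions of the form
   (countable filtration ending in <a>, a in Q) form a sigma-closed poset, and its generic object is
   a filtration of M.

   Necessity for a module N of size at most aleph_1: meeting aleph_1 dense sets below a condition of
   a sigma-closed poset decides enough of a name for a filtration to obtain subsets
   L x, U x of N playing the role of f k and f (k + 1) for the least f (k + 1) containing x.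
   As in the Hill lemma, countable sets a closed under suitable countable-valued functions then
   satisfy that <b> extends <a> whenever a is contained in b, since a countably presented quotient
   needs only countably many generators and relations.

   If M fails the sufficient condition, the bad countable sets a are stationary, each with a club
   witnessing that it is bad. RP_internal yields N of size aleph_1, closed under the ring,
   under functions generating the given club of submodules (so N belongs to that club and the necessity
   part applies to it), and under functions generating the clubs of all bad a that belong to the
   elementary submodel. Stationarily many countable subsets of N are bad and lie in the submodel,
   so one of them is closed in the sense of the Hill lemma; closing it off inside N contradicts its
   badness. *)

theory Submission
  imports Defs "HOL-Library.Countable_Set_Type"
begin

text \<open>Stationarity is the right strength in the sufficient condition. The club of members of Q
  containing a prescribed x meets the extensions of a, so a condition can always be prolonged to
  capture x and still end in Q; and a failure of stationarity hands over a club, hence a function on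
  finite sets under which one can close off. Internality of the reflection is what allows this
  closing off inside N. Each bad a has its own function, and N is closed only under those functions
  whose a is an element of the submodel; the reflected stationary set consists of just such a. The
  necessity part extracts ground-model data from a name. A chain of length omega_1 in a
  \<sigma>-closed poset needs lower bounds for its countable pieces only. The same countable
  directedness makes the relation of y being in \<open>L x\<close> well-founded, since an infinite
  descent would be forced by a single condition. The index ordinals live in the extension and are
  lost, which is why the filtration is recorded through L and U on elements.\<close>

lemma elts_inject [simp]: "elts x = elts y \<longleftrightarrow> x = y"
  using extensionality by blast

lemma small_elts [simp, intro]: "small (elts x)"
  by (simp add: small_def)

lemma elts_vset [simp]: "small A \<Longrightarrow> elts (vset A) = A"
proof -
  assume "small A"
  then obtain x where "A = elts x" by (auto simp: small_def)
  moreover have "(THE x'. elts x' = elts x) = x" by (rule the_equality) auto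
  ultimately show ?thesis by (simp add: vset_def)
qed

lemma vset_elts [simp]: "vset (elts x) = x"
  by (metis elts_inject elts_vset small_elts)

lemma vset_inject: "small A \<Longrightarrow> small B \<Longrightarrow> vset A = vset B \<longleftrightarrow> A = B"
  by (metis elts_vset)

lemma small_Collect_elts: "small {y \<in> elts x. \<phi> y}"
  using separation[of x \<phi>] by (metis small_elts)

lemma small_subset: "small A \<Longrightarrow> B \<subseteq> A \<Longrightarrow> small B"
  by (metis (no_types, lifting) Collect_cong Int_absorb1 Int_def elts_vset small_Collect_elts)

lemma small_image_same: "small A \<Longrightarrow> small (f ` A)" for f :: "'v::zfc \<Rightarrow> 'v"
  by (metis elts_vset replacement small_elts)

lemma small_UN_same: "small A \<Longrightarrow> (\<And>x. x \<in> A \<Longrightarrow> small (B x)) \<Longrightarrow> small (\<Union>x\<in>A. B x)"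
  for A :: "'v::zfc set" and B :: "'v \<Rightarrow> 'v set"
proof -
  assume A: "small A" and B: "\<And>x. x \<in> A \<Longrightarrow> small (B x)"
  obtain u where "elts u = (\<Union>y \<in> elts (vset ((\<lambda>x. vset (B x)) ` A)). elts y)"
    using union by blast
  also have "\<dots> = (\<Union>x\<in>A. B x)"
    using A B by (simp add: small_image_same)
  finally show ?thesis by (metis small_elts)
qed

lemma small_pair: "small {x, y}"
  by (metis pairing small_elts)

lemma small_sing [simp]: "small {x}"
  using small_pair[of x x] by simp

lemma small_empty [simp]: "small {}"
  by (rule small_subset[OF small_sing]) auto

lemma small_Un [simp]: "small A \<Longrightarrow> small B \<Longrightarrow> small (A \<union> B)"
proof -
  assume "small A" "small B"
  then have "small (\<Union>x\<in>{vset A, vset B}. elts x)"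
    by (intro small_UN_same) (auto simp: small_pair)
  then show ?thesis using \<open>small A\<close> \<open>small B\<close> by simp
qed

lemma small_insert [simp]: "small A \<Longrightarrow> small (insert x A)"
  using small_Un[of "{x}" A] by simp

lemma small_image2: "small A \<Longrightarrow> small B \<Longrightarrow> small {f x y |x y. x \<in> A \<and> y \<in> B}"
  for f :: "'v::zfc \<Rightarrow> 'v \<Rightarrow> 'v"
proof -
  assume "small A" "small B"
  then have "small (\<Union>x\<in>A. f x ` B)" by (intro small_UN_same small_image_same)
  also have "(\<Union>x\<in>A. f x ` B) = {f x y |x y. x \<in> A \<and> y \<in> B}" by auto
  finally show ?thesis .
qed

text \<open>Subsets are HOL sets and become elements of the universe only through
  \<open>vset\<close>. This bound is what later makes the poset of coded filtrations small.\<close>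

lemma small_vset_Pow: "small A \<Longrightarrow> small (vset ` Pow A)"
proof -
  assume A: "small A"
  obtain z where "elts z = {y. elts y \<subseteq> elts (vset A)}" using powerset by blast
  then have "vset ` Pow A \<subseteq> elts z" using A small_subset[OF A] by auto
  then show ?thesis using small_subset by blast
qed

lemma opair_inject [simp]: "opair x y = opair x' y' \<longleftrightarrow> x = x' \<and> y = y'"
  unfolding opair_def by (auto simp: vset_inject small_pair doubleton_eq_iff)

lemma wf_elts: "wf {(x, y). x \<in> elts y}"
  by (rule foundation)

lemma elts_induct [case_names step]:
  assumes "\<And>x. (\<And>y. y \<in> elts x \<Longrightarrow> \<phi> y) \<Longrightarrow> \<phi> x"
  shows "\<phi> x"
  using wf_induct_rule[OF wf_elts, of \<phi> x] assms by auto

lemma elts_irrefl [simp]: "x \<notin> elts x"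
  using wf_not_refl[OF wf_elts] by auto

lemma elts_asym: "x \<in> elts y \<Longrightarrow> y \<notin> elts x"
  using wf_asym[OF wf_elts] by auto

section \<open>Ordinals\<close>

lemma Ord_trans: "Ord \<alpha> \<Longrightarrow> \<beta> \<in> elts \<alpha> \<Longrightarrow> \<gamma> \<in> elts \<beta> \<Longrightarrow> \<gamma> \<in> elts \<alpha>"
  unfolding Ord_def by blast

lemma Ord_in_Ord: "Ord \<alpha> \<Longrightarrow> \<beta> \<in> elts \<alpha> \<Longrightarrow> Ord \<beta>"
  unfolding Ord_def by blast

text \<open>Nested membership induction on both ordinals. If they are incomparable while all smaller
  instances are comparable, each is contained in the other, and extensionality makes them
  equal.\<close>

lemma Ord_linear: "Ord \<alpha> \<Longrightarrow> Ord \<beta> \<Longrightarrow> \<alpha> \<in> elts \<beta> \<or> \<alpha> = \<beta> \<or> \<beta> \<in> elts \<alpha>"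
proof (induction \<alpha> arbitrary: \<beta> rule: elts_induct)
  case (step \<alpha>)
  note IH\<alpha> = step.IH and \<alpha> = step.prems(1)
  from step.prems(2) show ?case
  proof (induction \<beta> rule: elts_induct)
    case (step \<beta>)
    show ?case
    proof (rule ccontr)
      assume neg: "\<not> ?case"
      have "elts \<alpha> \<subseteq> elts \<beta>"
        using IH\<alpha> \<alpha> step.prems neg Ord_in_Ord Ord_trans by blast
      moreover have "elts \<beta> \<subseteq> elts \<alpha>"
        using step \<alpha> neg Ord_in_Ord Ord_trans by blast
      ultimately show False using neg by (metis elts_inject subset_antisym)
    qed
  qed
qed

lemma Ord_subset: "Ord \<alpha> \<Longrightarrow> Ord \<beta> \<Longrightarrow> elts \<alpha> \<subseteq> elts \<beta> \<longleftrightarrow> \<alpha> = \<beta> \<or> \<alpha> \<in> elts \<beta>"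
  using Ord_linear[of \<alpha> \<beta>] elts_irrefl by (auto dest: Ord_trans)

definition vsucc :: "'v::zfc \<Rightarrow> 'v"
  where "vsucc x = vset (insert x (elts x))"

lemma elts_vsucc [simp]: "elts (vsucc x) = insert x (elts x)"
  by (simp add: vsucc_def)

lemma Ord_vsucc [simp]: "Ord \<alpha> \<Longrightarrow> Ord (vsucc \<alpha>)"
  unfolding Ord_def by auto

lemma Ord_Union: "small A \<Longrightarrow> (\<And>\<alpha>. \<alpha> \<in> A \<Longrightarrow> Ord \<alpha>) \<Longrightarrow> Ord (vset (\<Union>\<alpha>\<in>A. elts \<alpha>))"
proof -
  assume "small A" and A: "\<And>\<alpha>. \<alpha> \<in> A \<Longrightarrow> Ord \<alpha>"
  then have "elts (vset (\<Union>\<alpha>\<in>A. elts \<alpha>)) = (\<Union>\<alpha>\<in>A. elts \<alpha>)" by (simp add: small_UN_same)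
  moreover have "elts \<beta> \<subseteq> (\<Union>\<alpha>\<in>A. elts \<alpha>)" if "\<beta> \<in> (\<Union>\<alpha>\<in>A. elts \<alpha>)" for \<beta>
    using that A by (auto intro: Ord_trans)
  moreover have "elts \<gamma> \<subseteq> elts \<beta>" if "\<beta> \<in> (\<Union>\<alpha>\<in>A. elts \<alpha>)" "\<gamma> \<in> elts \<beta>" for \<beta> \<gamma>
    using that A by (auto intro: Ord_trans Ord_in_Ord)
  ultimately show ?thesis unfolding Ord_def[of "vset _"] by simp
qed

primrec nat_ord :: "nat \<Rightarrow> 'v::zfc" where
  "nat_ord 0 = vset {}"
| "nat_ord (Suc n) = vsucc (nat_ord n)"

lemma elts_nat_ord: "elts (nat_ord n) = nat_ord ` {..<n}"
  by (induction n) (auto simp: lessThan_Suc)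

lemma Ord_nat_ord [simp]: "Ord (nat_ord n)"
  by (induction n) (auto simp: Ord_def)

lemma nat_ord_inject [simp]: "nat_ord m = (nat_ord n :: 'a::zfc) \<longleftrightarrow> m = n"
proof -
  have "nat_ord m \<noteq> (nat_ord n :: 'a)" if "m < n" for m n
  proof
    assume "nat_ord m = (nat_ord n :: 'a)"
    moreover have "nat_ord m \<in> elts (nat_ord n :: 'a)" using that by (simp add: elts_nat_ord)
    ultimately have "nat_ord n \<in> elts (nat_ord n :: 'a)" by simp
    then show False by simp
  qed
  then show ?thesis by (metis linorder_neqE_nat)
qed

lemma small_range_nat_ord: "small (range (nat_ord :: nat \<Rightarrow> 'a::zfc))"
proof -
  obtain x :: 'a where z: "\<exists>z\<in>elts x. elts z = {}"
    and s: "\<forall>y\<in>elts x. \<exists>z\<in>elts x. elts z = insert y (elts y)"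
    using infinity by blast
  have "nat_ord n \<in> elts x" for n
  proof (induction n)
    case 0 then show ?case using z by (metis elts_inject elts_vset nat_ord.simps(1) small_empty)
  next
    case (Suc n) then show ?case using s by (metis elts_inject elts_vsucc nat_ord.simps(2))
  qed
  then show ?thesis by (meson image_subsetI small_elts small_subset)
qed

text \<open>HOL countability becomes smallness by replacement: \<open>nat_ord\<close> carries an
  enumeration by the type \<open>nat\<close> over to a set of the universe.\<close>

lemma small_countable: "countable A \<Longrightarrow> small A" for A :: "'a::zfc set"
proof (cases "A = {}")
  case False
  assume "countable A"
  then obtain f :: "nat \<Rightarrow> 'a" where f: "A = range f" using False uncountable_def by blast
  have "A = (f \<circ> inv_into UNIV nat_ord) ` range (nat_ord :: nat \<Rightarrow> 'a)"
    unfolding f image_comp by (auto simp: inv_f_f inj_def image_iff)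
  then show ?thesis using small_image_same[OF small_range_nat_ord] by simp
qed simp

lemma small_image: "small (f ` A)" if "small A" for f :: "'v::zfc \<Rightarrow> 'v"
  using that by (rule small_image_same)

definition omega :: "'v::zfc" where "omega = vset (range nat_ord)"

lemma elts_omega [simp]: "elts omega = range nat_ord"
  by (simp add: omega_def small_range_nat_ord)

lemma Ord_omega: "Ord omega"
  unfolding Ord_def by (auto simp: elts_nat_ord)

lemma omega1_small_elts: "\<alpha> \<in> omega1 \<Longrightarrow> \<beta> \<in> elts \<alpha> \<Longrightarrow> \<beta> \<in> omega1"
proof -
  assume "\<alpha> \<in> omega1" "\<beta> \<in> elts \<alpha>"
  moreover then have "elts \<beta> \<subseteq> elts \<alpha>" by (auto simp: omega1_def Ord_def)
  ultimately show ?thesis by (auto simp: omega1_def intro: Ord_in_Ord countable_subset)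
qed

lemma omega1_vsucc: "\<alpha> \<in> omega1 \<Longrightarrow> vsucc \<alpha> \<in> omega1"
  by (auto simp: omega1_def)

lemma omega1_Union: "countable A \<Longrightarrow> A \<subseteq> omega1 \<Longrightarrow> vset (\<Union>\<alpha>\<in>A. elts \<alpha>) \<in> omega1"
  unfolding omega1_def by (auto intro!: Ord_Union small_countable simp: small_UN_same small_countable)

section \<open>Hartogs numbers\<close>

text \<open>As for the Mostowski collapse, induction shows that the isomorphism fixes every element,
  because \<open>g x\<close> and \<open>x\<close> have the same elements.\<close>

lemma ordinal_isomorphism_id:
  assumes "Ord \<alpha>" "Ord \<beta>" "bij_betw g (elts \<alpha>) (elts \<beta>)"
    and iso: "\<And>x y. x \<in> elts \<alpha> \<Longrightarrow> y \<in> elts \<alpha> \<Longrightarrow> x \<in> elts y \<longleftrightarrow> g x \<in> elts (g y)"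
  shows "\<alpha> = \<beta>"
proof -
  have "g x = x" if "x \<in> elts \<alpha>" for x
    using that
  proof (induction x rule: elts_induct)
    case (step x)
    have "elts (g x) = elts x"
    proof
      show "elts x \<subseteq> elts (g x)"
        using step iso assms(1) by (metis Ord_trans subsetI)
      show "elts (g x) \<subseteq> elts x"
      proof
        fix z assume z: "z \<in> elts (g x)"
        then have "z \<in> elts \<beta>" using step.prems assms(2,3) by (meson Ord_trans bij_betwE)
        then obtain y where y: "y \<in> elts \<alpha>" "z = g y" using assms(3) by (metis bij_betw_iff_bijections)
        then have "y \<in> elts x" using iso step.prems z by blast
        then show "z \<in> elts x" using step y by auto
      qed
    qed
    then show ?case by simp
  qed
  then have "elts \<alpha> = elts \<beta>" using assms(3) by (simp add: bij_betw_def)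
  then show ?thesis by simp
qed

lemma Ord_not_small: "\<not> small {\<alpha>. Ord \<alpha>}"
proof
  assume sm: "small {\<alpha>::'a. Ord \<alpha>}"
  then have "Ord (vset {\<alpha>::'a. Ord \<alpha>})"
    by (subst Ord_def) (auto simp: Ord_in_Ord dest: Ord_trans)
  then have "vset {\<alpha>::'a. Ord \<alpha>} \<in> elts (vset {\<alpha>. Ord \<alpha>})" using sm by simp
  then show False by simp
qed

text \<open>If every ordinal injected into \<open>A\<close>, each ordinal could be recovered from a
  relation on \<open>A\<close>, that is, from a subset of a fixed set of coded pairs. Replacement
  along the decoding would make the class of all ordinals small, against
  \<open>Ord_not_small\<close>.\<close>

lemma Hartogs:
  fixes A :: "'v::zfc set"
  assumes "small A"
  shows "\<exists>\<theta> :: 'v. Ord \<theta> \<and> \<not> |elts \<theta>| \<le>o |A|"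
proof (rule ccontr)
  assume "\<not> ?thesis"
  then have "\<forall>\<theta>::'v. Ord \<theta> \<longrightarrow> (\<exists>f. inj_on f (elts \<theta>) \<and> f ` elts \<theta> \<subseteq> A)"
    using card_of_ordLeq by blast
  then obtain f where f: "\<And>\<theta>::'v. Ord \<theta> \<Longrightarrow> inj_on (f \<theta>) (elts \<theta>) \<and> f \<theta> ` elts \<theta> \<subseteq> A"
    by metis
  \<comment> \<open>The relation is made reflexive so that the image of \<open>f \<theta>\<close>
    can be read off from its diagonal, even when \<theta> has a single element.\<close>
  define c where "c \<theta> = {opair (f \<theta> x) (f \<theta> y) |x y. x \<in> elts \<theta> \<and> y \<in> elts \<theta> \<and> (x = y \<or> x \<in> elts y)}" for \<theta>
  let ?AA = "{opair a b |a b. a \<in> A \<and> b \<in> A}"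
  have cAA: "c \<theta> \<in> Pow ?AA" if "Ord \<theta>" for \<theta>
    using f[OF that] unfolding c_def by blast
  have smAA: "small ?AA" using small_image2[OF assms assms] .
  have inj: "\<theta> = \<theta>'" if o: "Ord \<theta>" "Ord \<theta>'" and eq: "c \<theta> = c \<theta>'" for \<theta> \<theta>'
  proof -
    have im: "f \<theta> ` elts \<theta> = {a. opair a a \<in> c \<theta>}" if "Ord \<theta>" for \<theta>
      using f[OF that] unfolding c_def by (auto simp: inj_on_def)
    have rel: "opair (f \<theta> x) (f \<theta> y) \<in> c \<theta> \<longleftrightarrow> x = y \<or> x \<in> elts y"
      if "Ord \<theta>" "x \<in> elts \<theta>" "y \<in> elts \<theta>" for \<theta> x y
    proof -
      have "f \<theta> x = f \<theta> x' \<longleftrightarrow> x = x'" "f \<theta> y = f \<theta> x' \<longleftrightarrow> y = x'" if "x' \<in> elts \<theta>" for x'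
        using f[OF \<open>Ord \<theta>\<close>] that \<open>x \<in> elts \<theta>\<close> \<open>y \<in> elts \<theta>\<close> by (auto dest: inj_onD)
      then show ?thesis using that(2,3) unfolding c_def by auto
    qed
    define g where "g x = inv_into (elts \<theta>') (f \<theta>') (f \<theta> x)" for x
    have im_eq: "f \<theta> ` elts \<theta> = f \<theta>' ` elts \<theta>'" using im o eq by simp
    have b1: "bij_betw (f \<theta>) (elts \<theta>) (f \<theta>' ` elts \<theta>')"
      using f[OF o(1)] im_eq by (simp add: bij_betw_def)
    have b2: "bij_betw (inv_into (elts \<theta>') (f \<theta>')) (f \<theta>' ` elts \<theta>') (elts \<theta>')"
      using f[OF o(2)] by (intro bij_betw_inv_into) (simp add: bij_betw_def)
    have g: "bij_betw g (elts \<theta>) (elts \<theta>')"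
      using bij_betw_trans[OF b1 b2] by (simp add: g_def[abs_def] comp_def)
    have fg: "f \<theta>' (g x) = f \<theta> x" "g x \<in> elts \<theta>'" if "x \<in> elts \<theta>" for x
      using that im_eq unfolding g_def by (metis f_inv_into_f imageI, metis imageI inv_into_into)
    show ?thesis
    proof (rule ordinal_isomorphism_id[OF o g])
      fix x y assume xy: "x \<in> elts \<theta>" "y \<in> elts \<theta>"
      have "x = y \<or> x \<in> elts y \<longleftrightarrow> g x = g y \<or> g x \<in> elts (g y)"
        using rel[OF o(1) xy] rel[OF o(2) fg(2)[OF xy(1)] fg(2)[OF xy(2)]] fg xy eq by simp
      moreover have "g x = g y \<longleftrightarrow> x = y" using g xy by (meson bij_betw_def inj_on_eq_iff)
      ultimately show "x \<in> elts y \<longleftrightarrow> g x \<in> elts (g y)" by auto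
    qed
  qed
  let ?dec = "\<lambda>z. THE \<theta>. Ord \<theta> \<and> c \<theta> = elts z"
  have sub: "{\<theta>. Ord \<theta>} \<subseteq> ?dec ` (vset ` Pow ?AA)"
  proof
    fix \<theta> :: 'v assume "\<theta> \<in> {\<theta>. Ord \<theta>}"
    then have o: "Ord \<theta>" by simp
    have "elts (vset (c \<theta>)) = c \<theta>" by (rule elts_vset, rule small_subset[OF smAA], use cAA[OF o] in blast)
    then have "?dec (vset (c \<theta>)) = \<theta>"
      using o inj by (intro the_equality) auto
    moreover have "vset (c \<theta>) \<in> vset ` Pow ?AA" using cAA[OF o] by (rule imageI)
    ultimately show "\<theta> \<in> ?dec ` (vset ` Pow ?AA)"
      by (rule rev_image_eqI[OF _ sym, rotated])
  qed
  have "small {\<theta>::'v. Ord \<theta>}"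
    by (rule small_subset[OF small_image_same[OF small_vset_Pow[OF smAA]] sub])
  then show False using Ord_not_small by blast
qed

text \<open>Bridge between von Neumann ordinals and HOL cardinals. Membership well-orders
  \<open>elts \<theta>\<close>; a larger cardinality would put \<open>cardSuc |A|\<close> into a
  proper initial segment, which lies in some \<open>elts a\<close> and has size at most
  \<open>|A|\<close>.\<close>

lemma card_of_initial_ordinal:
  fixes A :: "'v::zfc set"
  assumes \<theta>: "Ord \<theta>" and gt: "\<not> |elts \<theta>| \<le>o |A|" and le: "\<And>\<alpha>. \<alpha> \<in> elts \<theta> \<Longrightarrow> |elts \<alpha>| \<le>o |A|"
  shows "|elts \<theta>| =o cardSuc |A|"
proof -
  have "|A| <o |elts \<theta>|" using gt by (simp add: card_of_Well_order not_ordLeq_iff_ordLess)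
  then have 1: "cardSuc |A| \<le>o |elts \<theta>|"
    by (simp add: cardSuc_least card_of_Card_order)
  define r where "r = {(x, y). x \<in> elts \<theta> \<and> y \<in> elts \<theta> \<and> (x = y \<or> x \<in> elts y)}"
  have wo: "well_order_on (elts \<theta>) r"
    unfolding well_order_on_def linear_order_on_def partial_order_on_def preorder_on_def
  proof (intro conjI)
    show "r \<subseteq> elts \<theta> \<times> elts \<theta>" "refl_on (elts \<theta>) r" by (auto simp: r_def refl_on_def)
    show "trans r" using \<theta> unfolding r_def trans_def by (auto intro: Ord_trans[OF Ord_in_Ord])
    show "antisym r" unfolding r_def antisym_def by (auto dest: elts_asym)
    show "total_on (elts \<theta>) r" using Ord_linear Ord_in_Ord[OF \<theta>] unfolding r_def total_on_def by blast
    show "wf (r - Id)" by (rule wf_subset[OF wf_elts]) (auto simp: r_def)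
  qed
  have fld: "Field r = elts \<theta>" by (auto simp: r_def Field_def)
  have "\<not> cardSuc |A| <o |elts \<theta>|"
  proof
    assume "cardSuc |A| <o |elts \<theta>|"
    also have "|elts \<theta>| \<le>o r" using card_of_least[OF wo] .
    finally have "cardSuc |A| <o r" .
    moreover have "Well_order r" using wo fld by simp
    moreover have "Well_order (cardSuc |A| )" 
      by (simp add: cardSuc_Card_order card_of_Card_order card_order_on_well_order_on)
    ultimately obtain a where a: "a \<in> Field r" and iso: "cardSuc |A| =o Restr r (underS r a)"
      using ordLess_iff_ordIso_Restr by blast
    have "Field (Restr r (underS r a)) \<subseteq> elts a"
      by (auto simp: Field_def underS_def r_def)
    moreover obtain h where "bij_betw h (Field (cardSuc |A| )) (Field (Restr r (underS r a)))"
      using iso unfolding ordIso_def BNF_Wellorder_Embedding.iso_def by auto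
    ultimately have "|Field (cardSuc |A| )| \<le>o |elts a|"
      by (metis bij_betw_def card_of_ordLeq)
    moreover have "|Field (cardSuc |A| )| =o cardSuc |A|"
      by (simp add: cardSuc_Card_order card_of_Card_order card_of_Field_ordIso)
    ultimately have "cardSuc |A| \<le>o |A|"
      using le[of a] a fld by (metis ordIso_iff_ordLeq ordLeq_transitive)
    then show False
      using cardSuc_greater[of "|A|"] by (simp add: card_of_Card_order not_ordLess_ordLeq)
  qed
  then show ?thesis using 1 
    by (meson ordIso_symmetric ordLeq_iff_ordLess_or_ordIso)
qed

text \<open>The least ordinal not injecting into \<open>A\<close> consists exactly of the ordinals
  that do. For the natural numbers this turns the class \<open>omega1\<close> into a set of size
  \<open>aleph1\<close>.\<close>

lemma ex_initial_ordinal: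
  fixes A :: "'v::zfc set"
  assumes "small A"
  shows "\<exists>\<theta> :: 'v. Ord \<theta> \<and> |elts \<theta>| =o cardSuc |A| \<and> elts \<theta> = {\<alpha>. Ord \<alpha> \<and> |elts \<alpha>| \<le>o |A| }"
proof -
  let ?Q = "{\<theta>::'v. Ord \<theta> \<and> \<not> |elts \<theta>| \<le>o |A| }"
  obtain \<theta> where \<theta>: "\<theta> \<in> ?Q" and min: "\<And>\<alpha>. \<alpha> \<in> elts \<theta> \<Longrightarrow> \<alpha> \<notin> ?Q"
    using Hartogs[OF assms] wf_elts unfolding wf_eq_minimal by (metis (no_types, lifting) case_prodI mem_Collect_eq)
  have le: "|elts \<alpha>| \<le>o |A|" if "\<alpha> \<in> elts \<theta>" for \<alpha>
    using min[OF that] Ord_in_Ord \<theta> that by blast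
  have "elts \<theta> = {\<alpha>. Ord \<alpha> \<and> |elts \<alpha>| \<le>o |A| }"
  proof (intro equalityI subsetI)
    fix \<alpha> assume "\<alpha> \<in> elts \<theta>"
    then show "\<alpha> \<in> {\<alpha>. Ord \<alpha> \<and> |elts \<alpha>| \<le>o |A| }" using le Ord_in_Ord \<theta> by blast
  next
    fix \<alpha> :: 'v assume a: "\<alpha> \<in> {\<alpha>. Ord \<alpha> \<and> |elts \<alpha>| \<le>o |A| }"
    have "\<not> elts \<theta> \<subseteq> elts \<alpha>"
    proof
      assume "elts \<theta> \<subseteq> elts \<alpha>"
      then have "|elts \<theta>| \<le>o |elts \<alpha>|" by (rule card_of_mono1)
      then show False using a \<theta> ordLeq_transitive by blast
    qed
    then show "\<alpha> \<in> elts \<theta>" using Ord_linear[of \<alpha> \<theta>] a \<theta> by (auto simp: Ord_def)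
  qed
  moreover have "|elts \<theta>| =o cardSuc |A|"
    by (rule card_of_initial_ordinal) (use \<theta> le in auto)
  moreover have "Ord \<theta>" using \<theta> by simp
  ultimately show ?thesis by blast
qed

lemma card_of_range_nat_ord: "|range (nat_ord :: nat \<Rightarrow> 'v::zfc)| =o natLeq"
proof -
  have "bij_betw (nat_ord :: nat \<Rightarrow> 'v) UNIV (range nat_ord)" by (simp add: bij_betw_def inj_def)
  then show ?thesis by (metis card_of_nat card_of_ordIso ordIso_symmetric ordIso_transitive)
qed

lemma omega1_eq: "\<exists>\<theta> :: 'v::zfc. Ord \<theta> \<and> elts \<theta> = omega1 \<and> |elts \<theta>| =o aleph1"
proof -
  obtain \<theta> :: 'v where \<theta>: "Ord \<theta>" "|elts \<theta>| =o cardSuc |range (nat_ord :: nat \<Rightarrow> 'v)|"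
    "elts \<theta> = {\<alpha>. Ord \<alpha> \<and> |elts \<alpha>| \<le>o |range (nat_ord :: nat \<Rightarrow> 'v)| }"
    using ex_initial_ordinal[OF small_range_nat_ord] by blast
  have "|elts \<alpha>| \<le>o |range (nat_ord :: nat \<Rightarrow> 'v)| \<longleftrightarrow> countable (elts \<alpha>)" for \<alpha> :: 'v
    unfolding countable_card_le_natLeq
    by (meson card_of_range_nat_ord ordIso_symmetric ordLeq_ordIso_trans)
  then have "elts \<theta> = omega1" using \<theta>(3) by (simp add: omega1_def)
  moreover have "cardSuc |range (nat_ord :: nat \<Rightarrow> 'v)| =o aleph1"
    using card_of_range_nat_ord
    by (simp add: cardSuc_invar_ordIso card_of_Card_order natLeq_Card_order)
  ultimately show ?thesis using \<theta> ordIso_transitive by blast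
qed

lemma small_omega1 [simp]: "small (omega1 :: 'v::zfc set)"
  using omega1_eq[where 'v = 'v] by (metis small_elts)

lemma Ord_omega1: "Ord (vset omega1)"
  using omega1_eq by (metis vset_elts)

lemma card_of_omega1: "|omega1 :: 'v::zfc set| =o aleph1"
  using omega1_eq[where 'v = 'v] by metis

lemma ordLess_aleph1: "|A| <o aleph1 \<longleftrightarrow> countable A"
  by (simp add: cardSuc_ordLeq_ordLess card_of_Card_order countable_card_le_natLeq natLeq_Card_order)

lemma ordLess_aleph2: "|A| <o aleph2 \<longleftrightarrow> |A| \<le>o aleph1"
  by (simp add: cardSuc_ordLeq_ordLess card_of_Card_order cardSuc_Card_order natLeq_Card_order)

lemma countable_ordLeq_aleph1: "countable A \<Longrightarrow> |A| \<le>o aleph1"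
  using ordLess_aleph1 ordLess_imp_ordLeq by blast

text \<open>The index set is a class of ordinals of the universe rather than a HOL well-order, so
  that constructions along it can use well-founded recursion on membership.\<close>

lemma enumerate_aleph1:
  assumes "|A| \<le>o aleph1" "A \<noteq> {}"
  shows "\<exists>f :: 'v::zfc \<Rightarrow> 'a. f ` omega1 = A"
  using assms card_of_ordLeq2[OF assms(2)] card_of_omega1
  by (metis ordIso_symmetric ordLeq_ordIso_trans)

lemma Card_order_aleph1: "Card_order aleph1"
  by (simp add: cardSuc_Card_order natLeq_Card_order)

lemma infinite_aleph1: "infinite (Field aleph1)"
  using cardSuc_finite[OF natLeq_Card_order] by (simp add: Field_natLeq)

lemma ordLeq_aleph1_Un: "|A| \<le>o aleph1 \<Longrightarrow> |B| \<le>o aleph1 \<Longrightarrow> |A \<union> B| \<le>o aleph1"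
  using card_of_Un_ordLeq_infinite_Field[OF infinite_aleph1] Card_order_aleph1 by blast

lemma ordLeq_aleph1_subset: "|B| \<le>o aleph1 \<Longrightarrow> A \<subseteq> B \<Longrightarrow> |A| \<le>o aleph1"
  using card_of_mono1 ordLeq_transitive by blast

lemma ordLeq_aleph1_Times: "|A| \<le>o aleph1 \<Longrightarrow> |B| \<le>o aleph1 \<Longrightarrow> |A \<times> B| \<le>o aleph1"
  using card_of_Sigma_ordLeq_infinite_Field[OF infinite_aleph1 Card_order_aleph1, of A "\<lambda>_. B"] by blast

section \<open>Transitive closures\<close>

lemma tr_closure_eq: "tr_closure x = elts x \<union> (\<Union>y\<in>elts x. tr_closure y)"
proof -
  let ?E = "{(u, v). u \<in> elts v}"
  have "(z, x) \<in> ?E\<^sup>+ \<longleftrightarrow> z \<in> elts x \<or> (\<exists>y\<in>elts x. (z, y) \<in> ?E\<^sup>+)" for z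
    by (auto elim: tranclE intro: trancl_into_trancl)
  then show ?thesis unfolding tr_closure_def by blast
qed

lemma small_tr_closure [simp]: "small (tr_closure x)"
  by (induction x rule: elts_induct) (subst tr_closure_eq, simp add: small_UN_same)

lemma tr_closure_elts: "y \<in> elts x \<Longrightarrow> tr_closure y \<subseteq> tr_closure x" "y \<in> elts x \<Longrightarrow> y \<in> tr_closure x"
  using tr_closure_eq[of x] by auto

lemma tr_closure_Ord: "Ord \<alpha> \<Longrightarrow> tr_closure \<alpha> = elts \<alpha>"
proof (induction \<alpha> rule: elts_induct)
  case (step \<alpha>)
  then show ?case using tr_closure_eq[of \<alpha>] Ord_in_Ord[OF step.prems] Ord_trans[OF step.prems] by auto
qed

lemma H_elts: "x \<in> H \<theta> \<Longrightarrow> y \<in> elts x \<Longrightarrow> y \<in> H \<theta>"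
  unfolding H_def by (metis card_of_mono1 mem_Collect_eq ordLeq_ordLess_trans tr_closure_elts(1))

text \<open>Take the initial ordinal for the successor cardinal of the transitive closure of
  \<open>X\<close> together with the natural numbers; infinite successor cardinals are
  regular.\<close>

lemma ex_regular_cardinal:
  fixes X :: "'v::zfc"
  shows "\<exists>\<theta> :: 'v. regular_cardinal \<theta> \<and> X \<in> H \<theta> \<and> omega1 \<subseteq> H \<theta>"
proof -
  let ?A = "tr_closure X \<union> range (nat_ord :: nat \<Rightarrow> 'v)"
  have sm: "small ?A" by (simp add: small_range_nat_ord)
  have inf: "infinite ?A" by (simp add: finite_image_iff inj_def)
  obtain \<theta> :: 'v where \<theta>: "Ord \<theta>" "|elts \<theta>| =o cardSuc |?A|" "elts \<theta> = {\<alpha>. Ord \<alpha> \<and> |elts \<alpha>| \<le>o |?A| }"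
    using ex_initial_ordinal[OF sm] by blast
  have lt: "|B| <o |elts \<theta>|" if "|B| \<le>o |?A|" for B :: "'v set"
  proof -
    have "|B| <o cardSuc |?A|" using that cardSuc_greater[of "|?A|"] ordLeq_ordLess_trans by (metis card_of_Card_order)
    then show ?thesis using \<theta>(2) by (meson ordIso_symmetric ordLess_ordIso_trans)
  qed
  have inf\<theta>: "infinite (elts \<theta>)"
  proof
    assume "finite (elts \<theta>)"
    then show False using lt[of ?A] inf by (meson card_of_ordLeq_finite ordLess_imp_ordLeq card_of_refl ordIso_iff_ordLeq)
  qed
  have cinf: "Cinfinite |?A|" using inf unfolding cinfinite_def Field_card_of using card_of_card_order_on by blast
  have reg: "regularCard |elts \<theta>|"
    by (rule regularCard_ordIso[OF ordIso_symmetric[OF \<theta>(2)] Cinfinite_cardSuc[OF cinf] regularCard_cardSuc[OF cinf]])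
  have "regular_cardinal \<theta>"
    unfolding regular_cardinal_def using \<theta> inf\<theta> reg lt by blast
  moreover have "X \<in> H \<theta>" unfolding H_def by (auto intro: lt card_of_mono1)
  moreover have "omega1 \<subseteq> H \<theta>"
  proof
    fix \<alpha> :: 'v assume "\<alpha> \<in> omega1"
    then have "tr_closure \<alpha> = elts \<alpha>" "countable (elts \<alpha>)" by (auto simp: omega1_def tr_closure_Ord)
    moreover have "|range (nat_ord :: nat \<Rightarrow> 'v)| \<le>o |?A|" by (rule card_of_mono1) auto
    ultimately have "|tr_closure \<alpha>| \<le>o |?A|"
      using card_of_range_nat_ord unfolding countable_card_le_natLeq
      by (metis ordIso_iff_ordLeq ordLeq_transitive)
    then show "\<alpha> \<in> H \<theta>" unfolding H_def using lt by blast
  qed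
  ultimately show ?thesis by blast
qed

section \<open>Names and conditions\<close>

text \<open>A name \<pi> occurring in \<sigma> lies three membership steps below it, through
  \<open>vset {\<pi>}\<close> and the Kuratowski pair, so recursion on names reduces to
  foundation.\<close>

lemma name_wf: "wf {(\<pi>, \<sigma>). \<exists>s. opair \<pi> s \<in> elts \<sigma>}"
proof -
  let ?E = "{(u :: 'a, v). u \<in> elts v}"
  have *: "(\<pi>, \<sigma>) \<in> ?E\<^sup>+" if "opair \<pi> s \<in> elts \<sigma>" for \<pi> s \<sigma> :: 'a
  proof -
    have 1: "(\<pi>, vset {\<pi>}) \<in> ?E" by simp
    have 2: "(vset {\<pi>}, opair \<pi> s) \<in> ?E" by (simp add: opair_def small_pair)
    have 3: "(opair \<pi> s, \<sigma>) \<in> ?E" using that by simp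
    show ?thesis by (rule trancl_into_trancl[OF trancl_into_trancl[OF r_into_trancl[OF 1] 2] 3])
  qed
  show ?thesis
    by (rule wf_subset[OF wf_trancl[OF wf_elts]]) (use * in blast)
qed

lemma name_induct [case_names step]:
  assumes "\<And>\<sigma>. (\<And>\<pi> s. opair \<pi> s \<in> elts \<sigma> \<Longrightarrow> \<phi> \<pi>) \<Longrightarrow> \<phi> \<sigma>"
  shows "\<phi> \<sigma>"
  using wf_induct_rule[OF name_wf, of \<phi> \<sigma>] assms by blast

named_theorems stable_intros
named_theorems fcong_intros

context forcing_poset
begin

abbreviation le (infix "\<preceq>" 50) where "q \<preceq> p \<equiv> (q, p) \<in> r"

lemma le_refl [simp]: "p \<in> P \<Longrightarrow> p \<preceq> p"
  using partial_order_onD(1)[OF partial_order] by (simp add: refl_on_def)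

lemma le_trans [trans]: "p \<preceq> q \<Longrightarrow> q \<preceq> s \<Longrightarrow> p \<preceq> s"
  using partial_order_onD(2)[OF partial_order] by (meson transD)

lemma le_P: "q \<preceq> p \<Longrightarrow> q \<in> P" "q \<preceq> p \<Longrightarrow> p \<in> P"
  using partial_order_onD(4)[OF partial_order] by auto

section \<open>Stable formulas\<close>

text \<open>Stable formulas are the regular open sets of conditions, the elements of the Boolean
  completion. All connectives preserve stability, so a stable goal may always be proved on a dense
  set of stronger conditions; this is the basic mode of argument below.\<close>

definition fstable :: "('v \<Rightarrow> bool) \<Rightarrow> bool"
  where "fstable \<phi> \<longleftrightarrow> (\<forall>p \<in> P. \<phi> p \<longleftrightarrow> (\<forall>q. q \<preceq> p \<longrightarrow> (\<exists>q'. q' \<preceq> q \<and> \<phi> q')))"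

lemma stable_mono: "fstable \<phi> \<Longrightarrow> \<phi> p \<Longrightarrow> q \<preceq> p \<Longrightarrow> \<phi> q"
  unfolding fstable_def by (meson le_P le_trans)

lemma stable_dense: "fstable \<phi> \<Longrightarrow> p \<in> P \<Longrightarrow> (\<And>q. q \<preceq> p \<Longrightarrow> \<exists>q'. q' \<preceq> q \<and> \<phi> q') \<Longrightarrow> \<phi> p"
  unfolding fstable_def by blast

lemma stableI:
  assumes "\<And>p q. \<phi> p \<Longrightarrow> q \<preceq> p \<Longrightarrow> \<phi> q"
    and "\<And>p. p \<in> P \<Longrightarrow> (\<And>q. q \<preceq> p \<Longrightarrow> \<exists>q'. q' \<preceq> q \<and> \<phi> q') \<Longrightarrow> \<phi> p"
  shows "fstable \<phi>"
  unfolding fstable_def using assms le_refl le_P by meson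

lemma fnot_iff: "(\<^bold>\<not> \<phi>) p \<longleftrightarrow> (\<forall>q. q \<preceq> p \<longrightarrow> \<not> \<phi> q)"
  by (simp add: fnot_def)

lemma fimp_iff': "(\<phi> \<^bold>\<longrightarrow> \<psi>) p \<longleftrightarrow> (\<forall>q. q \<preceq> p \<longrightarrow> \<phi> q \<longrightarrow> (\<exists>q'. q' \<preceq> q \<and> \<psi> q'))"
  unfolding fimp_def fnot_def fand_def by blast

lemma fdisj_iff: "(\<phi> \<^bold>\<or> \<psi>) p \<longleftrightarrow> (\<forall>q. q \<preceq> p \<longrightarrow> (\<exists>q'. q' \<preceq> q \<and> (\<phi> q' \<or> \<psi> q')))"
  unfolding fdisj_def fnot_def fand_def by blast

lemma fex_iff: "(\<^bold>\<exists>\<tau>. \<Phi> \<tau>) p \<longleftrightarrow> (\<forall>q. q \<preceq> p \<longrightarrow> (\<exists>q' \<tau>. q' \<preceq> q \<and> \<Phi> \<tau> q'))"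
  unfolding fex_def fnot_def fall_def by blast

lemma fex_ground_iff: "fex_ground \<C> \<Phi> p \<longleftrightarrow> (\<forall>q. q \<preceq> p \<longrightarrow> (\<exists>q'. q' \<preceq> q \<and> (\<exists>C \<in> \<C>. \<Phi> C q')))"
  unfolding fex_ground_def fnot_def by blast

lemma stable_fnot [stable_intros]:
  assumes "fstable \<phi>" shows "fstable (\<^bold>\<not> \<phi>)"
proof (rule stableI)
  show "(\<^bold>\<not> \<phi>) q" if "(\<^bold>\<not> \<phi>) p" "q \<preceq> p" for p q
    using that le_trans unfolding fnot_iff by blast
  fix p assume d: "\<And>q. q \<preceq> p \<Longrightarrow> \<exists>q'. q' \<preceq> q \<and> (\<^bold>\<not> \<phi>) q'"
  show "(\<^bold>\<not> \<phi>) p" unfolding fnot_iff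
  proof (intro allI impI notI)
    fix q assume "q \<preceq> p" "\<phi> q"
    then obtain q' where "q' \<preceq> q" "(\<^bold>\<not> \<phi>) q'" using d by blast
    then show False using stable_mono[OF assms \<open>\<phi> q\<close>] le_P le_refl unfolding fnot_iff by blast
  qed
qed

lemma stable_Conj:
  assumes "\<And>i. i \<in> I \<Longrightarrow> fstable (\<Phi> i)" shows "fstable (\<lambda>p. \<forall>i \<in> I. \<Phi> i p)"
proof (rule stableI)
  show "\<forall>i \<in> I. \<Phi> i q" if "\<forall>i \<in> I. \<Phi> i p" "q \<preceq> p" for p q
    using that stable_mono[OF assms] by blast
  fix p assume "p \<in> P" and d: "\<And>q. q \<preceq> p \<Longrightarrow> \<exists>q'. q' \<preceq> q \<and> (\<forall>i \<in> I. \<Phi> i q')"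
  show "\<forall>i \<in> I. \<Phi> i p"
  proof
    fix i assume "i \<in> I"
    then show "\<Phi> i p" using d by (intro stable_dense[OF assms \<open>p \<in> P\<close>]) blast+
  qed
qed

lemma stable_fand [stable_intros]: "fstable \<phi> \<Longrightarrow> fstable \<psi> \<Longrightarrow> fstable (\<phi> \<^bold>\<and> \<psi>)"
  using stable_Conj[of UNIV "\<lambda>b. if b then \<phi> else \<psi>"] unfolding fand_def[abs_def]
  by (simp add: all_bool_eq)

lemma stable_fall [stable_intros]: "(\<And>\<tau>. fstable (\<Phi> \<tau>)) \<Longrightarrow> fstable (\<^bold>\<forall>\<tau>. \<Phi> \<tau>)"
  using stable_Conj[of UNIV \<Phi>] unfolding fall_def[abs_def] by simp

lemma stable_Ball [stable_intros]: "(\<And>C. fstable (\<Phi> C)) \<Longrightarrow> fstable (\<lambda>p. \<forall>C \<in> \<C>. \<Phi> C p)"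
  by (rule stable_Conj)

lemma stable_fimp [stable_intros]: "fstable \<phi> \<Longrightarrow> fstable \<psi> \<Longrightarrow> fstable (\<phi> \<^bold>\<longrightarrow> \<psi>)"
  unfolding fimp_def by (intro stable_intros)

lemma stable_fdisj [stable_intros]: "fstable \<phi> \<Longrightarrow> fstable \<psi> \<Longrightarrow> fstable (\<phi> \<^bold>\<or> \<psi>)"
  unfolding fdisj_def by (intro stable_intros)

lemma stable_fiff [stable_intros]: "fstable \<phi> \<Longrightarrow> fstable \<psi> \<Longrightarrow> fstable (\<phi> \<^bold>\<longleftrightarrow> \<psi>)"
  unfolding fiff_def by (intro stable_intros)

lemma stable_fex [stable_intros]: "(\<And>\<tau>. fstable (\<Phi> \<tau>)) \<Longrightarrow> fstable (\<^bold>\<exists>\<tau>. \<Phi> \<tau>)"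
  unfolding fex_def by (intro stable_intros)

lemma stable_fex_ground [stable_intros]: "(\<And>C. fstable (\<Phi> C)) \<Longrightarrow> fstable (fex_ground \<C> \<Phi>)"
  unfolding fex_ground_def by (intro stable_intros)

text \<open>\<open>fimp\<close> is defined through negations and so a priori yields \<psi> only
  densely. Stability of \<psi> removes the density, and implication behaves as in Kripke
  semantics.\<close>

lemma fimp_iff:
  assumes "fstable \<phi>" "fstable \<psi>"
  shows "(\<phi> \<^bold>\<longrightarrow> \<psi>) p \<longleftrightarrow> (\<forall>q. q \<preceq> p \<longrightarrow> \<phi> q \<longrightarrow> \<psi> q)"
  unfolding fimp_iff'
proof (intro iffI allI impI)
  fix q assume *: "\<forall>q. q \<preceq> p \<longrightarrow> \<phi> q \<longrightarrow> (\<exists>q'. q' \<preceq> q \<and> \<psi> q')" and q: "q \<preceq> p" "\<phi> q"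
  show "\<psi> q"
    by (rule stable_dense[OF assms(2)]) (use * q stable_mono[OF assms(1)] le_P le_trans in blast)+
qed (use le_P le_refl in blast)

lemma fiff_iff:
  assumes "fstable \<phi>" "fstable \<psi>"
  shows "(\<phi> \<^bold>\<longleftrightarrow> \<psi>) p \<longleftrightarrow> (\<forall>q. q \<preceq> p \<longrightarrow> \<phi> q \<longleftrightarrow> \<psi> q)"
  unfolding fiff_def fand_def fimp_iff[OF assms] fimp_iff[OF assms(2,1)] by blast

lemma fexI: "p \<in> P \<Longrightarrow> fstable (\<Phi> \<tau>) \<Longrightarrow> \<Phi> \<tau> p \<Longrightarrow> (\<^bold>\<exists>\<tau>. \<Phi> \<tau>) p"
  unfolding fex_iff using stable_mono[of "\<Phi> \<tau>"] le_refl le_P by blast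

lemma fexD: "(\<^bold>\<exists>\<tau>. \<Phi> \<tau>) p \<Longrightarrow> p \<in> P \<Longrightarrow> \<exists>q \<tau>. q \<preceq> p \<and> \<Phi> \<tau> q"
  unfolding fex_iff using le_refl by blast

text \<open>A forced existential statement has witnesses only on a dense set. For a stable goal this
  is as good as having one.\<close>

lemma fexE:
  assumes "(\<^bold>\<exists>\<tau>. \<Phi> \<tau>) p" "p \<in> P" "fstable \<chi>" "\<And>\<tau> q. q \<preceq> p \<Longrightarrow> \<Phi> \<tau> q \<Longrightarrow> \<chi> q"
  shows "\<chi> p"
proof (rule stable_dense[OF assms(3,2)])
  fix q assume q: "q \<preceq> p"
  then obtain q' \<tau> where "q' \<preceq> q" "\<Phi> \<tau> q'" using assms(1) unfolding fex_iff by blast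
  then show "\<exists>q'. q' \<preceq> q \<and> \<chi> q'" using assms(4) le_trans[OF _ q] by blast
qed

lemma fdisjE:
  assumes "(\<phi> \<^bold>\<or> \<psi>) p" "p \<in> P" "fstable \<chi>"
    "\<And>q. q \<preceq> p \<Longrightarrow> \<phi> q \<Longrightarrow> \<chi> q" "\<And>q. q \<preceq> p \<Longrightarrow> \<psi> q \<Longrightarrow> \<chi> q"
  shows "\<chi> p"
proof (rule stable_dense[OF assms(3,2)])
  fix q assume q: "q \<preceq> p"
  then obtain q' where "q' \<preceq> q" "\<phi> q' \<or> \<psi> q'" using assms(1) unfolding fdisj_iff by blast
  then show "\<exists>q'. q' \<preceq> q \<and> \<chi> q'" using assms(4,5) le_trans[OF _ q] by blast
qed

lemma fdisjI1: "fstable \<phi> \<Longrightarrow> \<phi> p \<Longrightarrow> (\<phi> \<^bold>\<or> \<psi>) p"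
  unfolding fdisj_iff using stable_mono[of \<phi>] le_refl le_P by blast

lemma fdisjI2: "fstable \<psi> \<Longrightarrow> \<psi> p \<Longrightarrow> (\<phi> \<^bold>\<or> \<psi>) p"
  unfolding fdisj_iff using stable_mono[of \<psi>] le_refl le_P by blast

section \<open>Equality and membership\<close>

lemma feq_P: "feq \<sigma> \<tau> p \<Longrightarrow> p \<in> P"
  by (auto elim: feq.cases)

lemma feq_refl: "p \<in> P \<Longrightarrow> feq \<sigma> \<sigma> p"
proof (induction \<sigma> arbitrary: p rule: name_induct)
  case (step \<sigma>)
  have *: "\<exists>q' \<rho> t. q' \<preceq> q \<and> opair \<rho> t \<in> elts \<sigma> \<and> q' \<preceq> t \<and> feq \<pi> \<rho> q' \<and> feq \<rho> \<pi> q'"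
    if "opair \<pi> s \<in> elts \<sigma>" "q \<preceq> s" for \<pi> s q
    using that step.IH[OF that(1)] le_P le_refl by blast
  show ?case by (rule feqI[OF step.prems]) (use * in blast)+
qed

lemma feq_sym: "feq \<sigma> \<tau> p \<Longrightarrow> feq \<tau> \<sigma> p"
proof (induction rule: feq.induct)
  case (feqI p \<sigma> \<tau>)
  show ?case
    by (rule feq.feqI[OF feqI(1)]) (use feqI(2,3) in blast)+
qed

lemma feq_iff:
  "feq \<sigma> \<tau> p \<longleftrightarrow> p \<in> P \<and>
    (\<forall>\<pi> s. opair \<pi> s \<in> elts \<sigma> \<longrightarrow> (\<forall>q. q \<preceq> p \<and> q \<preceq> s \<longrightarrow> (\<exists>q' \<rho> t. q' \<preceq> q \<and> opair \<rho> t \<in> elts \<tau> \<and> q' \<preceq> t \<and> feq \<pi> \<rho> q'))) \<and>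
    (\<forall>\<pi> s. opair \<pi> s \<in> elts \<tau> \<longrightarrow> (\<forall>q. q \<preceq> p \<and> q \<preceq> s \<longrightarrow> (\<exists>q' \<rho> t. q' \<preceq> q \<and> opair \<rho> t \<in> elts \<sigma> \<and> q' \<preceq> t \<and> feq \<pi> \<rho> q')))"
  (is "_ \<longleftrightarrow> _ \<and> ?A \<and> ?B")
proof
  assume "feq \<sigma> \<tau> p"
  then show "p \<in> P \<and> ?A \<and> ?B"
  proof (cases rule: feq.cases)
    case feqI
    have ?B using feqI(3) feq_sym by blast
    then show ?thesis using feqI by blast
  qed
next
  assume *: "p \<in> P \<and> ?A \<and> ?B"
  then have "\<forall>\<rho> t. opair \<rho> t \<in> elts \<tau> \<longrightarrow> (\<forall>q. q \<preceq> p \<and> q \<preceq> t \<longrightarrow>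
           (\<exists>q' \<pi> s. q' \<preceq> q \<and> opair \<pi> s \<in> elts \<sigma> \<and> q' \<preceq> s \<and> feq \<pi> \<rho> q'))"
    using feq_sym by blast
  then show "feq \<sigma> \<tau> p" using * by (intro feqI) blast+
qed

lemma fmem_name: "opair \<pi> s \<in> elts \<sigma> \<Longrightarrow> q \<preceq> s \<Longrightarrow> fmem \<pi> \<sigma> q"
  unfolding fmem_def
proof (intro allI impI)
  fix q1 assume 1: "opair \<pi> s \<in> elts \<sigma>" "q \<preceq> s" "q1 \<preceq> q"
  show "\<exists>q' \<rho> t. q' \<preceq> q1 \<and> opair \<rho> t \<in> elts \<sigma> \<and> q' \<preceq> t \<and> feq \<pi> \<rho> q'"
    using 1 le_refl[OF le_P(1)[OF 1(3)]] le_trans[OF 1(3,2)] feq_refl[OF le_P(1)[OF 1(3)]] by blast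
qed

lemma stable_fmem [stable_intros]: "fstable (fmem \<pi> \<tau>)"
proof (rule stableI)
  show "fmem \<pi> \<tau> q" if "fmem \<pi> \<tau> p" "q \<preceq> p" for p q
    using that(1) le_trans[OF _ that(2)] unfolding fmem_def by blast
  fix p assume d: "\<And>q. q \<preceq> p \<Longrightarrow> \<exists>q'. q' \<preceq> q \<and> fmem \<pi> \<tau> q'"
  show "fmem \<pi> \<tau> p" unfolding fmem_def
  proof (intro allI impI)
    fix q assume "q \<preceq> p"
    then obtain q' where q': "q' \<preceq> q" "fmem \<pi> \<tau> q'" using d by blast
    then obtain q'' \<rho> t where "q'' \<preceq> q'" "opair \<rho> t \<in> elts \<tau> \<and> q'' \<preceq> t \<and> feq \<pi> \<rho> q''"
      using le_refl le_P unfolding fmem_def by blast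
    then show "\<exists>q' \<rho> t. q' \<preceq> q \<and> opair \<rho> t \<in> elts \<tau> \<and> q' \<preceq> t \<and> feq \<pi> \<rho> q'"
      using le_trans[OF _ q'(1)] by blast
  qed
qed

text \<open>Folding the inner clause of the recursion back into \<open>fmem\<close> turns forced
  equality into mutual inclusion of the named elements, the form from which extensionality
  follows.\<close>

lemma feq_fmem: "feq \<sigma> \<tau> p \<longleftrightarrow> p \<in> P \<and>
    (\<forall>\<pi> s q. opair \<pi> s \<in> elts \<sigma> \<longrightarrow> q \<preceq> p \<longrightarrow> q \<preceq> s \<longrightarrow> fmem \<pi> \<tau> q) \<and>
    (\<forall>\<pi> s q. opair \<pi> s \<in> elts \<tau> \<longrightarrow> q \<preceq> p \<longrightarrow> q \<preceq> s \<longrightarrow> fmem \<pi> \<sigma> q)"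
  (is "_ \<longleftrightarrow> _ \<and> ?A \<and> ?B")
proof -
  have "(\<forall>\<pi> s. opair \<pi> s \<in> elts \<sigma> \<longrightarrow> (\<forall>q. q \<preceq> p \<and> q \<preceq> s \<longrightarrow> (\<exists>q' \<rho> t. q' \<preceq> q \<and> opair \<rho> t \<in> elts \<tau> \<and> q' \<preceq> t \<and> feq \<pi> \<rho> q'))) \<longleftrightarrow>
    (\<forall>\<pi> s q. opair \<pi> s \<in> elts \<sigma> \<longrightarrow> q \<preceq> p \<longrightarrow> q \<preceq> s \<longrightarrow> fmem \<pi> \<tau> q)" (is "?L \<longleftrightarrow> ?R") for \<sigma> \<tau>
  proof
    assume L: ?L
    show ?R unfolding fmem_def
    proof (intro allI impI)
      fix \<pi> s q q1 assume "opair \<pi> s \<in> elts \<sigma>" and q: "q \<preceq> p" "q \<preceq> s" "q1 \<preceq> q"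
      then show "\<exists>q' \<rho> t. q' \<preceq> q1 \<and> opair \<rho> t \<in> elts \<tau> \<and> q' \<preceq> t \<and> feq \<pi> \<rho> q'"
        using L le_trans[OF q(3,1)] le_trans[OF q(3,2)] by blast
    qed
  next
    assume R: ?R
    show ?L
    proof (intro allI impI)
      fix \<pi> s q assume "opair \<pi> s \<in> elts \<sigma>" "q \<preceq> p \<and> q \<preceq> s"
      then have "fmem \<pi> \<tau> q" "q \<preceq> q" using R le_P le_refl by blast+
      then show "\<exists>q' \<rho> t. q' \<preceq> q \<and> opair \<rho> t \<in> elts \<tau> \<and> q' \<preceq> t \<and> feq \<pi> \<rho> q'"
        unfolding fmem_def by blast
    qed
  qed
  then show ?thesis by (subst feq_iff) simp
qed

lemma stable_feq [stable_intros]: "fstable (feq \<sigma> \<tau>)"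
proof (rule stableI)
  show "feq \<sigma> \<tau> q" if "feq \<sigma> \<tau> p" "q \<preceq> p" for p q
    using that(1) le_P(1)[OF that(2)] le_trans[OF _ that(2)] unfolding feq_fmem by blast
  fix p assume p: "p \<in> P" and d: "\<And>q. q \<preceq> p \<Longrightarrow> \<exists>q'. q' \<preceq> q \<and> feq \<sigma> \<tau> q'"
  have *: "fmem \<pi> y q"
    if e: "opair \<pi> s \<in> elts x" and q: "q \<preceq> p" "q \<preceq> s"
      and xy: "\<And>q. feq \<sigma> \<tau> q \<Longrightarrow> feq x y q" for \<pi> s q x y
  proof (rule stable_dense[OF stable_fmem le_P(1)[OF q(1)]])
    fix q1 assume q1: "q1 \<preceq> q"
    obtain q' where q': "q' \<preceq> q1" "feq \<sigma> \<tau> q'" using d[OF le_trans[OF q1 q(1)]] by blast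
    have "fmem \<pi> y q'"
      using xy[OF q'(2)] e le_refl[OF le_P(1)[OF q'(1)]] le_trans[OF q'(1) le_trans[OF q1 q(2)]]
      unfolding feq_fmem by blast
    then show "\<exists>q'. q' \<preceq> q1 \<and> fmem \<pi> y q'" using q' by blast
  qed
  show "feq \<sigma> \<tau> p" unfolding feq_fmem using p *[of _ _ \<sigma> _ \<tau>] *[of _ _ \<tau> _ \<sigma>] feq_sym by blast
qed

lemmas feq_mono = stable_mono[OF stable_feq]
lemmas fmem_mono = stable_mono[OF stable_fmem]

text \<open>Induction on \<sigma> with the other names and the condition generalized. A named
  element of \<sigma> is matched densely with one of \<tau> and then with one of \<rho>; the
  converse inclusion runs this chain backwards by symmetry.\<close>

lemma feq_trans: "feq \<sigma> \<tau> p \<Longrightarrow> feq \<tau> \<rho> p \<Longrightarrow> feq \<sigma> \<rho> p"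
proof (induction \<sigma> arbitrary: \<tau> \<rho> p rule: name_induct)
  case (step \<sigma>)
  note A = iffD1[OF feq_iff step.prems(1)] and B = iffD1[OF feq_iff step.prems(2)]
  show ?case
  proof (subst feq_iff, intro conjI allI impI)
    show "p \<in> P" using A by blast
  next
    fix \<pi> s q assume 1: "opair \<pi> s \<in> elts \<sigma>" and q: "q \<preceq> p \<and> q \<preceq> s"
    then obtain q1 \<pi>1 s1 where 2: "q1 \<preceq> q" "opair \<pi>1 s1 \<in> elts \<tau>" "q1 \<preceq> s1" "feq \<pi> \<pi>1 q1"
      using A by blast
    then obtain q2 \<pi>2 s2 where 3: "q2 \<preceq> q1" "opair \<pi>2 s2 \<in> elts \<rho>" "q2 \<preceq> s2" "feq \<pi>1 \<pi>2 q2"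
      using B le_trans[OF 2(1)] q by blast
    have "feq \<pi> \<pi>2 q2" using step.IH[OF 1 feq_mono[OF 2(4) 3(1)] 3(4)] .
    then show "\<exists>q' \<rho>' t. q' \<preceq> q \<and> opair \<rho>' t \<in> elts \<rho> \<and> q' \<preceq> t \<and> feq \<pi> \<rho>' q'"
      using 3 le_trans[OF 3(1) 2(1)] by blast
  next
    fix \<pi> s q assume 1: "opair \<pi> s \<in> elts \<rho>" and q: "q \<preceq> p \<and> q \<preceq> s"
    then obtain q1 \<pi>1 s1 where 2: "q1 \<preceq> q" "opair \<pi>1 s1 \<in> elts \<tau>" "q1 \<preceq> s1" "feq \<pi> \<pi>1 q1"
      using B by blast
    then obtain q2 \<pi>2 s2 where 3: "q2 \<preceq> q1" "opair \<pi>2 s2 \<in> elts \<sigma>" "q2 \<preceq> s2" "feq \<pi>1 \<pi>2 q2"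
      using A le_trans[OF 2(1)] q by blast
    have "feq \<pi>2 \<pi> q2" using step.IH[OF 3(2) feq_sym[OF 3(4)] feq_sym[OF feq_mono[OF 2(4) 3(1)]]] .
    then show "\<exists>q' \<rho>' t. q' \<preceq> q \<and> opair \<rho>' t \<in> elts \<sigma> \<and> q' \<preceq> t \<and> feq \<pi> \<rho>' q'"
      using 3 le_trans[OF 3(1) 2(1)] feq_sym by blast
  qed
qed

text \<open>The Leibniz property, substitution of forced equals. It holds in both places of
  membership and passes through every connective, so it is available for all derived
  formulas.\<close>

definition fcong :: "('v \<Rightarrow> 'v \<Rightarrow> bool) \<Rightarrow> bool"
  where "fcong \<Phi> \<longleftrightarrow> (\<forall>x y p. feq x y p \<longrightarrow> \<Phi> x p \<longrightarrow> \<Phi> y p)"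

lemma fcongD: "fcong \<Phi> \<Longrightarrow> feq x y p \<Longrightarrow> \<Phi> x p \<Longrightarrow> \<Phi> y p"
  unfolding fcong_def by blast

lemma fcong_const [fcong_intros]: "fcong (\<lambda>x. \<phi>)"
  unfolding fcong_def by blast

lemma fcong_fmem1 [fcong_intros]: "fcong (\<lambda>x. fmem x \<tau>)"
  unfolding fcong_def fmem_def
proof (intro allI impI)
  fix x y p q assume xy: "feq x y p" and
    x: "\<forall>q. q \<preceq> p \<longrightarrow> (\<exists>q' \<rho> t. q' \<preceq> q \<and> opair \<rho> t \<in> elts \<tau> \<and> q' \<preceq> t \<and> feq x \<rho> q')" and q: "q \<preceq> p"
  then obtain q' \<rho> t where 1: "q' \<preceq> q" "opair \<rho> t \<in> elts \<tau> \<and> q' \<preceq> t" "feq x \<rho> q'" by blast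
  have "feq y \<rho> q'" using feq_trans[OF feq_sym[OF feq_mono[OF xy le_trans[OF 1(1) q]]] 1(3)] .
  then show "\<exists>q' \<rho> t. q' \<preceq> q \<and> opair \<rho> t \<in> elts \<tau> \<and> q' \<preceq> t \<and> feq y \<rho> q'" using 1 by blast
qed

lemma fcong_fmem2 [fcong_intros]: "fcong (\<lambda>x. fmem \<pi> x)"
proof -
  have "fmem \<pi> y p" if xy: "feq x y p" and "fmem \<pi> x p" for x y p
  proof (rule stable_dense[OF stable_fmem])
    show "p \<in> P" using xy feq_P by blast
    fix q assume q: "q \<preceq> p"
    then obtain q' \<rho> t where 1: "q' \<preceq> q" "opair \<rho> t \<in> elts x" "q' \<preceq> t" "feq \<pi> \<rho> q'"
      using \<open>fmem \<pi> x p\<close> unfolding fmem_def by blast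
    then have "fmem \<rho> y q'" using xy le_trans[OF 1(1) q] unfolding feq_fmem by blast
    then have "fmem \<pi> y q'" using fcongD[OF fcong_fmem1 feq_sym[OF 1(4)]] by blast
    then show "\<exists>q'. q' \<preceq> q \<and> fmem \<pi> y q'" using 1(1) by blast
  qed
  then show ?thesis unfolding fcong_def by blast
qed

lemma fcong_feq2 [fcong_intros]: "fcong (\<lambda>x. feq \<tau> x)"
  unfolding fcong_def using feq_trans feq_sym by blast

lemma fcong_fnot [fcong_intros]: "fcong \<Phi> \<Longrightarrow> fcong (\<lambda>x. \<^bold>\<not> \<Phi> x)"
  unfolding fcong_def fnot_iff by (meson feq_mono feq_sym)

lemma fcong_fand [fcong_intros]: "fcong \<Phi> \<Longrightarrow> fcong \<Psi> \<Longrightarrow> fcong (\<lambda>x. \<Phi> x \<^bold>\<and> \<Psi> x)"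
  unfolding fcong_def fand_def by blast

lemma fcong_fall [fcong_intros]: "(\<And>\<tau>. fcong (\<Phi> \<tau>)) \<Longrightarrow> fcong (\<lambda>x. \<^bold>\<forall>\<tau>. \<Phi> \<tau> x)"
  unfolding fcong_def fall_def by blast

lemma fcong_Ball [fcong_intros]: "(\<And>C. fcong (\<Phi> C)) \<Longrightarrow> fcong (\<lambda>x p. \<forall>C \<in> \<C>. \<Phi> C x p)"
  unfolding fcong_def by blast

lemma fcong_fimp [fcong_intros]: "fcong \<Phi> \<Longrightarrow> fcong \<Psi> \<Longrightarrow> fcong (\<lambda>x. \<Phi> x \<^bold>\<longrightarrow> \<Psi> x)"
  unfolding fimp_def by (intro fcong_intros)

lemma fcong_fdisj [fcong_intros]: "fcong \<Phi> \<Longrightarrow> fcong \<Psi> \<Longrightarrow> fcong (\<lambda>x. \<Phi> x \<^bold>\<or> \<Psi> x)"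
  unfolding fdisj_def by (intro fcong_intros)

lemma fcong_fiff [fcong_intros]: "fcong \<Phi> \<Longrightarrow> fcong \<Psi> \<Longrightarrow> fcong (\<lambda>x. \<Phi> x \<^bold>\<longleftrightarrow> \<Psi> x)"
  unfolding fiff_def by (intro fcong_intros)

lemma fcong_fex [fcong_intros]: "(\<And>\<tau>. fcong (\<Phi> \<tau>)) \<Longrightarrow> fcong (\<lambda>x. \<^bold>\<exists>\<tau>. \<Phi> \<tau> x)"
  unfolding fex_def by (intro fcong_intros)

lemma feq_ext:
  assumes "p \<in> P" "\<And>u q. q \<preceq> p \<Longrightarrow> fmem u x q \<longleftrightarrow> fmem u y q"
  shows "feq x y p"
proof -
  show ?thesis unfolding feq_fmem using assms fmem_name by blast
qed

lemma feq_ext_iff: "p \<in> P \<Longrightarrow> (\<^bold>\<forall>u. u \<^bold>\<in> x \<^bold>\<longleftrightarrow> u \<^bold>\<in> y) p \<longleftrightarrow> feq x y p"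
proof -
  assume p: "p \<in> P"
  have "(\<^bold>\<forall>u. u \<^bold>\<in> x \<^bold>\<longleftrightarrow> u \<^bold>\<in> y) p \<longleftrightarrow> (\<forall>u q. q \<preceq> p \<longrightarrow> fmem u x q \<longleftrightarrow> fmem u y q)"
    unfolding fall_def by (simp add: fiff_iff stable_intros)
  also have "\<dots> \<longleftrightarrow> feq x y p"
    using p feq_ext fcongD[OF fcong_fmem2] feq_mono feq_sym by metis
  finally show ?thesis .
qed

section \<open>Canonical names and pairs\<close>

text \<open>The \<open>cut\<close> produced by \<open>wfrec\<close> is harmless, since the body
  evaluates the function only at elements of \<open>x\<close>.\<close>

lemma elts_check: "elts (check x) = {opair (check y) p |y p. y \<in> elts x \<and> p \<in> P}"
proof -
  have "check x = vset {opair (check y) p |y p. y \<in> elts x \<and> p \<in> P}"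
  proof -
    let ?H = "\<lambda>f x. vset {opair (f y) p | y p. y \<in> elts x \<and> p \<in> P}"
    have "check x = ?H (cut check {(x, y). x \<in> elts y} x) x"
      by (rule def_wfrec[OF _ wf_elts]) (simp add: check_def)
    also have "\<dots> = ?H check x"
    proof -
      have "cut check {(x, y). x \<in> elts y} x y = check y" if "y \<in> elts x" for y
        using that by (simp add: cut_apply)
      then show ?thesis by (intro arg_cong[where f = vset] Collect_cong) metis
    qed
    finally show ?thesis .
  qed
  moreover have "small {opair (check y) p |y p. y \<in> elts x \<and> p \<in> P}"
    using small_image2[OF small_elts small, of "\<lambda>y p. opair (check y) p"] .
  ultimately show ?thesis by simp
qed

lemma fmem_checkD:
  assumes "fmem \<pi> (check x) p" "p \<in> P"
  shows "\<exists>q y. q \<preceq> p \<and> y \<in> elts x \<and> feq \<pi> (check y) q"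
  using assms unfolding fmem_def elts_check by (fastforce dest: le_refl)

lemma fmem_checkI: "y \<in> elts x \<Longrightarrow> fmem (check y) (check x) p"
  unfolding fmem_def elts_check using le_refl le_P feq_refl by blast

lemma feq_check [simp]: "feq (check x) (check y) p \<longleftrightarrow> p \<in> P \<and> x = y"
proof
  show "feq (check x) (check y) p \<Longrightarrow> p \<in> P \<and> x = y"
  proof (induction x arbitrary: y p rule: elts_induct)
    case (step x)
    have p: "p \<in> P" using step.prems feq_P by blast
    have "z \<in> elts y" if "z \<in> elts x" for z
    proof -
      have "fmem (check z) (check y) p"
        using fcongD[OF fcong_fmem2 step.prems] fmem_checkI[OF that] by blast
      then show ?thesis using fmem_checkD[OF _ p] step.IH[OF that] by blast
    qed
    moreover have "z \<in> elts x" if "z \<in> elts y" for z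
    proof -
      have "fmem (check z) (check x) p"
        using fcongD[OF fcong_fmem2 feq_sym[OF step.prems]] fmem_checkI[OF that] by blast
      then show ?thesis using fmem_checkD[OF _ p] step.IH feq_sym by blast
    qed
    ultimately have "elts x = elts y" by blast
    then show ?case using p by simp
  qed
qed (auto intro: feq_refl)

lemma fmem_check [simp]: "p \<in> P \<Longrightarrow> fmem (check y) (check x) p \<longleftrightarrow> y \<in> elts x"
  by (metis feq_check fmem_checkD fmem_checkI)

text \<open>A name for the unordered pair. As in \<open>check\<close>, every condition is attached
  to both entries because a largest condition need not exist.\<close>

definition upn :: "'v \<Rightarrow> 'v \<Rightarrow> 'v"
  where "upn x y = vset {opair z s |z s. z \<in> {x, y} \<and> s \<in> P}"

definition opn :: "'v \<Rightarrow> 'v \<Rightarrow> 'v"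
  where "opn x y = upn (upn x x) (upn x y)"

lemma elts_upn: "elts (upn x y) = {opair z s |z s. z \<in> {x, y} \<and> s \<in> P}"
  unfolding upn_def using small_image2[OF small_pair small, of opair] by simp

lemma fmem_upn: "fmem u (upn x y) p \<longleftrightarrow> (feq u x \<^bold>\<or> feq u y) p"
proof -
  have "(\<exists>q' \<rho> t. q' \<preceq> q \<and> opair \<rho> t \<in> elts (upn x y) \<and> q' \<preceq> t \<and> feq u \<rho> q') \<longleftrightarrow>
      (\<exists>q'. q' \<preceq> q \<and> (feq u x q' \<or> feq u y q'))"
    (is "?L \<longleftrightarrow> ?R") for q
  proof
    show ?R if ?L using that unfolding elts_upn opair_inject by auto
    assume ?R
    then obtain q' z where "q' \<preceq> q" "z = x \<or> z = y" "feq u z q'" by blast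
    then have "q' \<preceq> q \<and> opair z q' \<in> elts (upn x y) \<and> q' \<preceq> q' \<and> feq u z q'"
      using le_P le_refl unfolding elts_upn by blast
    then show ?L by blast
  qed
  then show ?thesis unfolding fmem_def fdisj_iff by simp
qed

lemma fmem_upn': "fmem u (upn x y) = (feq u x \<^bold>\<or> feq u y)"
  by (rule ext) (rule fmem_upn)

lemma check_upn: "check (vset {x, y}) = upn (check x) (check y)"
proof (rule extensionality)
  have "elts (check (vset {x, y})) = {opair (check z) p |z p. z \<in> {x, y} \<and> p \<in> P}"
    by (simp only: elts_check elts_vset[OF small_pair])
  also have "\<dots> = elts (upn (check x) (check y))" unfolding elts_upn by blast
  finally show "elts (check (vset {x, y})) = elts (upn (check x) (check y))" .
qed

lemma check_opn: "check (opair x y) = opn (check x) (check y)"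
  unfolding opair_def opn_def using check_upn[of x x] by (simp add: check_upn)

lemma upn1_inject: "feq (upn x x) (upn x' y') p \<Longrightarrow> feq x' x p \<and> feq y' x p"
proof -
  assume e: "feq (upn x x) (upn x' y') p"
  have p: "p \<in> P" using e feq_P by blast
  have "feq u x p" if "(feq u x' \<^bold>\<or> feq u y') p" for u
  proof -
    have "fmem u (upn x x) p" using that fcongD[OF fcong_fmem2 feq_sym[OF e]] by (simp add: fmem_upn)
    then show ?thesis unfolding fmem_upn by (rule fdisjE[OF _ p stable_feq])
  qed
  then show ?thesis using p by (meson fdisjI1 fdisjI2 feq_refl stable_feq)
qed

text \<open>The formula \<open>fpair\<close> describes a Kuratowski pair in the forcing language.
  Extensionality in the extension trades it for equality with the explicit name
  \<open>opn x y\<close>, and then \<open>fapp\<close> becomes plain membership.\<close>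

lemma fpair_iff: "p \<in> P \<Longrightarrow> fpair z x y p \<longleftrightarrow> feq z (opn x y) p"
proof -
  assume p: "p \<in> P"
  have 1: "(\<^bold>\<forall>u. u \<^bold>\<in> w \<^bold>\<longleftrightarrow> (u \<^bold>= x \<^bold>\<or> u \<^bold>= y)) q \<longleftrightarrow> feq w (upn x y) q" if "q \<in> P" for w q x y
    using feq_ext_iff[OF that, of w "upn x y"] unfolding fmem_upn' .
  have 2: "(\<^bold>\<forall>u. u \<^bold>\<in> w \<^bold>\<longleftrightarrow> u \<^bold>= x) q \<longleftrightarrow> feq w (upn x x) q" if "q \<in> P" for w q
  proof -
    have "(feq u x \<^bold>\<or> feq u x) q' \<longleftrightarrow> feq u x q'" if "q' \<in> P" for u q'
      using that fdisjE[OF _ _ stable_feq] fdisjI1[OF stable_feq] by metis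
    then have *: "(feq u x \<^bold>\<or> feq u x) q' \<longleftrightarrow> feq u x q'" if "q' \<preceq> q" for u q'
      using that le_P by blast
    have "(fmem u w \<^bold>\<longleftrightarrow> feq u x) q \<longleftrightarrow> (fmem u w \<^bold>\<longleftrightarrow> (feq u x \<^bold>\<or> feq u x)) q" for u
      by (subst fiff_iff, (intro stable_intros)+, subst fiff_iff, (intro stable_intros)+) (simp add: *)
    then show ?thesis
      unfolding 1[OF that, symmetric] fall_def by simp
  qed
  let ?A = "\<lambda>w. \<^bold>\<forall>u. u \<^bold>\<in> w \<^bold>\<longleftrightarrow> u \<^bold>= x"
  let ?B = "\<lambda>w. \<^bold>\<forall>u. u \<^bold>\<in> w \<^bold>\<longleftrightarrow> (u \<^bold>= x \<^bold>\<or> u \<^bold>= y)"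
  have "(q' \<preceq> q \<and> (?A w q' \<or> ?B w q')) = (q' \<preceq> q \<and> (feq w (upn x x) q' \<or> feq w (upn x y) q'))" for w q q'
    using 1[of q' w x y] 2[of q' w] le_P(1)[of q' q] by argo
  then have "(?A w \<^bold>\<or> ?B w) q \<longleftrightarrow> fmem w (opn x y) q" for w q
    unfolding opn_def fmem_upn' fdisj_iff by simp
  then have "(fmem w z \<^bold>\<longleftrightarrow> (?A w \<^bold>\<or> ?B w)) = (fmem w z \<^bold>\<longleftrightarrow> fmem w (opn x y))" for w
    by (intro arg_cong2[where f = fiff] ext refl)
  then have "fpair z x y p \<longleftrightarrow> (\<^bold>\<forall>w. w \<^bold>\<in> z \<^bold>\<longleftrightarrow> w \<^bold>\<in> opn x y) p"
    unfolding fpair_def by simp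
  then show ?thesis using feq_ext_iff[OF p] by simp
qed

lemma stable_fpair [stable_intros]: "fstable (fpair z x y)"
  unfolding fpair_def by (intro stable_intros)

lemma stable_fapp [stable_intros]: "fstable (fapp f x y)"
  unfolding fapp_def by (intro stable_intros)

lemma fapp_iff: "p \<in> P \<Longrightarrow> fapp f x y p \<longleftrightarrow> fmem (opn x y) f p"
proof
  assume p: "p \<in> P"
  show "fmem (opn x y) f p" if "fapp f x y p"
    using that unfolding fapp_def
  proof (rule fexE[OF _ p stable_fmem])
    fix \<tau> q assume "q \<preceq> p" "(\<tau> \<^bold>\<in> f \<^bold>\<and> fpair \<tau> x y) q"
    then show "fmem (opn x y) f q"
      using fcongD[OF fcong_fmem1] fpair_iff le_P unfolding fand_def by blast
  qed
  show "fapp f x y p" if "fmem (opn x y) f p"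
    unfolding fapp_def
    by (rule fexI[where \<tau> = "opn x y"])
      (use p that in \<open>auto simp: fand_def fpair_iff feq_refl intro!: stable_intros\<close>)
qed

lemma fcong_fpair [fcong_intros]:
  "fcong (\<lambda>z. fpair z x y)" "fcong (\<lambda>x. fpair z x y)" "fcong (\<lambda>y. fpair z x y)"
  unfolding fpair_def by (intro fcong_intros)+

lemma fcong_fapp [fcong_intros]:
  "fcong (\<lambda>f. fapp f x y)" "fcong (\<lambda>x. fapp f x y)" "fcong (\<lambda>y. fapp f x y)"
  unfolding fapp_def by (intro fcong_intros)+

text \<open>From right to left this is substitution. From left to right it is the usual argument for
  Kuratowski pairs, with every case distinction replaced by a passage to stronger conditions;
  \<open>fdisjE\<close> permits this because the goal is stable.\<close>

lemma opn_inject: "feq (opn x y) (opn x' y') p \<longleftrightarrow> feq x x' p \<and> feq y y' p"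
proof
  assume e: "feq x x' p \<and> feq y y' p"
  then have p: "p \<in> P" using feq_P by blast
  have "fpair (opn x y) x y p" using p by (simp add: fpair_iff feq_refl)
  then have "fpair (opn x y) x' y' p"
    using e fcongD[OF fcong_fpair(2)] fcongD[OF fcong_fpair(3)] by blast
  then show "feq (opn x y) (opn x' y') p" using p by (simp add: fpair_iff)
next
  assume e: "feq (opn x y) (opn x' y') p"
  have p: "p \<in> P" using e feq_P by blast
  have L: "(feq u (upn x' x') \<^bold>\<or> feq u (upn x' y')) q"
    if "feq u (upn x x) q \<or> feq u (upn x y) q" "q \<preceq> p" for u q
    using fcongD[OF fcong_fmem2 feq_mono[OF e that(2)]] that(1) fdisjI1 fdisjI2 stable_feq
    unfolding opn_def fmem_upn by blast
  have R: "(feq u (upn x x) \<^bold>\<or> feq u (upn x y)) q"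
    if "feq u (upn x' x') q \<or> feq u (upn x' y') q" "q \<preceq> p" for u q
    using fcongD[OF fcong_fmem2 feq_mono[OF feq_sym[OF e] that(2)]] that(1) fdisjI1 fdisjI2 stable_feq
    unfolding opn_def fmem_upn by blast
  have in1: "(feq u a \<^bold>\<or> feq u b) q" if "feq (upn a' b') (upn a b) q" "feq u a' q \<or> feq u b' q" for u a b a' b' q
    using fcongD[OF fcong_fmem2 that(1)] that(2) fdisjI1 fdisjI2 stable_feq unfolding fmem_upn by metis
  have "(feq (upn x x) (upn x' x') \<^bold>\<or> feq (upn x x) (upn x' y')) p"
    using L p feq_refl le_refl by blast
  then have x: "feq x x' p"
    by (rule fdisjE[OF _ p stable_feq]) (use upn1_inject feq_sym in blast)+
  have xx: "feq x x' q" "feq x' x q" if "q \<preceq> p" for q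
    using feq_mono[OF x that] feq_sym by blast+
  have "(feq (upn x y) (upn x' x') \<^bold>\<or> feq (upn x y) (upn x' y')) p"
    using L p feq_refl le_refl by blast
  then have "feq y y' p"
  proof (rule fdisjE[OF _ p stable_feq])
    \<comment> \<open>The degenerate case: the second set collapses to a singleton, so both y and y'
      turn out equal to x.\<close>
    fix q assume q: "q \<preceq> p" and "feq (upn x y) (upn x' x') q"
    then have "feq y x' q" using upn1_inject feq_sym by blast
    then have yx: "feq y x q" using xx[OF q] feq_trans by blast
    have "(feq (upn x' y') (upn x x) \<^bold>\<or> feq (upn x' y') (upn x y)) q"
      using R q feq_refl le_P by blast
    then have "feq y' x q"
    proof (rule fdisjE[OF _ le_P(1)[OF q] stable_feq])
      fix q1 assume q1: "q1 \<preceq> q"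
      show "feq y' x q1" if "feq (upn x' y') (upn x x) q1"
        using that upn1_inject feq_sym by blast
      show "feq y' x q1" if e1: "feq (upn x' y') (upn x y) q1"
      proof -
        have "(feq y' x \<^bold>\<or> feq y' y) q1"
          using in1[OF e1] feq_refl le_P q1 by blast
        then show ?thesis
        proof (rule fdisjE[OF _ le_P(1)[OF q1] stable_feq])
          fix q2 assume "q2 \<preceq> q1" "feq y' y q2"
          then show "feq y' x q2" using feq_mono[OF yx le_trans[OF _ q1]] feq_trans by blast
        qed
      qed
    qed
    then show "feq y y' q" using yx feq_trans feq_sym by blast
  next
    fix q assume q: "q \<preceq> p" and e2: "feq (upn x y) (upn x' y') q"
    have "(feq y' x \<^bold>\<or> feq y' y) q"
      using in1[OF feq_sym[OF e2]] feq_refl le_P q by blast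
    then show "feq y y' q"
    proof (rule fdisjE[OF _ le_P(1)[OF q] stable_feq])
      fix q1 assume q1: "q1 \<preceq> q" and y'x: "feq y' x q1"
      have y'x': "feq y' x' q1" using y'x xx[OF le_trans[OF q1 q]] feq_trans by blast
      have "(feq y x' \<^bold>\<or> feq y y') q1"
        using in1[OF feq_mono[OF e2 q1]] feq_refl le_P q1 by blast
      then show "feq y y' q1"
      proof (rule fdisjE[OF _ le_P(1)[OF q1] stable_feq])
        fix q2 assume "q2 \<preceq> q1" "feq y x' q2"
        then show "feq y y' q2" using feq_mono[OF y'x'] feq_sym feq_trans by blast
      qed
    qed (use feq_sym in blast)
  qed
  then show "feq x x' p \<and> feq y y' p" using x by blast
qed

lemma fapp_check [simp]: "p \<in> P \<Longrightarrow> fapp (check f) (check x) (check y) p \<longleftrightarrow> opair x y \<in> elts f"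
  by (simp add: fapp_iff check_opn[symmetric])

lemma fapp_checkD:
  assumes "fapp (check f) x y p" "p \<in> P" "\<And>e. e \<in> elts f \<Longrightarrow> \<exists>a b. e = opair a b"
  shows "\<exists>q a b. q \<preceq> p \<and> opair a b \<in> elts f \<and> feq x (check a) q \<and> feq y (check b) q"
proof -
  obtain q e where q: "q \<preceq> p" "e \<in> elts f" "feq (opn x y) (check e) q"
    using fmem_checkD[OF iffD1[OF fapp_iff[OF assms(2)] assms(1)] assms(2)] by blast
  then obtain a b where "e = opair a b" using assms(3) by blast
  then show ?thesis using q by (auto simp: check_opn opn_inject)
qed

lemma fpair_check [simp]: "p \<in> P \<Longrightarrow> fpair (check z) (check x) (check y) p \<longleftrightarrow> z = opair x y"
  by (simp add: fpair_iff check_opn[symmetric])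

end

section \<open>Left modules\<close>

context left_module
begin

lemma smult_l_zero: "x \<in> carrier M \<Longrightarrow> \<zero>\<^bsub>R\<^esub> \<odot>\<^bsub>M\<^esub> x = \<zero>\<^bsub>M\<^esub>"
proof -
  assume x: "x \<in> carrier M"
  have "\<zero>\<^bsub>R\<^esub> \<odot>\<^bsub>M\<^esub> x \<oplus>\<^bsub>M\<^esub> \<zero>\<^bsub>R\<^esub> \<odot>\<^bsub>M\<^esub> x = \<zero>\<^bsub>R\<^esub> \<odot>\<^bsub>M\<^esub> x"
    using x smult_l_distr[of "\<zero>\<^bsub>R\<^esub>" "\<zero>\<^bsub>R\<^esub>" x] smult_closed by simp
  then show ?thesis using x smult_closed by (metis M.add.l_cancel_one R.zero_closed)
qed

lemma smult_minus_one: "x \<in> carrier M \<Longrightarrow> (\<ominus>\<^bsub>R\<^esub> \<one>\<^bsub>R\<^esub>) \<odot>\<^bsub>M\<^esub> x = \<ominus>\<^bsub>M\<^esub> x"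
proof -
  assume x: "x \<in> carrier M"
  have "(\<ominus>\<^bsub>R\<^esub> \<one>\<^bsub>R\<^esub>) \<odot>\<^bsub>M\<^esub> x \<oplus>\<^bsub>M\<^esub> x = (\<ominus>\<^bsub>R\<^esub> \<one>\<^bsub>R\<^esub> \<oplus>\<^bsub>R\<^esub> \<one>\<^bsub>R\<^esub>) \<odot>\<^bsub>M\<^esub> x"
    using x smult_l_distr[of "\<ominus>\<^bsub>R\<^esub> \<one>\<^bsub>R\<^esub>" "\<one>\<^bsub>R\<^esub>" x] smult_one by simp
  also have "\<dots> = \<zero>\<^bsub>M\<^esub>" using x by (simp add: R.l_neg smult_l_zero)
  finally show ?thesis using x smult_closed by (metis M.minus_equality R.a_inv_closed R.one_closed)
qed

text \<open>Closure under negatives comes from scalar multiplication by minus one.\<close>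

lemma submoduleI:
  assumes "N \<subseteq> carrier M" "\<zero>\<^bsub>M\<^esub> \<in> N" "\<And>x y. x \<in> N \<Longrightarrow> y \<in> N \<Longrightarrow> x \<oplus>\<^bsub>M\<^esub> y \<in> N"
    "\<And>a x. a \<in> carrier R \<Longrightarrow> x \<in> N \<Longrightarrow> a \<odot>\<^bsub>M\<^esub> x \<in> N"
  shows "submodule N R M"
proof (intro submodule.intro subgroup.intro submodule_axioms.intro)
  fix x assume x: "x \<in> N"
  then have "\<ominus>\<^bsub>M\<^esub> x = (\<ominus>\<^bsub>R\<^esub> \<one>\<^bsub>R\<^esub>) \<odot>\<^bsub>M\<^esub> x" using assms(1) smult_minus_one by auto
  also have "\<dots> \<in> N" using x assms(4) by simp
  finally show "inv\<^bsub>add_monoid M\<^esub> x \<in> N" by (simp add: a_inv_def)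
qed (use assms in auto)

lemma submoduleD:
  assumes "submodule N R M"
  shows "N \<subseteq> carrier M" "\<zero>\<^bsub>M\<^esub> \<in> N" "x \<in> N \<Longrightarrow> y \<in> N \<Longrightarrow> x \<oplus>\<^bsub>M\<^esub> y \<in> N"
    "a \<in> carrier R \<Longrightarrow> x \<in> N \<Longrightarrow> a \<odot>\<^bsub>M\<^esub> x \<in> N" "x \<in> N \<Longrightarrow> \<ominus>\<^bsub>M\<^esub> x \<in> N"
    "x \<in> N \<Longrightarrow> y \<in> N \<Longrightarrow> x \<ominus>\<^bsub>M\<^esub> y \<in> N"
proof -
  interpret N: submodule N R M by fact
  show "N \<subseteq> carrier M" using N.subset by simp
  show "\<zero>\<^bsub>M\<^esub> \<in> N" using N.one_closed by simp
  show add: "x \<in> N \<Longrightarrow> y \<in> N \<Longrightarrow> x \<oplus>\<^bsub>M\<^esub> y \<in> N" for x y using N.m_closed by simp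
  show "a \<in> carrier R \<Longrightarrow> x \<in> N \<Longrightarrow> a \<odot>\<^bsub>M\<^esub> x \<in> N" by (rule N.smult_closed)
  show neg: "x \<in> N \<Longrightarrow> \<ominus>\<^bsub>M\<^esub> x \<in> N" for x using N.m_inv_closed by (simp add: a_inv_def)
  show "x \<in> N \<Longrightarrow> y \<in> N \<Longrightarrow> x \<ominus>\<^bsub>M\<^esub> y \<in> N" using add neg by (simp add: a_minus_def)
qed

lemma submodule_carrier: "submodule (carrier M) R M"
  by (rule submoduleI) (auto intro: smult_closed)

lemma submodule_zero: "submodule {\<zero>\<^bsub>M\<^esub>} R M"
proof (rule submoduleI)
  fix a x assume a: "a \<in> carrier R" and "x \<in> {\<zero>\<^bsub>M\<^esub>}"
  moreover have "a \<odot>\<^bsub>M\<^esub> \<zero>\<^bsub>M\<^esub> = \<zero>\<^bsub>M\<^esub>"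
    using a smult_assoc1[of a "\<zero>\<^bsub>R\<^esub>" "\<zero>\<^bsub>M\<^esub>"] smult_l_zero by simp
  ultimately show "a \<odot>\<^bsub>M\<^esub> x \<in> {\<zero>\<^bsub>M\<^esub>}" by simp
qed auto

lemma submodule_Inter: "\<N> \<noteq> {} \<Longrightarrow> (\<And>N. N \<in> \<N> \<Longrightarrow> submodule N R M) \<Longrightarrow> submodule (\<Inter>\<N>) R M"
proof (rule submoduleI)
  assume ne: "\<N> \<noteq> {}" and sub: "\<And>N. N \<in> \<N> \<Longrightarrow> submodule N R M"
  show "\<Inter>\<N> \<subseteq> carrier M" using ne submoduleD(1)[OF sub] by blast
  show "\<zero>\<^bsub>M\<^esub> \<in> \<Inter>\<N>" using submoduleD(2)[OF sub] by blast
  show "x \<oplus>\<^bsub>M\<^esub> y \<in> \<Inter>\<N>" if "x \<in> \<Inter>\<N>" "y \<in> \<Inter>\<N>" for x y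
    using that submoduleD(3)[OF sub] by blast
  show "a \<odot>\<^bsub>M\<^esub> x \<in> \<Inter>\<N>" if "a \<in> carrier R" "x \<in> \<Inter>\<N>" for a x
    using that submoduleD(4)[OF sub] by blast
qed

lemma submodule_span: "W \<subseteq> carrier M \<Longrightarrow> submodule (span R M W) R M"
  unfolding span_def using submodule_carrier by (intro submodule_Inter) auto

lemma span_superset: "W \<subseteq> span R M W"
  unfolding span_def by blast

lemma span_base: "x \<in> W \<Longrightarrow> x \<in> span R M W"
  by (rule subsetD[OF span_superset])

lemma span_least: "submodule N R M \<Longrightarrow> W \<subseteq> N \<Longrightarrow> span R M W \<subseteq> N"
  unfolding span_def by blast

lemma span_mono: "V \<subseteq> W \<Longrightarrow> span R M V \<subseteq> span R M W"
  unfolding span_def by blast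

lemma span_submodule: "submodule N R M \<Longrightarrow> span R M N = N"
  using span_least span_superset by blast

lemma submodule_Union_chain:
  assumes "I \<noteq> {}" "\<And>i. i \<in> I \<Longrightarrow> submodule (N i) R M"
    and "\<And>i j. i \<in> I \<Longrightarrow> j \<in> I \<Longrightarrow> N i \<subseteq> N j \<or> N j \<subseteq> N i"
  shows "submodule (\<Union>i\<in>I. N i) R M"
proof (rule submoduleI)
  show "(\<Union>i\<in>I. N i) \<subseteq> carrier M" using assms(2) submoduleD(1) by blast
  show "\<zero>\<^bsub>M\<^esub> \<in> (\<Union>i\<in>I. N i)" using assms(1,2) submoduleD(2) by blast
  fix x y assume "x \<in> (\<Union>i\<in>I. N i)" "y \<in> (\<Union>i\<in>I. N i)"
  then obtain i j where "i \<in> I" "x \<in> N i" "j \<in> I" "y \<in> N j" by blast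
  moreover then have "N i \<subseteq> N j \<or> N j \<subseteq> N i" using assms(3) by blast
  ultimately show "x \<oplus>\<^bsub>M\<^esub> y \<in> (\<Union>i\<in>I. N i)" using assms(2) submoduleD(3) by blast
next
  fix a x assume "a \<in> carrier R" "x \<in> (\<Union>i\<in>I. N i)"
  then show "a \<odot>\<^bsub>M\<^esub> x \<in> (\<Union>i\<in>I. N i)" using assms(2) submoduleD(4) by blast
qed

lemma submodule_sum:
  assumes "submodule A R M" "submodule B R M"
  shows "submodule {x \<oplus>\<^bsub>M\<^esub> y |x y. x \<in> A \<and> y \<in> B} R M"
proof (rule submoduleI)
  note A = submoduleD[OF assms(1)] and B = submoduleD[OF assms(2)]
  let ?S = "{x \<oplus>\<^bsub>M\<^esub> y |x y. x \<in> A \<and> y \<in> B}"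
  show "?S \<subseteq> carrier M" using A(1) B(1) by blast
  show "\<zero>\<^bsub>M\<^esub> \<in> ?S" using A(2) B(2) M.r_zero[OF M.zero_closed, symmetric] by blast
  fix x y assume "x \<in> ?S" "y \<in> ?S"
  then obtain a b a' b' where *: "x = a \<oplus>\<^bsub>M\<^esub> b" "y = a' \<oplus>\<^bsub>M\<^esub> b'" "a \<in> A" "a' \<in> A" "b \<in> B" "b' \<in> B" by blast
  then have "a \<in> carrier M" "a' \<in> carrier M" "b \<in> carrier M" "b' \<in> carrier M" using A(1) B(1) by auto
  then have "x \<oplus>\<^bsub>M\<^esub> y = (a \<oplus>\<^bsub>M\<^esub> a') \<oplus>\<^bsub>M\<^esub> (b \<oplus>\<^bsub>M\<^esub> b')" using * by (simp add: M.a_ac)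
  then show "x \<oplus>\<^bsub>M\<^esub> y \<in> ?S" using * A(3) B(3) by blast
next
  note A = submoduleD[OF assms(1)] and B = submoduleD[OF assms(2)]
  let ?S = "{x \<oplus>\<^bsub>M\<^esub> y |x y. x \<in> A \<and> y \<in> B}"
  fix c x assume c: "c \<in> carrier R" and "x \<in> ?S"
  then obtain a b where *: "x = a \<oplus>\<^bsub>M\<^esub> b" "a \<in> A" "b \<in> B" by blast
  then have "c \<odot>\<^bsub>M\<^esub> x = c \<odot>\<^bsub>M\<^esub> a \<oplus>\<^bsub>M\<^esub> c \<odot>\<^bsub>M\<^esub> b" using smult_r_distr[OF c subsetD[OF A(1)] subsetD[OF B(1)]] by simp
  then show "c \<odot>\<^bsub>M\<^esub> x \<in> ?S" using * A(4) B(4) c by blast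
qed

lemma span_Un:
  assumes "A \<subseteq> carrier M" "B \<subseteq> carrier M"
  shows "span R M (A \<union> B) = {x \<oplus>\<^bsub>M\<^esub> y |x y. x \<in> span R M A \<and> y \<in> span R M B}"
proof -
  let ?S = "{x \<oplus>\<^bsub>M\<^esub> y |x y. x \<in> span R M A \<and> y \<in> span R M B}"
  note A = submodule_span[OF assms(1)] and B = submodule_span[OF assms(2)]
  have "A \<subseteq> ?S"
  proof
    fix x assume "x \<in> A"
    then have "x = x \<oplus>\<^bsub>M\<^esub> \<zero>\<^bsub>M\<^esub>" "x \<in> span R M A" using assms span_superset by auto
    then show "x \<in> ?S" using submoduleD(2)[OF B] by blast
  qed
  moreover have "B \<subseteq> ?S"
  proof
    fix x assume "x \<in> B"
    then have "x = \<zero>\<^bsub>M\<^esub> \<oplus>\<^bsub>M\<^esub> x" "x \<in> span R M B" using assms span_superset by auto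
    then show "x \<in> ?S" using submoduleD(2)[OF A] by blast
  qed
  ultimately have "span R M (A \<union> B) \<subseteq> ?S" by (intro span_least[OF submodule_sum[OF A B]] Un_least)
  moreover have "?S \<subseteq> span R M (A \<union> B)"
  proof -
    have AB: "submodule (span R M (A \<union> B)) R M" using assms by (intro submodule_span) auto
    have "span R M A \<subseteq> span R M (A \<union> B)" "span R M B \<subseteq> span R M (A \<union> B)" by (rule span_mono, blast)+
    then show ?thesis using submoduleD(3)[OF AB] by blast
  qed
  ultimately show ?thesis by blast
qed

lemma left_module_submodule: "submodule N R M \<Longrightarrow> left_module R (M\<lparr>carrier := N\<rparr>)"
proof -
  assume N: "submodule N R M"
  then interpret N: submodule N R M .
  note D = submoduleD[OF N]
  have NM: "x \<in> carrier M" if "x \<in> N" for x using that D(1) by blast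
  have "abelian_group (M\<lparr>carrier := N\<rparr>)"
  proof (rule abelian_groupI)
    fix x assume "x \<in> carrier (M\<lparr>carrier := N\<rparr>)"
    then show "\<exists>y\<in>carrier (M\<lparr>carrier := N\<rparr>). y \<oplus>\<^bsub>M\<lparr>carrier := N\<rparr>\<^esub> x = \<zero>\<^bsub>M\<lparr>carrier := N\<rparr>\<^esub>"
      using D(5) NM M.l_neg by (intro bexI[of _ "\<ominus>\<^bsub>M\<^esub> x"]) auto
  qed (simp_all add: D(2,3) NM M.a_ac)
  then show ?thesis
    by (intro left_module.intro left_module_axioms.intro R.ring_axioms)
      (simp_all add: NM D(4) smult_l_distr smult_r_distr smult_assoc1 smult_one)
qed

lemma submodule_update_iff: "submodule N R M \<Longrightarrow> submodule K R (M\<lparr>carrier := N\<rparr>) \<Longrightarrow> submodule K R M"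
proof -
  assume N: "submodule N R M" and K: "submodule K R (M\<lparr>carrier := N\<rparr>)"
  interpret N: left_module R "M\<lparr>carrier := N\<rparr>" using left_module_submodule[OF N] .
  show ?thesis using N.submoduleD[OF K] submoduleD[OF N] by (intro submoduleI) auto
qed

end

text \<open>By the first isomorphism theorem, an isomorphism of N'/N with C amounts to a
  homomorphism of N' onto C with kernel N. In this form no quotient module has to be built in the
  ground model.\<close>

definition quot_iso ::
    "('r, 'x) ring_scheme \<Rightarrow> ('r, 'm, 'y) module_scheme \<Rightarrow> 'm set \<Rightarrow> 'm set \<Rightarrow>
     ('r, 'n, 'z) module_scheme \<Rightarrow> ('m \<Rightarrow> 'n) \<Rightarrow> bool"
  where "quot_iso R M N' N C \<phi> \<longleftrightarrow> \<phi> ` N' = carrier C \<and>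
    (\<forall>x \<in> N'. \<forall>y \<in> N'. \<phi> (x \<oplus>\<^bsub>M\<^esub> y) = \<phi> x \<oplus>\<^bsub>C\<^esub> \<phi> y) \<and>
    (\<forall>a \<in> carrier R. \<forall>x \<in> N'. \<phi> (a \<odot>\<^bsub>M\<^esub> x) = a \<odot>\<^bsub>C\<^esub> \<phi> x) \<and>
    (\<forall>x \<in> N'. \<phi> x = \<zero>\<^bsub>C\<^esub> \<longleftrightarrow> x \<in> N)"

definition coset :: "('r, 'm, 'y) module_scheme \<Rightarrow> 'm set \<Rightarrow> 'm \<Rightarrow> 'm set"
  where "coset M N a = (\<lambda>n. a \<oplus>\<^bsub>M\<^esub> n) ` N"

lemma quot_iso_minus:
  assumes "left_module R M" "left_module R C" "submodule N' R M" "quot_iso R M N' N C \<phi>" "x \<in> N'" "y \<in> N'"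
  shows "\<phi> (x \<ominus>\<^bsub>M\<^esub> y) = \<phi> x \<ominus>\<^bsub>C\<^esub> \<phi> y"
proof -
  interpret M: left_module R M by fact
  interpret C: left_module R C by fact
  note D = M.submoduleD[OF assms(3)]
  have "\<phi> y \<in> carrier C" using assms(4,6) by (auto simp: quot_iso_def)
  then have "\<phi> (\<ominus>\<^bsub>M\<^esub> y) = \<ominus>\<^bsub>C\<^esub> \<phi> y"
    using assms(4,6) D(1) M.smult_minus_one[of y, symmetric] C.smult_minus_one[of "\<phi> y"]
    by (auto simp: quot_iso_def)
  then show ?thesis using assms(4-6) D(5) by (simp add: a_minus_def quot_iso_def)
qed

text \<open>Connects the kernel description with actual cosets, which are what the forcing formula
  \<open>fquotient_iso\<close> speaks about.\<close>

lemma coset_eq_iff: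
  assumes "left_module R M" "left_module R C" "submodule N' R M" "submodule N R M" "N \<subseteq> N'"
    "quot_iso R M N' N C \<phi>" "x \<in> N'" "y \<in> N'"
  shows "coset M N x = coset M N y \<longleftrightarrow> \<phi> x = \<phi> y"
proof -
  interpret M: left_module R M by fact
  interpret C: left_module R C by fact
  note N = M.submoduleD[OF assms(4)] and N' = M.submoduleD[OF assms(3)]
  have cx: "x \<in> carrier M" "y \<in> carrier M" using assms(7,8) N'(1) by auto
  have sub: "coset M N x \<subseteq> coset M N y" if "\<phi> x = \<phi> y" "x \<in> N'" "y \<in> N'" for x y
  proof -
    have "\<phi> x \<in> carrier C" using assms(6) that by (auto simp: quot_iso_def)
    then have "\<phi> (x \<ominus>\<^bsub>M\<^esub> y) = \<zero>\<^bsub>C\<^esub>"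
      using quot_iso_minus[OF assms(1-3,6) that(2,3)] that(1) by (simp add: C.M.r_neg a_minus_def)
    then have xy: "x \<ominus>\<^bsub>M\<^esub> y \<in> N" using assms(6) N'(6)[OF that(2,3)] by (auto simp: quot_iso_def)
    show ?thesis unfolding coset_def
    proof (rule image_subsetI)
      fix n assume n: "n \<in> N"
      then have "n \<in> carrier M" "x \<in> carrier M" "y \<in> carrier M" using N(1) N'(1) that by auto
      then have "x \<oplus>\<^bsub>M\<^esub> n = y \<oplus>\<^bsub>M\<^esub> ((x \<ominus>\<^bsub>M\<^esub> y) \<oplus>\<^bsub>M\<^esub> n)"
        by (simp add: a_minus_def M.M.a_ac M.M.r_neg1 M.M.r_neg)
      then show "x \<oplus>\<^bsub>M\<^esub> n \<in> (\<oplus>\<^bsub>M\<^esub>) y ` N" using N(3)[OF xy n] by blast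
    qed
  qed
  show ?thesis
  proof
    assume "coset M N x = coset M N y"
    moreover have "x \<in> coset M N x" unfolding coset_def using N(2) cx by (metis M.M.r_zero image_eqI)
    ultimately obtain n where n: "n \<in> N" "x = y \<oplus>\<^bsub>M\<^esub> n" unfolding coset_def by blast
    then have "\<phi> n = \<zero>\<^bsub>C\<^esub>" "\<phi> x = \<phi> y \<oplus>\<^bsub>C\<^esub> \<phi> n" using assms(5,6,8) by (auto simp: quot_iso_def)
    moreover have "\<phi> y \<in> carrier C" using assms(6,8) by (auto simp: quot_iso_def)
    ultimately show "\<phi> x = \<phi> y" by simp
  qed (use sub assms(7,8) in \<open>metis subset_antisym\<close>)
qed

section \<open>Absoluteness\<close>

context forcing_poset
begin

lemma stable_derived [stable_intros]:
  "fstable (fsubset A B)" "fstable (ffunction_on f A)" "fstable (fbijection f A B)" "fstable (ford A)"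
  "fstable (fempty A)" "fstable (fsucc A B)" "fstable (fadd M x y z)" "fstable (fsmult R M a x z)"
  unfolding fsubset_def ffunction_on_def fbijection_def ford_def fempty_def fsucc_def fadd_def fsmult_def
  by (intro stable_intros)+

lemma fcong_derived [fcong_intros]:
  "fcong (\<lambda>A. fsubset A B)" "fcong (\<lambda>B. fsubset A B)" "fcong (\<lambda>A. ffunction_on f A)"
  "fcong (\<lambda>A. ford A)" "fcong (\<lambda>A. fempty A)"
  "fcong (\<lambda>A. fsucc A B)" "fcong (\<lambda>B. fsucc A B)"
  "fcong (\<lambda>x. fadd M x y z)" "fcong (\<lambda>y. fadd M x y z)" "fcong (\<lambda>z. fadd M x y z)"
  "fcong (\<lambda>a. fsmult R M a x z)" "fcong (\<lambda>x. fsmult R M a x z)" "fcong (\<lambda>z. fsmult R M a x z)"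
  unfolding fsubset_def ffunction_on_def ford_def fempty_def fsucc_def fadd_def fsmult_def
  by (intro fcong_intros)+

lemma stable_derived2 [stable_intros]: "fstable (fsubmodule R M N)" "fstable (fcoset M N a K)"
  unfolding fsubmodule_def fcoset_def by (intro stable_intros)+

lemma fcong_derived2 [fcong_intros]: "fcong (\<lambda>N. fsubmodule R M N)"
  "fcong (\<lambda>N. fcoset M N a K)" "fcong (\<lambda>a. fcoset M N a K)" "fcong (\<lambda>K. fcoset M N a K)"
  unfolding fsubmodule_def fcoset_def by (intro fcong_intros)+

lemma stable_fquotient_iso [stable_intros]: "fstable (fquotient_iso R M N' N C)"
  unfolding fquotient_iso_def by (intro stable_intros)

lemma fcong_fquotient_iso [fcong_intros]:
  "fcong (\<lambda>N'. fquotient_iso R M N' N C)" "fcong (\<lambda>N. fquotient_iso R M N' N C)"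
  unfolding fquotient_iso_def by (intro fcong_intros)+

lemma fandI: "\<phi> p \<Longrightarrow> \<psi> p \<Longrightarrow> (\<phi> \<^bold>\<and> \<psi>) p"
  by (simp add: fand_def)

lemma fallI: "(\<And>\<tau>. \<Phi> \<tau> p) \<Longrightarrow> (\<^bold>\<forall>\<tau>. \<Phi> \<tau>) p"
  by (simp add: fall_def)

lemma fimpI: "(\<And>q. q \<preceq> p \<Longrightarrow> \<phi> q \<Longrightarrow> \<psi> q) \<Longrightarrow> (\<phi> \<^bold>\<longrightarrow> \<psi>) p"
  unfolding fimp_iff' using le_P le_refl by blast

lemma fiffI: "(\<And>q. q \<preceq> p \<Longrightarrow> \<phi> q \<Longrightarrow> \<psi> q) \<Longrightarrow> (\<And>q. q \<preceq> p \<Longrightarrow> \<psi> q \<Longrightarrow> \<phi> q) \<Longrightarrow> (\<phi> \<^bold>\<longleftrightarrow> \<psi>) p"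
  unfolding fiff_def by (intro fandI fimpI)

lemma fand_iff: "(\<phi> \<^bold>\<and> \<psi>) p \<longleftrightarrow> \<phi> p \<and> \<psi> p"
  by (simp add: fand_def)

lemma fiff_cong:
  assumes "\<And>q. q \<preceq> p \<Longrightarrow> \<phi> q = \<phi>' q" "\<And>q. q \<preceq> p \<Longrightarrow> \<psi> q = \<psi>' q"
  shows "(\<phi> \<^bold>\<longleftrightarrow> \<psi>) p = (\<phi>' \<^bold>\<longleftrightarrow> \<psi>') p"
proof -
  have "(\<phi> \<^bold>\<longrightarrow> \<psi>) p = (\<phi>' \<^bold>\<longrightarrow> \<psi>') p" if "\<And>q. q \<preceq> p \<Longrightarrow> \<phi> q = \<phi>' q" "\<And>q. q \<preceq> p \<Longrightarrow> \<psi> q = \<psi>' q" for \<phi> \<psi> \<phi>' \<psi>'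
    unfolding fimp_iff' using that le_trans by (metis (full_types))
  from this[OF assms] this[OF assms(2,1)] show ?thesis unfolding fiff_def fand_def by simp
qed

text \<open>A name for an element of a ground-model set is equal to some \<open>check a\<close> only
  densely. With a stable goal one may still argue with one fixed \<open>a\<close>.\<close>

lemma fmem_check_elim:
  assumes "fmem x (check A) p" "p \<in> P" "fstable \<chi>"
    "\<And>q a. q \<preceq> p \<Longrightarrow> a \<in> elts A \<Longrightarrow> feq x (check a) q \<Longrightarrow> \<chi> q"
  shows "\<chi> p"
proof (rule stable_dense[OF assms(3,2)])
  fix q assume q: "q \<preceq> p"
  obtain q' a where "q' \<preceq> q" "a \<in> elts A" "feq x (check a) q'"
    using fmem_checkD[OF fmem_mono[OF assms(1) q] le_P(1)[OF q]] by blast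
  then show "\<exists>q'. q' \<preceq> q \<and> \<chi> q'" using assms(4)[OF le_trans[OF _ q]] by blast
qed

lemma fmem_check_eq: "a \<in> elts A \<Longrightarrow> feq x (check a) q \<Longrightarrow> fmem x (check A) q"
  using fcongD[OF fcong_fmem1 feq_sym] fmem_checkI by blast

lemma fmem_check_mono: "fmem x (check A) p \<Longrightarrow> p \<in> P \<Longrightarrow> elts A \<subseteq> elts B \<Longrightarrow> fmem x (check B) p"
proof (erule fmem_check_elim, assumption, rule stable_fmem)
  fix q a assume "elts A \<subseteq> elts B" "a \<in> elts A" "feq x (check a) q"
  then show "fmem x (check B) q" using fcongD[OF fcong_fmem1 feq_sym] fmem_checkI by blast
qed

lemma fsubset_check: "p \<in> P \<Longrightarrow> elts A \<subseteq> elts B \<Longrightarrow> fsubset (check A) (check B) p"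
  unfolding fsubset_def fall_def by (auto simp: fimp_iff stable_fmem dest: le_P intro: fmem_check_mono)

lemma fapp_check_fun:
  assumes "p \<in> P" "opair a b \<in> elts f" "\<And>b'. opair a b' \<in> elts f \<Longrightarrow> b' = b"
    "\<And>e. e \<in> elts f \<Longrightarrow> \<exists>a b. e = opair a b"
  shows "fapp (check f) (check a) z p \<longleftrightarrow> feq z (check b) p"
proof
  assume z: "fapp (check f) (check a) z p"
  show "feq z (check b) p"
  proof (rule stable_dense[OF stable_feq assms(1)])
    fix q assume q: "q \<preceq> p"
    obtain q' a' b' where q': "q' \<preceq> q" "opair a' b' \<in> elts f" "feq (check a) (check a') q'" "feq z (check b') q'"
      using fapp_checkD[OF stable_mono[OF stable_fapp z q] le_P(1)[OF q] assms(4)] by blast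
    then have "b' = b" using assms(3) by simp
    then show "\<exists>q'. q' \<preceq> q \<and> feq z (check b) q'" using q' by blast
  qed
next
  assume "feq z (check b) p"
  then show "fapp (check f) (check a) z p"
    using fcongD[OF fcong_fapp(3) feq_sym] assms by (metis fapp_check)
qed

lemma fapp_opn: "(\<^bold>\<exists>u. fpair u x y \<^bold>\<and> fapp f u z) p \<longleftrightarrow> fapp f (opn x y) z p" if p: "p \<in> P"
proof
  assume "(\<^bold>\<exists>u. fpair u x y \<^bold>\<and> fapp f u z) p"
  then show "fapp f (opn x y) z p"
  proof (rule fexE[OF _ p stable_fapp])
    fix \<tau> q assume "q \<preceq> p" "(fpair \<tau> x y \<^bold>\<and> fapp f \<tau> z) q"
    then show "fapp f (opn x y) z q" using fcongD[OF fcong_fapp(2)] fpair_iff le_P(1) unfolding fand_def by blast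
  qed
next
  assume "fapp f (opn x y) z p"
  then have "(fpair (opn x y) x y \<^bold>\<and> fapp f (opn x y) z) p" using p by (simp add: fand_def fpair_iff feq_refl)
  then show "(\<^bold>\<exists>u. fpair u x y \<^bold>\<and> fapp f u z) p"
    by (intro fexI[where \<tau> = "opn x y", OF p] stable_intros)
qed

lemma elts_add_graph:
  assumes "small (carrier M)"
  shows "elts (add_graph M) = {opair (opair x y) (x \<oplus>\<^bsub>M\<^esub> y) | x y. x \<in> carrier M \<and> y \<in> carrier M}"
  unfolding add_graph_def using small_image2[OF assms assms, of "\<lambda>x y. opair (opair x y) (x \<oplus>\<^bsub>M\<^esub> y)"] by simp

lemma elts_smult_graph:
  assumes "small (carrier M)" "small (carrier R)"
  shows "elts (smult_graph R M) = {opair (opair a x) (a \<odot>\<^bsub>M\<^esub> x) | a x. a \<in> carrier R \<and> x \<in> carrier M}"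
  unfolding smult_graph_def using small_image2[OF assms(2,1), of "\<lambda>a x. opair (opair a x) (a \<odot>\<^bsub>M\<^esub> x)"] by simp

lemma fadd_check:
  assumes "p \<in> P" "small (carrier M)" "x \<in> carrier M" "y \<in> carrier M"
  shows "fadd M (check x) (check y) z p \<longleftrightarrow> feq z (check (x \<oplus>\<^bsub>M\<^esub> y)) p"
  unfolding fadd_def fapp_opn[OF assms(1)] check_opn[symmetric]
  by (rule fapp_check_fun[OF assms(1)]) (use assms in \<open>auto simp: elts_add_graph\<close>)

lemma fsmult_check:
  assumes "p \<in> P" "small (carrier M)" "small (carrier R)" "a \<in> carrier R" "x \<in> carrier M"
  shows "fsmult R M (check a) (check x) z p \<longleftrightarrow> feq z (check (a \<odot>\<^bsub>M\<^esub> x)) p"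
  unfolding fsmult_def fapp_opn[OF assms(1)] check_opn[symmetric]
  by (rule fapp_check_fun[OF assms(1)]) (use assms in \<open>auto simp: elts_smult_graph\<close>)

lemma fadd_eq: "fadd M x y z p \<Longrightarrow> feq x (check a) p \<Longrightarrow> feq y (check b) p \<Longrightarrow>
    small (carrier M) \<Longrightarrow> a \<in> carrier M \<Longrightarrow> b \<in> carrier M \<Longrightarrow> feq z (check (a \<oplus>\<^bsub>M\<^esub> b)) p"
  by (subst fadd_check[OF feq_P, symmetric], assumption+)
    (erule (1) fcongD[OF fcong_derived(9) _ fcongD[OF fcong_derived(8)]])

lemma fsmult_eq: "fsmult R M x y z p \<Longrightarrow> feq x (check a) p \<Longrightarrow> feq y (check b) p \<Longrightarrow>
    small (carrier M) \<Longrightarrow> small (carrier R) \<Longrightarrow> a \<in> carrier R \<Longrightarrow> b \<in> carrier M \<Longrightarrow> feq z (check (a \<odot>\<^bsub>M\<^esub> b)) p"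
  by (subst fsmult_check[OF feq_P, symmetric], assumption+)
    (erule (1) fcongD[OF fcong_derived(12) _ fcongD[OF fcong_derived(11)]])

lemma fsubmodule_check:
  assumes p: "p \<in> P" and M: "left_module R M" and sm: "small (carrier M)" "small (carrier R)" and N: "submodule N R M"
  shows "fsubmodule R M (check (vset N)) p"
proof -
  interpret M: left_module R M by fact
  note D = M.submoduleD[OF N]
  have smN: "small N" using small_subset[OF sm(1) D(1)] .
  have 1: "fsubset (check (vset N)) (fcarrier M) p"
    unfolding fcarrier_def using p smN sm D(1) by (intro fsubset_check) auto
  have 2: "fmem (check \<zero>\<^bsub>M\<^esub>) (check (vset N)) p" using p smN D(2) by simp
  have 3: "fmem z (check (vset N)) q" if q: "q \<preceq> p"
    and x: "fmem x (check (vset N)) q" and y: "fmem y (check (vset N)) q" and z: "fadd M x y z q" for q x y z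
  proof (rule fmem_check_elim[OF x le_P(1)[OF q] stable_fmem])
    fix q1 a assume q1: "q1 \<preceq> q" "a \<in> elts (vset N)" "feq x (check a) q1"
    show "fmem z (check (vset N)) q1"
    proof (rule fmem_check_elim[OF fmem_mono[OF y q1(1)] le_P(1)[OF q1(1)] stable_fmem])
      fix q2 b assume q2: "q2 \<preceq> q1" "b \<in> elts (vset N)" "feq y (check b) q2"
      have "feq z (check (a \<oplus>\<^bsub>M\<^esub> b)) q2"
        by (rule fadd_eq[OF stable_mono[OF stable_derived(7) z le_trans[OF q2(1) q1(1)]] feq_mono[OF q1(3) q2(1)] q2(3) sm(1)])
          (use q1 q2 smN D(1) in auto)
      then show "fmem z (check (vset N)) q2"
        using q1 q2 smN D(3) by (intro fmem_check_eq[of "a \<oplus>\<^bsub>M\<^esub> b"]) auto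
    qed
  qed
  have 4: "fmem z (check (vset N)) q" if q: "q \<preceq> p"
    and x: "fmem x (check (vset (carrier R))) q" and y: "fmem y (check (vset N)) q" and z: "fsmult R M x y z q" for q x y z
  proof (rule fmem_check_elim[OF x le_P(1)[OF q] stable_fmem])
    fix q1 a assume q1: "q1 \<preceq> q" "a \<in> elts (vset (carrier R))" "feq x (check a) q1"
    show "fmem z (check (vset N)) q1"
    proof (rule fmem_check_elim[OF fmem_mono[OF y q1(1)] le_P(1)[OF q1(1)] stable_fmem])
      fix q2 b assume q2: "q2 \<preceq> q1" "b \<in> elts (vset N)" "feq y (check b) q2"
      have "feq z (check (a \<odot>\<^bsub>M\<^esub> b)) q2"
        by (rule fsmult_eq[OF stable_mono[OF stable_derived(8) z le_trans[OF q2(1) q1(1)]] feq_mono[OF q1(3) q2(1)] q2(3) sm])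
          (use q1 q2 smN sm(2) D(1) in auto)
      then show "fmem z (check (vset N)) q2"
        using q1 q2 smN sm(2) D(4) by (intro fmem_check_eq[of "a \<odot>\<^bsub>M\<^esub> b"]) auto
    qed
  qed
  show ?thesis
    unfolding fsubmodule_def fall_def
    by (auto simp: fand_def fimp_iff stable_intros 1 2 intro: 3 4)
qed

text \<open>A name for the subset of a ground-model set that is cut out by a predicate on
  conditions. It behaves as intended when \<Phi> persists to stronger conditions, as assumed in
  \<open>fmem_comp\<close>.\<close>

definition comp :: "'v \<Rightarrow> ('v \<Rightarrow> 'v \<Rightarrow> bool) \<Rightarrow> 'v"
  where "comp A \<Phi> = vset {opair (check a) s |a s. a \<in> elts A \<and> s \<in> P \<and> \<Phi> a s}"

lemma elts_comp: "elts (comp A \<Phi>) = {opair (check a) s |a s. a \<in> elts A \<and> s \<in> P \<and> \<Phi> a s}"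
  unfolding comp_def
  by (rule elts_vset, rule small_subset[OF small_image2[OF small_elts[of A] small, of "\<lambda>a. opair (check a)"]]) blast

lemma fmem_comp:
  assumes mono: "\<And>a p q. \<Phi> a p \<Longrightarrow> q \<preceq> p \<Longrightarrow> \<Phi> a q"
  shows "fmem u (comp A \<Phi>) p \<longleftrightarrow> (\<forall>q. q \<preceq> p \<longrightarrow> (\<exists>q' a. q' \<preceq> q \<and> a \<in> elts A \<and> feq u (check a) q' \<and> \<Phi> a q'))"
proof -
  have "(\<exists>q' \<rho> t. q' \<preceq> q \<and> opair \<rho> t \<in> elts (comp A \<Phi>) \<and> q' \<preceq> t \<and> feq u \<rho> q') \<longleftrightarrow>
    (\<exists>q' a. q' \<preceq> q \<and> a \<in> elts A \<and> feq u (check a) q' \<and> \<Phi> a q')" (is "?L \<longleftrightarrow> ?R") for q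
  proof
    assume ?L
    then obtain q' a t where "q' \<preceq> q" "a \<in> elts A" "t \<in> P" "\<Phi> a t" "q' \<preceq> t" "feq u (check a) q'"
      unfolding elts_comp opair_inject by auto
    then show ?R using mono by blast
  next
    assume ?R
    then obtain q' a where *: "q' \<preceq> q" "a \<in> elts A" "feq u (check a) q'" "\<Phi> a q'" by blast
    then have "opair (check a) q' \<in> elts (comp A \<Phi>)" "q' \<preceq> q'" unfolding elts_comp using le_P le_refl by blast+
    then show ?L using * by blast
  qed
  then show ?thesis unfolding fmem_def by simp
qed

lemma fcoset_check:
  assumes "p \<in> P" "small (carrier M)" "N \<subseteq> carrier M" "a \<in> carrier M" "\<And>n. n \<in> N \<Longrightarrow> a \<oplus>\<^bsub>M\<^esub> n \<in> carrier M"
  shows "fcoset M (check (vset N)) (check a) K p \<longleftrightarrow> feq K (check (vset (coset M N a))) p"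
proof -
  have smN: "small N" using small_subset assms by blast
  have smK: "small (coset M N a)" unfolding coset_def using small_image[OF smN] .
  have *: "(\<^bold>\<exists>n. n \<^bold>\<in> check (vset N) \<^bold>\<and> fadd M (check a) n x) q \<longleftrightarrow> fmem x (check (vset (coset M N a))) q"
    if q: "q \<in> P" for x q
  proof
    assume "(\<^bold>\<exists>n. n \<^bold>\<in> check (vset N) \<^bold>\<and> fadd M (check a) n x) q"
    then show "fmem x (check (vset (coset M N a))) q"
    proof (rule fexE[OF _ q stable_fmem])
      fix n q1 assume q1: "q1 \<preceq> q" and n: "(n \<^bold>\<in> check (vset N) \<^bold>\<and> fadd M (check a) n x) q1"
      show "fmem x (check (vset (coset M N a))) q1"
      proof (rule fmem_check_elim[OF _ le_P(1)[OF q1] stable_fmem])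
        show "fmem n (check (vset N)) q1" using n by (simp add: fand_def)
        fix q2 n0 assume q2: "q2 \<preceq> q1" "n0 \<in> elts (vset N)" "feq n (check n0) q2"
        have "fadd M (check a) n x q2" using n stable_mono[OF stable_derived(7) _ q2(1)] by (simp add: fand_def)
        then have "feq x (check (a \<oplus>\<^bsub>M\<^esub> n0)) q2"
          by (rule fadd_eq) (use q2 assms smN le_P in \<open>auto simp: feq_refl\<close>)
        then show "fmem x (check (vset (coset M N a))) q2"
          using q2 smN smK by (intro fmem_check_eq[of "a \<oplus>\<^bsub>M\<^esub> n0"]) (auto simp: coset_def)
      qed
    qed
  next
    assume x: "fmem x (check (vset (coset M N a))) q"
    show "(\<^bold>\<exists>n. n \<^bold>\<in> check (vset N) \<^bold>\<and> fadd M (check a) n x) q"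
    proof (rule fmem_check_elim[OF x q])
      show "fstable (\<^bold>\<exists>n. n \<^bold>\<in> check (vset N) \<^bold>\<and> fadd M (check a) n x)" by (intro stable_intros)
      fix q1 x0 assume q1: "q1 \<preceq> q" "x0 \<in> elts (vset (coset M N a))" "feq x (check x0) q1"
      then obtain n where n: "n \<in> N" "x0 = a \<oplus>\<^bsub>M\<^esub> n" using smK by (auto simp: coset_def)
      have "fadd M (check a) (check n) x q1" using fadd_check le_P(1) q1 n assms by auto
      then show "(\<^bold>\<exists>n. n \<^bold>\<in> check (vset N) \<^bold>\<and> fadd M (check a) n x) q1"
        using n smN le_P(1)[OF q1(1)] by (intro fexI[where \<tau> = "check n"] stable_intros) (simp_all add: fand_def)
    qed
  qed
  have "fcoset M (check (vset N)) (check a) K p \<longleftrightarrow> (\<^bold>\<forall>x. x \<^bold>\<in> K \<^bold>\<longleftrightarrow> x \<^bold>\<in> check (vset (coset M N a))) p"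
    unfolding fcoset_def fall_def using * le_P(1) by (intro all_cong1 fiff_cong) auto
  then show ?thesis using feq_ext_iff[OF assms(1)] by simp
qed

lemma fapp_graph:
  assumes "elts g = {opair x (F x) |x. x \<in> A}" "x0 \<in> A" "feq x (check x0) p"
  shows "fapp (check g) x y p \<longleftrightarrow> feq y (check (F x0)) p"
proof -
  have "fapp (check g) x y p \<longleftrightarrow> fapp (check g) (check x0) y p"
    using fcongD[OF fcong_fapp(2)] assms(3) feq_sym by blast
  also have "\<dots> \<longleftrightarrow> feq y (check (F x0)) p"
    by (rule fapp_check_fun) (use assms feq_P in auto)
  finally show ?thesis .
qed

lemma fapp_graph_elim:
  assumes "elts g = {opair x (F x) |x. x \<in> A}" "fapp (check g) x y p" "p \<in> P" "fstable \<chi>"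
    "\<And>q x0. q \<preceq> p \<Longrightarrow> x0 \<in> A \<Longrightarrow> feq x (check x0) q \<Longrightarrow> feq y (check (F x0)) q \<Longrightarrow> \<chi> q"
  shows "\<chi> p"
proof (rule stable_dense[OF assms(4,3)])
  fix q assume q: "q \<preceq> p"
  obtain q' a b where q': "q' \<preceq> q" "opair a b \<in> elts g" "feq x (check a) q'" "feq y (check b) q'"
    using fapp_checkD[OF stable_mono[OF stable_fapp assms(2) q] le_P(1)[OF q]] assms(1) by blast
  then have "a \<in> A" "b = F a" using assms(1) by auto
  then show "\<exists>q'. q' \<preceq> q \<and> \<chi> q'" using assms(5)[OF le_trans[OF q'(1) q]] q' by blast
qed

lemma fbijection_check:
  assumes p: "p \<in> P" and g: "elts g = {opair x (F x) |x. x \<in> elts A}" and F: "bij_betw F (elts A) (elts B)"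
  shows "fbijection (check g) (check A) (check B) p"
proof -
  have FB: "F x \<in> elts B" if "x \<in> elts A" for x using F that by (auto simp: bij_betw_def)
  have 1: "(\<^bold>\<exists>x. x \<^bold>\<in> check A \<^bold>\<and> (\<^bold>\<exists>y. fpair z x y)) q" if q: "q \<preceq> p" and z: "fmem z (check g) q" for q z
  proof (rule fmem_check_elim[OF z le_P(1)[OF q]])
    fix q1 e assume q1: "q1 \<preceq> q" "e \<in> elts g" "feq z (check e) q1"
    then obtain x where x: "x \<in> elts A" "e = opair x (F x)" using g by auto
    have "fpair z (check x) (check (F x)) q1"
      by (rule fcongD[OF fcong_fpair(1) feq_sym[OF q1(3)]]) (use x le_P(1)[OF q1(1)] in simp)
    then show "(\<^bold>\<exists>x. x \<^bold>\<in> check A \<^bold>\<and> (\<^bold>\<exists>y. fpair z x y)) q1"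
      using x le_P(1)[OF q1(1)]
      by (intro fexI[where \<tau> = "check x"] stable_intros) (auto simp: fand_def intro!: fexI[where \<tau> = "check (F x)"] stable_intros)
  qed (intro stable_intros)
  have 2: "(\<^bold>\<exists>y. fapp (check g) x y \<^bold>\<and> (\<^bold>\<forall>y'. fapp (check g) x y' \<^bold>\<longrightarrow> y' \<^bold>= y)) q"
    if q: "q \<preceq> p" and x: "fmem x (check A) q" for q x
  proof (rule fmem_check_elim[OF x le_P(1)[OF q]])
    fix q1 a assume q1: "q1 \<preceq> q" "a \<in> elts A" "feq x (check a) q1"
    note fg = fapp_graph[OF g q1(2) feq_mono[OF q1(3)]]
    show "(\<^bold>\<exists>y. fapp (check g) x y \<^bold>\<and> (\<^bold>\<forall>y'. fapp (check g) x y' \<^bold>\<longrightarrow> y' \<^bold>= y)) q1"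
      using le_P(1)[OF q1(1)] fg le_refl
      by (intro fexI[where \<tau> = "check (F a)"] stable_intros) (auto simp: fand_def fall_def fimp_iff stable_intros)
  qed (intro stable_intros)
  have 3: "fmem y (check B) q" if q: "q \<preceq> p" and xy: "fapp (check g) x y q" for q x y
    by (rule fapp_graph_elim[OF g xy le_P(1)[OF q] stable_fmem]) (rule fmem_check_eq[OF FB])
  have 4: "feq x x' q" if q: "q \<preceq> p" and xy: "fapp (check g) x y q" "fapp (check g) x' y q" for q x x' y
  proof (rule fapp_graph_elim[OF g xy(1) le_P(1)[OF q] stable_feq])
    fix q1 x0 assume q1: "q1 \<preceq> q" "x0 \<in> elts A" "feq x (check x0) q1" "feq y (check (F x0)) q1"
    show "feq x x' q1"
    proof (rule fapp_graph_elim[OF g stable_mono[OF stable_fapp xy(2) q1(1)] le_P(1)[OF q1(1)] stable_feq])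
      fix q2 x1 assume q2: "q2 \<preceq> q1" "x1 \<in> elts A" "feq x' (check x1) q2" "feq y (check (F x1)) q2"
      have "feq (check (F x0)) (check (F x1)) q2"
        using feq_trans[OF feq_sym[OF feq_mono[OF q1(4) q2(1)]] q2(4)] .
      then have "x0 = x1" using F q1(2) q2(2) by (auto simp: bij_betw_def dest: inj_onD)
      then show "feq x x' q2" using feq_trans[OF feq_mono[OF q1(3) q2(1)]] feq_sym[OF q2(3)] by blast
    qed
  qed
  have 5: "(\<^bold>\<exists>x. fapp (check g) x y) q" if q: "q \<preceq> p" and y: "fmem y (check B) q" for q y
  proof (rule fmem_check_elim[OF y le_P(1)[OF q]])
    fix q1 b assume q1: "q1 \<preceq> q" "b \<in> elts B" "feq y (check b) q1"
    then obtain a where a: "a \<in> elts A" "b = F a" using F by (auto simp: bij_betw_def)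
    show "(\<^bold>\<exists>x. fapp (check g) x y) q1"
      using fapp_graph[OF g a(1) feq_refl[OF le_P(1)[OF q1(1)]]] q1(3) a(2) le_P(1)[OF q1(1)]
      by (intro fexI[where \<tau> = "check a"] stable_intros) auto
  qed (intro stable_intros)
  show ?thesis
    unfolding fbijection_def ffunction_on_def
    by (intro fandI fallI fimpI) (use 1 2 3 4 5 in \<open>auto simp: fand_iff\<close>)
qed

lemma fcoset_eq:
  assumes "feq a (check a0) p" "fcoset M (check (vset N)) a K p"
    "small (carrier M)" "N \<subseteq> carrier M" "a0 \<in> carrier M" "\<And>n. n \<in> N \<Longrightarrow> a0 \<oplus>\<^bsub>M\<^esub> n \<in> carrier M"
  shows "feq K (check (vset (coset M N a0))) p"
  using fcoset_check[OF feq_P[OF assms(1)] assms(3-6)] fcongD[OF fcong_derived2(3) assms(1,2)] by blast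

text \<open>The witnesses are canonical names: the set of ground-model cosets, and the graph of the
  map that \<phi> induces on them. Every clause then reduces, on a dense set, to an identity between
  ground-model elements.\<close>

lemma fquotient_iso_check:
  assumes p: "p \<in> P" and M: "left_module R M" and C: "left_module R C"
    and sm: "small (carrier M)" "small (carrier R)" "small (carrier C)"
    and N: "submodule N' R M" "submodule N R M" "N \<subseteq> N'" and \<phi>: "quot_iso R M N' N C \<phi>"
  shows "fquotient_iso R M (check (vset N')) (check (vset N)) C p"
proof -
  interpret M: left_module R M by fact
  interpret C: left_module R C by fact
  note D' = M.submoduleD[OF N(1)] and D = M.submoduleD[OF N(2)]
  have smN: "small N" "small N'" using small_subset[OF sm(1)] D(1) D'(1) by auto
  have sub: "N \<subseteq> carrier M" using D(1) .
  have N'M: "a \<in> carrier M" if "a \<in> N'" for a using that D'(1) by blast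
  have add: "a \<oplus>\<^bsub>M\<^esub> n \<in> carrier M" if "a \<in> N'" "n \<in> N" for a n using that D(1) D'(1) by auto
  have smc: "small (coset M N a)" for a unfolding coset_def using small_image[OF smN(1)] .
  define c where "c a = vset (coset M N a)" for a
  have c_eq: "c a = c b \<longleftrightarrow> \<phi> a = \<phi> b" if "a \<in> N'" "b \<in> N'" for a b
    unfolding c_def vset_inject[OF smc smc] using coset_eq_iff[OF M C N \<phi> that] .
  \<comment> \<open>The value at a coset is taken at a chosen representative; \<open>c_eq\<close>
    makes it independent of the choice.\<close>
  define F where "F K = \<phi> (SOME a. a \<in> N' \<and> c a = K)" for K
  have Fc: "F (c a) = \<phi> a" if "a \<in> N'" for a
  proof -
    have "\<exists>b. b \<in> N' \<and> c b = c a" using that by blast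
    from someI_ex[OF this] show ?thesis unfolding F_def using c_eq[OF _ that] by blast
  qed
  define Q where "Q = vset (c ` N')"
  have Q: "elts Q = c ` N'" unfolding Q_def using small_image[OF smN(2)] by simp
  define g where "g = vset ((\<lambda>K. opair K (F K)) ` (c ` N'))"
  have g: "elts g = {opair K (F K) |K. K \<in> elts Q}"
    unfolding g_def Q using small_image[OF small_image[OF smN(2)]] by (subst elts_vset) auto
  have \<phi>C: "\<phi> a \<in> carrier C" if "a \<in> N'" for a using \<phi> that by (auto simp: quot_iso_def)
  have "bij_betw F (elts Q) (elts (vset (carrier C)))"
    unfolding bij_betw_def
  proof
    show "inj_on F (elts Q)" unfolding Q by (rule inj_onI) (use Fc c_eq in auto)
    have "F ` elts Q = \<phi> ` N'" unfolding Q image_image by (rule image_cong) (auto simp: Fc)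
    then show "F ` elts Q = elts (vset (carrier C))" using \<phi> sm(3) by (simp add: quot_iso_def)
  qed
  from fbijection_check[OF p g this]
  have bij: "fbijection (check g) (check Q) (fcarrier C) p" unfolding fcarrier_def .
  have val: "feq x (check (\<phi> a)) q"
    if "a \<in> N'" "feq a' (check a) q" "fcoset M (check (vset N)) a' K q" "fapp (check g) K x q" for a a' K x q
  proof -
    have "feq K (check (c a)) q"
      unfolding c_def using fcoset_eq[OF that(2,3) sm(1) sub N'M add] that(1) by blast
    then show ?thesis using fapp_graph[OF g, of "c a" K q x] that Q Fc by auto
  qed
  have cosI: "fcoset M (check (vset N)) (check a) (check (c a)) q" if "q \<in> P" "a \<in> N'" for a q
    unfolding c_def using fcoset_check[OF that(1) sm(1) sub N'M add] that feq_refl by blast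
  have 1: "fmem K (check Q) q \<longleftrightarrow> (\<^bold>\<exists>a. a \<^bold>\<in> check (vset N') \<^bold>\<and> fcoset M (check (vset N)) a K) q" if q: "q \<preceq> p" for q K
  proof
    assume K: "fmem K (check Q) q"
    show "(\<^bold>\<exists>a. a \<^bold>\<in> check (vset N') \<^bold>\<and> fcoset M (check (vset N)) a K) q"
    proof (rule fmem_check_elim[OF K le_P(1)[OF q]])
      fix q1 k assume q1: "q1 \<preceq> q" "k \<in> elts Q" "feq K (check k) q1"
      then obtain a where a: "a \<in> N'" "k = c a" using Q by auto
      have "fcoset M (check (vset N)) (check a) K q1"
        using fcongD[OF fcong_derived2(4) feq_sym[OF q1(3)]] cosI[OF le_P(1)[OF q1(1)] a(1)] a(2) by blast
      then show "(\<^bold>\<exists>a. a \<^bold>\<in> check (vset N') \<^bold>\<and> fcoset M (check (vset N)) a K) q1"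
        using a smN le_P(1)[OF q1(1)] by (intro fexI[where \<tau> = "check a"] stable_intros) (auto simp: fand_def)
    qed (intro stable_intros)
  next
    assume "(\<^bold>\<exists>a. a \<^bold>\<in> check (vset N') \<^bold>\<and> fcoset M (check (vset N)) a K) q"
    then show "fmem K (check Q) q"
    proof (rule fexE[OF _ le_P(1)[OF q] stable_fmem])
      fix a q1 assume q1: "q1 \<preceq> q" and a: "(a \<^bold>\<in> check (vset N') \<^bold>\<and> fcoset M (check (vset N)) a K) q1"
      show "fmem K (check Q) q1"
      proof (rule fmem_check_elim[OF _ le_P(1)[OF q1] stable_fmem])
        show "fmem a (check (vset N')) q1" using a by (simp add: fand_def)
        fix q2 a0 assume q2: "q2 \<preceq> q1" "a0 \<in> elts (vset N')" "feq a (check a0) q2"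
        have "fcoset M (check (vset N)) a K q2" using a stable_mono[OF stable_derived2(2) _ q2(1)] by (simp add: fand_def)
        then have "feq K (check (c a0)) q2"
          unfolding c_def using fcoset_eq[OF q2(3) _ sm(1) sub N'M add] q2(2) smN(2) by auto
        then show "fmem K (check Q) q2" using q2 smN Q by (intro fmem_check_eq[of "c a0"]) auto
      qed
    qed
  qed
  have 2: "fadd C x y z q"
    if q: "q \<preceq> p" and a: "fmem a (check (vset N')) q" and b: "fmem b (check (vset N')) q" and s: "fadd M a b s q"
      and K: "fcoset M (check (vset N)) a K q" "fcoset M (check (vset N)) b L q" "fcoset M (check (vset N)) s J q"
      and h: "fapp (check g) K x q" "fapp (check g) L y q" "fapp (check g) J z q" for q a b s K L J x y z
  proof (rule fmem_check_elim[OF a le_P(1)[OF q] stable_derived(7)])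
    fix q1 a0 assume q1: "q1 \<preceq> q" "a0 \<in> elts (vset N')" "feq a (check a0) q1"
    show "fadd C x y z q1"
    proof (rule fmem_check_elim[OF fmem_mono[OF b q1(1)] le_P(1)[OF q1(1)] stable_derived(7)])
      fix q2 b0 assume q2: "q2 \<preceq> q1" "b0 \<in> elts (vset N')" "feq b (check b0) q2"
      have ab: "a0 \<in> N'" "b0 \<in> N'" "a0 \<oplus>\<^bsub>M\<^esub> b0 \<in> N'" using q1 q2 smN D'(3) by auto
      have q2q: "q2 \<preceq> q" using le_trans[OF q2(1) q1(1)] .
      note mono = stable_mono[OF _ _ q2q]
      note a2 = feq_mono[OF q1(3) q2(1)]
      have s2: "feq s (check (a0 \<oplus>\<^bsub>M\<^esub> b0)) q2"
        by (rule fadd_eq[OF mono[OF stable_derived(7) s] a2 q2(3) sm(1)]) (use ab N'M in auto)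
      have xyz: "feq x (check (\<phi> a0)) q2" "feq y (check (\<phi> b0)) q2" "feq z (check (\<phi> (a0 \<oplus>\<^bsub>M\<^esub> b0))) q2"
        using val[OF ab(1) a2 mono[OF stable_derived2(2) K(1)] mono[OF stable_fapp h(1)]]
          val[OF ab(2) q2(3) mono[OF stable_derived2(2) K(2)] mono[OF stable_fapp h(2)]]
          val[OF ab(3) s2 mono[OF stable_derived2(2) K(3)] mono[OF stable_fapp h(3)]] by blast+
      have "\<phi> (a0 \<oplus>\<^bsub>M\<^esub> b0) = \<phi> a0 \<oplus>\<^bsub>C\<^esub> \<phi> b0" using \<phi> ab by (auto simp: quot_iso_def)
      then have "fadd C (check (\<phi> a0)) (check (\<phi> b0)) z q2"
        using fadd_check[OF le_P(1)[OF q2(1)] sm(3) \<phi>C[OF ab(1)] \<phi>C[OF ab(2)]] xyz(3) by simp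
      then show "fadd C x y z q2"
        using fcongD[OF fcong_derived(8) feq_sym[OF xyz(1)]] fcongD[OF fcong_derived(9) feq_sym[OF xyz(2)]] by blast
    qed
  qed
  have 3: "fsmult R C d x z q"
    if q: "q \<preceq> p" and d: "fmem d (check (vset (carrier R))) q" and a: "fmem a (check (vset N')) q" and s: "fsmult R M d a s q"
      and K: "fcoset M (check (vset N)) a K q" "fcoset M (check (vset N)) s J q"
      and h: "fapp (check g) K x q" "fapp (check g) J z q" for q d a s K J x z
  proof (rule fmem_check_elim[OF d le_P(1)[OF q] stable_derived(8)])
    fix q1 d0 assume q1: "q1 \<preceq> q" "d0 \<in> elts (vset (carrier R))" "feq d (check d0) q1"
    show "fsmult R C d x z q1"
    proof (rule fmem_check_elim[OF fmem_mono[OF a q1(1)] le_P(1)[OF q1(1)] stable_derived(8)])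
      fix q2 a0 assume q2: "q2 \<preceq> q1" "a0 \<in> elts (vset N')" "feq a (check a0) q2"
      have ab: "a0 \<in> N'" "d0 \<in> carrier R" "d0 \<odot>\<^bsub>M\<^esub> a0 \<in> N'" using q1 q2 smN sm(2) D'(4) by auto
      have q2q: "q2 \<preceq> q" using le_trans[OF q2(1) q1(1)] .
      note mono = stable_mono[OF _ _ q2q]
      note d2 = feq_mono[OF q1(3) q2(1)]
      have s2: "feq s (check (d0 \<odot>\<^bsub>M\<^esub> a0)) q2"
        by (rule fsmult_eq[OF mono[OF stable_derived(8) s] d2 q2(3) sm(1,2)]) (use ab N'M in auto)
      have xz: "feq x (check (\<phi> a0)) q2" "feq z (check (\<phi> (d0 \<odot>\<^bsub>M\<^esub> a0))) q2"
        using val[OF ab(1) q2(3) mono[OF stable_derived2(2) K(1)] mono[OF stable_fapp h(1)]]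
          val[OF ab(3) s2 mono[OF stable_derived2(2) K(2)] mono[OF stable_fapp h(2)]] by blast+
      have "\<phi> (d0 \<odot>\<^bsub>M\<^esub> a0) = d0 \<odot>\<^bsub>C\<^esub> \<phi> a0" using \<phi> ab by (auto simp: quot_iso_def)
      then have "fsmult R C (check d0) (check (\<phi> a0)) z q2"
        using fsmult_check[OF le_P(1)[OF q2(1)] sm(3,2) ab(2) \<phi>C[OF ab(1)]] xz(2) by simp
      then show "fsmult R C d x z q2"
        using fcongD[OF fcong_derived(11) feq_sym[OF d2]] fcongD[OF fcong_derived(12) feq_sym[OF xz(1)]] by blast
    qed
  qed
  show ?thesis
    unfolding fquotient_iso_def
  proof (rule fexI[where \<tau> = "check Q", OF p], (intro stable_intros)[1], rule fexI[where \<tau> = "check g", OF p], (intro stable_intros)[1])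
    show "((\<^bold>\<forall>K. K \<^bold>\<in> check Q \<^bold>\<longleftrightarrow> (\<^bold>\<exists>a. a \<^bold>\<in> check (vset N') \<^bold>\<and> fcoset M (check (vset N)) a K)) \<^bold>\<and>
       fbijection (check g) (check Q) (fcarrier C) \<^bold>\<and>
       (\<^bold>\<forall>a b s K L J x y z.
          a \<^bold>\<in> check (vset N') \<^bold>\<and> b \<^bold>\<in> check (vset N') \<^bold>\<and> fadd M a b s \<^bold>\<and>
          fcoset M (check (vset N)) a K \<^bold>\<and> fcoset M (check (vset N)) b L \<^bold>\<and> fcoset M (check (vset N)) s J \<^bold>\<and>
          fapp (check g) K x \<^bold>\<and> fapp (check g) L y \<^bold>\<and> fapp (check g) J z \<^bold>\<longrightarrow> fadd C x y z) \<^bold>\<and>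
       (\<^bold>\<forall>c a s K J x z.
          c \<^bold>\<in> check (vset (carrier R)) \<^bold>\<and> a \<^bold>\<in> check (vset N') \<^bold>\<and> fsmult R M c a s \<^bold>\<and>
          fcoset M (check (vset N)) a K \<^bold>\<and> fcoset M (check (vset N)) s J \<^bold>\<and>
          fapp (check g) K x \<^bold>\<and> fapp (check g) J z \<^bold>\<longrightarrow> fsmult R C c x z)) p"
      by (intro fandI fallI fimpI fiffI) (use 1 2 3 bij in \<open>auto simp: fand_iff\<close>)
  qed
qed

end

section \<open>Successor ordinals, with membership in \<open>vsucc \<beta>\<close> serving as the
  relation of being at most \<beta>\<close>

lemma vsucc_inject [simp]: "vsucc x = vsucc y \<longleftrightarrow> x = y"
  by (metis elts_asym elts_vsucc insertE insertI1)

lemma vsucc_neq [simp]: "vsucc x \<noteq> x" "x \<noteq> vsucc x"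
  by (metis elts_irrefl elts_vsucc insertI1)+

lemma Ord_le_iff: "Ord \<alpha> \<Longrightarrow> Ord \<beta> \<Longrightarrow> \<alpha> \<in> elts (vsucc \<beta>) \<longleftrightarrow> elts \<alpha> \<subseteq> elts \<beta>"
  by (simp add: Ord_subset)

lemma Ord_in_vsucc: "Ord \<beta> \<Longrightarrow> \<alpha> \<in> elts (vsucc \<beta>) \<Longrightarrow> Ord \<alpha>"
  by (metis Ord_in_Ord Ord_vsucc)

lemma Ord_zero_le: "Ord \<beta> \<Longrightarrow> vset {} \<in> elts (vsucc \<beta>)"
  using Ord_le_iff[of "nat_ord 0" \<beta>] Ord_nat_ord[of 0] by (simp del: Ord_nat_ord)

lemma vsucc_le: "Ord \<beta> \<Longrightarrow> \<alpha> \<in> elts \<beta> \<Longrightarrow> vsucc \<alpha> \<in> elts (vsucc \<beta>)"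
  by (subst Ord_le_iff) (auto intro: Ord_vsucc[OF Ord_in_Ord] Ord_trans)

lemma Ord_le_trans: "Ord \<gamma> \<Longrightarrow> \<alpha> \<in> elts (vsucc \<beta>) \<Longrightarrow> \<beta> \<in> elts (vsucc \<gamma>) \<Longrightarrow> \<alpha> \<in> elts (vsucc \<gamma>)"
  by (auto intro: Ord_trans)

section \<open>Countable filtrations\<close>

text \<open>A filtration of length \<open>\<alpha> + 1\<close>, so that \<open>s \<alpha>\<close> is its last member.\<close>

definition fseq :: "'v::zfc ring \<Rightarrow> ('v, 'v) module set \<Rightarrow> ('v, 'v) module \<Rightarrow> 'v \<Rightarrow> ('v \<Rightarrow> 'v set) \<Rightarrow> bool"
  where "fseq R \<C> M \<alpha> s \<longleftrightarrow> \<alpha> \<in> omega1 \<and>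
    (\<forall>i \<in> elts (vsucc \<alpha>). submodule (s i) R M) \<and> s (vset {}) = {\<zero>\<^bsub>M\<^esub>} \<and>
    (\<forall>j \<in> elts (vsucc \<alpha>). \<forall>i \<in> elts j. s i \<subseteq> s j) \<and>
    (\<forall>j \<in> elts (vsucc \<alpha>). j \<noteq> vset {} \<longrightarrow> (\<forall>i. j \<noteq> vsucc i) \<longrightarrow> s j = (\<Union>i \<in> elts j. s i)) \<and>
    (\<forall>i \<in> elts \<alpha>. \<exists>C \<in> \<C>. \<exists>\<phi>. quot_iso R M (s (vsucc i)) (s i) C \<phi>)"

definition end_ext :: "'v::zfc \<Rightarrow> ('v \<Rightarrow> 'v set) \<Rightarrow> 'v \<Rightarrow> ('v \<Rightarrow> 'v set) \<Rightarrow> bool"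
  where "end_ext \<alpha> s \<beta> t \<longleftrightarrow> \<alpha> \<in> elts (vsucc \<beta>) \<and> (\<forall>i \<in> elts (vsucc \<alpha>). t i = s i)"

text \<open>All filtrations ending in X are quantified over because different conditions may reach X
  in different ways. The property is vacuous if none ends in X, so it is always used together with
  \<open>fext\<close> from the zero submodule, where the trivial filtration exists.\<close>

definition fext :: "'v::zfc ring \<Rightarrow> ('v, 'v) module set \<Rightarrow> ('v, 'v) module \<Rightarrow> 'v set \<Rightarrow> 'v set \<Rightarrow> bool"
  where "fext R \<C> M X Y \<longleftrightarrow> (\<forall>\<alpha> s. fseq R \<C> M \<alpha> s \<and> s \<alpha> = X \<longrightarrow>
    (\<exists>\<beta> t. fseq R \<C> M \<beta> t \<and> t \<beta> = Y \<and> end_ext \<alpha> s \<beta> t))"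

lemma fseqD:
  assumes "fseq R \<C> M \<alpha> s"
  shows "\<alpha> \<in> omega1" "Ord \<alpha>" "i \<in> elts (vsucc \<alpha>) \<Longrightarrow> submodule (s i) R M" "s (vset {}) = {\<zero>\<^bsub>M\<^esub>}"
    "j \<in> elts (vsucc \<alpha>) \<Longrightarrow> i \<in> elts j \<Longrightarrow> s i \<subseteq> s j"
    "j \<in> elts (vsucc \<alpha>) \<Longrightarrow> j \<noteq> vset {} \<Longrightarrow> (\<And>i. j \<noteq> vsucc i) \<Longrightarrow> s j = (\<Union>i \<in> elts j. s i)"
    "i \<in> elts \<alpha> \<Longrightarrow> \<exists>C \<in> \<C>. \<exists>\<phi>. quot_iso R M (s (vsucc i)) (s i) C \<phi>"
proof -
  note D = assms[unfolded fseq_def]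
  show "\<alpha> \<in> omega1" using D by (elim conjE)
  then show "Ord \<alpha>" by (simp add: omega1_def)
  show "i \<in> elts (vsucc \<alpha>) \<Longrightarrow> submodule (s i) R M" using D by (elim conjE) (rule bspec)
  show "s (vset {}) = {\<zero>\<^bsub>M\<^esub>}" using D by (elim conjE)
  show "j \<in> elts (vsucc \<alpha>) \<Longrightarrow> i \<in> elts j \<Longrightarrow> s i \<subseteq> s j" using D by (elim conjE) (drule (1) bspec)+
  show "j \<in> elts (vsucc \<alpha>) \<Longrightarrow> j \<noteq> vset {} \<Longrightarrow> (\<And>i. j \<noteq> vsucc i) \<Longrightarrow> s j = (\<Union>i \<in> elts j. s i)"
    using D by (elim conjE) (drule (1) bspec, simp)
  show "i \<in> elts \<alpha> \<Longrightarrow> \<exists>C \<in> \<C>. \<exists>\<phi>. quot_iso R M (s (vsucc i)) (s i) C \<phi>"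
    using D by (elim conjE) (drule (1) bspec)
qed

lemma fseq_le: "fseq R \<C> M \<alpha> s \<Longrightarrow> i \<in> elts (vsucc \<alpha>) \<Longrightarrow> s i \<subseteq> s \<alpha>"
  using fseqD(5)[of R \<C> M \<alpha> s \<alpha> i] by auto

lemma end_ext_refl: "end_ext \<alpha> s \<alpha> s"
  by (simp add: end_ext_def)

lemma end_ext_trans: "Ord \<gamma> \<Longrightarrow> end_ext \<alpha> s \<beta> t \<Longrightarrow> end_ext \<beta> t \<gamma> u \<Longrightarrow> end_ext \<alpha> s \<gamma> u"
proof -
  assume \<gamma>: "Ord \<gamma>" and 1: "end_ext \<alpha> s \<beta> t" and 2: "end_ext \<beta> t \<gamma> u"
  have \<beta>: "Ord \<beta>" using 2 \<gamma> Ord_in_vsucc unfolding end_ext_def by blast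
  show ?thesis unfolding end_ext_def
  proof
    show "\<alpha> \<in> elts (vsucc \<gamma>)" using 1 2 \<gamma> Ord_le_trans unfolding end_ext_def by blast
    show "\<forall>i\<in>elts (vsucc \<alpha>). u i = s i"
    proof
      fix i assume i: "i \<in> elts (vsucc \<alpha>)"
      then have "i \<in> elts (vsucc \<beta>)" using 1 \<beta> Ord_le_trans unfolding end_ext_def by blast
      then have "u i = t i" using 2 unfolding end_ext_def by blast
      also have "t i = s i" using 1 i unfolding end_ext_def by blast
      finally show "u i = s i" .
    qed
  qed
qed

lemma fext_refl: "fext R \<C> M X X"
  unfolding fext_def using end_ext_refl by blast

lemma fext_trans: "fext R \<C> M X Y \<Longrightarrow> fext R \<C> M Y Z \<Longrightarrow> fext R \<C> M X Z"
  unfolding fext_def using end_ext_trans fseqD(2) by metis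

lemma fext_step:
  assumes "C \<in> \<C>" "quot_iso R M Y X C \<phi>" "submodule Y R M" "X \<subseteq> Y"
  shows "fext R \<C> M X Y"
  unfolding fext_def
proof (intro allI impI)
  fix \<alpha> s assume *: "fseq R \<C> M \<alpha> s \<and> s \<alpha> = X"
  then have s: "fseq R \<C> M \<alpha> s" and sX: "s \<alpha> = X" by auto
  note D = fseqD[OF s]
  let ?t = "s(vsucc \<alpha> := Y)"
  have old: "?t i = s i" if "i \<in> elts (vsucc \<alpha>)" for i
    using that elts_irrefl[of "vsucc \<alpha>"] by auto
  have "fseq R \<C> M (vsucc \<alpha>) ?t"
    unfolding fseq_def
  proof (intro conjI ballI impI)
    show "vsucc \<alpha> \<in> omega1" using omega1_vsucc D(1) .
    show "submodule (?t i) R M" if "i \<in> elts (vsucc (vsucc \<alpha>))" for i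
      using that old D(3) assms(3) by auto
    show "?t (vset {}) = {\<zero>\<^bsub>M\<^esub>}" using old[OF Ord_zero_le[OF D(2)]] D(4) by simp
    show "?t i \<subseteq> ?t j" if "j \<in> elts (vsucc (vsucc \<alpha>))" "i \<in> elts j" for i j
    proof (cases "j = vsucc \<alpha>")
      case True
      then show ?thesis using that(2) old[of i] fseq_le[OF s, of i] sX assms(4) by auto
    next
      case False
      then have "j \<in> elts (vsucc \<alpha>)" using that(1) by simp
      moreover then have "i \<in> elts (vsucc \<alpha>)" using that(2) Ord_trans[OF Ord_vsucc[OF D(2)]] by blast
      ultimately show ?thesis using D(5)[of j i] that(2) old by simp
    qed
    show "?t j = (\<Union>i\<in>elts j. ?t i)"
      if "j \<in> elts (vsucc (vsucc \<alpha>))" "j \<noteq> vset {}" "\<forall>i. j \<noteq> vsucc i" for j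
    proof -
      have j: "j \<in> elts (vsucc \<alpha>)" using that(1,3) by auto
      then have "i \<in> elts (vsucc \<alpha>)" if "i \<in> elts j" for i using that Ord_trans[OF Ord_vsucc[OF D(2)]] by blast
      then show ?thesis using D(6)[OF j that(2)] that(3) old j by auto
    qed
    show "\<exists>C\<in>\<C>. \<exists>\<phi>. quot_iso R M (?t (vsucc i)) (?t i) C \<phi>" if "i \<in> elts (vsucc \<alpha>)" for i
    proof (cases "i = \<alpha>")
      case True then show ?thesis using assms sX by auto
    next
      case False
      then have i: "i \<in> elts \<alpha>" using that by simp
      then show ?thesis using D(7)[OF i] old[OF that] old[OF vsucc_le[OF D(2) i]] by simp
    qed
  qed
  moreover have "end_ext \<alpha> s (vsucc \<alpha>) ?t" unfolding end_ext_def using old by simp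
  ultimately show "\<exists>\<beta> t. fseq R \<C> M \<beta> t \<and> t \<beta> = Y \<and> end_ext \<alpha> s \<beta> t"
    by (intro exI[of _ "vsucc \<alpha>"] exI[of _ ?t]) simp
qed

text \<open>The length of the union is the supremum \<beta> of the lengths, which is again
  countable. The extensions need not be proper, so \<beta> may already be one of the lengths, and
  the new last member must then agree with the old one.\<close>

lemma fseq_limit:
  fixes s :: "nat \<Rightarrow> 'v::zfc \<Rightarrow> 'v set"
  assumes M: "left_module R M" and s: "\<And>n. fseq R \<C> M (\<alpha> n) (s n)"
    and ext: "\<And>n. end_ext (\<alpha> n) (s n) (\<alpha> (Suc n)) (s (Suc n))"
  shows "\<exists>\<beta> t. fseq R \<C> M \<beta> t \<and> t \<beta> = (\<Union>n. s n (\<alpha> n)) \<and> (\<forall>n. end_ext (\<alpha> n) (s n) \<beta> t)"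
proof -
  interpret M: left_module R M by fact
  note D = fseqD[OF s]
  have ext': "end_ext (\<alpha> m) (s m) (\<alpha> n) (s n)" if "m \<le> n" for m n
    using that
  proof (induction n rule: dec_induct)
    case base show ?case by (rule end_ext_refl)
  next
    case (step n) then show ?case using end_ext_trans[OF D(2) _ ext] by blast
  qed
  have le: "\<alpha> m \<in> elts (vsucc (\<alpha> n))" if "m \<le> n" for m n
    using ext'[OF that] by (simp add: end_ext_def)
  have coh: "s m i = s n i" if "i \<in> elts (vsucc (\<alpha> m))" "i \<in> elts (vsucc (\<alpha> n))" for m n i
    using that ext'[of m n] ext'[of n m] linear[of m n] unfolding end_ext_def by metis
  have chain: "s m (\<alpha> m) \<subseteq> s n (\<alpha> n)" if "m \<le> n" for m n
  proof -
    have "s m (\<alpha> m) = s n (\<alpha> m)" by (rule coh[OF _ le[OF that]]) simp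
    then show ?thesis using fseq_le[OF s le[OF that]] by simp
  qed
  define U where "U = (\<Union>n. s n (\<alpha> n))"
  have sU: "s n i \<subseteq> U" if "i \<in> elts (vsucc (\<alpha> n))" for n i
    using fseq_le[OF s that] unfolding U_def by blast
  define \<beta> where "\<beta> = vset (\<Union>n. elts (\<alpha> n))"
  have om: "\<beta> \<in> omega1"
    unfolding \<beta>_def using omega1_Union[of "range \<alpha>"] D(1) by (auto simp: image_image)
  then have O\<beta>: "Ord \<beta>" by (simp add: omega1_def)
  have e\<beta>: "elts \<beta> = (\<Union>n. elts (\<alpha> n))"
    unfolding \<beta>_def using small_UN_same[of "range \<alpha>" elts] small_countable[of "range \<alpha>"] by (subst elts_vset) auto
  have \<alpha>\<beta>: "\<alpha> n \<in> elts (vsucc \<beta>)" for n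
    by (subst Ord_le_iff[OF D(2) O\<beta>]) (auto simp: e\<beta>)
  \<comment> \<open>Below \<beta> any stage reaching i may be used, by coherence; at \<beta> the
    union is inserted.\<close>
  define t where "t i = (if i \<in> elts \<beta> then s (SOME n. i \<in> elts (\<alpha> n)) i else U)" for i
  have t: "t i = s n i" if i: "i \<in> elts (vsucc (\<alpha> n))" for i n
  proof (cases "i \<in> elts \<beta>")
    case True
    then have "\<exists>n. i \<in> elts (\<alpha> n)" using e\<beta> by blast
    from someI_ex[OF this] have "i \<in> elts (vsucc (\<alpha> (SOME n. i \<in> elts (\<alpha> n))))" by simp
    from coh[OF this i] True show ?thesis unfolding t_def by presburger
  next
    case False
    \<comment> \<open>Here the lengths are constant from stage n on, so U is the last member already
      reached at stage n.\<close>
    then have "i = \<alpha> n" using i e\<beta> by auto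
    have "s m (\<alpha> m) \<subseteq> s n (\<alpha> n)" for m
    proof (cases "m \<le> n")
      case True
      then show ?thesis using chain by blast
    next
      case nm: False
      then have "\<alpha> n \<in> elts (vsucc (\<alpha> m))" by (intro le) simp
      moreover have "\<alpha> n \<notin> elts (\<alpha> m)" using False \<open>i = \<alpha> n\<close> e\<beta> by blast
      ultimately have "\<alpha> m = \<alpha> n" by simp
      then show ?thesis using coh[of "\<alpha> n" m n] by simp
    qed
    then have "U = s n (\<alpha> n)" unfolding U_def by blast
    then show ?thesis using False \<open>i = \<alpha> n\<close> by (simp add: t_def)
  qed
  have t\<beta>: "t \<beta> = U" by (simp add: t_def)
  have cases: "(\<exists>n. j \<in> elts (vsucc (\<alpha> n))) \<or> j = \<beta>" if "j \<in> elts (vsucc \<beta>)" for j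
    using that e\<beta> by auto
  have down: "i \<in> elts (vsucc (\<alpha> n))" if "j \<in> elts (vsucc (\<alpha> n))" "i \<in> elts j" for i j n
    using Ord_trans[OF Ord_vsucc[OF D(2)] that] .
  have subU: "submodule U R M"
    unfolding U_def
  proof (rule M.submodule_Union_chain)
    show "submodule (s n (\<alpha> n)) R M" for n using D(3) by simp
    show "s i (\<alpha> i) \<subseteq> s j (\<alpha> j) \<or> s j (\<alpha> j) \<subseteq> s i (\<alpha> i)" for i j
      by (cases "i \<le> j") (simp_all add: chain)
  qed simp
  have "fseq R \<C> M \<beta> t"
    unfolding fseq_def
  proof (intro conjI ballI impI)
    show "\<beta> \<in> omega1" by (rule om)
    show "submodule (t i) R M" if "i \<in> elts (vsucc \<beta>)" for i
      using cases[OF that]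
    proof
      assume "\<exists>n. i \<in> elts (vsucc (\<alpha> n))"
      then obtain n where n: "i \<in> elts (vsucc (\<alpha> n))" by blast
      then show ?thesis using t[OF n] D(3)[OF n] by simp
    qed (use t\<beta> subU in simp)
    show "t (vset {}) = {\<zero>\<^bsub>M\<^esub>}" using t[OF Ord_zero_le[OF D(2)]] D(4) by simp
    show "t i \<subseteq> t j" if j: "j \<in> elts (vsucc \<beta>)" and i: "i \<in> elts j" for i j
      using cases[OF j]
    proof
      assume "\<exists>n. j \<in> elts (vsucc (\<alpha> n))"
      then obtain n where n: "j \<in> elts (vsucc (\<alpha> n))" by blast
      then show ?thesis using t[OF n] t[OF down[OF n i]] D(5)[OF n i] by simp
    next
      assume jb: "j = \<beta>"
      then obtain n where "i \<in> elts (vsucc (\<alpha> n))" using i e\<beta> by auto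
      then show ?thesis using t sU t\<beta> jb by simp
    qed
    show "t j = (\<Union>i\<in>elts j. t i)" if j: "j \<in> elts (vsucc \<beta>)" "j \<noteq> vset {}" "\<forall>i. j \<noteq> vsucc i" for j
    proof (cases "\<exists>n. j \<in> elts (vsucc (\<alpha> n))")
      case True
      then obtain n where n: "j \<in> elts (vsucc (\<alpha> n))" by blast
      have "t i = s n i" if "i \<in> elts j" for i using t[OF down[OF n that]] .
      then show ?thesis using t[OF n] D(6)[OF n j(2)] j(3) by simp
    next
      case False
      then have jb: "j = \<beta>" using cases[OF j(1)] by blast
      then have "\<alpha> n \<in> elts \<beta>" for n using \<alpha>\<beta>[of n] False by auto
      moreover have "t (\<alpha> n) = s n (\<alpha> n)" for n using t by simp
      ultimately have "U \<subseteq> (\<Union>i\<in>elts \<beta>. t i)" unfolding U_def by blast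
      moreover have "t i \<subseteq> U" if "i \<in> elts \<beta>" for i
      proof -
        obtain n where "i \<in> elts (vsucc (\<alpha> n))" using \<open>i \<in> elts \<beta>\<close> e\<beta> by auto
        then show ?thesis using t sU by simp
      qed
      ultimately show ?thesis using jb t\<beta> by blast
    qed
    show "\<exists>C\<in>\<C>. \<exists>\<phi>. quot_iso R M (t (vsucc i)) (t i) C \<phi>" if "i \<in> elts \<beta>" for i
    proof -
      obtain n where n: "i \<in> elts (\<alpha> n)" using \<open>i \<in> elts \<beta>\<close> e\<beta> by blast
      have "t (vsucc i) = s n (vsucc i)" by (rule t[OF vsucc_le[OF D(2) n]])
      moreover have "t i = s n i" using n by (intro t) simp
      ultimately show ?thesis using D(7)[OF n] by presburger
    qed
  qed
  moreover have "end_ext (\<alpha> n) (s n) \<beta> t" for n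
    unfolding end_ext_def using \<alpha>\<beta> t by blast
  ultimately show ?thesis using t\<beta> unfolding U_def by (intro exI[of _ \<beta>] exI[of _ t]) simp
qed

text \<open>Dependent choice on pairs of a length and a filtration. The clause for stage 0 pins the
  sequence to the filtration that was given.\<close>

lemma fext_limit:
  assumes "left_module R M" "\<And>n. fext R \<C> M (X n) (X (Suc n))"
  shows "fext R \<C> M (X 0) (\<Union>n. X n)"
  unfolding fext_def
proof (intro allI impI)
  fix \<alpha> s assume 0: "fseq R \<C> M \<alpha> s \<and> s \<alpha> = X 0"
  let ?Q = "\<lambda>n (\<alpha>, s). fseq R \<C> M \<alpha> s \<and> s \<alpha> = X n"
  let ?E = "\<lambda>(\<alpha>, s) (\<beta>, t). end_ext \<alpha> s \<beta> t"
  have "\<exists>f. \<forall>n. (?Q n (f n) \<and> (n = 0 \<longrightarrow> f n = (\<alpha>, s))) \<and> ?E (f n) (f (Suc n))"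
  proof (rule dependent_nat_choice)
    show "\<exists>x. ?Q 0 x \<and> (0 = 0 \<longrightarrow> x = (\<alpha>, s))" using 0 by auto
    fix x n assume x: "?Q n x \<and> (n = 0 \<longrightarrow> x = (\<alpha>, s))"
    obtain \<alpha>' s' where xs: "x = (\<alpha>', s')" by (cases x)
    then have "fseq R \<C> M \<alpha>' s' \<and> s' \<alpha>' = X n" using x by simp
    then obtain \<beta> t where "fseq R \<C> M \<beta> t \<and> t \<beta> = X (Suc n) \<and> end_ext \<alpha>' s' \<beta> t"
      using assms(2)[of n] unfolding fext_def by blast
    then show "\<exists>y. (?Q (Suc n) y \<and> (Suc n = 0 \<longrightarrow> y = (\<alpha>, s))) \<and> ?E x y"
      using xs by (intro exI[of _ "(\<beta>, t)"]) simp
  qed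
  then obtain f where f: "\<And>n. (?Q n (f n) \<and> (n = 0 \<longrightarrow> f n = (\<alpha>, s))) \<and> ?E (f n) (f (Suc n))" by blast
  have f0: "f 0 = (\<alpha>, s)" using f[of 0] by simp
  have 1: "fseq R \<C> M (fst (f n)) (snd (f n))" "snd (f n) (fst (f n)) = X n"
    "end_ext (fst (f n)) (snd (f n)) (fst (f (Suc n))) (snd (f (Suc n)))" for n
    using f[of n] by (auto split: prod.splits)
  obtain \<beta> t where "fseq R \<C> M \<beta> t" "t \<beta> = (\<Union>n. X n)" "\<forall>n. end_ext (fst (f n)) (snd (f n)) \<beta> t"
    using fseq_limit[of R M \<C> "\<lambda>n. fst (f n)" "\<lambda>n. snd (f n)", OF assms(1) 1(1,3)] 1(2) by auto
  moreover then have "end_ext \<alpha> s \<beta> t" using f0 by (metis fst_conv snd_conv)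
  ultimately show "\<exists>\<beta> t. fseq R \<C> M \<beta> t \<and> t \<beta> = (\<Union>n. X n) \<and> end_ext \<alpha> s \<beta> t" by blast
qed

lemma (in left_module) span_Union_chain:
  assumes "\<And>n. b n \<subseteq> carrier M" "\<And>n. b n \<subseteq> b (Suc n)"
  shows "span R M (\<Union>n::nat. b n) = (\<Union>n. span R M (b n))"
proof
  have mono: "b m \<subseteq> b n" if "m \<le> n" for m n using lift_Suc_mono_le[of b] assms(2) that by blast
  have "submodule (\<Union>n. span R M (b n)) R M"
  proof (rule submodule_Union_chain)
    show "submodule (span R M (b n)) R M" for n using assms(1) by (rule submodule_span)
    show "span R M (b i) \<subseteq> span R M (b j) \<or> span R M (b j) \<subseteq> span R M (b i)" for i j
      using span_mono[OF mono[of i j]] span_mono[OF mono[of j i]] linear[of i j] by blast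
  qed simp
  moreover have "(\<Union>n. b n) \<subseteq> (\<Union>n. span R M (b n))" using span_superset by blast
  ultimately show "span R M (\<Union>n. b n) \<subseteq> (\<Union>n. span R M (b n))" by (rule span_least)
  show "(\<Union>n. span R M (b n)) \<subseteq> span R M (\<Union>n. b n)"
    by (intro UN_least span_mono) blast
qed

section \<open>Forcing a filtration\<close>

context forcing_poset
begin

lemma fsucc_check: "p \<in> P \<Longrightarrow> fsucc (check j) (check i) p \<longleftrightarrow> j = vsucc i"
proof
  assume p: "p \<in> P" and s: "fsucc (check j) (check i) p"
  have *: "fmem (check u) (check j) p \<longleftrightarrow> (fmem (check u) (check i) \<^bold>\<or> feq (check u) (check i)) p" for u
    using s p unfolding fsucc_def fall_def by (simp add: fiff_iff stable_intros)
  have "u \<in> elts j \<longleftrightarrow> u \<in> elts (vsucc i)" for u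
  proof -
    have "(fmem (check u) (check i) \<^bold>\<or> feq (check u) (check i)) p \<longleftrightarrow> u \<in> elts (vsucc i)"
    proof
      assume "(fmem (check u) (check i) \<^bold>\<or> feq (check u) (check i)) p"
      then obtain q' where "q' \<preceq> p" "fmem (check u) (check i) q' \<or> feq (check u) (check i) q'"
        unfolding fdisj_iff using le_refl[OF p] by blast
      then show "u \<in> elts (vsucc i)" using le_P(1) by auto
    next
      assume "u \<in> elts (vsucc i)"
      then show "(fmem (check u) (check i) \<^bold>\<or> feq (check u) (check i)) p"
        using p fdisjI1[OF stable_fmem] fdisjI2[OF stable_feq] by auto
    qed
    then show ?thesis using * p by simp
  qed
  then have "elts j = elts (vsucc i)" by blast
  then show "j = vsucc i" by (metis elts_inject)
next
  assume p: "p \<in> P" and "j = vsucc i"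
  then show "fsucc (check j) (check i) p"
    unfolding fsucc_def
  proof (intro fallI fiffI)
    fix u q assume q: "q \<preceq> p" "fmem u (check j) q" and j: "j = vsucc i"
    show "(fmem u (check i) \<^bold>\<or> feq u (check i)) q"
    proof (rule fmem_check_elim[OF q(2) le_P(1)[OF q(1)]])
      fix q' a assume "q' \<preceq> q" "a \<in> elts j" "feq u (check a) q'"
      then show "(fmem u (check i) \<^bold>\<or> feq u (check i)) q'"
        using j fdisjI1[OF stable_fmem] fdisjI2[OF stable_feq] fmem_check_eq by auto
    qed (intro stable_intros)
  next
    fix u q assume q: "q \<preceq> p" "(fmem u (check i) \<^bold>\<or> feq u (check i)) q" and j: "j = vsucc i"
    show "fmem u (check j) q"
      by (rule fdisjE[OF q(2) le_P(1)[OF q(1)] stable_fmem])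
        (use j fmem_check_mono[of u i _ j] le_P fmem_check_eq[of i j u] in auto)
  qed
qed

lemma fempty_check: "p \<in> P \<Longrightarrow> fempty (check i) p \<longleftrightarrow> elts i = {}"
proof
  assume p: "p \<in> P" and e: "fempty (check i) p"
  show "elts i = {}"
  proof (rule equals0I)
    fix u assume "u \<in> elts i"
    then have "(\<^bold>\<exists>u. u \<^bold>\<in> check i) p" using p by (intro fexI[where \<tau> = "check u"] stable_intros) auto
    then show False using e p le_refl unfolding fempty_def fnot_iff by blast
  qed
next
  assume "p \<in> P" "elts i = {}"
  then show "fempty (check i) p"
    unfolding fempty_def fnot_iff using fmem_checkD fexD le_P by (metis empty_iff)
qed

end

text \<open>Only the filtration decoded from a condition by \<open>len\<close> and \<open>sq\<close>
  matters for what is forced. How conditions are coded, and the extra component that makes the poset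
  \<sigma>-closed, are left to the instance.\<close>

locale filtration_forcing = forcing_poset P r + left_module R M
  for P :: "'v::zfc set" and r and R :: "'v ring" and M :: "('v, 'v) module" +
  fixes \<C> :: "('v, 'v) module set" and len :: "'v \<Rightarrow> 'v" and sq :: "'v \<Rightarrow> 'v \<Rightarrow> 'v set"
  assumes smM: "small (carrier M)" and smR: "small (carrier R)"
    and \<C>: "\<And>C. C \<in> \<C> \<Longrightarrow> is_module R C"
    and fsq: "\<And>p. p \<in> P \<Longrightarrow> fseq R \<C> M (len p) (sq p)"
    and ext: "\<And>p q. q \<preceq> p \<Longrightarrow> end_ext (len p) (sq p) (len q) (sq q)"
    and dense: "\<And>p x. p \<in> P \<Longrightarrow> x \<in> carrier M \<Longrightarrow> \<exists>q. q \<preceq> p \<and> x \<in> sq q (len q)"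
begin

text \<open>The name of the union of all filtrations in the generic filter. The bounding set
  contains every relevant pair, since indices are countable ordinals and members are subsets of
  M.\<close>

definition fdot :: 'v
  where "fdot = comp (vset {opair i z |i z. i \<in> omega1 \<and> z \<in> vset ` Pow (carrier M)})
    (\<lambda>e p. \<exists>i \<in> elts (vsucc (len p)). e = opair i (vset (sq p i)))"

definition etadot :: 'v
  where "etadot = comp (vset omega1) (\<lambda>i p. i \<in> elts (vsucc (len p)))"

lemma Olen: "p \<in> P \<Longrightarrow> Ord (len p)"
  using fseqD(2)[OF fsq] .

lemma len_mono: "q \<preceq> p \<Longrightarrow> i \<in> elts (vsucc (len p)) \<Longrightarrow> i \<in> elts (vsucc (len q))"
  using ext[of q p] Ord_le_trans[OF Olen[OF le_P(1)]] unfolding end_ext_def by blast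

lemma sq_eq: "q \<preceq> p \<Longrightarrow> i \<in> elts (vsucc (len p)) \<Longrightarrow> sq q i = sq p i"
  using ext[of q p] unfolding end_ext_def by blast

lemma sq_sub: "p \<in> P \<Longrightarrow> i \<in> elts (vsucc (len p)) \<Longrightarrow> submodule (sq p i) R M"
  using fseqD(3)[OF fsq] .

lemma sq_carrier: "p \<in> P \<Longrightarrow> i \<in> elts (vsucc (len p)) \<Longrightarrow> sq p i \<subseteq> carrier M"
  using submoduleD(1)[OF sq_sub] .

lemma sq_small: "p \<in> P \<Longrightarrow> i \<in> elts (vsucc (len p)) \<Longrightarrow> small (sq p i)"
  using small_subset[OF smM sq_carrier] .

lemma dom_omega1: "p \<in> P \<Longrightarrow> i \<in> elts (vsucc (len p)) \<Longrightarrow> i \<in> omega1"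
  using omega1_small_elts[OF omega1_vsucc[OF fseqD(1)[OF fsq]]] .

lemma fdot_iff: "fmem z fdot p \<longleftrightarrow> (\<forall>q. q \<preceq> p \<longrightarrow>
    (\<exists>q' i. q' \<preceq> q \<and> i \<in> elts (vsucc (len q')) \<and> feq z (check (opair i (vset (sq q' i)))) q'))"
proof -
  have sm: "small {opair i z |i z. i \<in> (omega1 :: 'v set) \<and> z \<in> vset ` Pow (carrier M)}"
    by (intro small_image2 small_omega1 small_vset_Pow smM)
  show ?thesis
    unfolding fdot_def
  proof (subst fmem_comp)
    show "\<exists>i\<in>elts (vsucc (len q)). a = opair i (vset (sq q i))"
      if "\<exists>i\<in>elts (vsucc (len p)). a = opair i (vset (sq p i))" "q \<preceq> p" for a p q
      using that len_mono sq_eq by metis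
  next
    show "(\<forall>q. q \<preceq> p \<longrightarrow> (\<exists>q' a. q' \<preceq> q \<and> a \<in> elts (vset {opair i z |i z. i \<in> omega1 \<and> z \<in> vset ` Pow (carrier M)}) \<and>
        feq z (check a) q' \<and> (\<exists>i\<in>elts (vsucc (len q')). a = opair i (vset (sq q' i))))) \<longleftrightarrow>
      (\<forall>q. q \<preceq> p \<longrightarrow>
        (\<exists>q' i. q' \<preceq> q \<and> i \<in> elts (vsucc (len q')) \<and> feq z (check (opair i (vset (sq q' i)))) q'))"
      (is "(\<forall>q. _ \<longrightarrow> ?L q) \<longleftrightarrow> (\<forall>q. _ \<longrightarrow> ?R q)")
    proof (intro all_cong1 imp_cong refl)
      fix q
      show "?L q \<longleftrightarrow> ?R q"
      proof
        assume "?R q"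
        then obtain q' i where *: "q' \<preceq> q" "i \<in> elts (vsucc (len q'))" "feq z (check (opair i (vset (sq q' i)))) q'" by blast
        then have "opair i (vset (sq q' i)) \<in> {opair i z |i z. i \<in> omega1 \<and> z \<in> vset ` Pow (carrier M)}"
          using dom_omega1 sq_carrier le_P by blast
        then have "opair i (vset (sq q' i)) \<in> elts (vset {opair i z |i z. i \<in> omega1 \<and> z \<in> vset ` Pow (carrier M)})"
          unfolding elts_vset[OF sm] .
        then show "?L q" using * by blast
      qed blast
    qed
  qed
qed

lemma etadot_iff: "fmem z etadot p \<longleftrightarrow> (\<forall>q. q \<preceq> p \<longrightarrow>
    (\<exists>q' i. q' \<preceq> q \<and> i \<in> elts (vsucc (len q')) \<and> feq z (check i) q'))"
proof -
  have "q' \<preceq> q \<and> i \<in> elts (vset omega1) \<and> feq z (check i) q' \<and> i \<in> elts (vsucc (len q')) \<longleftrightarrow>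
    q' \<preceq> q \<and> i \<in> elts (vsucc (len q')) \<and> feq z (check i) q'" for q' q i
    using dom_omega1 le_P by auto
  then show ?thesis
    unfolding etadot_def by (subst fmem_comp[OF len_mono]) auto
qed

lemma fdot_memI: "p \<in> P \<Longrightarrow> i \<in> elts (vsucc (len p)) \<Longrightarrow> fapp fdot (check i) (check (vset (sq p i))) p"
  unfolding fapp_iff check_opn[symmetric] fdot_iff
proof (intro allI impI)
  fix q assume "p \<in> P" "i \<in> elts (vsucc (len p))" and q: "q \<preceq> p"
  then have "i \<in> elts (vsucc (len q))" "sq q i = sq p i" using len_mono sq_eq by blast+
  then show "\<exists>q' j. q' \<preceq> q \<and> j \<in> elts (vsucc (len q')) \<and>
      feq (check (opair i (vset (sq p i)))) (check (opair j (vset (sq q' j)))) q'"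
    using le_P(1)[OF q] by (intro exI[of _ q] exI[of _ i]) auto
qed

lemma etadot_memI: "i \<in> elts (vsucc (len p)) \<Longrightarrow> fmem (check i) etadot p"
  unfolding etadot_iff
proof (intro allI impI)
  fix q assume "i \<in> elts (vsucc (len p))" and q: "q \<preceq> p"
  then have "i \<in> elts (vsucc (len q))" using len_mono by blast
  then show "\<exists>q' j. q' \<preceq> q \<and> j \<in> elts (vsucc (len q')) \<and> feq (check i) (check j) q'"
    using le_P(1)[OF q] by (intro exI[of _ q] exI[of _ i]) auto
qed

lemma etadot_elim:
  assumes "fmem x etadot p" "p \<in> P" "fstable \<chi>"
    "\<And>q i. q \<preceq> p \<Longrightarrow> i \<in> elts (vsucc (len q)) \<Longrightarrow> feq x (check i) q \<Longrightarrow> \<chi> q"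
  shows "\<chi> p"
proof (rule stable_dense[OF assms(3,2)])
  fix q assume q: "q \<preceq> p"
  then obtain q' i where "q' \<preceq> q" "i \<in> elts (vsucc (len q'))" "feq x (check i) q'"
    using assms(1) unfolding etadot_iff by blast
  then show "\<exists>q'. q' \<preceq> q \<and> \<chi> q'" using assms(4) le_trans[OF _ q] by blast
qed

lemma fdot_elim:
  assumes "fapp fdot x y p" "p \<in> P" "fstable \<chi>"
    "\<And>q i. q \<preceq> p \<Longrightarrow> i \<in> elts (vsucc (len q)) \<Longrightarrow> feq x (check i) q \<Longrightarrow> feq y (check (vset (sq q i))) q \<Longrightarrow> \<chi> q"
  shows "\<chi> p"
proof (rule stable_dense[OF assms(3,2)])
  fix q assume q: "q \<preceq> p"
  then obtain q' i where q': "q' \<preceq> q" "i \<in> elts (vsucc (len q'))" "feq (opn x y) (check (opair i (vset (sq q' i)))) q'"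
    using assms(1) unfolding fapp_iff[OF assms(2)] fdot_iff by blast
  then have "feq x (check i) q'" "feq y (check (vset (sq q' i))) q'" unfolding check_opn opn_inject by auto
  then show "\<exists>q'. q' \<preceq> q \<and> \<chi> q'" using assms(4)[OF le_trans[OF q'(1) q] q'(2)] q'(1) by blast
qed

lemma fdot_elim2:
  assumes "fapp fdot x y p" "fapp fdot x' y' p" "p \<in> P" "fstable \<chi>"
    "\<And>q i j. q \<preceq> p \<Longrightarrow> i \<in> elts (vsucc (len q)) \<Longrightarrow> feq x (check i) q \<Longrightarrow> feq y (check (vset (sq q i))) q \<Longrightarrow>
      j \<in> elts (vsucc (len q)) \<Longrightarrow> feq x' (check j) q \<Longrightarrow> feq y' (check (vset (sq q j))) q \<Longrightarrow> \<chi> q"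
  shows "\<chi> p"
proof (rule fdot_elim[OF assms(1,3,4)])
  fix q i assume q: "q \<preceq> p" "i \<in> elts (vsucc (len q))" "feq x (check i) q" "feq y (check (vset (sq q i))) q"
  show "\<chi> q"
  proof (rule fdot_elim[OF stable_mono[OF stable_fapp assms(2) q(1)] le_P(1)[OF q(1)] assms(4)])
    fix q' j assume q': "q' \<preceq> q" "j \<in> elts (vsucc (len q'))" "feq x' (check j) q'" "feq y' (check (vset (sq q' j))) q'"
    show "\<chi> q'"
      by (rule assms(5)[OF le_trans[OF q'(1) q(1)] len_mono[OF q'(1) q(2)] feq_mono[OF q(3) q'(1)] _ q'(2-4)])
        (use feq_mono[OF q(4) q'(1)] sq_eq[OF q'(1) q(2)] in simp)
  qed
qed

lemma check_sub: "p \<in> P \<Longrightarrow> i \<in> elts (vsucc (len p)) \<Longrightarrow> j \<in> elts i \<Longrightarrow> j \<in> elts (vsucc (len p))"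
  using Ord_trans[OF Ord_vsucc[OF Olen]] .

lemma feq_D: "feq x y p \<Longrightarrow> fcong \<Phi> \<Longrightarrow> \<Phi> y p \<Longrightarrow> \<Phi> x p"
  using fcongD[OF _ feq_sym] .

text \<open>The facts \<open>c1\<close> to \<open>c9\<close> are the clauses of
  \<open>ffiltered\<close> in order. Each one passes to conditions that decide the indices
  concerned; the clauses on members then follow from those of \<open>fseq\<close> and from
  absoluteness, and exhaustion of M from \<open>dense\<close>.\<close>

lemma ffiltered_forced:
  assumes p0: "p0 \<in> P"
  shows "ffiltered R \<C> M p0"
proof -
  have zero: "elts (vset {}) = ({} :: 'v set)" by simp
  have c1a: "fsubset \<beta> etadot q" if q: "q \<in> P" "fmem \<beta> etadot q" for \<beta> q
  proof (rule etadot_elim[OF q(2,1)])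
    fix q1 i assume q1: "q1 \<preceq> q" "i \<in> elts (vsucc (len q1))" "feq \<beta> (check i) q1"
    have "fsubset (check i) etadot q1"
      unfolding fsubset_def
    proof (intro fallI fimpI)
      fix x q2 assume q2: "q2 \<preceq> q1" "fmem x (check i) q2"
      show "fmem x etadot q2"
      proof (rule fmem_check_elim[OF q2(2) le_P(1)[OF q2(1)] stable_fmem])
        fix q3 j assume q3: "q3 \<preceq> q2" "j \<in> elts i" "feq x (check j) q3"
        have "j \<in> elts (vsucc (len q3))"
          using check_sub[OF le_P(1)[OF q3(1)] len_mono[OF q3(1) len_mono[OF q2(1) q1(2)]] q3(2)] .
        then show "fmem x etadot q3" using feq_D[OF q3(3) fcong_fmem1] etadot_memI by blast
      qed
    qed
    then show "fsubset \<beta> etadot q1" using feq_D[OF q1(3) fcong_derived(1)] by blast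
  qed (intro stable_intros)
  have c1b: "fsubset \<gamma> \<beta> q" if q: "q \<in> P" "fmem \<beta> etadot q" "fmem \<gamma> \<beta> q" for \<beta> \<gamma> q
  proof (rule etadot_elim[OF q(2,1)])
    fix q1 i assume q1: "q1 \<preceq> q" "i \<in> elts (vsucc (len q1))" "feq \<beta> (check i) q1"
    have "fmem \<gamma> (check i) q1" using fcongD[OF fcong_fmem2 q1(3)] fmem_mono[OF q(3) q1(1)] by blast
    then show "fsubset \<gamma> \<beta> q1"
    proof (rule fmem_check_elim[OF _ le_P(1)[OF q1(1)]])
      fix q2 j assume q2: "q2 \<preceq> q1" "j \<in> elts i" "feq \<gamma> (check j) q2"
      have "Ord i" using Ord_in_vsucc[OF Olen[OF le_P(1)[OF q1(1)]] q1(2)] .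
      then have "fsubset (check j) (check i) q2"
        using fsubset_check[OF le_P(1)[OF q2(1)]] q2(2) unfolding Ord_def by blast
      then show "fsubset \<gamma> \<beta> q2"
        using feq_D[OF q2(3) fcong_derived(1)] feq_D[OF feq_mono[OF q1(3) q2(1)] fcong_derived(2)] by blast
    qed (intro stable_intros)
  qed (intro stable_intros)
  have c1: "ford etadot q" if "q \<in> P" for q
    unfolding ford_def by (intro fandI fallI fimpI) (use c1a c1b le_P in \<open>auto simp: fand_iff\<close>)
  have c2: "(\<^bold>\<not> fempty etadot) q" if "q \<in> P" for q
    unfolding fnot_iff
  proof (intro allI impI notI)
    fix q1 assume q1: "q1 \<preceq> q" "fempty etadot q1"
    have "fmem (check (vset {})) etadot q1" using etadot_memI[OF Ord_zero_le[OF Olen[OF le_P(1)[OF q1(1)]]]] .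
    then have "(\<^bold>\<exists>u. u \<^bold>\<in> etadot) q1" using le_P(1)[OF q1(1)] by (intro fexI stable_intros)
    then show False using q1 le_refl[OF le_P(1)[OF q1(1)]] unfolding fempty_def fnot_iff by blast
  qed
  have c3a: "(\<^bold>\<exists>x. x \<^bold>\<in> etadot \<^bold>\<and> (\<^bold>\<exists>y. fpair z x y)) q" if q: "q \<in> P" "fmem z fdot q" for z q
  proof (rule stable_dense[OF _ q(1)])
    show "fstable (\<^bold>\<exists>x. x \<^bold>\<in> etadot \<^bold>\<and> (\<^bold>\<exists>y. fpair z x y))" by (intro stable_intros)
    fix q1 assume "q1 \<preceq> q"
    then obtain q2 i where q2: "q2 \<preceq> q1" "i \<in> elts (vsucc (len q2))" "feq z (check (opair i (vset (sq q2 i)))) q2"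
      using q(2) unfolding fdot_iff by blast
    have "fpair z (check i) (check (vset (sq q2 i))) q2"
      by (rule feq_D[OF q2(3) fcong_fpair(1)]) (use le_P(1)[OF q2(1)] in simp)
    then have "(\<^bold>\<exists>x. x \<^bold>\<in> etadot \<^bold>\<and> (\<^bold>\<exists>y. fpair z x y)) q2"
      using le_P(1)[OF q2(1)] etadot_memI[OF q2(2)]
      by (intro fexI[where \<tau> = "check i"] stable_intros) (auto simp: fand_iff intro!: fexI stable_intros)
    then show "\<exists>q2. q2 \<preceq> q1 \<and> (\<^bold>\<exists>x. x \<^bold>\<in> etadot \<^bold>\<and> (\<^bold>\<exists>y. fpair z x y)) q2" using q2(1) by blast
  qed
  have c3b: "(\<^bold>\<exists>y. fapp fdot x y \<^bold>\<and> (\<^bold>\<forall>y'. fapp fdot x y' \<^bold>\<longrightarrow> y' \<^bold>= y)) q" if q: "q \<in> P" "fmem x etadot q" for x q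
  proof (rule etadot_elim[OF q(2,1)])
    fix q1 i assume q1: "q1 \<preceq> q" "i \<in> elts (vsucc (len q1))" "feq x (check i) q1"
    have 1: "fapp fdot x (check (vset (sq q1 i))) q1"
      using feq_D[OF q1(3) fcong_fapp(2)] fdot_memI[OF le_P(1)[OF q1(1)] q1(2)] by blast
    have 2: "feq y' (check (vset (sq q1 i))) q2" if q2: "q2 \<preceq> q1" "fapp fdot x y' q2" for q2 y'
    proof (rule fdot_elim[OF q2(2) le_P(1)[OF q2(1)] stable_feq])
      fix q3 i' assume q3: "q3 \<preceq> q2" "i' \<in> elts (vsucc (len q3))" "feq x (check i') q3" "feq y' (check (vset (sq q3 i'))) q3"
      have "feq (check i) (check i') q3"
        using feq_trans[OF feq_sym[OF feq_mono[OF q1(3) le_trans[OF q3(1) q2(1)]]] q3(3)] .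
      then have "i' = i" by simp
      then show "feq y' (check (vset (sq q1 i))) q3" using q3(4) sq_eq[OF le_trans[OF q3(1) q2(1)] q1(2)] by simp
    qed
    show "(\<^bold>\<exists>y. fapp fdot x y \<^bold>\<and> (\<^bold>\<forall>y'. fapp fdot x y' \<^bold>\<longrightarrow> y' \<^bold>= y)) q1"
      by (rule fexI[OF le_P(1)[OF q1(1)]], intro stable_intros, intro fandI fallI fimpI, rule 1) (rule 2)
  qed (intro stable_intros)
  have c3: "ffunction_on fdot etadot q" if "q \<in> P" for q
    unfolding ffunction_on_def by (intro fandI fallI fimpI) (use c3a c3b le_P in auto)
  have c4: "fsubmodule R M N q" if q: "q \<in> P" "fapp fdot i N q" for i N q
  proof (rule fdot_elim[OF q(2,1)])
    fix q1 i0 assume q1: "q1 \<preceq> q" "i0 \<in> elts (vsucc (len q1))" "feq N (check (vset (sq q1 i0))) q1"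
    show "fsubmodule R M N q1"
      by (rule feq_D[OF q1(3) fcong_derived2(1)])
        (rule fsubmodule_check[OF le_P(1)[OF q1(1)] left_module_axioms smM smR sq_sub[OF le_P(1)[OF q1(1)] q1(2)]])
  qed (intro stable_intros)
  have c5: "fsubset N N' q" if q: "q \<in> P" "fmem i j q" "fapp fdot i N q" "fapp fdot j N' q" for i j N N' q
  proof (rule fdot_elim2[OF q(3,4,1)])
    fix q1 i0 j0 assume q1: "q1 \<preceq> q" and i: "i0 \<in> elts (vsucc (len q1))" "feq i (check i0) q1" "feq N (check (vset (sq q1 i0))) q1"
      and j: "j0 \<in> elts (vsucc (len q1))" "feq j (check j0) q1" "feq N' (check (vset (sq q1 j0))) q1"
    note P1 = le_P(1)[OF q1]
    have "fmem (check i0) (check j0) q1"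
      using fcongD[OF fcong_fmem1 i(2) fcongD[OF fcong_fmem2 j(2) fmem_mono[OF q(2) q1]]] .
    then have "sq q1 i0 \<subseteq> sq q1 j0" using fseqD(5)[OF fsq[OF P1] j(1)] P1 by simp
    then have "fsubset (check (vset (sq q1 i0))) (check (vset (sq q1 j0))) q1"
      using fsubset_check[OF P1] sq_small[OF P1] i(1) j(1) by simp
    then show "fsubset N N' q1" using feq_D[OF i(3) fcong_derived(1)] feq_D[OF j(3) fcong_derived(2)] by blast
  qed (intro stable_intros)
  have c6: "(\<^bold>\<forall>x. x \<^bold>\<in> N' \<^bold>\<longleftrightarrow> (\<^bold>\<exists>i N. i \<^bold>\<in> j \<^bold>\<and> fapp fdot i N \<^bold>\<and> x \<^bold>\<in> N)) q"
    if q: "q \<in> P" "fapp fdot j N' q" "(\<^bold>\<not> fempty j) q" "(\<^bold>\<not> (\<^bold>\<exists>i. fsucc j i)) q" for j N' q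
  proof (rule fdot_elim[OF q(2,1)])
    fix q1 j0 assume q1: "q1 \<preceq> q" and j: "j0 \<in> elts (vsucc (len q1))" "feq j (check j0) q1" "feq N' (check (vset (sq q1 j0))) q1"
    note P1 = le_P(1)[OF q1]
    have "j0 \<noteq> vset {}"
    proof
      assume "j0 = vset {}"
      then have "fempty (check j0) q1" using fempty_check[OF P1] by simp
      then have "fempty j q1" using feq_D[OF j(2) fcong_derived(5)] by blast
      then show False using q(3) q1 unfolding fnot_iff by blast
    qed
    moreover have "j0 \<noteq> vsucc i0" for i0
    proof
      assume "j0 = vsucc i0"
      then have "fsucc (check j0) (check i0) q1" using fsucc_check[OF P1] by simp
      then have "fsucc j (check i0) q1" using feq_D[OF j(2) fcong_derived(6)] by blast
      then have "(\<^bold>\<exists>i. fsucc j i) q1" using P1 by (intro fexI stable_intros)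
      then show False using q(4) q1 unfolding fnot_iff by blast
    qed
    ultimately have lim: "sq q1 j0 = (\<Union>i\<in>elts j0. sq q1 i)" using fseqD(6)[OF fsq[OF P1] j(1)] by blast
    show "(\<^bold>\<forall>x. x \<^bold>\<in> N' \<^bold>\<longleftrightarrow> (\<^bold>\<exists>i N. i \<^bold>\<in> j \<^bold>\<and> fapp fdot i N \<^bold>\<and> x \<^bold>\<in> N)) q1"
    proof (intro fallI fiffI)
      fix x q2 assume q2: "q2 \<preceq> q1" and "fmem x N' q2"
      then have "fmem x (check (vset (sq q1 j0))) q2" using fcongD[OF fcong_fmem2 feq_mono[OF j(3) q2]] by blast
      then show "(\<^bold>\<exists>i N. i \<^bold>\<in> j \<^bold>\<and> fapp fdot i N \<^bold>\<and> x \<^bold>\<in> N) q2"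
      proof (rule fmem_check_elim[OF _ le_P(1)[OF q2]])
        fix q3 x0 assume q3: "q3 \<preceq> q2" "x0 \<in> elts (vset (sq q1 j0))" "feq x (check x0) q3"
        note P3 = le_P(1)[OF q3(1)] and q31 = le_trans[OF q3(1) q2]
        obtain i0 where i0: "i0 \<in> elts j0" "x0 \<in> sq q1 i0" using q3(2) sq_small[OF P1 j(1)] lim by auto
        have i0': "i0 \<in> elts (vsucc (len q1))" using check_sub[OF P1 j(1) i0(1)] .
        have 1: "fmem (check i0) j q3"
          by (rule feq_D[OF feq_mono[OF j(2) q31] fcong_fmem2]) (use i0(1) P3 in simp)
        have 2: "fapp fdot (check i0) (check (vset (sq q1 i0))) q3"
          using stable_mono[OF stable_fapp fdot_memI[OF P1 i0'] q31] .
        have 3: "fmem x (check (vset (sq q1 i0))) q3"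
          by (rule fmem_check_eq[OF _ q3(3)]) (use i0(2) sq_small[OF P1 i0'] in simp)
        show "(\<^bold>\<exists>i N. i \<^bold>\<in> j \<^bold>\<and> fapp fdot i N \<^bold>\<and> x \<^bold>\<in> N) q3"
          by (rule fexI[where \<tau> = "check i0", OF P3], intro stable_intros,
              rule fexI[where \<tau> = "check (vset (sq q1 i0))", OF P3], intro stable_intros)
            (intro fandI 1 2 3)
      qed (intro stable_intros)
    next
      fix x q2 assume q2: "q2 \<preceq> q1" and ex: "(\<^bold>\<exists>i N. i \<^bold>\<in> j \<^bold>\<and> fapp fdot i N \<^bold>\<and> x \<^bold>\<in> N) q2"
      show "fmem x N' q2"
      proof (rule fexE[OF ex le_P(1)[OF q2] stable_fmem])
        fix i q3 assume q3: "q3 \<preceq> q2" and ex: "(\<^bold>\<exists>N. i \<^bold>\<in> j \<^bold>\<and> fapp fdot i N \<^bold>\<and> x \<^bold>\<in> N) q3"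
        show "fmem x N' q3"
        proof (rule fexE[OF ex le_P(1)[OF q3] stable_fmem])
          fix N q4 assume q4: "q4 \<preceq> q3" and *: "(i \<^bold>\<in> j \<^bold>\<and> fapp fdot i N \<^bold>\<and> x \<^bold>\<in> N) q4"
          have ij: "fmem i j q4" and f: "fapp fdot i N q4" and x: "fmem x N q4" using * by (auto simp: fand_iff)
          have q41: "q4 \<preceq> q" using le_trans[OF q4 le_trans[OF q3 le_trans[OF q2 q1]]] .
          have "fsubset N N' q4" by (rule c5[OF le_P(1)[OF q4] ij f stable_mono[OF stable_fapp q(2) q41]])
          then show "fmem x N' q4"
            using x le_refl[OF le_P(1)[OF q4]] unfolding fsubset_def fall_def by (auto simp: fimp_iff stable_intros)
        qed
      qed
    qed
  qed (intro stable_intros)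
  have c7a: "(\<^bold>\<exists>i N. fapp fdot i N \<^bold>\<and> x \<^bold>\<in> N) q" if q: "q \<in> P" "fmem x (fcarrier M) q" for x q
    using q(2) unfolding fcarrier_def
  proof (rule fmem_check_elim[OF _ q(1)])
    show "fstable (\<^bold>\<exists>i N. fapp fdot i N \<^bold>\<and> x \<^bold>\<in> N)" by (intro stable_intros)
    fix q1 x0 assume q1: "q1 \<preceq> q" "x0 \<in> elts (vset (carrier M))" "feq x (check x0) q1"
    show "(\<^bold>\<exists>i N. fapp fdot i N \<^bold>\<and> x \<^bold>\<in> N) q1"
    proof (rule stable_dense[OF _ le_P(1)[OF q1(1)]])
      show "fstable (\<^bold>\<exists>i N. fapp fdot i N \<^bold>\<and> x \<^bold>\<in> N)" by (intro stable_intros)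
      fix q2 assume q2: "q2 \<preceq> q1"
      obtain q3 where q3: "q3 \<preceq> q2" "x0 \<in> sq q3 (len q3)" using dense[OF le_P(1)[OF q2]] q1(2) smM by auto
      note P3 = le_P(1)[OF q3(1)]
      have 1: "fapp fdot (check (len q3)) (check (vset (sq q3 (len q3)))) q3" by (rule fdot_memI[OF P3]) simp
      have 2: "fmem x (check (vset (sq q3 (len q3)))) q3"
        by (rule fmem_check_eq[OF _ feq_mono[OF q1(3) le_trans[OF q3(1) q2]]])
          (use sq_small[OF P3, of "len q3"] q3(2) in simp)
      have "(\<^bold>\<exists>i N. fapp fdot i N \<^bold>\<and> x \<^bold>\<in> N) q3"
        by (rule fexI[where \<tau> = "check (len q3)", OF P3], intro stable_intros,
            rule fexI[where \<tau> = "check (vset (sq q3 (len q3)))", OF P3], intro stable_intros)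
          (intro fandI 1 2)
      then show "\<exists>q3. q3 \<preceq> q2 \<and> (\<^bold>\<exists>i N. fapp fdot i N \<^bold>\<and> x \<^bold>\<in> N) q3" using q3(1) by blast
    qed
  qed
  have c7b: "fmem x (fcarrier M) q" if q: "q \<in> P" and ex: "(\<^bold>\<exists>i N. fapp fdot i N \<^bold>\<and> x \<^bold>\<in> N) q" for x q
  proof (rule fexE[OF ex q(1) stable_fmem])
    fix i q1 assume q1: "q1 \<preceq> q" and ex: "(\<^bold>\<exists>N. fapp fdot i N \<^bold>\<and> x \<^bold>\<in> N) q1"
    show "fmem x (fcarrier M) q1"
    proof (rule fexE[OF ex le_P(1)[OF q1] stable_fmem])
      fix N q2 assume q2: "q2 \<preceq> q1" and *: "(fapp fdot i N \<^bold>\<and> x \<^bold>\<in> N) q2"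
      have f: "fapp fdot i N q2" and x: "fmem x N q2" using * by (auto simp: fand_iff)
      show "fmem x (fcarrier M) q2"
      proof (rule fdot_elim[OF f le_P(1)[OF q2] stable_fmem])
        fix q3 i0 assume q3: "q3 \<preceq> q2" "i0 \<in> elts (vsucc (len q3))" "feq N (check (vset (sq q3 i0))) q3"
        have "fmem x (check (vset (sq q3 i0))) q3" using fcongD[OF fcong_fmem2 q3(3) fmem_mono[OF x q3(1)]] .
        then show "fmem x (fcarrier M) q3"
          unfolding fcarrier_def
          by (rule fmem_check_mono[OF _ le_P(1)[OF q3(1)]])
            (use sq_small[OF le_P(1)[OF q3(1)] q3(2)] sq_carrier[OF le_P(1)[OF q3(1)] q3(2)] smM in simp)
      qed
    qed
  qed
  have c8: "(\<^bold>\<forall>x. x \<^bold>\<in> N \<^bold>\<longleftrightarrow> x \<^bold>= check \<zero>\<^bsub>M\<^esub>) q" if q: "q \<in> P" "fapp fdot i N q" "fempty i q" for i N q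
  proof (rule fdot_elim[OF q(2,1)])
    fix q1 i0 assume q1: "q1 \<preceq> q" and i: "i0 \<in> elts (vsucc (len q1))" "feq i (check i0) q1" "feq N (check (vset (sq q1 i0))) q1"
    note P1 = le_P(1)[OF q1]
    have "fempty (check i0) q1" using fcongD[OF fcong_derived(5) i(2) stable_mono[OF stable_derived(5) q(3) q1]] .
    then have "i0 = vset {}" using fempty_check[OF P1] by (metis elts_inject zero)
    then have "sq q1 i0 = {\<zero>\<^bsub>M\<^esub>}" using fseqD(4)[OF fsq[OF P1]] by simp
    then have N: "feq N (check (vset {\<zero>\<^bsub>M\<^esub>})) q1" using i(3) by simp
    show "(\<^bold>\<forall>x. x \<^bold>\<in> N \<^bold>\<longleftrightarrow> x \<^bold>= check \<zero>\<^bsub>M\<^esub>) q1"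
    proof (intro fallI fiffI)
      fix x q2 assume q2: "q2 \<preceq> q1" "fmem x N q2"
      have "fmem x (check (vset {\<zero>\<^bsub>M\<^esub>})) q2" using fcongD[OF fcong_fmem2 feq_mono[OF N q2(1)] q2(2)] .
      then show "feq x (check \<zero>\<^bsub>M\<^esub>) q2" by (rule fmem_check_elim[OF _ le_P(1)[OF q2(1)] stable_feq]) simp
    next
      fix x q2 assume q2: "q2 \<preceq> q1" "feq x (check \<zero>\<^bsub>M\<^esub>) q2"
      show "fmem x N q2" by (rule feq_D[OF feq_mono[OF N q2(1)] fcong_fmem2], rule fmem_check_eq[OF _ q2(2)]) simp
    qed
  qed (intro stable_intros)
  have c9: "fex_ground \<C> (\<lambda>C. fquotient_iso R M N' N C) q"
    if q: "q \<in> P" "fsucc j i q" "fapp fdot i N q" "fapp fdot j N' q" for i j N N' q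
  proof (rule fdot_elim2[OF q(3,4,1)])
    fix q1 i0 j0 assume q1: "q1 \<preceq> q" and i: "i0 \<in> elts (vsucc (len q1))" "feq i (check i0) q1" "feq N (check (vset (sq q1 i0))) q1"
      and j: "j0 \<in> elts (vsucc (len q1))" "feq j (check j0) q1" "feq N' (check (vset (sq q1 j0))) q1"
    note P1 = le_P(1)[OF q1]
    have "fsucc (check j0) (check i0) q1"
      using fcongD[OF fcong_derived(7) i(2) fcongD[OF fcong_derived(6) j(2) stable_mono[OF stable_derived(6) q(2) q1]]] .
    then have js: "j0 = vsucc i0" using fsucc_check[OF P1] by blast
    \<comment> \<open>Otherwise the successor j0 would exceed the length of the condition. Hence the
      step from i0 is one of the steps recorded in \<open>fseq\<close>.\<close>
    then have "i0 \<noteq> len q1" using j(1) elts_asym[of i0 "vsucc (len q1)"] vsucc_neq by (metis elts_asym elts_vsucc insertE insertI1)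
    then have "i0 \<in> elts (len q1)" using i(1) by simp
    then obtain C \<phi> where C: "C \<in> \<C>" "quot_iso R M (sq q1 j0) (sq q1 i0) C \<phi>"
      using fseqD(7)[OF fsq[OF P1]] js by blast
    have "fquotient_iso R M (check (vset (sq q1 j0))) (check (vset (sq q1 i0))) C q1"
      by (rule fquotient_iso_check[OF P1 left_module_axioms _ smM smR _ sq_sub[OF P1 j(1)] sq_sub[OF P1 i(1)] _ C(2)])
        (use \<C>[OF C(1)] fseqD(5)[OF fsq[OF P1] j(1), of i0] js in \<open>auto simp: is_module_def\<close>)
    then have "fquotient_iso R M N' N C q1"
      using feq_D[OF j(3) fcong_fquotient_iso(1)] feq_D[OF i(3) fcong_fquotient_iso(2)] by blast
    then show "fex_ground \<C> (\<lambda>C. fquotient_iso R M N' N C) q1"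
      unfolding fex_ground_iff using C(1) stable_mono[OF stable_fquotient_iso] le_refl le_P by blast
  qed (intro stable_intros)
  have c7: "(x \<^bold>\<in> fcarrier M \<^bold>\<longleftrightarrow> (\<^bold>\<exists>i N. fapp fdot i N \<^bold>\<and> x \<^bold>\<in> N)) q" if "q \<in> P" for x q
    using c7a c7b le_P by (intro fiffI) blast+
  have c6': "(x \<^bold>\<in> N' \<^bold>\<longleftrightarrow> (\<^bold>\<exists>i N. i \<^bold>\<in> j \<^bold>\<and> fapp fdot i N \<^bold>\<and> x \<^bold>\<in> N)) q"
    if "q \<in> P" "fapp fdot j N' q" "(\<^bold>\<not> fempty j) q" "(\<^bold>\<not> (\<^bold>\<exists>i. fsucc j i)) q" for x j N' q
    using c6[OF that] unfolding fall_def by blast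
  have c8': "(x \<^bold>\<in> N \<^bold>\<longleftrightarrow> x \<^bold>= check \<zero>\<^bsub>M\<^esub>) q" if "q \<in> P" "fapp fdot i N q" "fempty i q" for x i N q
    using c8[OF that] unfolding fall_def by blast
  show ?thesis
    unfolding ffiltered_def
    by (rule fexI[where \<tau> = etadot, OF p0], (intro stable_intros)[1], rule fexI[where \<tau> = fdot, OF p0], (intro stable_intros)[1],
        intro fandI fallI fimpI c1 c2 c3 p0)
      (use p0 c4 c5 c6' c7 c8' c9 le_P in \<open>auto simp: fand_iff\<close>)
qed

end

section \<open>The poset of countable filtrations ending in spans of members of Q\<close>

text \<open>The set b is stored along with the filtration: its span does not determine it, and
  \<sigma>-closure needs an increasing sequence of members of Q, not merely of spans.\<close>

definition cond_code :: "'v::zfc \<Rightarrow> ('v \<Rightarrow> 'v set) \<Rightarrow> 'v set \<Rightarrow> 'v"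
  where "cond_code \<alpha> s b = opair (vset ((\<lambda>i. opair i (vset (s i))) ` elts (vsucc \<alpha>))) (vset b)"

lemma cond_code_eq_iff:
  assumes "\<And>i. i \<in> elts (vsucc \<alpha>) \<Longrightarrow> small (s i)" "\<And>i. i \<in> elts (vsucc \<beta>) \<Longrightarrow> small (t i)" "small b" "small c"
  shows "cond_code \<alpha> s b = cond_code \<beta> t c \<longleftrightarrow> \<alpha> = \<beta> \<and> (\<forall>i \<in> elts (vsucc \<alpha>). s i = t i) \<and> b = c"
proof
  assume eq: "cond_code \<alpha> s b = cond_code \<beta> t c"
  have g: "(\<lambda>i. opair i (vset (s i))) ` elts (vsucc \<alpha>) = (\<lambda>i. opair i (vset (t i))) ` elts (vsucc \<beta>)"
    using eq unfolding cond_code_def opair_inject vset_inject[OF small_image[OF small_elts] small_image[OF small_elts]] by blast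
  have "i \<in> elts (vsucc \<beta>) \<and> s i = t i" if i: "i \<in> elts (vsucc \<alpha>)" for i
  proof -
    have "opair i (vset (s i)) \<in> (\<lambda>i. opair i (vset (t i))) ` elts (vsucc \<beta>)" using g i by blast
    then have "i \<in> elts (vsucc \<beta>)" "vset (s i) = vset (t i)" by auto
    then show ?thesis using assms(1)[OF i] assms(2)[of i] vset_inject by blast
  qed
  moreover have "i \<in> elts (vsucc \<alpha>)" if i: "i \<in> elts (vsucc \<beta>)" for i
  proof -
    have "opair i (vset (t i)) \<in> (\<lambda>i. opair i (vset (s i))) ` elts (vsucc \<alpha>)" using g i by blast
    then show ?thesis by auto
  qed
  ultimately have "elts (vsucc \<alpha>) = elts (vsucc \<beta>)" "\<forall>i \<in> elts (vsucc \<alpha>). s i = t i" by blast+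
  moreover have "b = c" using eq assms(3,4) unfolding cond_code_def opair_inject by (simp add: vset_inject)
  ultimately show "\<alpha> = \<beta> \<and> (\<forall>i \<in> elts (vsucc \<alpha>). s i = t i) \<and> b = c"
    using elts_inject vsucc_inject by blast
next
  assume "\<alpha> = \<beta> \<and> (\<forall>i \<in> elts (vsucc \<alpha>). s i = t i) \<and> b = c"
  then show "cond_code \<alpha> s b = cond_code \<beta> t c"
    unfolding cond_code_def by (intro arg_cong2[where f = opair] arg_cong[where f = vset] image_cong) auto
qed

text \<open>A condition is a countable filtration whose last member is the span of its stored set b
  in Q. Lower bounds exist because countable unions keep the length countable and \<open>lim\<close>
  keeps the union of the b in Q; density is supplied by \<open>step\<close>.\<close>

lemma sigma_closed_potentially_filteredI:
  fixes R :: "'v::zfc ring" and M :: "('v, 'v) module"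
  assumes M: "left_module R M" and sm: "small (carrier M)" "small (carrier R)"
    and \<C>: "\<And>C. C \<in> \<C> \<Longrightarrow> is_module R C"
    and Q: "Q \<noteq> {}" "\<And>b. b \<in> Q \<Longrightarrow> b \<subseteq> carrier M" "\<And>b. b \<in> Q \<Longrightarrow> fext R \<C> M {\<zero>\<^bsub>M\<^esub>} (span R M b)"
    and step: "\<And>b x. b \<in> Q \<Longrightarrow> x \<in> carrier M \<Longrightarrow> \<exists>c \<in> Q. b \<subseteq> c \<and> x \<in> c \<and> fext R \<C> M (span R M b) (span R M c)"
    and lim: "\<And>b :: nat \<Rightarrow> 'v set. (\<And>n. b n \<in> Q) \<Longrightarrow> (\<And>n. b n \<subseteq> b (Suc n)) \<Longrightarrow> (\<Union>n. b n) \<in> Q"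
  shows "sigma_closed_potentially_filtered R \<C> M"
proof -
  interpret M: left_module R M by fact
  define cond where "cond \<alpha> s b \<longleftrightarrow> fseq R \<C> M \<alpha> s \<and> b \<in> Q \<and> s \<alpha> = span R M b" for \<alpha> s b
  define P where "P = {cond_code \<alpha> s b |\<alpha> s b. cond \<alpha> s b}"
  have sms: "small (s i)" if "fseq R \<C> M \<alpha> s" "i \<in> elts (vsucc \<alpha>)" for \<alpha> s i
    using M.submoduleD(1)[OF fseqD(3)[OF that]] small_subset sm(1) by blast
  have smb: "small b" if "b \<in> Q" for b using Q(2)[OF that] small_subset sm(1) by blast
  have code_eq: "cond_code \<alpha> s b = cond_code \<beta> t c \<longleftrightarrow> \<alpha> = \<beta> \<and> (\<forall>i \<in> elts (vsucc \<alpha>). s i = t i) \<and> b = c"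
    if "cond \<alpha> s b" "cond \<beta> t c" for \<alpha> s b \<beta> t c
    by (rule cond_code_eq_iff) (use that sms smb in \<open>auto simp: cond_def\<close>)
  have "\<forall>p \<in> P. \<exists>\<alpha> s b. cond \<alpha> s b \<and> p = cond_code \<alpha> s b" unfolding P_def by blast
  \<comment> \<open>The code determines \<open>S p\<close> only at indices up to \<open>L p\<close>,
    so decoded filtrations are compared only there.\<close>
  then obtain L S B where LSB: "\<And>p. p \<in> P \<Longrightarrow> cond (L p) (S p) (B p)" "\<And>p. p \<in> P \<Longrightarrow> p = cond_code (L p) (S p) (B p)"
    by metis
  define r where "r = {(q, p). q \<in> P \<and> p \<in> P \<and> end_ext (L p) (S p) (L q) (S q) \<and> B p \<subseteq> B q}"
  have codeP: "cond_code \<alpha> s b \<in> P" if "cond \<alpha> s b" for \<alpha> s b unfolding P_def using that by blast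
  have decode: "L (cond_code \<alpha> s b) = \<alpha>" "\<forall>i \<in> elts (vsucc \<alpha>). S (cond_code \<alpha> s b) i = s i" "B (cond_code \<alpha> s b) = b"
    if "cond \<alpha> s b" for \<alpha> s b
    using code_eq[OF that LSB(1)[OF codeP[OF that]]] LSB(2)[OF codeP[OF that]] by auto
  have below: "(cond_code \<beta> t c, p) \<in> r" if "p \<in> P" "cond \<beta> t c" "end_ext (L p) (S p) \<beta> t" "B p \<subseteq> c" for p \<beta> t c
  proof -
    have "Ord \<beta>" using that(2) fseqD(2) unfolding cond_def by blast
    then have "end_ext (L p) (S p) \<beta> (S (cond_code \<beta> t c))"
      using that(3) decode(2)[OF that(2)] Ord_le_trans unfolding end_ext_def by metis
    then show ?thesis unfolding r_def using that decode(1,3)[OF that(2)] codeP by simp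
  qed
  have OL: "Ord (L p)" if "p \<in> P" for p using LSB(1)[OF that] fseqD(2) unfolding cond_def by blast
  have smP: "small P"
  proof -
    let ?A = "{opair i z |i z. i \<in> (omega1 :: 'v set) \<and> z \<in> vset ` Pow (carrier M)}"
    let ?B = "{opair x y |x y. x \<in> vset ` Pow ?A \<and> y \<in> vset ` Pow (carrier M)}"
    have "small ?B" by (intro small_image2 small_vset_Pow small_omega1 sm)
    moreover have "P \<subseteq> ?B"
    proof
      fix p assume "p \<in> P"
      then obtain \<alpha> s b where p: "p = cond_code \<alpha> s b" "fseq R \<C> M \<alpha> s" "b \<in> Q" unfolding P_def cond_def by blast
      have "opair i (vset (s i)) \<in> ?A" if "i \<in> elts (vsucc \<alpha>)" for i
        using omega1_small_elts[OF omega1_vsucc[OF fseqD(1)[OF p(2)]] that] M.submoduleD(1)[OF fseqD(3)[OF p(2) that]] by blast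
      then have "(\<lambda>i. opair i (vset (s i))) ` elts (vsucc \<alpha>) \<in> Pow ?A" by blast
      then show "p \<in> ?B" unfolding p(1) cond_code_def using Q(2)[OF p(3)] by blast
    qed
    ultimately show ?thesis by (rule small_subset)
  qed
  \<comment> \<open>The trivial filtration, with zero as its only member, is prolonged to the span
    of some member of Q. This starting point gives the later uses of \<open>fext\<close> their
    content.\<close>
  have neP: "P \<noteq> {}"
  proof -
    obtain b where b: "b \<in> Q" using Q(1) by blast
    have "fseq R \<C> M (vset {}) (\<lambda>_. {\<zero>\<^bsub>M\<^esub>})"
      unfolding fseq_def using Ord_nat_ord[of 0] M.submodule_zero by (auto simp: omega1_def)
    then obtain \<beta> t where "fseq R \<C> M \<beta> t" "t \<beta> = span R M b"
      using Q(3)[OF b] unfolding fext_def by blast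
    then have "cond \<beta> t b" using b unfolding cond_def by blast
    then show ?thesis using codeP by blast
  qed
  have po: "partial_order_on P r"
    unfolding partial_order_on_def preorder_on_def
  proof (intro conjI)
    show "r \<subseteq> P \<times> P" unfolding r_def by blast
    show "refl_on P r" unfolding r_def refl_on_def using end_ext_refl by auto
    show "trans r"
      unfolding r_def trans_def using end_ext_trans OL by blast
    show "antisym r"
    proof (rule antisymI)
      fix p q assume "(p, q) \<in> r" "(q, p) \<in> r"
      then have pq: "p \<in> P" "q \<in> P" "end_ext (L p) (S p) (L q) (S q)" "end_ext (L q) (S q) (L p) (S p)" "B p = B q"
        unfolding r_def by auto
      have "L p = L q" using pq(3,4) elts_asym unfolding end_ext_def by auto
      moreover have "\<forall>i \<in> elts (vsucc (L p)). S p i = S q i" using pq(3) unfolding end_ext_def by simp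
      ultimately have "cond_code (L p) (S p) (B p) = cond_code (L q) (S q) (B q)"
        using code_eq[OF LSB(1)[OF pq(1)] LSB(1)[OF pq(2)]] pq(5) by blast
      with LSB(2)[OF pq(1)] LSB(2)[OF pq(2)] show "p = q" by argo
    qed
  qed
  have fp: "forcing_poset P r" using smP neP po by (rule forcing_poset.intro)
  have sc: "sigma_closed P r"
    unfolding sigma_closed_def
  proof (intro allI impI)
    fix c :: "nat \<Rightarrow> 'v" assume c: "\<forall>n. c n \<in> P \<and> (c (Suc n), c n) \<in> r"
    have cn: "fseq R \<C> M (L (c n)) (S (c n))" "B (c n) \<in> Q" "S (c n) (L (c n)) = span R M (B (c n))"
      "end_ext (L (c n)) (S (c n)) (L (c (Suc n))) (S (c (Suc n)))" "B (c n) \<subseteq> B (c (Suc n))" for n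
      using c LSB(1)[of "c n"] unfolding cond_def r_def by auto
    obtain \<beta> t where t: "fseq R \<C> M \<beta> t" "t \<beta> = (\<Union>n. S (c n) (L (c n)))" "\<And>n. end_ext (L (c n)) (S (c n)) \<beta> t"
      using fseq_limit[of R M \<C> "\<lambda>n. L (c n)" "\<lambda>n. S (c n)", OF M cn(1,4)] by blast
    \<comment> \<open>The union of the spans is the span of the union, so the limit filtration again
      ends in the span of a member of Q.\<close>
    have "t \<beta> = span R M (\<Union>n. B (c n))"
      using t(2) M.span_Union_chain[of "\<lambda>n. B (c n)"] Q(2)[OF cn(2)] cn(3,5) by simp
    moreover have "(\<Union>n. B (c n)) \<in> Q" using lim[of "\<lambda>n. B (c n)"] cn(2,5) by blast
    ultimately have "cond \<beta> t (\<Union>n. B (c n))" using t(1) unfolding cond_def by blast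
    then show "\<exists>q\<in>P. \<forall>n. (q, c n) \<in> r"
      using below[of _ \<beta> t] c t(3) codeP by blast
  qed
  interpret F: filtration_forcing P r R M \<C> L S
  proof (rule filtration_forcing.intro[OF fp M], rule filtration_forcing_axioms.intro)
    show "small (carrier M)" "small (carrier R)" by (fact sm)+
    show "is_module R C" if "C \<in> \<C>" for C using \<C>[OF that] .
    show "fseq R \<C> M (L p) (S p)" if "p \<in> P" for p using LSB(1)[OF that] unfolding cond_def by blast
    show "end_ext (L p) (S p) (L q) (S q)" if "(q, p) \<in> r" for p q using that unfolding r_def by blast
    show "\<exists>q. (q, p) \<in> r \<and> x \<in> S q (L q)" if p: "p \<in> P" and x: "x \<in> carrier M" for p x
    proof -
      have c: "fseq R \<C> M (L p) (S p)" "B p \<in> Q" "S p (L p) = span R M (B p)" using LSB(1)[OF p] unfolding cond_def by auto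
      obtain b where b: "b \<in> Q" "B p \<subseteq> b" "x \<in> b" "fext R \<C> M (span R M (B p)) (span R M b)"
        using step[OF c(2) x] by blast
      then obtain \<beta> t where t: "fseq R \<C> M \<beta> t" "t \<beta> = span R M b" "end_ext (L p) (S p) \<beta> t"
        using c unfolding fext_def by blast
      then have cb: "cond \<beta> t b" using b(1) unfolding cond_def by blast
      have "S (cond_code \<beta> t b) (L (cond_code \<beta> t b)) = span R M b" using decode[OF cb] t(2) by simp
      then show ?thesis using below[OF p cb t(3) b(2)] b(3) M.span_superset by blast
    qed
  qed
  show ?thesis
    unfolding sigma_closed_potentially_filtered_def using fp sc F.ffiltered_forced by blast
qed

section \<open>Countable presentations\<close>

lemma left_module_free_module:
  assumes "ring R" shows "left_module R (free_module R I)"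
proof -
  interpret R: ring R by fact
  let ?F = "free_module R I"
  have fin: "finite {i. f i \<noteq> \<zero>\<^bsub>R\<^esub>}" if "finite {i. c i \<noteq> \<zero>\<^bsub>R\<^esub>}" "finite {i. d i \<noteq> \<zero>\<^bsub>R\<^esub>}"
    "\<And>i. c i = \<zero>\<^bsub>R\<^esub> \<Longrightarrow> d i = \<zero>\<^bsub>R\<^esub> \<Longrightarrow> f i = \<zero>\<^bsub>R\<^esub>" for c d f
    by (rule finite_subset[OF _ finite_UnI[OF that(1,2)]]) (use that(3) in blast)
  have mem: "c \<in> carrier ?F \<longleftrightarrow> (\<forall>i\<in>I. c i \<in> carrier R) \<and> (\<forall>i. i \<notin> I \<longrightarrow> c i = \<zero>\<^bsub>R\<^esub>) \<and> finite {i. c i \<noteq> \<zero>\<^bsub>R\<^esub>}" for c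
    by (simp add: free_module_def)
  have cR: "c i \<in> carrier R" if "c \<in> carrier ?F" for c i
    using that mem[of c] R.zero_closed by (cases "i \<in> I") auto
  have ops: "c \<oplus>\<^bsub>?F\<^esub> d = (\<lambda>i. c i \<oplus>\<^bsub>R\<^esub> d i)" "a \<odot>\<^bsub>?F\<^esub> c = (\<lambda>i. a \<otimes>\<^bsub>R\<^esub> c i)" "\<zero>\<^bsub>?F\<^esub> = (\<lambda>i. \<zero>\<^bsub>R\<^esub>)" for a c d
    by (simp_all add: free_module_def)
  have add: "c \<oplus>\<^bsub>?F\<^esub> d \<in> carrier ?F" if "c \<in> carrier ?F" "d \<in> carrier ?F" for c d
    using that fin[of c d "\<lambda>i. c i \<oplus>\<^bsub>R\<^esub> d i"] unfolding ops mem by simp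
  have smult: "a \<odot>\<^bsub>?F\<^esub> c \<in> carrier ?F" if "a \<in> carrier R" "c \<in> carrier ?F" for a c
    using that fin[of c c "\<lambda>i. a \<otimes>\<^bsub>R\<^esub> c i"] unfolding ops mem by simp
  have "abelian_group ?F"
  proof (rule abelian_groupI)
    show "\<zero>\<^bsub>?F\<^esub> \<in> carrier ?F" unfolding ops mem by simp
    fix c assume c: "c \<in> carrier ?F"
    have "(\<lambda>i. \<ominus>\<^bsub>R\<^esub> c i) \<in> carrier ?F"
      using c fin[of c c "\<lambda>i. \<ominus>\<^bsub>R\<^esub> c i"] unfolding mem by simp
    moreover have "(\<lambda>i. \<ominus>\<^bsub>R\<^esub> c i) \<oplus>\<^bsub>?F\<^esub> c = \<zero>\<^bsub>?F\<^esub>" unfolding ops using R.l_neg cR[OF c] by simp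
    ultimately show "\<exists>d\<in>carrier ?F. d \<oplus>\<^bsub>?F\<^esub> c = \<zero>\<^bsub>?F\<^esub>" by blast
  qed (simp_all add: add[unfolded ops] ops cR R.a_ac)
  then show ?thesis
    by (intro left_module.intro left_module_axioms.intro assms)
      (simp_all add: smult[unfolded ops] ops cR R.l_distr R.r_distr R.m_assoc)
qed

text \<open>Lift the images of the free generators from C to U. Evaluating combinations of the lifts
  E gives a map v from the free module with \<phi> after v equal to h. Hence E generates U modulo L,
  and an element of the span of E lying in L is a value of v on the kernel of h. That kernel is
  spanned by countably many relations, whose values are the set K of the conclusion.\<close>

lemma countably_presented_quotient:
  assumes M: "left_module R M" and C: "left_module R C" and cp: "countably_presented R C"
    and U: "submodule U R M" and L: "submodule L R M" "L \<subseteq> U" and \<phi>: "quot_iso R M U L C \<phi>"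
  shows "\<exists>E K. countable E \<and> countable K \<and> E \<subseteq> U \<and> K \<subseteq> L \<and>
    (\<forall>z \<in> U. \<exists>l \<in> L. z \<ominus>\<^bsub>M\<^esub> l \<in> span R M E) \<and> span R M E \<inter> L \<subseteq> span R M K"
proof -
  interpret M: left_module R M by fact
  interpret C: left_module R C by fact
  note Ud = M.submoduleD[OF U] and Ld = M.submoduleD[OF L(1)]
  obtain I :: "nat set" and K h where IK: "K \<subseteq> carrier (free_module R I)" "countable K"
    "h \<in> module_hom R (free_module R I) C" "h ` carrier (free_module R I) = carrier C"
    "{x \<in> carrier (free_module R I). h x = \<zero>\<^bsub>C\<^esub>} = span R (free_module R I) K"
    using cp unfolding countably_presented_def Let_def by blast
  define F where "F = free_module R I"
  interpret F: left_module R F unfolding F_def by (rule left_module_free_module) (rule M.R.ring_axioms)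
  have mem: "c \<in> carrier F \<longleftrightarrow> (\<forall>i\<in>I. c i \<in> carrier R) \<and> (\<forall>i. i \<notin> I \<longrightarrow> c i = \<zero>\<^bsub>R\<^esub>) \<and> finite {i. c i \<noteq> \<zero>\<^bsub>R\<^esub>}" for c
    by (simp add: F_def free_module_def)
  have cR: "c i \<in> carrier R" if "c \<in> carrier F" for c i
    using that mem[of c] M.R.zero_closed by (cases "i \<in> I") auto
  have ops: "c \<oplus>\<^bsub>F\<^esub> d = (\<lambda>i. c i \<oplus>\<^bsub>R\<^esub> d i)" "a \<odot>\<^bsub>F\<^esub> c = (\<lambda>i. a \<otimes>\<^bsub>R\<^esub> c i)" "\<zero>\<^bsub>F\<^esub> = (\<lambda>i. \<zero>\<^bsub>R\<^esub>)" for a c d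
    by (simp_all add: F_def free_module_def)
  have h: "h (c \<oplus>\<^bsub>F\<^esub> d) = h c \<oplus>\<^bsub>C\<^esub> h d" "a \<in> carrier R \<Longrightarrow> h (a \<odot>\<^bsub>F\<^esub> c) = a \<odot>\<^bsub>C\<^esub> h c" "h c \<in> carrier C"
    if "c \<in> carrier F" "d \<in> carrier F" for a c d
    using IK(3) that unfolding F_def module_hom_def by auto
  have h0: "h \<zero>\<^bsub>F\<^esub> = \<zero>\<^bsub>C\<^esub>"
    using h(2)[of "\<zero>\<^bsub>F\<^esub>" "\<zero>\<^bsub>F\<^esub>" "\<zero>\<^bsub>R\<^esub>"] F.smult_l_zero[of "\<zero>\<^bsub>F\<^esub>"]
      C.smult_l_zero[OF h(3)[OF F.M.zero_closed F.M.zero_closed]] by simp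
  have \<phi>': "\<phi> ` U = carrier C" "\<And>x y. x \<in> U \<Longrightarrow> y \<in> U \<Longrightarrow> \<phi> (x \<oplus>\<^bsub>M\<^esub> y) = \<phi> x \<oplus>\<^bsub>C\<^esub> \<phi> y"
    "\<And>a x. a \<in> carrier R \<Longrightarrow> x \<in> U \<Longrightarrow> \<phi> (a \<odot>\<^bsub>M\<^esub> x) = a \<odot>\<^bsub>C\<^esub> \<phi> x" "\<And>x. x \<in> U \<Longrightarrow> \<phi> x = \<zero>\<^bsub>C\<^esub> \<longleftrightarrow> x \<in> L"
    using \<phi> unfolding quot_iso_def by blast+
  define \<delta> where "\<delta> n = (\<lambda>i. if i = n then \<one>\<^bsub>R\<^esub> else \<zero>\<^bsub>R\<^esub>)" for n :: nat
  have \<delta>: "\<delta> n \<in> carrier F" if "n \<in> I" for n using that unfolding mem \<delta>_def by auto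
  have "\<exists>e\<in>U. \<phi> e = h (\<delta> n)" if "n \<in> I" for n
    using \<phi>'(1) h(3)[OF \<delta>[OF that] \<delta>[OF that]] by (metis imageE)
  then obtain e where e: "\<And>n. n \<in> I \<Longrightarrow> e n \<in> U" "\<And>n. n \<in> I \<Longrightarrow> \<phi> (e n) = h (\<delta> n)" by metis
  let ?E = "e ` I"
  have EU: "?E \<subseteq> U" using e(1) by blast
  have EM: "?E \<subseteq> carrier M" using EU Ud(1) by blast
  note sE = M.submoduleD[OF M.submodule_span[OF EM]]
  have sEU: "span R M ?E \<subseteq> U" by (rule M.span_least[OF U EU])
  define t where "t r n = (if n \<in> I then r n \<odot>\<^bsub>M\<^esub> e n else \<zero>\<^bsub>M\<^esub>)" for r n
  have tE: "t r n \<in> span R M ?E" if "r \<in> carrier F" for r n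
    unfolding t_def using sE(2,4) cR[OF that] M.span_superset[of ?E] by auto
  \<comment> \<open>The finite sum of lifted terms is written as a partial sum by recursion on m, so
    that \<phi> can be computed on it by induction, compared with h on the truncations
    \<open>tr m r\<close>.\<close>
  define ev where "ev m r = rec_nat \<zero>\<^bsub>M\<^esub> (\<lambda>n z. z \<oplus>\<^bsub>M\<^esub> t r n) m" for m r
  have ev: "ev 0 r = \<zero>\<^bsub>M\<^esub>" "ev (Suc m) r = ev m r \<oplus>\<^bsub>M\<^esub> t r m" for m r by (simp_all add: ev_def)
  have evE: "ev m r \<in> span R M ?E" if "r \<in> carrier F" for m r
    by (induction m) (simp_all add: ev sE(2,3) tE[OF that])
  have evM: "ev m r \<in> carrier M" "t r m \<in> carrier M" if "r \<in> carrier F" for m r using evE[OF that] tE[OF that] sE(1) by blast+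
  have eM: "e n \<in> carrier M" if "n \<in> I" for n using e(1)[OF that] Ud(1) by blast
  have ev_add: "ev m (r \<oplus>\<^bsub>F\<^esub> r') = ev m r \<oplus>\<^bsub>M\<^esub> ev m r'" if r: "r \<in> carrier F" "r' \<in> carrier F" for m r r'
  proof (induction m)
    case (Suc m)
    have "t (r \<oplus>\<^bsub>F\<^esub> r') m = t r m \<oplus>\<^bsub>M\<^esub> t r' m"
      unfolding t_def ops using M.smult_l_distr cR r eM by auto
    then show ?case using Suc evM[OF r(1)] evM[OF r(2)] by (simp add: ev M.M.a_ac)
  qed (simp add: ev)
  have ev_smult: "ev m (a \<odot>\<^bsub>F\<^esub> r) = a \<odot>\<^bsub>M\<^esub> ev m r" if r: "r \<in> carrier F" "a \<in> carrier R" for m r a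
  proof (induction m)
    case 0 then show ?case using M.submoduleD(4)[OF M.submodule_zero r(2)] by (simp add: ev)
  next
    case (Suc m)
    have "t (a \<odot>\<^bsub>F\<^esub> r) m = a \<odot>\<^bsub>M\<^esub> t r m"
      unfolding t_def ops using M.smult_assoc1 cR r eM M.submoduleD(4)[OF M.submodule_zero r(2)] by auto
    then show ?case using Suc evM[OF r(1)] r(2) by (simp add: ev M.smult_r_distr)
  qed
  define tr where "tr m r = (\<lambda>i. if i < m then r i else \<zero>\<^bsub>R\<^esub>)" for m :: nat and r :: "nat \<Rightarrow> _"
  have trF: "tr m r \<in> carrier F" if "r \<in> carrier F" for m r
  proof -
    have "finite {i. tr m r i \<noteq> \<zero>\<^bsub>R\<^esub>}" by (rule finite_subset[of _ "{..<m}"]) (auto simp: tr_def)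
    then show ?thesis using that unfolding mem by (auto simp: tr_def)
  qed
  have \<phi>ev: "\<phi> (ev m r) = h (tr m r)" if r: "r \<in> carrier F" for m r
  proof (induction m)
    case 0
    have "\<phi> \<zero>\<^bsub>M\<^esub> = \<zero>\<^bsub>C\<^esub>" using \<phi>'(4) Ud(2) Ld(2) by blast
    moreover have "tr 0 r = \<zero>\<^bsub>F\<^esub>" by (simp add: tr_def ops)
    ultimately show ?case using h0 by (simp add: ev)
  next
    case (Suc m)
    have ts: "tr (Suc m) r = tr m r \<oplus>\<^bsub>F\<^esub> (if m \<in> I then r m \<odot>\<^bsub>F\<^esub> \<delta> m else \<zero>\<^bsub>F\<^esub>)"
      using r mem[of r] cR[OF r] by (auto simp: tr_def ops \<delta>_def less_Suc_eq)
    have "\<phi> (ev (Suc m) r) = \<phi> (ev m r) \<oplus>\<^bsub>C\<^esub> \<phi> (t r m)"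
      using \<phi>'(2) evE[OF r] tE[OF r] sEU by (simp add: ev subset_iff)
    also have "\<phi> (t r m) = h (if m \<in> I then r m \<odot>\<^bsub>F\<^esub> \<delta> m else \<zero>\<^bsub>F\<^esub>)"
      unfolding t_def using \<phi>'(3) e cR[OF r] h(2)[OF \<delta> \<delta>] h0 \<phi>'(4)[OF Ud(2)] Ld(2) by simp
    also have "\<phi> (ev m r) \<oplus>\<^bsub>C\<^esub> \<dots> = h (tr (Suc m) r)"
      unfolding ts Suc
      by (rule h(1)[symmetric, OF trF[OF r]]) (use F.smult_closed cR[OF r] \<delta> in auto)
    finally show ?case .
  qed
  have bnd: "\<exists>m. \<forall>i\<ge>m. r i = \<zero>\<^bsub>R\<^esub>" if "r \<in> carrier F" for r
  proof -
    have "finite {i. r i \<noteq> \<zero>\<^bsub>R\<^esub>}" using that mem by blast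
    then obtain m where "\<forall>i\<in>{i. r i \<noteq> \<zero>\<^bsub>R\<^esub>}. i < m" using finite_nat_set_iff_bounded by blast
    then show ?thesis by (metis leD mem_Collect_eq)
  qed
  have ev_stable: "ev m' r = ev m r" if "r \<in> carrier F" "\<forall>i\<ge>m. r i = \<zero>\<^bsub>R\<^esub>" "m \<le> m'" for r m m'
    using that(3)
  proof (induction m' rule: dec_induct)
    case (step n)
    then have "t r n = \<zero>\<^bsub>M\<^esub>" unfolding t_def using that(2) M.smult_l_zero eM by auto
    then show ?case using step evM[OF that(1)] by (simp add: ev)
  qed simp
  \<comment> \<open>All bounds beyond the support give the same partial sum, so the chosen bound can
    be exchanged for one common to several elements.\<close>
  define v where "v r = ev (SOME m. \<forall>i\<ge>m. r i = \<zero>\<^bsub>R\<^esub>) r" for r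
  have v: "v r = ev m r" if "r \<in> carrier F" "\<forall>i\<ge>m. r i = \<zero>\<^bsub>R\<^esub>" for r m
  proof -
    let ?m = "SOME m. \<forall>i\<ge>m. r i = \<zero>\<^bsub>R\<^esub>"
    have z: "\<forall>i\<ge>?m. r i = \<zero>\<^bsub>R\<^esub>" using someI_ex[OF bnd[OF that(1)]] .
    have "ev (max ?m m) r = ev ?m r" by (rule ev_stable[OF that(1) z]) simp
    moreover have "ev (max ?m m) r = ev m r" by (rule ev_stable[OF that]) simp
    ultimately show ?thesis unfolding v_def by simp
  qed
  have v_add: "v (r \<oplus>\<^bsub>F\<^esub> r') = v r \<oplus>\<^bsub>M\<^esub> v r'" if r: "r \<in> carrier F" "r' \<in> carrier F" for r r'
  proof -
    obtain m m' where m: "\<forall>i\<ge>m. r i = \<zero>\<^bsub>R\<^esub>" "\<forall>i\<ge>m'. r' i = \<zero>\<^bsub>R\<^esub>" using bnd r by metis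
    then have "v r = ev (max m m') r" "v r' = ev (max m m') r'"
      by (intro v r; simp)+
    moreover have "v (r \<oplus>\<^bsub>F\<^esub> r') = ev (max m m') (r \<oplus>\<^bsub>F\<^esub> r')"
      by (rule v) (use r m F.M.a_closed in \<open>auto simp: ops\<close>)
    ultimately show ?thesis using ev_add[OF r] by simp
  qed
  have v_smult: "v (a \<odot>\<^bsub>F\<^esub> r) = a \<odot>\<^bsub>M\<^esub> v r" if r: "r \<in> carrier F" "a \<in> carrier R" for r a
  proof -
    obtain m where m: "\<forall>i\<ge>m. r i = \<zero>\<^bsub>R\<^esub>" using bnd r by metis
    then have "v r = ev m r" using v r by simp
    moreover have "v (a \<odot>\<^bsub>F\<^esub> r) = ev m (a \<odot>\<^bsub>F\<^esub> r)"
      by (rule v) (use r m F.smult_closed in \<open>auto simp: ops\<close>)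
    ultimately show ?thesis using ev_smult[OF r] by simp
  qed
  have vE: "v r \<in> span R M ?E" if "r \<in> carrier F" for r using evE[OF that] by (simp add: v_def)
  have vU: "v r \<in> U" if "r \<in> carrier F" for r using vE[OF that] sEU by blast
  have \<phi>v: "\<phi> (v r) = h r" if r: "r \<in> carrier F" for r
  proof -
    obtain m where m: "\<forall>i\<ge>m. r i = \<zero>\<^bsub>R\<^esub>" using bnd r by metis
    then have "tr m r = r" by (auto simp: tr_def)
    then show ?thesis using v[OF r m] \<phi>ev[OF r, of m] by simp
  qed
  have v0: "v \<zero>\<^bsub>F\<^esub> = \<zero>\<^bsub>M\<^esub>"
    using v_smult[of "\<zero>\<^bsub>F\<^esub>" "\<zero>\<^bsub>R\<^esub>"] F.smult_l_zero[of "\<zero>\<^bsub>F\<^esub>"]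
      M.smult_l_zero[OF subsetD[OF sE(1) vE[OF F.M.zero_closed]]] by simp
  have vimg: "submodule (v ` carrier F) R M"
  proof (rule M.submoduleI)
    show "v ` carrier F \<subseteq> carrier M" using vE sE(1) by blast
    show "\<zero>\<^bsub>M\<^esub> \<in> v ` carrier F" using v0 F.M.zero_closed by (metis imageI)
    show "x \<oplus>\<^bsub>M\<^esub> y \<in> v ` carrier F" if xy: "x \<in> v ` carrier F" "y \<in> v ` carrier F" for x y
    proof -
      obtain r r' where "r \<in> carrier F" "r' \<in> carrier F" "x = v r" "y = v r'" using xy by blast
      then show ?thesis using v_add[of r r', symmetric] F.M.a_closed by simp
    qed
    show "a \<odot>\<^bsub>M\<^esub> x \<in> v ` carrier F" if ax: "a \<in> carrier R" "x \<in> v ` carrier F" for a x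
    proof -
      obtain r where "r \<in> carrier F" "x = v r" using ax by blast
      then show ?thesis using v_smult[of r a, symmetric] F.smult_closed ax(1) by simp
    qed
  qed
  have "e n \<in> v ` carrier F" if n: "n \<in> I" for n
  proof -
    have "ev n (\<delta> n) = \<zero>\<^bsub>M\<^esub>"
    proof -
      have "t (\<delta> n) m = \<zero>\<^bsub>M\<^esub>" if "m < n" for m
        unfolding t_def \<delta>_def using that M.smult_l_zero eM by auto
      then have "ev m (\<delta> n) = \<zero>\<^bsub>M\<^esub>" if "m \<le> n" for m
        using that by (induction m) (auto simp: ev)
      then show ?thesis by simp
    qed
    then have "ev (Suc n) (\<delta> n) = e n"
      using n M.smult_one[OF eM[OF n]] eM[OF n] by (simp add: ev t_def \<delta>_def)
    moreover have "v (\<delta> n) = ev (Suc n) (\<delta> n)" by (rule v[OF \<delta>[OF n]]) (simp add: \<delta>_def)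
    ultimately show ?thesis using \<delta>[OF n] by (metis imageI)
  qed
  then have sEv: "span R M ?E \<subseteq> v ` carrier F" by (intro M.span_least[OF vimg]) blast
  have KF: "K \<subseteq> carrier F" using IK(1) F_def by simp
  have vKM: "v ` K \<subseteq> carrier M" using KF vE sE(1) by blast
  note sK = M.submoduleD[OF M.submodule_span[OF vKM]]
  have "submodule {r \<in> carrier F. v r \<in> span R M (v ` K)} R F"
    by (rule F.submoduleI) (use sK v0 v_add v_smult F.smult_closed in auto)
  then have kerK: "span R F K \<subseteq> {r \<in> carrier F. v r \<in> span R M (v ` K)}"
    using KF M.span_superset[of "v ` K"] by (intro F.span_least) auto
  have ker: "{r \<in> carrier F. h r = \<zero>\<^bsub>C\<^esub>} = span R F K" using IK(5) F_def by simp
  show ?thesis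
  proof (intro exI conjI ballI)
    show "countable ?E" "countable (v ` K)" using IK(2) by auto
    show "?E \<subseteq> U" by (rule EU)
    show "v ` K \<subseteq> L"
    proof
      fix z assume "z \<in> v ` K"
      then obtain r where r: "r \<in> K" "z = v r" by blast
      then have "h r = \<zero>\<^bsub>C\<^esub>" using ker F.span_superset[of K] by blast
      then show "z \<in> L" using \<phi>v[of r] \<phi>'(4)[OF vU[of r]] r KF by auto
    qed
    show "\<exists>l\<in>L. z \<ominus>\<^bsub>M\<^esub> l \<in> span R M ?E" if z: "z \<in> U" for z
    proof -
      obtain r where r: "r \<in> carrier F" "h r = \<phi> z" using IK(4) \<phi>'(1) z F_def by (metis imageE imageI)
      have "\<phi> (z \<ominus>\<^bsub>M\<^esub> v r) = \<phi> z \<ominus>\<^bsub>C\<^esub> \<phi> (v r)" by (rule quot_iso_minus[OF M C U \<phi> z vU[OF r(1)]])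
      also have "\<dots> = \<zero>\<^bsub>C\<^esub>" using \<phi>v[OF r(1)] r h(3)[OF r(1) r(1)] by (simp add: a_minus_def C.M.r_neg)
      finally have l: "z \<ominus>\<^bsub>M\<^esub> v r \<in> L" using \<phi>'(4)[OF Ud(6)[OF z vU[OF r(1)]]] by blast
      have zM: "z \<in> carrier M" "v r \<in> carrier M" using z vU[OF r(1)] Ud(1) by auto
      have "z \<ominus>\<^bsub>M\<^esub> (z \<ominus>\<^bsub>M\<^esub> v r) = v r"
        using zM by (simp add: a_minus_def M.M.minus_add M.M.r_neg1 M.M.r_neg2 M.M.minus_minus)
      then show ?thesis using l vE[OF r(1)] by metis
    qed
    show "span R M ?E \<inter> L \<subseteq> span R M (v ` K)"
    proof
      fix w assume w: "w \<in> span R M ?E \<inter> L"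
      then obtain r where r: "r \<in> carrier F" "w = v r" using sEv by blast
      then have "h r = \<zero>\<^bsub>C\<^esub>" using \<phi>v[OF r(1)] \<phi>'(4)[OF vU[OF r(1)]] w by auto
      then show "w \<in> span R M (v ` K)" using r ker kerK by blast
    qed
  qed
qed

lemma (in left_module) minus_eq_zeroD:
  assumes "x \<ominus>\<^bsub>M\<^esub> y = \<zero>\<^bsub>M\<^esub>" "x \<in> carrier M" "y \<in> carrier M"
  shows "x = y"
proof -
  have "x = (x \<ominus>\<^bsub>M\<^esub> y) \<oplus>\<^bsub>M\<^esub> y" using assms(2,3) by (simp add: a_minus_def M.a_assoc M.l_neg)
  then show ?thesis using assms by simp
qed

section \<open>The Hill lemma\<close>

text \<open>
  A filtration of the submodule \<open>N\<close>, indexed by the nonzero elements of \<open>N\<close> instead of ordinals: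
  \<open>U x\<close> is the first member of the filtration that contains \<open>x\<close>, and \<open>L x\<close> is its predecessor.
\<close>

definition indexed_filtration ::
    "'v::zfc ring \<Rightarrow> ('v, 'v) module set \<Rightarrow> ('v, 'v) module \<Rightarrow> 'v set \<Rightarrow> ('v \<Rightarrow> 'v set) \<Rightarrow> ('v \<Rightarrow> 'v set) \<Rightarrow> bool"
  where "indexed_filtration R \<C> M N L U \<longleftrightarrow>
    (\<forall>x \<in> N - {\<zero>\<^bsub>M\<^esub>}. submodule (L x) R M \<and> submodule (U x) R M \<and> L x \<subseteq> U x \<and> U x \<subseteq> N \<and>
       x \<in> U x \<and> x \<notin> L x \<and> (\<exists>C \<in> \<C>. \<exists>\<phi>. quot_iso R M (U x) (L x) C \<phi>)) \<and>
    (\<forall>x \<in> N - {\<zero>\<^bsub>M\<^esub>}. \<forall>y \<in> N - {\<zero>\<^bsub>M\<^esub>}. (y \<in> L x \<longrightarrow> U y \<subseteq> L x) \<and>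
       (y \<in> U x \<longrightarrow> y \<notin> L x \<longrightarrow> U y = U x \<and> L y = L x) \<and> (y \<notin> U x \<longrightarrow> x \<in> L y)) \<and>
    wf {(y, x). x \<in> N - {\<zero>\<^bsub>M\<^esub>} \<and> y \<in> N - {\<zero>\<^bsub>M\<^esub>} \<and> y \<in> L x}"

text \<open>For the step from \<open>L x\<close> to \<open>U x\<close>: \<open>E x\<close> generates
  it modulo \<open>L x\<close>, the span of \<open>K x\<close> covers the part of the span of
  \<open>E x\<close> inside \<open>L x\<close>, and \<open>k x\<close> is the component of x in
  \<open>L x\<close>. By \<open>E_eq\<close> the generators depend on the step only, so a closed set
  with one nonzero element of a step outside its lower member contains generators of the whole
  step.\<close>

locale hill = left_module R M
  for R :: "'v::zfc ring" and M :: "('v, 'v) module" +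
  fixes \<C> :: "('v, 'v) module set" and N :: "'v set" and L U E K :: "'v \<Rightarrow> 'v set" and k :: "'v \<Rightarrow> 'v"
  assumes filt: "indexed_filtration R \<C> M N L U"
    and \<C>: "\<And>C. C \<in> \<C> \<Longrightarrow> left_module R C"
    and subN: "submodule N R M"
    and EU: "\<And>x. x \<in> N - {\<zero>\<^bsub>M\<^esub>} \<Longrightarrow> E x \<subseteq> U x"
    and KL: "\<And>x. x \<in> N - {\<zero>\<^bsub>M\<^esub>} \<Longrightarrow> K x \<subseteq> L x"
    and kL: "\<And>x. x \<in> N - {\<zero>\<^bsub>M\<^esub>} \<Longrightarrow> k x \<in> L x"
    and kE: "\<And>x. x \<in> N - {\<zero>\<^bsub>M\<^esub>} \<Longrightarrow> x \<ominus>\<^bsub>M\<^esub> k x \<in> span R M (E x)"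
    and EK: "\<And>x. x \<in> N - {\<zero>\<^bsub>M\<^esub>} \<Longrightarrow> span R M (E x) \<inter> L x \<subseteq> span R M (K x)"
    and E_eq: "\<And>x y. U x = U y \<Longrightarrow> L x = L y \<Longrightarrow> E x = E y"
begin

abbreviation N0 where "N0 \<equiv> N - {\<zero>\<^bsub>M\<^esub>}"

lemma LU:
  assumes "x \<in> N0"
  shows "submodule (L x) R M" "submodule (U x) R M" "L x \<subseteq> U x" "U x \<subseteq> N" "x \<in> U x" "x \<notin> L x"
    "\<exists>C \<in> \<C>. \<exists>\<phi>. quot_iso R M (U x) (L x) C \<phi>"
  using filt assms unfolding indexed_filtration_def by blast+

lemma LU_cases:
  assumes "x \<in> N0" "y \<in> N0"
  shows "y \<in> L x \<Longrightarrow> U y \<subseteq> L x" "y \<in> U x \<Longrightarrow> y \<notin> L x \<Longrightarrow> U y = U x \<and> L y = L x" "y \<notin> U x \<Longrightarrow> x \<in> L y"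
  using filt assms unfolding indexed_filtration_def by blast+

lemma U_sub: "x \<in> N0 \<Longrightarrow> y \<in> N0 \<Longrightarrow> y \<in> U x \<Longrightarrow> U y \<subseteq> U x"
  using LU_cases[of x y] LU(3)[of x] by blast

lemma U_linear: "x \<in> N0 \<Longrightarrow> y \<in> N0 \<Longrightarrow> U x \<subseteq> U y \<or> U y \<subseteq> U x"
  using U_sub[of x y] LU_cases(3)[of x y] LU(3)[of y] U_sub[of y x] by blast

lemma filt_induct [consumes 1, case_names step]:
  assumes "x \<in> N0" "\<And>x. x \<in> N0 \<Longrightarrow> (\<And>y. y \<in> N0 \<Longrightarrow> y \<in> L x \<Longrightarrow> \<phi> y) \<Longrightarrow> \<phi> x"
  shows "\<phi> x"
proof -
  have "wf {(y, x). x \<in> N0 \<and> y \<in> N0 \<and> y \<in> L x}" using filt unfolding indexed_filtration_def by blast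
  from wf_induct_rule[OF this, of "\<lambda>x. x \<in> N0 \<longrightarrow> \<phi> x" x] show ?thesis using assms by blast
qed

definition closed :: "'v set \<Rightarrow> bool"
  where "closed a \<longleftrightarrow> a \<subseteq> N \<and> (\<forall>x \<in> a - {\<zero>\<^bsub>M\<^esub>}. E x \<subseteq> a \<and> K x \<subseteq> a \<and> k x \<in> a)"

lemma diff_swap:
  assumes M: "u \<in> carrier M" "v \<in> carrier M" "u' \<in> carrier M" "v' \<in> carrier M"
    and eq: "u \<oplus>\<^bsub>M\<^esub> v = u' \<oplus>\<^bsub>M\<^esub> v'"
  shows "v' \<ominus>\<^bsub>M\<^esub> v = u \<ominus>\<^bsub>M\<^esub> u'"
proof -
  have "v' = \<ominus>\<^bsub>M\<^esub> u' \<oplus>\<^bsub>M\<^esub> (u' \<oplus>\<^bsub>M\<^esub> v')" using M by (simp add: M.r_neg1)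
  also have "\<dots> = \<ominus>\<^bsub>M\<^esub> u' \<oplus>\<^bsub>M\<^esub> (u \<oplus>\<^bsub>M\<^esub> v)" by (simp only: eq)
  finally have "v' \<ominus>\<^bsub>M\<^esub> v = \<ominus>\<^bsub>M\<^esub> u' \<oplus>\<^bsub>M\<^esub> (u \<oplus>\<^bsub>M\<^esub> v) \<ominus>\<^bsub>M\<^esub> v" by simp
  also have "\<dots> = u \<oplus>\<^bsub>M\<^esub> \<ominus>\<^bsub>M\<^esub> u' \<oplus>\<^bsub>M\<^esub> (v \<oplus>\<^bsub>M\<^esub> \<ominus>\<^bsub>M\<^esub> v)" using M(1-3) by (simp add: a_minus_def M.a_ac del: M.r_neg)
  also have "\<dots> = u \<ominus>\<^bsub>M\<^esub> u'" using M(1-3) by (simp add: a_minus_def M.r_neg)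
  finally show ?thesis .
qed

lemma NM: "N \<subseteq> carrier M" using submoduleD(1)[OF subN] .

text \<open>Rebuilds x from its component in \<open>L x\<close> and the generators of its
  step.\<close>

lemma span_decomp:
  assumes "x \<in> N0" "X \<subseteq> carrier M" "k x \<in> span R M X" "E x \<subseteq> span R M X"
  shows "x \<in> span R M X"
proof -
  note D = submoduleD[OF submodule_span[OF assms(2)]]
  have "x \<ominus>\<^bsub>M\<^esub> k x \<in> span R M X"
    using kE[OF assms(1)] span_least[OF submodule_span[OF assms(2)] assms(4)] by blast
  then have "(x \<ominus>\<^bsub>M\<^esub> k x) \<oplus>\<^bsub>M\<^esub> k x \<in> span R M X" using D(3) assms(3) by blast
  moreover have "x \<in> carrier M" "k x \<in> carrier M" using assms(1) NM D(1) assms(3) by auto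
  then have "(x \<ominus>\<^bsub>M\<^esub> k x) \<oplus>\<^bsub>M\<^esub> k x = x" by (simp add: a_minus_def M.a_assoc M.l_neg)
  ultimately show ?thesis by simp
qed

text \<open>If a meets the step at z in some y, the span of a inside \<open>U z\<close> is generated
  by the part of a in \<open>L z\<close> and by \<open>E y\<close>. What the span of
  \<open>E y\<close> contributes to \<open>L z\<close> is spanned by \<open>K y\<close>, which a
  contains. This is where the relations enter.\<close>

lemma hill0:
  assumes a: "closed a" and z: "z \<in> N0"
  shows "span R M (a \<inter> U z) \<inter> L z \<subseteq> span R M (a \<inter> L z)"
proof (cases "a \<inter> U z \<subseteq> L z")
  case True
  then show ?thesis using span_mono[of "a \<inter> U z" "a \<inter> L z"] by blast
next
  case False
  then obtain y where y: "y \<in> a" "y \<in> U z" "y \<notin> L z" by blast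
  have aN: "a \<subseteq> N" using a by (simp add: closed_def)
  have y0: "y \<in> N0" using y aN submoduleD(2)[OF LU(1)[OF z]] by blast
  have yz: "U y = U z" "L y = L z" using LU_cases(2)[OF z y0 y(2,3)] by auto
  have Ey: "E y \<subseteq> a \<inter> U z" and Ky: "K y \<subseteq> a \<inter> L z"
    using a y(1) y0 EU[OF y0] KL[OF y0] yz unfolding closed_def by auto
  have aLM: "a \<inter> L z \<subseteq> carrier M" using aN NM by blast
  have EM: "E y \<subseteq> carrier M" using Ey aN NM by blast
  note AL = submodule_span[OF aLM] and SE = submodule_span[OF EM]
  let ?S = "{l \<oplus>\<^bsub>M\<^esub> e |l e. l \<in> span R M (a \<inter> L z) \<and> e \<in> span R M (E y)}"
  have "a \<inter> U z \<subseteq> span R M ((a \<inter> L z) \<union> E y)"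
  proof
    fix u assume u: "u \<in> a \<inter> U z"
    show "u \<in> span R M ((a \<inter> L z) \<union> E y)"
    proof (cases "u \<in> L z")
      case True then show ?thesis using u by (intro span_base) blast
    next
      case False
      then have u0: "u \<in> N0" using u aN submoduleD(2)[OF LU(1)[OF z]] by blast
      have uz: "U u = U z" "L u = L z" using LU_cases(2)[OF z u0] u False by auto
      show ?thesis
      proof (rule span_decomp[OF u0])
        show "(a \<inter> L z) \<union> E y \<subseteq> carrier M" using aLM EM by blast
        have "k u \<in> a \<inter> L z" using a u u0 kL[OF u0] uz unfolding closed_def by auto
        then show "k u \<in> span R M ((a \<inter> L z) \<union> E y)" by (intro span_base) blast
        show "E u \<subseteq> span R M ((a \<inter> L z) \<union> E y)" using E_eq[of u y] uz yz span_superset[of "(a \<inter> L z) \<union> E y"] by auto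
      qed
    qed
  qed
  then have sub: "span R M (a \<inter> U z) \<subseteq> ?S"
    unfolding span_Un[OF aLM EM, symmetric] using aLM EM by (intro span_least submodule_span) auto
  show ?thesis
  proof
    fix w assume w: "w \<in> span R M (a \<inter> U z) \<inter> L z"
    then obtain l e where le: "w = l \<oplus>\<^bsub>M\<^esub> e" "l \<in> span R M (a \<inter> L z)" "e \<in> span R M (E y)" using sub by blast
    have lL: "l \<in> L z" using le(2) span_least[OF LU(1)[OF z], of "a \<inter> L z"] by blast
    have M: "l \<in> carrier M" "e \<in> carrier M" using le submoduleD(1)[OF AL] submoduleD(1)[OF SE] by auto
    have "w \<ominus>\<^bsub>M\<^esub> l \<in> L z" using submoduleD(6)[OF LU(1)[OF z]] w lL by blast
    moreover have "w \<ominus>\<^bsub>M\<^esub> l = e" using M le(1) by (simp add: a_minus_def M.a_ac M.r_neg1 M.r_neg2 M.r_neg)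
    ultimately have "e \<in> span R M (K y)" using EK[OF y0] le(3) yz by blast
    then have "e \<in> span R M (a \<inter> L z)" using span_mono[OF Ky] by blast
    then show "w \<in> span R M (a \<inter> L z)" using le submoduleD(3)[OF AL] by blast
  qed
qed

text \<open>The sets \<open>U z\<close> form a chain, so the span over an initial segment T is the
  union of the spans over the \<open>U z\<close> inside it. An element of the span is thus supported
  below a single z.\<close>

lemma span_directed:
  assumes a: "a \<subseteq> N" and T: "\<And>z. z \<in> T - {\<zero>\<^bsub>M\<^esub>} \<Longrightarrow> U z \<subseteq> T" and w: "w \<in> span R M (a \<inter> T)"
  shows "w = \<zero>\<^bsub>M\<^esub> \<or> (\<exists>z \<in> a \<inter> T - {\<zero>\<^bsub>M\<^esub>}. w \<in> span R M (a \<inter> U z))"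
proof (cases "a \<inter> T - {\<zero>\<^bsub>M\<^esub>} = {}")
  case True
  then have "span R M (a \<inter> T) \<subseteq> {\<zero>\<^bsub>M\<^esub>}" by (intro span_least submodule_zero) blast
  then show ?thesis using w by blast
next
  case False
  let ?I = "a \<inter> T - {\<zero>\<^bsub>M\<^esub>}"
  have I: "z \<in> N0" if "z \<in> ?I" for z using that a by blast
  have sub: "submodule (span R M (a \<inter> U z)) R M" for z using a NM by (intro submodule_span) blast
  have "submodule (\<Union>z\<in>?I. span R M (a \<inter> U z)) R M"
  proof (rule submodule_Union_chain[OF False sub])
    fix i j assume "i \<in> ?I" "j \<in> ?I"
    then have "U i \<subseteq> U j \<or> U j \<subseteq> U i" using U_linear I by blast
    then show "span R M (a \<inter> U i) \<subseteq> span R M (a \<inter> U j) \<or> span R M (a \<inter> U j) \<subseteq> span R M (a \<inter> U i)"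
      using span_mono[of "a \<inter> U i" "a \<inter> U j"] span_mono[of "a \<inter> U j" "a \<inter> U i"] by blast
  qed
  moreover have "a \<inter> T \<subseteq> (\<Union>z\<in>?I. span R M (a \<inter> U z))"
  proof
    fix z assume z: "z \<in> a \<inter> T"
    show "z \<in> (\<Union>z\<in>?I. span R M (a \<inter> U z))"
    proof (cases "z = \<zero>\<^bsub>M\<^esub>")
      case True
      then show ?thesis using False submoduleD(2)[OF sub] by blast
    next
      case False
      then have "z \<in> a \<inter> U z" using LU(5)[of z] z a by blast
      then show ?thesis using span_superset[of "a \<inter> U z"] z False by blast
    qed
  qed
  ultimately have "span R M (a \<inter> T) \<subseteq> (\<Union>z\<in>?I. span R M (a \<inter> U z))" by (rule span_least)
  then show ?thesis using w by blast
qed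

text \<open>Descend along the well-founded order. If w lies in \<open>U x\<close> and is supported
  below some z outside \<open>U x\<close>, then w is in \<open>L z\<close>, and \<open>hill0\<close>
  moves its support below a smaller index.\<close>

lemma hill1:
  assumes a: "closed a" and x: "x \<in> N0"
  shows "span R M a \<inter> U x \<subseteq> span R M (a \<inter> U x)"
proof
  have aN: "a \<subseteq> N" using a by (simp add: closed_def)
  have sx: "submodule (span R M (a \<inter> U x)) R M" using aN NM by (intro submodule_span) blast
  have *: "w \<in> span R M (a \<inter> U x)" if "z \<in> N0" "w \<in> span R M (a \<inter> U z)" "w \<in> U x" for z w
    using that
  proof (induction z rule: filt_induct)
    case (step z)
    show ?case
    proof (cases "z \<in> U x")
      case True
      then have "U z \<subseteq> U x" using U_sub x step by blast
      then show ?thesis using span_mono[of "a \<inter> U z" "a \<inter> U x"] step.prems by blast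
    next
      case False
      then have "x \<in> L z" using LU_cases(3)[OF x step.hyps] by blast
      then have "w \<in> L z" using LU_cases(1)[OF step.hyps x] step.prems by blast
      then have "w \<in> span R M (a \<inter> L z)" using hill0[OF a step.hyps] step.prems by blast
      moreover have "U y \<subseteq> L z" if "y \<in> L z - {\<zero>\<^bsub>M\<^esub>}" for y
        using LU_cases(1)[OF step.hyps, of y] that LU(3,4)[OF step.hyps] by blast
      ultimately have "w = \<zero>\<^bsub>M\<^esub> \<or> (\<exists>y \<in> a \<inter> L z - {\<zero>\<^bsub>M\<^esub>}. w \<in> span R M (a \<inter> U y))"
        using span_directed[OF aN] by blast
      then show ?thesis using step.IH step.prems aN submoduleD(2)[OF sx] by blast
    qed
  qed
  fix w assume w: "w \<in> span R M a \<inter> U x"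
  have "a \<inter> N = a" using aN by blast
  then have "w = \<zero>\<^bsub>M\<^esub> \<or> (\<exists>z \<in> a \<inter> N - {\<zero>\<^bsub>M\<^esub>}. w \<in> span R M (a \<inter> U z))"
    using span_directed[OF aN, of N w] w LU(4) by auto
  then show "w \<in> span R M (a \<inter> U x)" using * w submoduleD(2)[OF sx] by blast
qed

text \<open>A dichotomy. If a already meets the step at x, it contains the generators and the span
  does not grow. Otherwise the span of a meets \<open>U x\<close> only inside \<open>L x\<close>,
  and the added step is isomorphic to the quotient of \<open>U x\<close> by \<open>L x\<close>, a
  member of \<C> up to isomorphism.\<close>

lemma hill_step:
  assumes a: "closed a" and b: "closed b" "a \<subseteq> b" and x: "x \<in> b" "x \<noteq> \<zero>\<^bsub>M\<^esub>"
  shows "fext R \<C> M (span R M (a \<union> (b \<inter> L x))) (span R M (a \<union> (b \<inter> U x)))"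
proof -
  have aN: "a \<subseteq> N" and bN: "b \<subseteq> N" using a b by (auto simp: closed_def)
  have x0: "x \<in> N0" using x bN by blast
  note Lx = LU(1)[OF x0] and Ux = LU(2)[OF x0]
  have M: "a \<subseteq> carrier M" "b \<inter> L x \<subseteq> carrier M" "b \<inter> U x \<subseteq> carrier M" using aN bN NM by auto
  have sXM: "a \<union> (b \<inter> L x) \<subseteq> carrier M" "a \<union> (b \<inter> U x) \<subseteq> carrier M" using M by auto
  have XY: "span R M (a \<union> (b \<inter> L x)) \<subseteq> span R M (a \<union> (b \<inter> U x))" using LU(3)[OF x0] by (intro span_mono) blast
  show ?thesis
  proof (cases "a \<inter> U x \<subseteq> L x")
    case False
    then obtain y where y: "y \<in> a" "y \<in> U x" "y \<notin> L x" by blast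
    have y0: "y \<in> N0" using y aN submoduleD(2)[OF Lx] by blast
    have yx: "U y = U x" "L y = L x" using LU_cases(2)[OF x0 y0 y(2,3)] by auto
    have "u \<in> span R M (a \<union> (b \<inter> L x))" if u: "u \<in> b" "u \<in> U x" for u
    proof (cases "u \<in> L x")
      case True then show ?thesis using u by (intro span_base) blast
    next
      case False
      then have u0: "u \<in> N0" using u bN submoduleD(2)[OF Lx] by blast
      have ux: "U u = U x" "L u = L x" using LU_cases(2)[OF x0 u0 u(2) False] by auto
      show ?thesis
      proof (rule span_decomp[OF u0 sXM(1)])
        have "k u \<in> b \<inter> L x" using b u u0 kL[OF u0] ux unfolding closed_def by auto
        then show "k u \<in> span R M (a \<union> (b \<inter> L x))" by (intro span_base) blast
        have "E u = E y" by (rule E_eq) (simp_all add: ux yx)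
        also have "\<dots> \<subseteq> a" using a y(1) y0 unfolding closed_def by auto
        finally show "E u \<subseteq> span R M (a \<union> (b \<inter> L x))" using span_superset[of "a \<union> (b \<inter> L x)"] by blast
      qed
    qed
    then have "a \<union> (b \<inter> U x) \<subseteq> span R M (a \<union> (b \<inter> L x))" using span_superset[of "a \<union> (b \<inter> L x)"] by blast
    then have "span R M (a \<union> (b \<inter> U x)) = span R M (a \<union> (b \<inter> L x))"
      using XY span_least[OF submodule_span[OF sXM(1)]] by blast
    then show ?thesis using fext_refl by simp
  next
    case True
    obtain C \<phi> where C: "C \<in> \<C>" and \<phi>: "quot_iso R M (U x) (L x) C \<phi>" using LU(7)[OF x0] by blast
    interpret C: left_module R C using \<C>[OF C] .
    have \<phi>': "\<phi> ` U x = carrier C" "\<And>y z. y \<in> U x \<Longrightarrow> z \<in> U x \<Longrightarrow> \<phi> (y \<oplus>\<^bsub>M\<^esub> z) = \<phi> y \<oplus>\<^bsub>C\<^esub> \<phi> z"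
      "\<And>c y. c \<in> carrier R \<Longrightarrow> y \<in> U x \<Longrightarrow> \<phi> (c \<odot>\<^bsub>M\<^esub> y) = c \<odot>\<^bsub>C\<^esub> \<phi> y" "\<And>y. y \<in> U x \<Longrightarrow> \<phi> y = \<zero>\<^bsub>C\<^esub> \<longleftrightarrow> y \<in> L x"
      using \<phi> unfolding quot_iso_def by blast+
    define A B B0 where "A = span R M a" and "B = span R M (b \<inter> U x)" and "B0 = span R M (b \<inter> L x)"
    note sA = submodule_span[OF M(1), folded A_def] and sB = submodule_span[OF M(3), folded B_def]
      and sB0 = submodule_span[OF M(2), folded B0_def]
    note A = submoduleD[OF sA] and B = submoduleD[OF sB] and B0 = submoduleD[OF sB0]
    have BU: "B \<subseteq> U x" unfolding B_def by (rule span_least[OF Ux]) blast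
    have B0L: "B0 \<subseteq> L x" unfolding B0_def by (rule span_least[OF Lx]) blast
    have B0B: "B0 \<subseteq> B" unfolding B_def B0_def using LU(3)[OF x0] by (intro span_mono) blast
    have AU: "A \<inter> U x \<subseteq> L x"
      using hill1[OF a x0] True span_least[OF Lx, of "a \<inter> U x"] unfolding A_def by blast
    have BL: "B \<inter> L x \<subseteq> B0" using hill0[OF b(1) x0] unfolding B_def B0_def .
    define X Y where "X = span R M (a \<union> (b \<inter> L x))" and "Y = span R M (a \<union> (b \<inter> U x))"
    have X: "X = {u \<oplus>\<^bsub>M\<^esub> v |u v. u \<in> A \<and> v \<in> B0}" unfolding X_def A_def B0_def by (rule span_Un[OF M(1,2)])
    have Y: "Y = {u \<oplus>\<^bsub>M\<^esub> v |u v. u \<in> A \<and> v \<in> B}" unfolding Y_def A_def B_def by (rule span_Un[OF M(1,3)])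
    \<comment> \<open>Project the sum A + B to its second component and apply \<phi>. Two
      decompositions differ by an element of A in \<open>U x\<close>, hence in \<open>L x\<close>,
      where \<phi> vanishes.\<close>
    define \<psi> where "\<psi> w = \<phi> (SOME v. v \<in> B \<and> (\<exists>u \<in> A. w = u \<oplus>\<^bsub>M\<^esub> v))" for w
    have val: "\<psi> (u \<oplus>\<^bsub>M\<^esub> v) = \<phi> v" if uv: "u \<in> A" "v \<in> B" for u v
    proof -
      let ?v = "SOME v'. v' \<in> B \<and> (\<exists>u' \<in> A. u \<oplus>\<^bsub>M\<^esub> v = u' \<oplus>\<^bsub>M\<^esub> v')"
      have "?v \<in> B \<and> (\<exists>u' \<in> A. u \<oplus>\<^bsub>M\<^esub> v = u' \<oplus>\<^bsub>M\<^esub> ?v)" by (rule someI[of _ v]) (use uv in blast)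
      then obtain u' where u': "?v \<in> B" "u' \<in> A" "u \<oplus>\<^bsub>M\<^esub> v = u' \<oplus>\<^bsub>M\<^esub> ?v" by blast
      have cM: "u \<in> carrier M" "v \<in> carrier M" "u' \<in> carrier M" "?v \<in> carrier M" using uv u' A(1) B(1) by auto
      have "?v \<ominus>\<^bsub>M\<^esub> v = u \<ominus>\<^bsub>M\<^esub> u'" by (rule diff_swap[OF cM u'(3)])
      moreover have "u \<ominus>\<^bsub>M\<^esub> u' \<in> A" using A(6) uv u' by blast
      moreover have "?v \<ominus>\<^bsub>M\<^esub> v \<in> U x" using B(6)[OF u'(1) uv(2)] BU by blast
      ultimately have "?v \<ominus>\<^bsub>M\<^esub> v \<in> L x" using AU by auto
      then have "\<phi> (?v \<ominus>\<^bsub>M\<^esub> v) = \<zero>\<^bsub>C\<^esub>" using \<phi>'(4) \<open>?v \<ominus>\<^bsub>M\<^esub> v \<in> U x\<close> by blast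
      moreover have "\<phi> (?v \<ominus>\<^bsub>M\<^esub> v) = \<phi> ?v \<ominus>\<^bsub>C\<^esub> \<phi> v"
        using quot_iso_minus[OF left_module_axioms C.left_module_axioms Ux \<phi>] u'(1) uv(2) BU by blast
      moreover have "\<phi> ?v \<in> carrier C" "\<phi> v \<in> carrier C" using \<phi>'(1) u'(1) uv(2) BU by auto
      ultimately have "\<phi> ?v = \<phi> v" using C.minus_eq_zeroD by simp
      then show ?thesis unfolding \<psi>_def .
    qed
    have "quot_iso R M Y X C \<psi>"
      unfolding quot_iso_def
    proof (intro conjI ballI)
      show "\<psi> ` Y = carrier C"
      proof
        show "\<psi> ` Y \<subseteq> carrier C" unfolding Y using val \<phi>'(1) BU by (auto simp: image_iff subset_iff) (metis image_eqI)
        show "carrier C \<subseteq> \<psi> ` Y"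
        proof
          \<comment> \<open>A nonzero class of \<open>U x\<close> modulo \<open>L x\<close> has a
            representative in the span of \<open>E x\<close>, and \<open>E x\<close> is contained in
            b because x is an element of b.\<close>
          fix c assume "c \<in> carrier C"
          then obtain z where z: "z \<in> U x" "c = \<phi> z" using \<phi>'(1) by blast
          show "c \<in> \<psi> ` Y"
          proof (cases "z \<in> L x")
            case True
            then have "c = \<phi> \<zero>\<^bsub>M\<^esub>" using z \<phi>'(4)[OF z(1)] \<phi>'(4)[OF submoduleD(2)[OF Ux]] submoduleD(2)[OF Lx] by simp
            then have "c = \<psi> (\<zero>\<^bsub>M\<^esub> \<oplus>\<^bsub>M\<^esub> \<zero>\<^bsub>M\<^esub>)" using val[OF A(2) B(2)] by simp
            then show ?thesis unfolding Y using A(2) B(2) by blast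
          next
            case False
            then have z0: "z \<in> N0" using z LU(4)[OF x0] submoduleD(2)[OF Lx] by blast
            have zx: "U z = U x" "L z = L x" using LU_cases(2)[OF x0 z0 z(1) False] by auto
            have Ez: "E z \<subseteq> b \<inter> U x" using E_eq[of z x] zx EU[OF x0] b(1) x unfolding closed_def by auto
            have e: "z \<ominus>\<^bsub>M\<^esub> k z \<in> B" using kE[OF z0] span_mono[OF Ez] unfolding B_def by blast
            have kz: "k z \<in> L x" "k z \<in> U x" using kL[OF z0] zx LU(3)[OF x0] by auto
            have "\<phi> (z \<ominus>\<^bsub>M\<^esub> k z) = \<phi> z \<ominus>\<^bsub>C\<^esub> \<phi> (k z)"
              using quot_iso_minus[OF left_module_axioms C.left_module_axioms Ux \<phi> z(1) kz(2)] .
            also have "\<dots> = \<phi> z"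
              using \<phi>'(4)[OF kz(2)] kz(1) imageI[OF z(1), of \<phi>] \<phi>'(1) by (simp add: a_minus_def)
            finally have "c = \<psi> (\<zero>\<^bsub>M\<^esub> \<oplus>\<^bsub>M\<^esub> (z \<ominus>\<^bsub>M\<^esub> k z))" using val[OF A(2) e] z(2) by simp
            then show ?thesis unfolding Y using A(2) e by blast
          qed
        qed
      qed
    next
      fix y z assume "y \<in> Y" "z \<in> Y"
      then obtain u v u' v' where *: "y = u \<oplus>\<^bsub>M\<^esub> v" "z = u' \<oplus>\<^bsub>M\<^esub> v'" "u \<in> A" "v \<in> B" "u' \<in> A" "v' \<in> B"
        unfolding Y by blast
      then have "u \<in> carrier M" "v \<in> carrier M" "u' \<in> carrier M" "v' \<in> carrier M" using A(1) B(1) by auto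
      then have "y \<oplus>\<^bsub>M\<^esub> z = (u \<oplus>\<^bsub>M\<^esub> u') \<oplus>\<^bsub>M\<^esub> (v \<oplus>\<^bsub>M\<^esub> v')" using * by (simp add: M.a_ac)
      moreover have "v \<in> U x" "v' \<in> U x" using * BU by auto
      ultimately show "\<psi> (y \<oplus>\<^bsub>M\<^esub> z) = \<psi> y \<oplus>\<^bsub>C\<^esub> \<psi> z"
        using * val[OF A(3)[OF *(3,5)] B(3)[OF *(4,6)]] val \<phi>'(2) by simp
    next
      fix c y assume c: "c \<in> carrier R" and "y \<in> Y"
      then obtain u v where *: "y = u \<oplus>\<^bsub>M\<^esub> v" "u \<in> A" "v \<in> B" unfolding Y by blast
      then have "u \<in> carrier M" "v \<in> carrier M" using A(1) B(1) by auto
      then have "c \<odot>\<^bsub>M\<^esub> y = c \<odot>\<^bsub>M\<^esub> u \<oplus>\<^bsub>M\<^esub> c \<odot>\<^bsub>M\<^esub> v" using * c smult_r_distr by simp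
      then show "\<psi> (c \<odot>\<^bsub>M\<^esub> y) = c \<odot>\<^bsub>C\<^esub> \<psi> y"
        using * val[OF A(4)[OF c *(2)] B(4)[OF c *(3)]] val \<phi>'(3)[OF c] BU by auto
    next
      fix y assume "y \<in> Y"
      then obtain u v where *: "y = u \<oplus>\<^bsub>M\<^esub> v" "u \<in> A" "v \<in> B" unfolding Y by blast
      have \<psi>y: "\<psi> y = \<phi> v" using val * by simp
      show "\<psi> y = \<zero>\<^bsub>C\<^esub> \<longleftrightarrow> y \<in> X"
      proof
        assume "\<psi> y = \<zero>\<^bsub>C\<^esub>"
        then have "v \<in> L x" using \<psi>y \<phi>'(4)[of v] *(3) BU by auto
        then show "y \<in> X" unfolding X using * BL by blast
      next
        assume "y \<in> X"
        then obtain u' v' where "y = u' \<oplus>\<^bsub>M\<^esub> v'" "u' \<in> A" "v' \<in> B0" unfolding X by blast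
        then have "\<psi> y = \<phi> v'" "v' \<in> L x" "v' \<in> U x" using val[of u' v'] B0B B0L BU by auto
        then show "\<psi> y = \<zero>\<^bsub>C\<^esub>" using \<phi>'(4) by simp
      qed
    qed
    then have "fext R \<C> M X Y"
      by (rule fext_step[OF C]) (use submodule_span[OF sXM(2)] XY in \<open>simp_all add: X_def Y_def\<close>)
    then show ?thesis unfolding X_def Y_def .
  qed
qed

lemma closed_U: "closed b \<Longrightarrow> x \<in> N0 \<Longrightarrow> closed (b \<inter> U x)"
  unfolding closed_def
proof (intro conjI ballI)
  assume b: "b \<subseteq> N \<and> (\<forall>x\<in>b - {\<zero>\<^bsub>M\<^esub>}. E x \<subseteq> b \<and> K x \<subseteq> b \<and> k x \<in> b)" and x: "x \<in> N0"
  then show "b \<inter> U x \<subseteq> N" by blast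
  fix y assume y: "y \<in> b \<inter> U x - {\<zero>\<^bsub>M\<^esub>}"
  then have y0: "y \<in> N0" using b by blast
  have "U y \<subseteq> U x" using U_sub[OF x y0] y by blast
  then show "E y \<subseteq> b \<inter> U x" "K y \<subseteq> b \<inter> U x" "k y \<in> b \<inter> U x"
    using b y EU[OF y0] KL[OF y0] kL[OF y0] LU(3)[OF y0] by blast+
qed

lemma closed_Un: "closed a \<Longrightarrow> closed b \<Longrightarrow> closed (a \<union> b)"
  unfolding closed_def by blast

text \<open>T is an initial segment of the filtration. Since b is countable, \<omega> many of the
  sets \<open>U z\<close> cover b inside T, up to zero, and the extensions along them are composed
  by \<open>fext_limit\<close>.\<close>

lemma hill_limit:
  assumes T: "\<And>z. z \<in> T - {\<zero>\<^bsub>M\<^esub>} \<Longrightarrow> U z \<subseteq> T"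
    and IH: "\<And>z a. z \<in> b \<inter> T - {\<zero>\<^bsub>M\<^esub>} \<Longrightarrow> closed a \<Longrightarrow> a \<subseteq> b \<Longrightarrow>
      fext R \<C> M (span R M a) (span R M (a \<union> (b \<inter> U z)))"
    and b: "closed b" "countable b" and a: "closed a" "a \<subseteq> b"
  shows "fext R \<C> M (span R M a) (span R M (a \<union> (b \<inter> T)))"
proof -
  have aN: "a \<subseteq> N" and bN: "b \<subseteq> N" using a b by (auto simp: closed_def)
  show ?thesis
  proof (cases "b \<inter> T - {\<zero>\<^bsub>M\<^esub>} = {}")
    case True
    have sa: "submodule (span R M a) R M" using aN NM by (intro submodule_span) blast
    have "a \<union> (b \<inter> T) \<subseteq> span R M a" using True submoduleD(2)[OF sa] span_superset[of a] by blast
    then have "span R M (a \<union> (b \<inter> T)) = span R M a"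
      using span_least[OF sa, of "a \<union> (b \<inter> T)"] span_mono[of a "a \<union> (b \<inter> T)"] by blast
    then show ?thesis using fext_refl by simp
  next
    case False
    let ?I = "b \<inter> T - {\<zero>\<^bsub>M\<^esub>}"
    have I: "z \<in> N0" if "z \<in> ?I" for z using that bN by blast
    have "countable ?I" using b(2) by auto
    then obtain z :: "nat \<Rightarrow> 'v" where z: "?I = range z" using range_from_nat_into[OF False] by metis
    \<comment> \<open>The running maximum of the enumeration with respect to inclusion of U, so that
      the sets \<open>A n\<close> below increase.\<close>
    define y where "y = rec_nat (z 0) (\<lambda>n u. if U u \<subseteq> U (z (Suc n)) then z (Suc n) else u)"
    have y: "y 0 = z 0" "y (Suc n) = (if U (y n) \<subseteq> U (z (Suc n)) then z (Suc n) else y n)" for n by (simp_all add: y_def)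
    have zI: "z n \<in> ?I" for n using z by blast
    have yI: "y n \<in> ?I" for n by (induction n) (use y zI in auto)
    have ymono: "U (y n) \<subseteq> U (y (Suc n))" for n using y by simp
    have zy: "U (z n) \<subseteq> U (y n)" for n
    proof (cases n)
      case (Suc m)
      then show ?thesis using y U_linear[OF I[OF zI[of n]] I[OF yI[of m]]] by auto
    qed (simp add: y)
    define A where "A n = a \<union> (b \<inter> U (y n))" for n
    have clA: "closed (A n)" "A n \<subseteq> b" for n
      unfolding A_def using closed_Un[OF a(1) closed_U[OF b(1) I[OF yI]]] a(2) by auto
    have "fext R \<C> M (span R M (A n)) (span R M (A (Suc n)))" for n
    proof -
      have "A (Suc n) = A n \<union> (b \<inter> U (y (Suc n)))" unfolding A_def using ymono[of n] by blast
      then show ?thesis using IH[OF yI clA] by simp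
    qed
    from fext_limit[where X = "\<lambda>n. span R M (A n)", OF left_module_axioms this]
    have "fext R \<C> M (span R M (A 0)) (\<Union>n. span R M (A n))" .
    also have "(\<Union>n. span R M (A n)) = span R M (\<Union>n. A n)"
    proof (rule span_Union_chain[symmetric])
      show "A n \<subseteq> carrier M" for n using clA(2) bN NM by blast
      show "A n \<subseteq> A (Suc n)" for n unfolding A_def using ymono[of n] by blast
    qed
    also have "(\<Union>n. A n) = a \<union> (b \<inter> T)"
    proof
      show "(\<Union>n. A n) \<subseteq> a \<union> (b \<inter> T)" unfolding A_def using T yI by blast
      have "u \<in> (\<Union>n. A n)" if u: "u \<in> b \<inter> T" for u
      proof (cases "u = \<zero>\<^bsub>M\<^esub>")
        case True
        then show ?thesis unfolding A_def using submoduleD(2)[OF LU(2)[OF I[OF yI]]] u by blast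
      next
        case False
        then obtain n where n: "u = z n" using u z by blast
        then have "u \<in> U (y n)" using zy[of n] LU(5)[OF I[OF zI[of n]]] by blast
        then show ?thesis unfolding A_def using u by blast
      qed
      then show "a \<union> (b \<inter> T) \<subseteq> (\<Union>n. A n)" unfolding A_def by blast
    qed
    finally have "fext R \<C> M (span R M (A 0)) (span R M (a \<union> (b \<inter> T)))" .
    moreover have "fext R \<C> M (span R M a) (span R M (A 0))" unfolding A_def using IH[OF yI a] .
    ultimately show ?thesis using fext_trans by blast
  qed
qed

text \<open>Induction along the filtration: the part of b in \<open>L x\<close> is added by
  \<open>hill_limit\<close>, then the step at x by \<open>hill_step\<close>. A last use of
  \<open>hill_limit\<close> with N as initial segment reaches all of b.\<close>

lemma hill_fext:
  assumes a: "closed a" "a \<subseteq> b" and b: "closed b" "countable b"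
  shows "fext R \<C> M (span R M a) (span R M b)"
proof -
  have bN: "b \<subseteq> N" using b by (auto simp: closed_def)
  have *: "fext R \<C> M (span R M a) (span R M (a \<union> (b \<inter> U x)))"
    if "x \<in> N0" "x \<in> b" "closed a" "a \<subseteq> b" for x a
    using that
  proof (induction x arbitrary: a rule: filt_induct)
    case (step x)
    have "fext R \<C> M (span R M a) (span R M (a \<union> (b \<inter> L x)))"
    proof (rule hill_limit[OF _ _ b step.prems(2,3)])
      show "U z \<subseteq> L x" if "z \<in> L x - {\<zero>\<^bsub>M\<^esub>}" for z
        using LU_cases(1)[OF step.hyps, of z] that LU(3,4)[OF step.hyps] by blast
      show "fext R \<C> M (span R M a') (span R M (a' \<union> (b \<inter> U z)))"
        if "z \<in> b \<inter> L x - {\<zero>\<^bsub>M\<^esub>}" "closed a'" "a' \<subseteq> b" for z a'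
        using step.IH[of z a'] that bN by blast
    qed
    then show ?case using hill_step[OF step.prems(2) b(1) step.prems(3,1)] step.hyps fext_trans by blast
  qed
  have "fext R \<C> M (span R M a) (span R M (a \<union> (b \<inter> N)))"
    by (rule hill_limit[OF _ _ b a]) (use LU(4) bN * in auto)
  moreover have "a \<union> (b \<inter> N) = b" using a bN by blast
  ultimately show ?thesis by simp
qed

end

text \<open>Closure under a countable-valued function is a club condition on countable subsets of N.
  In this form the result can be confronted with a reflected stationary set.\<close>

lemma hill_lemma:
  fixes R :: "'v::zfc ring" and M :: "('v, 'v) module"
  assumes M: "left_module R M" and filt: "indexed_filtration R \<C> M N L U" and N: "submodule N R M"
    and \<C>: "\<And>C. C \<in> \<C> \<Longrightarrow> left_module R C \<and> countably_presented R C"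
  shows "\<exists>F. (\<forall>x \<in> N. countable (F x) \<and> F x \<subseteq> N) \<and>
    (\<forall>a b. a \<subseteq> b \<longrightarrow> b \<subseteq> N \<longrightarrow> countable b \<longrightarrow> (\<forall>x \<in> a. F x \<subseteq> a) \<longrightarrow> (\<forall>x \<in> b. F x \<subseteq> b) \<longrightarrow>
      fext R \<C> M (span R M a) (span R M b))"
proof -
  interpret M: left_module R M by fact
  let ?N0 = "N - {\<zero>\<^bsub>M\<^esub>}"
  let ?EK = "\<lambda>L U (E, K). countable E \<and> countable K \<and> E \<subseteq> U \<and> K \<subseteq> L \<and>
    (\<forall>z \<in> U. \<exists>l \<in> L. z \<ominus>\<^bsub>M\<^esub> l \<in> span R M E) \<and> span R M E \<inter> L \<subseteq> span R M K"
  \<comment> \<open>Generators and relations are chosen from the pair of submodules rather than from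
    x, which is what yields \<open>E_eq\<close>.\<close>
  define EK where "EK L U = (SOME p. ?EK L U p)" for L U
  have fd: "submodule (L x) R M" "submodule (U x) R M" "L x \<subseteq> U x" "U x \<subseteq> N" "x \<in> U x"
    "\<exists>C \<in> \<C>. \<exists>\<phi>. quot_iso R M (U x) (L x) C \<phi>" if "x \<in> ?N0" for x
    using filt that unfolding indexed_filtration_def by blast+
  have "?EK (L x) (U x) (EK (L x) (U x))" if x: "x \<in> ?N0" for x
  proof -
    obtain C \<phi> where C: "C \<in> \<C>" "quot_iso R M (U x) (L x) C \<phi>" using fd(6)[OF x] by blast
    then have "\<exists>E K. ?EK (L x) (U x) (E, K)"
      using countably_presented_quotient[OF M _ _ fd(2)[OF x] fd(1)[OF x] fd(3)[OF x] C(2)] \<C>[OF C(1)] by simp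
    then have "\<exists>p. ?EK (L x) (U x) p" by blast
    then show ?thesis unfolding EK_def by (rule someI_ex)
  qed
  then have EKp: "countable (fst (EK (L x) (U x)))" "countable (snd (EK (L x) (U x)))" "fst (EK (L x) (U x)) \<subseteq> U x"
    "snd (EK (L x) (U x)) \<subseteq> L x" "\<forall>z \<in> U x. \<exists>l \<in> L x. z \<ominus>\<^bsub>M\<^esub> l \<in> span R M (fst (EK (L x) (U x)))"
    "span R M (fst (EK (L x) (U x))) \<inter> L x \<subseteq> span R M (snd (EK (L x) (U x)))" if "x \<in> ?N0" for x
    using that by (auto simp: case_prod_unfold)
  have "\<forall>x \<in> ?N0. \<exists>l. l \<in> L x \<and> x \<ominus>\<^bsub>M\<^esub> l \<in> span R M (fst (EK (L x) (U x)))" using EKp(5) fd(5) by blast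
  then obtain k where k: "\<And>x. x \<in> ?N0 \<Longrightarrow> k x \<in> L x \<and> x \<ominus>\<^bsub>M\<^esub> k x \<in> span R M (fst (EK (L x) (U x)))" by metis
  interpret hill R M \<C> N L U "\<lambda>x. fst (EK (L x) (U x))" "\<lambda>x. snd (EK (L x) (U x))" k
  proof (rule hill.intro[OF M], rule hill_axioms.intro)
    show "left_module R C" if "C \<in> \<C>" for C using \<C>[OF that] by blast
    show "k x \<in> L x" "x \<ominus>\<^bsub>M\<^esub> k x \<in> span R M (fst (EK (L x) (U x)))" if "x \<in> ?N0" for x
      using k[OF that] by blast+
    show "fst (EK (L x) (U x)) = fst (EK (L y) (U y))" if "U x = U y" "L x = L y" for x y using that by simp
  qed (fact filt N | rule EKp(3,4,6), assumption)+
  define F where "F x = (if x = \<zero>\<^bsub>M\<^esub> then {} else fst (EK (L x) (U x)) \<union> snd (EK (L x) (U x)) \<union> {k x})" for x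
  have "closed a" if "a \<subseteq> N" "\<forall>x \<in> a. F x \<subseteq> a" for a
  proof -
    have "fst (EK (L x) (U x)) \<union> snd (EK (L x) (U x)) \<union> {k x} \<subseteq> a" if "x \<in> a - {\<zero>\<^bsub>M\<^esub>}" for x
      using bspec[OF \<open>\<forall>x \<in> a. F x \<subseteq> a\<close>, of x] that unfolding F_def by simp
    then show ?thesis using \<open>a \<subseteq> N\<close> unfolding closed_def by simp
  qed
  then have 1: "fext R \<C> M (span R M a) (span R M b)"
    if "a \<subseteq> b" "b \<subseteq> N" "countable b" "\<forall>x \<in> a. F x \<subseteq> a" "\<forall>x \<in> b. F x \<subseteq> b" for a b
    using that by (intro hill_fext) auto
  have 2: "countable (F x) \<and> F x \<subseteq> N" if x: "x \<in> N" for x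
  proof (cases "x = \<zero>\<^bsub>M\<^esub>")
    case False
    then have "x \<in> ?N0" using x by blast
    note EKx = EKp(1-4)[OF this] and kx = k[OF this] and fx = fd(3,4)[OF this]
    have "F x \<subseteq> U x" unfolding F_def using EKx kx fx by auto
    then show ?thesis using fx EKx unfolding F_def by auto
  qed (simp add: F_def)
  show ?thesis by (rule exI[of _ F]) (use 1 2 in simp)
qed

section \<open>Generic sequences of length \<open>\<omega>\<^sub>1\<close>\<close>

context forcing_poset
begin

lemma fallD: "(\<^bold>\<forall>\<tau>. \<Phi> \<tau>) p \<Longrightarrow> \<Phi> \<tau> p"
  by (simp add: fall_def)

lemma fimpD: "(\<phi> \<^bold>\<longrightarrow> \<psi>) p \<Longrightarrow> fstable \<phi> \<Longrightarrow> fstable \<psi> \<Longrightarrow> q \<preceq> p \<Longrightarrow> \<phi> q \<Longrightarrow> \<psi> q"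
  by (simp add: fimp_iff)

lemma fiffD: "(\<phi> \<^bold>\<longleftrightarrow> \<psi>) p \<Longrightarrow> fstable \<phi> \<Longrightarrow> fstable \<psi> \<Longrightarrow> q \<preceq> p \<Longrightarrow> \<phi> q \<longleftrightarrow> \<psi> q"
  by (simp add: fiff_iff)

text \<open>Running minima of an enumeration give a decreasing \<omega>-sequence coinitial in the
  chain, to which \<sigma>-closure applies.\<close>

lemma countable_chain_lower_bound:
  assumes sc: "sigma_closed P r" and B: "countable B" "B \<noteq> {}" "B \<subseteq> P"
    and chain: "\<And>b c. b \<in> B \<Longrightarrow> c \<in> B \<Longrightarrow> b \<preceq> c \<or> c \<preceq> b"
  shows "\<exists>q \<in> P. \<forall>b \<in> B. q \<preceq> b"
proof -
  define \<beta> where "\<beta> = from_nat_into B"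
  have \<beta>: "range \<beta> = B" unfolding \<beta>_def using range_from_nat_into[OF B(2,1)] .
  define c where "c = rec_nat (\<beta> 0) (\<lambda>n u. if \<beta> (Suc n) \<preceq> u then \<beta> (Suc n) else u)"
  have c: "c 0 = \<beta> 0" "c (Suc n) = (if \<beta> (Suc n) \<preceq> c n then \<beta> (Suc n) else c n)" for n by (simp_all add: c_def)
  have cB: "c n \<in> B" for n by (induction n) (use c \<beta> in auto)
  have "c (Suc n) \<preceq> c n" for n using c(2)[of n] cB[of n] B(3) by auto
  then obtain q where q: "q \<in> P" "\<And>n. q \<preceq> c n" using sc cB B(3) unfolding sigma_closed_def by (metis subsetD)
  have "c n \<preceq> \<beta> n" for n
  proof (cases n)
    case 0 then show ?thesis using c(1) cB[of 0] B(3) by auto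
  next
    case (Suc m)
    have "\<beta> (Suc m) \<in> P" using \<beta> B(3) by blast
    then show ?thesis using Suc c(2)[of m] chain[OF cB[of m], of "\<beta> (Suc m)"] \<beta> by auto
  qed
  then have "q \<preceq> \<beta> n" for n using q(2) le_trans by blast
  then show ?thesis using q(1) \<beta> by blast
qed

lemma meet_countably_many:
  assumes sc: "sigma_closed P r" and q0: "q0 \<in> P" and T: "countable T"
    and dense: "\<And>d q. d \<in> T \<Longrightarrow> q \<preceq> q0 \<Longrightarrow> \<exists>q'. q' \<preceq> q \<and> d q'"
    and opn: "\<And>d q q'. d \<in> T \<Longrightarrow> d q \<Longrightarrow> q' \<preceq> q \<Longrightarrow> d q'"
  shows "\<exists>q. q \<preceq> q0 \<and> (\<forall>d \<in> T. d q)"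
proof (cases "T = {}")
  case True
  then show ?thesis using q0 le_refl by blast
next
  case False
  define d where "d = from_nat_into T"
  have d: "range d = T" unfolding d_def using range_from_nat_into[OF False T] .
  define c where "c = rec_nat q0 (\<lambda>n u. SOME q. q \<preceq> u \<and> d n q)"
  have c: "c 0 = q0" "c (Suc n) = (SOME q. q \<preceq> c n \<and> d n q)" for n by (simp_all add: c_def)
  have step: "c (Suc n) \<preceq> c n \<and> d n (c (Suc n))" if "c n \<preceq> q0" for n
    unfolding c(2) by (rule someI_ex) (use dense[of "d n"] d that in blast)
  have c0: "c n \<preceq> q0" for n
  proof (induction n)
    case (Suc n) then show ?case using step[OF Suc] le_trans by blast
  qed (simp add: c q0)
  then obtain q where q: "q \<in> P" "\<And>n. q \<preceq> c n"
    using sc step le_P unfolding sigma_closed_def by metis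
  have "d n q" for n using opn[of "d n" "c (Suc n)" q] step[OF c0] q(2) d by blast
  then show ?thesis using q(2)[of 0] c(1) d by auto
qed

text \<open>A requirement \<open>D q t\<close> may depend on a condition q already in the chain,
  because later decisions refer to names chosen from q. At stage \<alpha> the countably many
  requirements with both parameters below \<alpha> are met at once.\<close>

lemma omega1_generic:
  fixes D :: "'v \<Rightarrow> 't \<Rightarrow> 'v \<Rightarrow> bool"
  assumes sc: "sigma_closed P r" and p0: "p0 \<in> P" and T: "|T| \<le>o aleph1" "T \<noteq> {}"
    and dense: "\<And>q t q'. q \<preceq> p0 \<Longrightarrow> t \<in> T \<Longrightarrow> q' \<preceq> q \<Longrightarrow> \<exists>q''. q'' \<preceq> q' \<and> D q t q''"
    and opn: "\<And>q t q' q''. t \<in> T \<Longrightarrow> D q t q' \<Longrightarrow> q'' \<preceq> q' \<Longrightarrow> D q t q''"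
  shows "\<exists>g. (\<forall>q \<in> g. q \<preceq> p0) \<and> (\<forall>B \<subseteq> g. countable B \<longrightarrow> (\<exists>q \<in> g. \<forall>b \<in> B. q \<preceq> b)) \<and>
    (\<forall>q \<in> g. \<forall>t \<in> T. \<exists>q' \<in> g. D q t q')"
proof -
  obtain \<tau> :: "'v \<Rightarrow> 't" where \<tau>: "\<tau> ` omega1 = T" using enumerate_aleph1[OF T] by blast
  define \<Phi> where "\<Phi> f \<alpha> q \<longleftrightarrow> q \<preceq> p0 \<and> (\<forall>\<beta>\<in>elts \<alpha>. q \<preceq> f \<beta>) \<and> (\<forall>\<beta>\<in>elts \<alpha>. \<forall>\<gamma>\<in>elts \<alpha>. D (f \<beta>) (\<tau> \<gamma>) q)"
    for f :: "'v \<Rightarrow> 'v" and \<alpha> q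
  define p where "p = wfrec {(x, y). x \<in> elts y} (\<lambda>f \<alpha>. SOME q. \<Phi> f \<alpha> q)"
  have p: "p \<alpha> = (SOME q. \<Phi> p \<alpha> q)" for \<alpha>
  proof -
    have "p \<alpha> = (SOME q. \<Phi> (cut p {(x, y). x \<in> elts y} \<alpha>) \<alpha> q)"
      by (rule def_wfrec[OF _ wf_elts]) (simp add: p_def)
    moreover have "\<Phi> (cut p {(x, y). x \<in> elts y} \<alpha>) \<alpha> = \<Phi> p \<alpha>"
    proof -
      have "cut p {(x, y). x \<in> elts y} \<alpha> \<beta> = p \<beta>" if "\<beta> \<in> elts \<alpha>" for \<beta> using that by (simp add: cut_apply)
      then show ?thesis unfolding \<Phi>_def by (intro ext) simp
    qed
    ultimately show ?thesis by simp
  qed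
  have \<Phi>: "\<Phi> p \<alpha> (p \<alpha>)" if "\<alpha> \<in> omega1" for \<alpha>
    using that
  proof (induction \<alpha> rule: elts_induct)
    case (step \<alpha>)
    have cnt: "countable (elts \<alpha>)" and O: "Ord \<alpha>" using step.prems by (auto simp: omega1_def)
    have IH: "\<Phi> p \<beta> (p \<beta>)" if "\<beta> \<in> elts \<alpha>" for \<beta> using step.IH[OF that omega1_small_elts[OF step.prems that]] .
    let ?B = "insert p0 (p ` elts \<alpha>)"
    have "\<exists>q \<in> P. \<forall>b \<in> ?B. q \<preceq> b"
    proof (rule countable_chain_lower_bound[OF sc])
      show "?B \<subseteq> P" using p0 IH le_P unfolding \<Phi>_def by blast
      have *: "p \<beta> \<preceq> p \<gamma> \<or> p \<gamma> \<preceq> p \<beta>" if "\<beta> \<in> elts \<alpha>" "\<gamma> \<in> elts \<alpha>" for \<beta> \<gamma>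
      proof -
        have "\<beta> \<in> elts \<gamma> \<or> \<beta> = \<gamma> \<or> \<gamma> \<in> elts \<beta>" using Ord_linear Ord_in_Ord[OF O] that by blast
        then show ?thesis using IH[OF that(1)] IH[OF that(2)] le_P le_refl unfolding \<Phi>_def by blast
      qed
      show "b \<preceq> c \<or> c \<preceq> b" if "b \<in> ?B" "c \<in> ?B" for b c
        using that * IH p0 le_refl unfolding \<Phi>_def by auto
    qed (use cnt in auto)
    then obtain q0 where q0: "q0 \<in> P" "\<And>b. b \<in> ?B \<Longrightarrow> q0 \<preceq> b" by blast
    let ?T = "(\<lambda>(\<beta>, \<gamma>). D (p \<beta>) (\<tau> \<gamma>)) ` (elts \<alpha> \<times> elts \<alpha>)"
    have t: "\<tau> \<gamma> \<in> T" if "\<gamma> \<in> elts \<alpha>" for \<gamma> using \<tau> omega1_small_elts[OF step.prems that] by blast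
    have "\<exists>q. q \<preceq> q0 \<and> (\<forall>d \<in> ?T. d q)"
    proof (rule meet_countably_many[OF sc q0(1)])
      show "countable ?T" using cnt by blast
      fix d q assume "d \<in> ?T" "q \<preceq> q0"
      then obtain \<beta> \<gamma> where bg: "d = D (p \<beta>) (\<tau> \<gamma>)" "\<beta> \<in> elts \<alpha>" "\<gamma> \<in> elts \<alpha>" by auto
      have "q0 \<preceq> p \<beta>" "p \<beta> \<preceq> p0" using q0(2) bg(2) IH[OF bg(2)] unfolding \<Phi>_def by blast+
      then show "\<exists>q'. q' \<preceq> q \<and> d q'" using dense[OF _ t[OF bg(3)] le_trans[OF \<open>q \<preceq> q0\<close>]] bg(1) by blast
    next
      fix d q q' assume "d \<in> ?T" "d q" "q' \<preceq> q"
      then show "d q'" using opn t by (auto simp: case_prod_unfold)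
    qed
    then obtain q where q: "q \<preceq> q0" "\<forall>d \<in> ?T. d q" by blast
    have "\<Phi> p \<alpha> q" unfolding \<Phi>_def using q q0(2) le_trans[OF q(1)] by auto
    then show ?case unfolding p[of \<alpha>] by (rule someI)
  qed
  let ?g = "p ` omega1"
  have 1: "\<exists>q \<in> ?g. \<forall>b \<in> B. q \<preceq> b" if B: "B \<subseteq> ?g" "countable B" for B
  proof -
    obtain A where A: "A \<subseteq> omega1" "countable A" "B = p ` A" using B by (metis countable_subset_image)
    \<comment> \<open>A countable stage beyond all indices of B; its condition is below every member
      of B.\<close>
    let ?\<alpha> = "vset (\<Union>\<alpha>\<in>vsucc ` A. elts \<alpha>)"
    have "?\<alpha> \<in> omega1" using A omega1_vsucc by (intro omega1_Union) auto
    moreover have "elts ?\<alpha> = (\<Union>\<alpha>\<in>vsucc ` A. elts \<alpha>)"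
      by (rule elts_vset, rule small_UN_same, rule small_countable) (use A(2) in auto)
    then have "A \<subseteq> elts ?\<alpha>" by auto
    ultimately show ?thesis using \<Phi>[of ?\<alpha>] A(3) unfolding \<Phi>_def by blast
  qed
  have 2: "\<exists>q' \<in> ?g. D q t q'" if qt: "q \<in> ?g" "t \<in> T" for q t
  proof -
    obtain \<beta> \<gamma> where bg: "\<beta> \<in> omega1" "\<gamma> \<in> omega1" "q = p \<beta>" "t = \<tau> \<gamma>" using qt \<tau> by blast
    let ?\<alpha> = "vset (\<Union>\<alpha>\<in>vsucc ` {\<beta>, \<gamma>}. elts \<alpha>)"
    have "?\<alpha> \<in> omega1" using bg omega1_vsucc by (intro omega1_Union) auto
    moreover have "elts ?\<alpha> = (\<Union>\<alpha>\<in>vsucc ` {\<beta>, \<gamma>}. elts \<alpha>)"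
      by (rule elts_vset, rule small_UN_same, rule small_countable) auto
    then have "\<beta> \<in> elts ?\<alpha>" "\<gamma> \<in> elts ?\<alpha>" by auto
    ultimately show ?thesis using \<Phi>[of ?\<alpha>] bg(3,4) unfolding \<Phi>_def by blast
  qed
  have 3: "q \<preceq> p0" if "q \<in> ?g" for q using \<Phi> that unfolding \<Phi>_def by blast
  show ?thesis
    by (rule exI[of _ ?g], intro conjI allI ballI impI) (rule 3 1 2, assumption+)+
qed

section \<open>Ordinals in the extension\<close>

text \<open>Foundation in the extension, by induction on a name equal to the first term: the second
  term is forced by a stronger condition to equal a named element of it, and the shifted sequence
  contradicts the induction hypothesis there.\<close>

lemma no_infinite_descent:
  assumes "q \<in> P" "\<And>n :: nat. fmem (\<iota> (Suc n)) (\<iota> n) q"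
  shows False
proof -
  have "False" if "feq (\<iota> 0) \<sigma> q" "\<And>n :: nat. fmem (\<iota> (Suc n)) (\<iota> n) q" for \<sigma> \<iota> q
    using that
  proof (induction \<sigma> arbitrary: \<iota> q rule: name_induct)
    case (step \<sigma>)
    have q: "q \<in> P" using step.prems(1) feq_P by blast
    have "fmem (\<iota> (Suc 0)) \<sigma> q" using fcongD[OF fcong_fmem2 step.prems] .
    then obtain q' \<rho> t where *: "q' \<preceq> q" "opair \<rho> t \<in> elts \<sigma>" "feq (\<iota> (Suc 0)) \<rho> q'"
      using le_refl[OF q] unfolding fmem_def by blast
    show ?case
      by (rule step.IH[OF *(2), of "\<lambda>n. \<iota> (Suc n)" q']) (use * fmem_mono[OF step.prems(2)] in auto)
  qed
  from this[of \<iota> "\<iota> 0" q, OF feq_refl[OF assms(1)] assms(2)] show ?thesis .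
qed

lemma fsubsetD: "fsubset A B p \<Longrightarrow> fmem x A p \<Longrightarrow> p \<in> P \<Longrightarrow> fmem x B p"
  unfolding fsubset_def fall_def by (auto simp: fimp_iff stable_fmem)

lemma fsubset_refl: "p \<in> P \<Longrightarrow> fsubset A A p"
  unfolding fsubset_def by (intro fallI fimpI)

lemma feq_fsubset: "feq A B p \<Longrightarrow> fsubset A B p"
  using fcongD[OF fcong_derived(2)] fsubset_refl feq_P by blast

lemma ford_trans: "ford \<alpha> p \<Longrightarrow> fmem \<beta> \<alpha> p \<Longrightarrow> p \<in> P \<Longrightarrow> fsubset \<beta> \<alpha> p"
  unfolding ford_def fall_def fand_iff by (auto simp: fimp_iff stable_intros)

lemma ford_elem: "ford \<alpha> p \<Longrightarrow> fmem \<beta> \<alpha> p \<Longrightarrow> p \<in> P \<Longrightarrow> ford \<beta> p"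
proof -
  assume \<alpha>: "ford \<alpha> p" and \<beta>: "fmem \<beta> \<alpha> p" and p: "p \<in> P"
  have tr: "fsubset \<gamma> \<beta> q" if "q \<preceq> p" "fmem \<beta> \<alpha> q" "fmem \<gamma> \<beta> q" for \<beta> \<gamma> q
  proof -
    have "(\<^bold>\<forall>\<beta> \<gamma>. \<beta> \<^bold>\<in> \<alpha> \<^bold>\<and> \<gamma> \<^bold>\<in> \<beta> \<^bold>\<longrightarrow> fsubset \<gamma> \<beta>) p" using \<alpha> unfolding ford_def fand_iff by blast
    from fimpD[OF fallD[OF fallD[OF this]] _ _ \<open>q \<preceq> p\<close>] show ?thesis
      using that by (simp add: fand_iff stable_intros)
  qed
  show "ford \<beta> p"
    unfolding ford_def
  proof (intro fandI fallI fimpI)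
    show "fsubset \<gamma> \<beta> q" if "q \<preceq> p" "fmem \<gamma> \<beta> q" for \<gamma> q
      using tr[OF that(1) fmem_mono[OF \<beta> that(1)] that(2)] .
    show "fsubset \<delta> \<gamma> q" if "q \<preceq> p" "(fmem \<gamma> \<beta> \<^bold>\<and> fmem \<delta> \<gamma>) q" for \<gamma> \<delta> q
    proof -
      have q: "fmem \<gamma> \<beta> q" "fmem \<delta> \<gamma> q" using that(2) by (auto simp: fand_iff)
      have "fmem \<gamma> \<alpha> q"
        using fsubsetD[OF stable_mono[OF stable_derived(1) ford_trans[OF \<alpha> \<beta> p] that(1)] q(1) le_P(1)[OF that(1)]] .
      then show ?thesis using tr[OF that(1) _ q(2)] by blast
    qed
  qed
qed

definition ftri :: "'v \<Rightarrow> 'v \<Rightarrow> 'v \<Rightarrow> bool"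
  where "ftri \<alpha> \<beta> = (fmem \<alpha> \<beta> \<^bold>\<or> (feq \<alpha> \<beta> \<^bold>\<or> fmem \<beta> \<alpha>))"

lemma stable_ftri: "fstable (ftri \<alpha> \<beta>)"
  unfolding ftri_def by (intro stable_intros)

lemma ftriI: "fmem \<alpha> \<beta> p \<Longrightarrow> ftri \<alpha> \<beta> p" "feq \<alpha> \<beta> p \<Longrightarrow> ftri \<alpha> \<beta> p" "fmem \<beta> \<alpha> p \<Longrightarrow> ftri \<alpha> \<beta> p"
  unfolding ftri_def by (meson fdisjI1 fdisjI2 stable_fdisj stable_feq stable_fmem)+

lemma ftriE:
  assumes "ftri \<alpha> \<beta> p" "p \<in> P" "fstable \<chi>"
    "\<And>q. q \<preceq> p \<Longrightarrow> fmem \<alpha> \<beta> q \<Longrightarrow> \<chi> q" "\<And>q. q \<preceq> p \<Longrightarrow> feq \<alpha> \<beta> q \<Longrightarrow> \<chi> q" "\<And>q. q \<preceq> p \<Longrightarrow> fmem \<beta> \<alpha> q \<Longrightarrow> \<chi> q"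
  shows "\<chi> p"
proof (rule fdisjE[OF assms(1)[unfolded ftri_def] assms(2,3,4)])
  fix q assume q: "q \<preceq> p" "(feq \<alpha> \<beta> \<^bold>\<or> fmem \<beta> \<alpha>) q"
  show "\<chi> q" by (rule fdisjE[OF q(2) le_P(1)[OF q(1)] assms(3)]) (use assms(5,6) le_trans[OF _ q(1)] in blast)+
qed

text \<open>The nested induction of \<open>Ord_linear\<close>, now over names. If trichotomy is not
  forced, some stronger condition excludes all three alternatives for good, and below it the two
  names are forced to have the same elements.\<close>

lemma ford_linear: "p \<in> P \<Longrightarrow> ford \<alpha> p \<Longrightarrow> ford \<beta> p \<Longrightarrow> ftri \<alpha> \<beta> p"
proof (induction \<alpha> arbitrary: \<beta> p rule: name_induct)
  case (step \<alpha>)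
  note IH\<alpha> = step.IH
  from step.prems show ?case
  proof (induction \<beta> arbitrary: p rule: name_induct)
    case (step \<beta>)
    note IH\<beta> = step.IH and p = step.prems(1) and \<alpha> = step.prems(2) and \<beta> = step.prems(3)
    show ?case
    proof (rule ccontr)
      assume "\<not> ftri \<alpha> \<beta> p"
      then obtain q where q: "q \<preceq> p" "\<And>q'. q' \<preceq> q \<Longrightarrow> \<not> ftri \<alpha> \<beta> q'"
        using stable_dense[OF stable_ftri p] by blast
      have mono: "ford \<alpha> q'" "ford \<beta> q'" "q' \<in> P" if "q' \<preceq> q" for q'
        using stable_mono[OF stable_derived(4)] \<alpha> \<beta> le_trans[OF that q(1)] le_P by blast+
      have 1: "fmem \<pi> \<beta> q1" if \<pi>: "opair \<pi> s \<in> elts \<alpha>" "q1 \<preceq> q" "q1 \<preceq> s" for \<pi> s q1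
      proof -
        note m = mono[OF \<pi>(2)]
        have mem: "fmem \<pi> \<alpha> q1" using fmem_name \<pi> by blast
        have "ftri \<pi> \<beta> q1" by (rule IH\<alpha>[OF \<pi>(1) m(3) ford_elem[OF m(1) mem m(3)] m(2)])
        then show ?thesis
        proof (rule ftriE[OF _ m(3) stable_fmem])
          fix q2 assume q2: "q2 \<preceq> q1" "feq \<pi> \<beta> q2"
          then have "fmem \<beta> \<alpha> q2" using fcongD[OF fcong_fmem1 _ fmem_mono[OF mem]] by blast
          then show "fmem \<pi> \<beta> q2" using ftriI(3) q(2) le_trans[OF q2(1) \<pi>(2)] by blast
        next
          fix q2 assume q2: "q2 \<preceq> q1" "fmem \<beta> \<pi> q2"
          have "fsubset \<pi> \<alpha> q2" using ford_trans[OF m(1) mem m(3)] stable_mono[OF stable_derived(1) _ q2(1)] by blast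
          then have "fmem \<beta> \<alpha> q2" using fsubsetD q2 le_P by blast
          then show "fmem \<pi> \<beta> q2" using ftriI(3) q(2) le_trans[OF q2(1) \<pi>(2)] by blast
        qed
      qed
      have 2: "fmem \<pi> \<alpha> q1" if \<pi>: "opair \<pi> s \<in> elts \<beta>" "q1 \<preceq> q" "q1 \<preceq> s" for \<pi> s q1
      proof -
        note m = mono[OF \<pi>(2)]
        have mem: "fmem \<pi> \<beta> q1" using fmem_name \<pi> by blast
        have "ftri \<alpha> \<pi> q1" by (rule IH\<beta>[OF \<pi>(1) m(3,1) ford_elem[OF m(2) mem m(3)]])
        then show ?thesis
        proof (rule ftriE[OF _ m(3) stable_fmem])
          fix q2 assume q2: "q2 \<preceq> q1" "feq \<alpha> \<pi> q2"
          then have "fmem \<alpha> \<beta> q2" using fcongD[OF fcong_fmem1 feq_sym fmem_mono[OF mem]] by blast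
          then show "fmem \<pi> \<alpha> q2" using ftriI(1) q(2) le_trans[OF q2(1) \<pi>(2)] by blast
        next
          fix q2 assume q2: "q2 \<preceq> q1" "fmem \<alpha> \<pi> q2"
          have "fsubset \<pi> \<beta> q2" using ford_trans[OF m(2) mem m(3)] stable_mono[OF stable_derived(1) _ q2(1)] by blast
          then have "fmem \<alpha> \<beta> q2" using fsubsetD q2 le_P by blast
          then show "fmem \<pi> \<alpha> q2" using ftriI(1) q(2) le_trans[OF q2(1) \<pi>(2)] by blast
        qed
      qed
      have "feq \<alpha> \<beta> q" unfolding feq_fmem using 1 2 le_P[OF q(1)] by blast
      then show False using ftriI(2) q le_P le_refl by blast
    qed
  qed
qed

lemma fsuccD:
  assumes "fsucc j i p" "p \<in> P"
  shows "fmem i j p" "fmem u j p \<Longrightarrow> (fmem u i \<^bold>\<or> feq u i) p"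
proof -
  have *: "fmem u j p \<longleftrightarrow> (fmem u i \<^bold>\<or> feq u i) p" for u
    using assms unfolding fsucc_def fall_def by (simp add: fiff_iff stable_intros)
  show "fmem i j p" using * fdisjI2[OF stable_feq feq_refl[OF assms(2)]] by blast
  show "fmem u j p \<Longrightarrow> (fmem u i \<^bold>\<or> feq u i) p" using * by blast
qed

text \<open>The body of \<open>ffiltered\<close> without its two existential quantifiers, so that
  names \<eta> and f can be fixed once below a suitable condition.\<close>

definition ffiltration :: "'v ring \<Rightarrow> ('v, 'v) module set \<Rightarrow> ('v, 'v) module \<Rightarrow> 'v \<Rightarrow> 'v \<Rightarrow> 'v \<Rightarrow> bool"
  where "ffiltration R \<C> M \<eta> f =
       (ford \<eta> \<^bold>\<and> (\<^bold>\<not> fempty \<eta>) \<^bold>\<and> ffunction_on f \<eta> \<^bold>\<and>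
       (\<^bold>\<forall>i N. fapp f i N \<^bold>\<longrightarrow> fsubmodule R M N) \<^bold>\<and>
       (\<^bold>\<forall>i j N N'. i \<^bold>\<in> j \<^bold>\<and> fapp f i N \<^bold>\<and> fapp f j N' \<^bold>\<longrightarrow> fsubset N N') \<^bold>\<and>
       (\<^bold>\<forall>j N'. fapp f j N' \<^bold>\<and> (\<^bold>\<not> fempty j) \<^bold>\<and> (\<^bold>\<not> (\<^bold>\<exists>i. fsucc j i)) \<^bold>\<longrightarrow>
          (\<^bold>\<forall>x. x \<^bold>\<in> N' \<^bold>\<longleftrightarrow> (\<^bold>\<exists>i N. i \<^bold>\<in> j \<^bold>\<and> fapp f i N \<^bold>\<and> x \<^bold>\<in> N))) \<^bold>\<and>
       (\<^bold>\<forall>x. x \<^bold>\<in> fcarrier M \<^bold>\<longleftrightarrow> (\<^bold>\<exists>i N. fapp f i N \<^bold>\<and> x \<^bold>\<in> N)) \<^bold>\<and>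
       (\<^bold>\<forall>i N. fapp f i N \<^bold>\<and> fempty i \<^bold>\<longrightarrow> (\<^bold>\<forall>x. x \<^bold>\<in> N \<^bold>\<longleftrightarrow> x \<^bold>= check \<zero>\<^bsub>M\<^esub>)) \<^bold>\<and>
       (\<^bold>\<forall>i j N N'. fsucc j i \<^bold>\<and> fapp f i N \<^bold>\<and> fapp f j N' \<^bold>\<longrightarrow>
          fex_ground \<C> (\<lambda>C. fquotient_iso R M N' N C)))"

lemma ffiltered_ffiltration: "ffiltered R \<C> M = (\<^bold>\<exists>\<eta> f. ffiltration R \<C> M \<eta> f)"
  unfolding ffiltered_def ffiltration_def ..

end

section \<open>Interpreting a name for a filtration\<close>

locale forced_filtration = forcing_poset P r + left_module R M
  for P :: "'v::zfc set" and r and R :: "'v ring" and M :: "('v, 'v) module" +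
  fixes \<C> :: "('v, 'v) module set" and p1 \<eta> f :: 'v
  assumes smM: "small (carrier M)" and smR: "small (carrier R)"
    and \<C>: "\<And>C. C \<in> \<C> \<Longrightarrow> is_module R C"
    and p1: "p1 \<in> P"
    and forced: "ffiltration R \<C> M \<eta> f p1"
begin

lemma ford_eta: "q \<preceq> p1 \<Longrightarrow> ford \<eta> q"
  using forced stable_mono[OF stable_derived(4)] unfolding ffiltration_def fand_iff by blast

lemma fun_f: "q \<preceq> p1 \<Longrightarrow> ffunction_on f \<eta> q"
  using forced stable_mono[OF stable_derived(2)] unfolding ffiltration_def fand_iff by blast

lemma f_submodule: "q \<preceq> p1 \<Longrightarrow> fapp f i N q \<Longrightarrow> fsubmodule R M N q"
proof -
  assume q: "q \<preceq> p1" "fapp f i N q"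
  have "(\<^bold>\<forall>i N. fapp f i N \<^bold>\<longrightarrow> fsubmodule R M N) p1" using forced unfolding ffiltration_def fand_iff by blast
  from fimpD[OF fallD[OF fallD[OF this]] _ _ q] show ?thesis by (simp add: stable_intros)
qed

lemma f_mono: "q \<preceq> p1 \<Longrightarrow> fmem i j q \<Longrightarrow> fapp f i N q \<Longrightarrow> fapp f j N' q \<Longrightarrow> fsubset N N' q"
proof -
  assume q: "q \<preceq> p1" and a: "fmem i j q" "fapp f i N q" "fapp f j N' q"
  have "(\<^bold>\<forall>i j N N'. i \<^bold>\<in> j \<^bold>\<and> fapp f i N \<^bold>\<and> fapp f j N' \<^bold>\<longrightarrow> fsubset N N') p1"
    using forced unfolding ffiltration_def fand_iff by blast
  from fimpD[OF fallD[OF fallD[OF fallD[OF fallD[OF this]]]] _ _ q] show ?thesis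
    using a by (simp add: stable_intros fand_iff)
qed

lemma f_limit: "q \<preceq> p1 \<Longrightarrow> fapp f j N' q \<Longrightarrow> (\<^bold>\<not> fempty j) q \<Longrightarrow> (\<^bold>\<not> (\<^bold>\<exists>i. fsucc j i)) q \<Longrightarrow> fmem x N' q \<Longrightarrow>
    (\<^bold>\<exists>i N. i \<^bold>\<in> j \<^bold>\<and> fapp f i N \<^bold>\<and> x \<^bold>\<in> N) q"
proof -
  assume q: "q \<preceq> p1" and a: "fapp f j N' q" "(\<^bold>\<not> fempty j) q" "(\<^bold>\<not> (\<^bold>\<exists>i. fsucc j i)) q" and x: "fmem x N' q"
  have "(\<^bold>\<forall>j N'. fapp f j N' \<^bold>\<and> (\<^bold>\<not> fempty j) \<^bold>\<and> (\<^bold>\<not> (\<^bold>\<exists>i. fsucc j i)) \<^bold>\<longrightarrow>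
          (\<^bold>\<forall>x. x \<^bold>\<in> N' \<^bold>\<longleftrightarrow> (\<^bold>\<exists>i N. i \<^bold>\<in> j \<^bold>\<and> fapp f i N \<^bold>\<and> x \<^bold>\<in> N))) p1"
    using forced unfolding ffiltration_def fand_iff by blast
  from fimpD[OF fallD[OF fallD[OF this]] _ _ q]
  have "(\<^bold>\<forall>x. x \<^bold>\<in> N' \<^bold>\<longleftrightarrow> (\<^bold>\<exists>i N. i \<^bold>\<in> j \<^bold>\<and> fapp f i N \<^bold>\<and> x \<^bold>\<in> N)) q"
    using a by (simp add: stable_intros fand_iff)
  from fiffD[OF fallD[OF this] _ _ le_refl[OF le_P(1)[OF q]]] show ?thesis using x by (simp add: stable_intros)
qed

lemma f_cover: "q \<preceq> p1 \<Longrightarrow> fmem x (fcarrier M) q \<Longrightarrow> (\<^bold>\<exists>i N. fapp f i N \<^bold>\<and> x \<^bold>\<in> N) q"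
proof -
  assume q: "q \<preceq> p1" and x: "fmem x (fcarrier M) q"
  have "(\<^bold>\<forall>x. x \<^bold>\<in> fcarrier M \<^bold>\<longleftrightarrow> (\<^bold>\<exists>i N. fapp f i N \<^bold>\<and> x \<^bold>\<in> N)) p1" using forced unfolding ffiltration_def fand_iff by blast
  from fiffD[OF fallD[OF this] _ _ q] show ?thesis using x by (simp add: stable_intros)
qed

lemma f_zero: "q \<preceq> p1 \<Longrightarrow> fapp f i N q \<Longrightarrow> fempty i q \<Longrightarrow> fmem x N q \<Longrightarrow> feq x (check \<zero>\<^bsub>M\<^esub>) q"
proof -
  assume q: "q \<preceq> p1" and a: "fapp f i N q" "fempty i q" and x: "fmem x N q"
  have "(\<^bold>\<forall>i N. fapp f i N \<^bold>\<and> fempty i \<^bold>\<longrightarrow> (\<^bold>\<forall>x. x \<^bold>\<in> N \<^bold>\<longleftrightarrow> x \<^bold>= check \<zero>\<^bsub>M\<^esub>)) p1"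
    using forced unfolding ffiltration_def fand_iff by blast
  from fimpD[OF fallD[OF fallD[OF this]] _ _ q]
  have "(\<^bold>\<forall>x. x \<^bold>\<in> N \<^bold>\<longleftrightarrow> x \<^bold>= check \<zero>\<^bsub>M\<^esub>) q" using a by (simp add: stable_intros fand_iff)
  from fiffD[OF fallD[OF this] _ _ le_refl[OF le_P(1)[OF q]]] show ?thesis using x by (simp add: stable_intros)
qed

lemma f_quotient: "q \<preceq> p1 \<Longrightarrow> fsucc j i q \<Longrightarrow> fapp f i N q \<Longrightarrow> fapp f j N' q \<Longrightarrow>
    fex_ground \<C> (\<lambda>C. fquotient_iso R M N' N C) q"
proof -
  assume q: "q \<preceq> p1" and a: "fsucc j i q" "fapp f i N q" "fapp f j N' q"
  have "(\<^bold>\<forall>i j N N'. fsucc j i \<^bold>\<and> fapp f i N \<^bold>\<and> fapp f j N' \<^bold>\<longrightarrow> fex_ground \<C> (\<lambda>C. fquotient_iso R M N' N C)) p1"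
    using forced unfolding ffiltration_def fand_iff by blast
  from fimpD[OF fallD[OF fallD[OF fallD[OF fallD[OF this]]]] _ _ q] show ?thesis
    using a by (simp add: stable_intros fand_iff)
qed

end

context forcing_poset
begin

lemma ffunction_dom:
  assumes F: "ffunction_on f A q" and q: "q \<in> P" and fi: "fapp f i N q"
  shows "fmem i A q"
proof -
  have "(\<^bold>\<forall>z. z \<^bold>\<in> f \<^bold>\<longrightarrow> (\<^bold>\<exists>x. x \<^bold>\<in> A \<^bold>\<and> (\<^bold>\<exists>y. fpair z x y))) q" using F unfolding ffunction_on_def fand_iff by blast
  from fimpD[OF fallD[OF this] _ _ le_refl[OF q]] fi
  have "(\<^bold>\<exists>x. x \<^bold>\<in> A \<^bold>\<and> (\<^bold>\<exists>y. fpair (opn i N) x y)) q" using fapp_iff[OF q] by (simp add: stable_intros)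
  then show ?thesis
  proof (rule fexE[OF _ q stable_fmem])
    fix x q1 assume q1: "q1 \<preceq> q" and "(x \<^bold>\<in> A \<^bold>\<and> (\<^bold>\<exists>y. fpair (opn i N) x y)) q1"
    then have x: "fmem x A q1" and "(\<^bold>\<exists>y. fpair (opn i N) x y) q1" by (auto simp: fand_iff)
    then show "fmem i A q1"
    proof (rule_tac fexE[OF _ le_P(1)[OF q1] stable_fmem])
      fix y q2 assume q2: "q2 \<preceq> q1" "fpair (opn i N) x y q2"
      then have "feq i x q2" using le_P by (simp add: fpair_iff opn_inject)
      then show "fmem i A q2" using fcongD[OF fcong_fmem1 feq_sym fmem_mono[OF x q2(1)]] by blast
    qed
  qed
qed

lemma ffunction_unique:
  assumes F: "ffunction_on f A q" and q: "q \<in> P" and fi: "fapp f i N q" "fapp f i N' q"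
  shows "feq N N' q"
proof -
  have "(\<^bold>\<forall>x. x \<^bold>\<in> A \<^bold>\<longrightarrow> (\<^bold>\<exists>y. fapp f x y \<^bold>\<and> (\<^bold>\<forall>y'. fapp f x y' \<^bold>\<longrightarrow> y' \<^bold>= y))) q"
    using F unfolding ffunction_on_def fand_iff by blast
  from fimpD[OF fallD[OF this] _ _ le_refl[OF q]] ffunction_dom[OF F q fi(1)]
  have "(\<^bold>\<exists>y. fapp f i y \<^bold>\<and> (\<^bold>\<forall>y'. fapp f i y' \<^bold>\<longrightarrow> y' \<^bold>= y)) q" by (simp add: stable_intros)
  then show ?thesis
  proof (rule fexE[OF _ q stable_feq])
    fix y q1 assume q1: "q1 \<preceq> q" and "(fapp f i y \<^bold>\<and> (\<^bold>\<forall>y'. fapp f i y' \<^bold>\<longrightarrow> y' \<^bold>= y)) q1"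
    then have *: "(\<^bold>\<forall>y'. fapp f i y' \<^bold>\<longrightarrow> y' \<^bold>= y) q1" by (simp add: fand_iff)
    have "feq N'' y q1" if "fapp f i N'' q" for N''
      using fimpD[OF fallD[OF *] stable_fapp stable_feq le_refl[OF le_P(1)[OF q1]] stable_mono[OF stable_fapp that q1]] .
    then show "feq N N' q1" using fi feq_trans feq_sym by blast
  qed
qed

lemma ffunction_total:
  assumes F: "ffunction_on f A q" and q: "q \<in> P" and i: "fmem i A q"
  shows "\<exists>q' N. q' \<preceq> q \<and> fapp f i N q'"
proof -
  have "(\<^bold>\<forall>x. x \<^bold>\<in> A \<^bold>\<longrightarrow> (\<^bold>\<exists>y. fapp f x y \<^bold>\<and> (\<^bold>\<forall>y'. fapp f x y' \<^bold>\<longrightarrow> y' \<^bold>= y))) q"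
    using F unfolding ffunction_on_def fand_iff by blast
  from fimpD[OF fallD[OF this] _ _ le_refl[OF q]] i
  have "(\<^bold>\<exists>y. fapp f i y \<^bold>\<and> (\<^bold>\<forall>y'. fapp f i y' \<^bold>\<longrightarrow> y' \<^bold>= y)) q" by (simp add: stable_intros)
  from fexD[OF this q] show ?thesis unfolding fand_iff by blast
qed

text \<open>Directedness of g brings finitely many forced memberships and the submodule property
  below one condition, where absoluteness of the operations applies.\<close>

lemma fsubmodule_ground:
  assumes sub: "fsubmodule R M N q0" and M: "left_module R M" and sm: "small (carrier M)" "small (carrier R)"
    and g: "q0 \<in> g" "g \<subseteq> P" "\<And>q q'. q \<in> g \<Longrightarrow> q' \<in> g \<Longrightarrow> \<exists>s \<in> g. s \<preceq> q \<and> s \<preceq> q'"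
  shows "submodule {y \<in> carrier M. \<exists>q \<in> g. fmem (check y) N q} R M"
proof -
  interpret M: left_module R M by fact
  have a: "(\<^bold>\<forall>x y z. x \<^bold>\<in> N \<^bold>\<and> y \<^bold>\<in> N \<^bold>\<and> fadd M x y z \<^bold>\<longrightarrow> z \<^bold>\<in> N) q0"
    and b: "(\<^bold>\<forall>a x z. a \<^bold>\<in> check (vset (carrier R)) \<^bold>\<and> x \<^bold>\<in> N \<^bold>\<and> fsmult R M a x z \<^bold>\<longrightarrow> z \<^bold>\<in> N) q0"
    and z: "fmem (check \<zero>\<^bsub>M\<^esub>) N q0"
    using sub unfolding fsubmodule_def fand_iff by blast+
  have add: "fmem z N s" if s: "s \<preceq> q0" and xy: "fmem x N s" "fmem y N s" "fadd M x y z s" for x y z s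
  proof -
    from fimpD[OF fallD[OF fallD[OF fallD[OF a, of x], of y], of z] _ _ s] show ?thesis
      using xy by (simp add: fand_iff stable_intros)
  qed
  have smult: "fmem z N s" if s: "s \<preceq> q0" and xy: "fmem c (check (vset (carrier R))) s" "fmem x N s" "fsmult R M c x z s" for c x z s
  proof -
    from fimpD[OF fallD[OF fallD[OF fallD[OF b, of c], of x], of z] _ _ s] show ?thesis
      using xy by (simp add: fand_iff stable_intros)
  qed
  show ?thesis
  proof (rule M.submoduleI)
    show "\<zero>\<^bsub>M\<^esub> \<in> {y \<in> carrier M. \<exists>q \<in> g. fmem (check y) N q}" using z g(1) by blast
    fix x y assume x: "x \<in> {y \<in> carrier M. \<exists>q \<in> g. fmem (check y) N q}" and y: "y \<in> {y \<in> carrier M. \<exists>q \<in> g. fmem (check y) N q}"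
    then obtain q q' where q: "q \<in> g" "fmem (check x) N q" "q' \<in> g" "fmem (check y) N q'" by blast
    obtain s where s: "s \<in> g" "s \<preceq> q" "s \<preceq> q'" using g(3) q by blast
    obtain s' where s': "s' \<in> g" "s' \<preceq> s" "s' \<preceq> q0" using g(3) s(1) g(1) by blast
    have xy: "fmem (check x) N s'" "fmem (check y) N s'"
      using fmem_mono[OF q(2) le_trans[OF s'(2) s(2)]] fmem_mono[OF q(4) le_trans[OF s'(2) s(3)]] .
    have "fadd M (check x) (check y) (check (x \<oplus>\<^bsub>M\<^esub> y)) s'"
      using fadd_check[OF le_P(1)[OF s'(2)] sm(1)] x y le_P(1)[OF s'(2)] by simp
    then have "fmem (check (x \<oplus>\<^bsub>M\<^esub> y)) N s'"
      by (rule add[OF s'(3) xy])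
    then show "x \<oplus>\<^bsub>M\<^esub> y \<in> {y \<in> carrier M. \<exists>q \<in> g. fmem (check y) N q}" using s'(1) x y by blast
  next
    fix c x assume c: "c \<in> carrier R" and x: "x \<in> {y \<in> carrier M. \<exists>q \<in> g. fmem (check y) N q}"
    then obtain q where q: "q \<in> g" "fmem (check x) N q" by blast
    obtain s' where s': "s' \<in> g" "s' \<preceq> q" "s' \<preceq> q0" using g(3) q(1) g(1) by blast
    have xy: "fmem (check x) N s'" "fmem (check c) (check (vset (carrier R))) s'"
      using fmem_mono[OF q(2) s'(2)] c sm(2) le_P(1)[OF s'(2)] by simp_all
    have "fsmult R M (check c) (check x) (check (c \<odot>\<^bsub>M\<^esub> x)) s'"
      using fsmult_check[OF le_P(1)[OF s'(2)] sm c] x le_P(1)[OF s'(2)] by simp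
    then have "fmem (check (c \<odot>\<^bsub>M\<^esub> x)) N s'"
      by (rule smult[OF s'(3) xy(2,1)])
    then show "c \<odot>\<^bsub>M\<^esub> x \<in> {y \<in> carrier M. \<exists>q \<in> g. fmem (check y) N q}" using s'(1) x c M.smult_closed by blast
  qed auto
qed

end

text \<open>The quotient lemma applied to C modulo zero with the identity map.\<close>

lemma countably_presented_generated:
  assumes C: "left_module R C" and cp: "countably_presented R C"
  shows "\<exists>E. countable E \<and> E \<subseteq> carrier C \<and> span R C E = carrier C"
proof -
  interpret C: left_module R C by fact
  have "quot_iso R C (carrier C) {\<zero>\<^bsub>C\<^esub>} C (\<lambda>x. x)" unfolding quot_iso_def by simp
  from countably_presented_quotient[OF C C cp C.submodule_carrier C.submodule_zero _ this]
  obtain E where E: "countable E" "E \<subseteq> carrier C" "\<forall>z \<in> carrier C. \<exists>l \<in> {\<zero>\<^bsub>C\<^esub>}. z \<ominus>\<^bsub>C\<^esub> l \<in> span R C E"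
    by auto
  have "z \<in> span R C E" if z: "z \<in> carrier C" for z
  proof -
    have "z \<ominus>\<^bsub>C\<^esub> \<zero>\<^bsub>C\<^esub> \<in> span R C E" using E(3) z by blast
    moreover have "z \<ominus>\<^bsub>C\<^esub> \<zero>\<^bsub>C\<^esub> = z" using z C.M.add.inv_one by (simp add: a_minus_def a_inv_def)
    ultimately show ?thesis by simp
  qed
  then have "span R C E = carrier C" using C.submoduleD(1)[OF C.submodule_span[OF E(2)]] by blast
  then show ?thesis using E by blast
qed

section \<open>Evaluating a forced quotient isomorphism at ground-model elements\<close>

context forcing_poset
begin

definition fiso :: "'v ring \<Rightarrow> ('v, 'v) module \<Rightarrow> 'v \<Rightarrow> 'v \<Rightarrow> ('v, 'v) module \<Rightarrow> 'v \<Rightarrow> 'v \<Rightarrow> 'v \<Rightarrow> bool"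
  where "fiso R M N' N C Q h =
       ((\<^bold>\<forall>K. K \<^bold>\<in> Q \<^bold>\<longleftrightarrow> (\<^bold>\<exists>a. a \<^bold>\<in> N' \<^bold>\<and> fcoset M N a K)) \<^bold>\<and>
       fbijection h Q (fcarrier C) \<^bold>\<and>
       (\<^bold>\<forall>a b s K L J x y z.
          a \<^bold>\<in> N' \<^bold>\<and> b \<^bold>\<in> N' \<^bold>\<and> fadd M a b s \<^bold>\<and>
          fcoset M N a K \<^bold>\<and> fcoset M N b L \<^bold>\<and> fcoset M N s J \<^bold>\<and>
          fapp h K x \<^bold>\<and> fapp h L y \<^bold>\<and> fapp h J z \<^bold>\<longrightarrow> fadd C x y z) \<^bold>\<and>
       (\<^bold>\<forall>c a s K J x z.
          c \<^bold>\<in> check (vset (carrier R)) \<^bold>\<and> a \<^bold>\<in> N' \<^bold>\<and> fsmult R M c a s \<^bold>\<and>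
          fcoset M N a K \<^bold>\<and> fcoset M N s J \<^bold>\<and>
          fapp h K x \<^bold>\<and> fapp h J z \<^bold>\<longrightarrow> fsmult R C c x z))"

lemma fquotient_iso_fiso: "fquotient_iso R M N' N C = (\<^bold>\<exists>Q h. fiso R M N' N C Q h)"
  unfolding fquotient_iso_def fiso_def ..

lemma stable_fiso [stable_intros]: "fstable (fiso R M N' N C Q h)"
  unfolding fiso_def by (intro stable_intros)

lemma fisoD:
  assumes iso: "fiso R M N' N C Q h p" and q: "q \<preceq> p"
  shows "fmem J Q q \<longleftrightarrow> (\<^bold>\<exists>a. a \<^bold>\<in> N' \<^bold>\<and> fcoset M N a J) q"
    and "ffunction_on h Q q"
    and "fapp h J x q \<Longrightarrow> fmem x (fcarrier C) q"
    and "fapp h J x q \<Longrightarrow> fapp h J' x q \<Longrightarrow> feq J J' q"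
    and "fmem x (fcarrier C) q \<Longrightarrow> (\<^bold>\<exists>J. fapp h J x) q"
    and "fmem a N' q \<Longrightarrow> fmem b N' q \<Longrightarrow> fadd M a b s q \<Longrightarrow> fcoset M N a K q \<Longrightarrow> fcoset M N b L q \<Longrightarrow> fcoset M N s J q \<Longrightarrow>
      fapp h K x q \<Longrightarrow> fapp h L y q \<Longrightarrow> fapp h J z q \<Longrightarrow> fadd C x y z q"
    and "fmem c (check (vset (carrier R))) q \<Longrightarrow> fmem a N' q \<Longrightarrow> fsmult R M c a s q \<Longrightarrow> fcoset M N a K q \<Longrightarrow> fcoset M N s J q \<Longrightarrow>
      fapp h K x q \<Longrightarrow> fapp h J z q \<Longrightarrow> fsmult R C c x z q"
proof -
  have 1: "(\<^bold>\<forall>K. K \<^bold>\<in> Q \<^bold>\<longleftrightarrow> (\<^bold>\<exists>a. a \<^bold>\<in> N' \<^bold>\<and> fcoset M N a K)) p"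
    and 2: "ffunction_on h Q p" "(\<^bold>\<forall>x y. fapp h x y \<^bold>\<longrightarrow> y \<^bold>\<in> fcarrier C) p"
      "(\<^bold>\<forall>x x' y. fapp h x y \<^bold>\<and> fapp h x' y \<^bold>\<longrightarrow> x \<^bold>= x') p" "(\<^bold>\<forall>y. y \<^bold>\<in> fcarrier C \<^bold>\<longrightarrow> (\<^bold>\<exists>x. fapp h x y)) p"
    and 3: "(\<^bold>\<forall>a b s K L J x y z.
          a \<^bold>\<in> N' \<^bold>\<and> b \<^bold>\<in> N' \<^bold>\<and> fadd M a b s \<^bold>\<and>
          fcoset M N a K \<^bold>\<and> fcoset M N b L \<^bold>\<and> fcoset M N s J \<^bold>\<and>
          fapp h K x \<^bold>\<and> fapp h L y \<^bold>\<and> fapp h J z \<^bold>\<longrightarrow> fadd C x y z) p"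
    and 4: "(\<^bold>\<forall>c a s K J x z.
          c \<^bold>\<in> check (vset (carrier R)) \<^bold>\<and> a \<^bold>\<in> N' \<^bold>\<and> fsmult R M c a s \<^bold>\<and>
          fcoset M N a K \<^bold>\<and> fcoset M N s J \<^bold>\<and>
          fapp h K x \<^bold>\<and> fapp h J z \<^bold>\<longrightarrow> fsmult R C c x z) p"
    using iso unfolding fiso_def fbijection_def fand_iff by blast+
  show "fmem J Q q \<longleftrightarrow> (\<^bold>\<exists>a. a \<^bold>\<in> N' \<^bold>\<and> fcoset M N a J) q"
    by (rule fiffD[OF fallD[OF 1] _ _ q]) (intro stable_intros)+
  show "ffunction_on h Q q" by (rule stable_mono[OF stable_derived(2) 2(1) q])
  show "fapp h J x q \<Longrightarrow> fmem x (fcarrier C) q"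
    by (rule fimpD[OF fallD[OF fallD[OF 2(2), of J], of x] _ _ q]) (intro stable_intros | assumption)+
  show "fmem x (fcarrier C) q \<Longrightarrow> (\<^bold>\<exists>J. fapp h J x) q"
    by (rule fimpD[OF fallD[OF 2(4), of x] _ _ q]) (intro stable_intros | assumption)+
  show "feq J J' q" if "fapp h J x q" "fapp h J' x q"
    by (rule fimpD[OF fallD[OF fallD[OF fallD[OF 2(3), of J], of J'], of x] _ _ q])
      ((intro stable_intros)+, use that in \<open>simp add: fand_iff\<close>)
  show "fadd C x y z q" if "fmem a N' q" "fmem b N' q" "fadd M a b s q" "fcoset M N a K q" "fcoset M N b L q" "fcoset M N s J q"
      "fapp h K x q" "fapp h L y q" "fapp h J z q"
    by (rule fimpD[OF fallD[OF fallD[OF fallD[OF fallD[OF fallD[OF fallD[OF fallD[OF fallD[OF fallD[OF 3, of a], of b], of s], of K], of L], of J], of x], of y], of z] _ _ q])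
      ((intro stable_intros)+, use that in \<open>simp add: fand_iff\<close>)
  show "fsmult R C c x z q" if "fmem c (check (vset (carrier R))) q" "fmem a N' q" "fsmult R M c a s q" "fcoset M N a K q" "fcoset M N s J q"
      "fapp h K x q" "fapp h J z q"
    by (rule fimpD[OF fallD[OF fallD[OF fallD[OF fallD[OF fallD[OF fallD[OF fallD[OF 4, of c], of a], of s], of K], of J], of x], of z] _ _ q])
      ((intro stable_intros)+, use that in \<open>simp add: fand_iff\<close>)
qed

lemma fcosetD: "fcoset M N a K p \<Longrightarrow> q \<preceq> p \<Longrightarrow> fmem x K q \<longleftrightarrow> (\<^bold>\<exists>n. n \<^bold>\<in> N \<^bold>\<and> fadd M a n x) q"
  unfolding fcoset_def by (rule fiffD[OF fallD]) (intro stable_intros | assumption)+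

lemma fcoset_unique: "fcoset M N a K p \<Longrightarrow> fcoset M N a K' p \<Longrightarrow> p \<in> P \<Longrightarrow> feq K K' p"
  using fcosetD by (intro feq_ext) blast+

lemma fsubmoduleD:
  assumes "fsubmodule R M N p" "q \<preceq> p"
  shows "fmem x N q \<Longrightarrow> fmem x (fcarrier M) q" "fmem (check \<zero>\<^bsub>M\<^esub>) N q"
    "fmem x N q \<Longrightarrow> fmem y N q \<Longrightarrow> fadd M x y z q \<Longrightarrow> fmem z N q"
    "fmem a (check (vset (carrier R))) q \<Longrightarrow> fmem x N q \<Longrightarrow> fsmult R M a x z q \<Longrightarrow> fmem z N q"
proof -
  have 1: "fsubset N (fcarrier M) p" "fmem (check \<zero>\<^bsub>M\<^esub>) N p"
    and 2: "(\<^bold>\<forall>x y z. x \<^bold>\<in> N \<^bold>\<and> y \<^bold>\<in> N \<^bold>\<and> fadd M x y z \<^bold>\<longrightarrow> z \<^bold>\<in> N) p"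
    and 3: "(\<^bold>\<forall>a x z. a \<^bold>\<in> check (vset (carrier R)) \<^bold>\<and> x \<^bold>\<in> N \<^bold>\<and> fsmult R M a x z \<^bold>\<longrightarrow> z \<^bold>\<in> N) p"
    using assms(1) unfolding fsubmodule_def fand_iff by blast+
  show "fmem x N q \<Longrightarrow> fmem x (fcarrier M) q"
    using fsubsetD[OF stable_mono[OF stable_derived(1) 1(1) assms(2)] _ le_P(1)[OF assms(2)]] .
  show "fmem (check \<zero>\<^bsub>M\<^esub>) N q" using fmem_mono[OF 1(2) assms(2)] .
  show "fmem z N q" if "fmem x N q" "fmem y N q" "fadd M x y z q"
    by (rule fimpD[OF fallD[OF fallD[OF fallD[OF 2, of x], of y], of z] _ _ assms(2)])
      ((intro stable_intros)+, use that in \<open>simp add: fand_iff\<close>)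
  show "fmem z N q" if "fmem a (check (vset (carrier R))) q" "fmem x N q" "fsmult R M a x z q"
    by (rule fimpD[OF fallD[OF fallD[OF fallD[OF 3, of a], of x], of z] _ _ assms(2)])
      ((intro stable_intros)+, use that in \<open>simp add: fand_iff\<close>)
qed

lemma fcoset_in_submodule:
  assumes K: "fsubmodule R M K p" and M: "left_module R M" and sm: "small (carrier M)" "small (carrier R)"
    and p: "p \<in> P" and y: "y \<in> carrier M" "fmem (check y) K p" and J: "fcoset M K (check y) J p"
  shows "feq J K p"
proof (rule feq_ext[OF p])
  interpret M: left_module R M by fact
  fix u q assume q: "q \<preceq> p"
  note Kq = fsubmoduleD[OF K]
  show "fmem u J q \<longleftrightarrow> fmem u K q"
  proof
    assume "fmem u J q"
    then have "(\<^bold>\<exists>n. n \<^bold>\<in> K \<^bold>\<and> fadd M (check y) n u) q" using fcosetD[OF J q] by blast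
    then show "fmem u K q"
    proof (rule fexE[OF _ le_P(1)[OF q] stable_fmem])
      fix n q1 assume q1: "q1 \<preceq> q" "(n \<^bold>\<in> K \<^bold>\<and> fadd M (check y) n u) q1"
      note q1p = le_trans[OF q1(1) q]
      show "fmem u K q1" by (rule Kq(3)[OF q1p fmem_mono[OF y(2) q1p]]) (use q1(2) in \<open>auto simp: fand_iff\<close>)
    qed
  next
    assume u: "fmem u K q"
    show "fmem u J q"
    proof (rule fmem_check_elim[OF Kq(1)[OF q u, unfolded fcarrier_def] le_P(1)[OF q] stable_fmem])
      fix q1 u0 assume q1: "q1 \<preceq> q" "u0 \<in> elts (vset (carrier M))" "feq u (check u0) q1"
      note q1p = le_trans[OF q1(1) q] and P1 = le_P(1)[OF q1(1)]
      have u0: "u0 \<in> carrier M" using q1(2) sm(1) by simp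
      have "fsmult R M (check (\<ominus>\<^bsub>R\<^esub> \<one>\<^bsub>R\<^esub>)) (check y) (check (\<ominus>\<^bsub>M\<^esub> y)) q1"
        using fsmult_check[OF P1 sm _ y(1)] M.smult_minus_one[OF y(1)] P1 by simp
      then have my: "fmem (check (\<ominus>\<^bsub>M\<^esub> y)) K q1"
        by (rule Kq(4)[OF q1p _ fmem_mono[OF y(2) q1p], rotated]) (use sm(2) P1 in simp)
      have "fadd M (check (\<ominus>\<^bsub>M\<^esub> y)) (check u0) (check (\<ominus>\<^bsub>M\<^esub> y \<oplus>\<^bsub>M\<^esub> u0)) q1"
        using fadd_check[OF P1 sm(1) _ u0] y(1) P1 by simp
      then have n: "fmem (check (\<ominus>\<^bsub>M\<^esub> y \<oplus>\<^bsub>M\<^esub> u0)) K q1"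
        by (rule Kq(3)[OF q1p my fcongD[OF fcong_fmem1 q1(3) fmem_mono[OF u q1(1)]]])
      have "y \<oplus>\<^bsub>M\<^esub> (\<ominus>\<^bsub>M\<^esub> y \<oplus>\<^bsub>M\<^esub> u0) = u0" using y(1) u0 by (simp add: M.M.r_neg2 M.M.r_neg1)
      then have "fadd M (check y) (check (\<ominus>\<^bsub>M\<^esub> y \<oplus>\<^bsub>M\<^esub> u0)) u q1"
        using fadd_check[OF P1 sm(1) y(1), of "\<ominus>\<^bsub>M\<^esub> y \<oplus>\<^bsub>M\<^esub> u0" u] y(1) u0 q1(3) by simp
      then have "(\<^bold>\<exists>n. n \<^bold>\<in> K \<^bold>\<and> fadd M (check y) n u) q1"
        using n P1 by (intro fexI[where \<tau> = "check (\<ominus>\<^bsub>M\<^esub> y \<oplus>\<^bsub>M\<^esub> u0)"] stable_intros) (auto simp: fand_iff)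
      then show "fmem u J q1" using fcosetD[OF J q1p] by blast
    qed
  qed
qed

text \<open>A coset is a subset of a ground-model set, so \<open>comp\<close> provides a name for it
  without strengthening the condition.\<close>

lemma fcoset_exists:
  assumes K: "fsubmodule R M K p" and M: "left_module R M" and sm: "small (carrier M)"
    and p: "p \<in> P" and y: "y \<in> carrier M"
  shows "\<exists>J. fcoset M K (check y) J p"
proof -
  interpret M: left_module R M by fact
  let ?\<Phi> = "\<lambda>a. \<^bold>\<exists>n. n \<^bold>\<in> K \<^bold>\<and> fadd M (check y) n a"
  let ?J = "comp (vset (carrier M)) (\<lambda>a. ?\<Phi> (check a))"
  have st: "fstable (?\<Phi> a)" for a by (intro stable_intros)
  have co: "fcong ?\<Phi>" by (intro fcong_intros)
  have memJ: "fmem u ?J q \<longleftrightarrow> (\<forall>q1. q1 \<preceq> q \<longrightarrow> (\<exists>q2 a. q2 \<preceq> q1 \<and> a \<in> elts (vset (carrier M)) \<and> feq u (check a) q2 \<and> ?\<Phi> (check a) q2))" for u q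
    by (rule fmem_comp) (rule stable_mono[OF st])
  have "fcoset M K (check y) ?J p"
    unfolding fcoset_def
  proof (intro fallI fiffI)
    fix u q assume q: "q \<preceq> p" and u: "fmem u ?J q"
    show "?\<Phi> u q"
    proof (rule stable_dense[OF st le_P(1)[OF q]])
      fix q1 assume "q1 \<preceq> q"
      then obtain q2 a where q2: "q2 \<preceq> q1" "feq u (check a) q2" "?\<Phi> (check a) q2" using u memJ by blast
      then show "\<exists>q'. q' \<preceq> q1 \<and> ?\<Phi> u q'" using fcongD[OF co feq_sym[OF q2(2)] q2(3)] by blast
    qed
  next
    fix u q assume q: "q \<preceq> p" and u: "?\<Phi> u q"
    then show "fmem u ?J q"
    proof (rule_tac fexE[OF u le_P(1)[OF q] stable_fmem])
      fix n q1 assume q1: "q1 \<preceq> q" "(n \<^bold>\<in> K \<^bold>\<and> fadd M (check y) n u) q1"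
      have n: "fmem n K q1" "fadd M (check y) n u q1" using q1(2) by (auto simp: fand_iff)
      show "fmem u ?J q1"
      proof (rule fmem_check_elim[OF fsubmoduleD(1)[OF K le_trans[OF q1(1) q] n(1), unfolded fcarrier_def] le_P(1)[OF q1(1)] stable_fmem])
        fix q2 n0 assume q2: "q2 \<preceq> q1" "n0 \<in> elts (vset (carrier M))" "feq n (check n0) q2"
        have n0: "n0 \<in> carrier M" using q2(2) sm by simp
        have "fadd M (check y) n u q2" using stable_mono[OF stable_derived(7) n(2) q2(1)] .
        then have ueq: "feq u (check (y \<oplus>\<^bsub>M\<^esub> n0)) q2"
          by (rule fadd_eq[OF _ feq_refl[OF le_P(1)[OF q2(1)]] q2(3) sm y n0])
        have "?\<Phi> u q2" using stable_mono[OF st u le_trans[OF q2(1) q1(1)]] .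
        then have \<Phi>: "?\<Phi> (check (y \<oplus>\<^bsub>M\<^esub> n0)) q2" using fcongD[OF co ueq] by blast
        show "fmem u ?J q2"
          unfolding memJ
        proof (intro allI impI)
          fix q3 assume q3: "q3 \<preceq> q2"
          show "\<exists>q4 a. q4 \<preceq> q3 \<and> a \<in> elts (vset (carrier M)) \<and> feq u (check a) q4 \<and> ?\<Phi> (check a) q4"
            by (rule exI[of _ q3], rule exI[of _ "y \<oplus>\<^bsub>M\<^esub> n0"])
              (use le_refl[OF le_P(1)[OF q3]] y n0 sm feq_mono[OF ueq q3] stable_mono[OF st \<Phi> q3] in simp)
        qed
      qed
    qed
  qed
  then show ?thesis by blast
qed

text \<open>q decides that h sends the coset of y modulo K to the ground-model element c. The coset
  itself may be a new set; only y and c come from the ground model.\<close>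

definition fval :: "('v, 'v) module \<Rightarrow> 'v \<Rightarrow> 'v \<Rightarrow> 'v \<Rightarrow> 'v \<Rightarrow> 'v \<Rightarrow> bool"
  where "fval M K h y c q \<longleftrightarrow> (\<exists>J. fcoset M K (check y) J q \<and> fapp h J (check c) q)"

lemma fval_mono: "fval M K h y c p \<Longrightarrow> q \<preceq> p \<Longrightarrow> fval M K h y c q"
  unfolding fval_def using stable_mono[OF stable_derived2(2)] stable_mono[OF stable_fapp] by blast

context
  fixes R :: "'v ring" and M C :: "('v, 'v) module" and N K Q h p
  assumes iso: "fiso R M N K C Q h p" and K: "fsubmodule R M K p" and N: "fsubmodule R M N p"
    and M: "left_module R M" and C: "left_module R C"
    and sm: "small (carrier M)" "small (carrier R)" "small (carrier C)"
begin

text \<open>The value of h lies in the canonical name for the carrier of C, so a stronger condition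
  identifies it with some \<open>check c\<close>.\<close>

lemma fval_exists:
  assumes q: "q \<preceq> p" and y: "y \<in> carrier M" "fmem (check y) N q"
  shows "\<exists>q' c. q' \<preceq> q \<and> c \<in> carrier C \<and> fval M K h y c q'"
proof -
  note Pq = le_P(1)[OF q]
  obtain J where J: "fcoset M K (check y) J q"
    using fcoset_exists[OF stable_mono[OF stable_derived2(1) K q] M sm(1) Pq y(1)] by blast
  have "(\<^bold>\<exists>a. a \<^bold>\<in> N \<^bold>\<and> fcoset M K a J) q"
    using J y(2) Pq by (intro fexI[where \<tau> = "check y"] stable_intros) (auto simp: fand_iff)
  then have "fmem J Q q" using fisoD(1)[OF iso q] by blast
  then obtain q1 v where q1: "q1 \<preceq> q" "fapp h J v q1" using ffunction_total[OF fisoD(2)[OF iso q] Pq] by blast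
  have "fmem v (check (vset (carrier C))) q1"
    using fisoD(3)[OF iso le_trans[OF q1(1) q] q1(2)] unfolding fcarrier_def .
  from fmem_checkD[OF this le_P(1)[OF q1(1)]]
  obtain q2 c where q2: "q2 \<preceq> q1" "c \<in> carrier C" "feq v (check c) q2" using sm(3) by auto
  have "fapp h J (check c) q2" using fcongD[OF fcong_fapp(3) q2(3) stable_mono[OF stable_fapp q1(2) q2(1)]] .
  then have "fval M K h y c q2"
    unfolding fval_def using stable_mono[OF stable_derived2(2) J le_trans[OF q2(1) q1(1)]] by blast
  then show ?thesis using q2(2) le_trans[OF q2(1) q1(1)] by blast
qed

lemma fval_carrier: "q \<preceq> p \<Longrightarrow> fval M K h y c q \<Longrightarrow> c \<in> carrier C"
  unfolding fval_def using fisoD(3)[OF iso] le_P(1) sm(3) unfolding fcarrier_def by fastforce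

lemma fval_unique:
  assumes q: "q \<preceq> p" and "fval M K h y c q" "fval M K h y c' q"
  shows "c = c'"
proof -
  note Pq = le_P(1)[OF q]
  obtain J J' where J: "fcoset M K (check y) J q" "fapp h J (check c) q" "fcoset M K (check y) J' q" "fapp h J' (check c') q"
    using assms(2,3) unfolding fval_def by blast
  have "fapp h J (check c') q" using fcongD[OF fcong_fapp(2) feq_sym[OF fcoset_unique[OF J(1,3) Pq]] J(4)] .
  from ffunction_unique[OF fisoD(2)[OF iso q] Pq J(2) this] show ?thesis by simp
qed

lemma fval_add:
  assumes q: "q \<preceq> p" and y: "y \<in> carrier M" "fmem (check y) N q" "fval M K h y c q"
    and y': "y' \<in> carrier M" "fmem (check y') N q" "fval M K h y' c' q" and s: "fval M K h (y \<oplus>\<^bsub>M\<^esub> y') c'' q"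
  shows "c'' = c \<oplus>\<^bsub>C\<^esub> c'"
proof -
  note Pq = le_P(1)[OF q]
  obtain J J' J'' where J: "fcoset M K (check y) J q" "fapp h J (check c) q" "fcoset M K (check y') J' q" "fapp h J' (check c') q"
      "fcoset M K (check (y \<oplus>\<^bsub>M\<^esub> y')) J'' q" "fapp h J'' (check c'') q"
    using y(3) y'(3) s unfolding fval_def by blast
  have "fadd M (check y) (check y') (check (y \<oplus>\<^bsub>M\<^esub> y')) q" using fadd_check[OF Pq sm(1) y(1) y'(1)] Pq by simp
  from fisoD(6)[OF iso q y(2) y'(2) this J(1,3,5,2,4,6)]
  have "feq (check c'') (check (c \<oplus>\<^bsub>C\<^esub> c')) q"
    using fadd_check[OF Pq sm(3) fval_carrier[OF q y(3)] fval_carrier[OF q y'(3)]] by blast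
  then show ?thesis by simp
qed

lemma fval_smult:
  assumes q: "q \<preceq> p" and a: "a \<in> carrier R" and y: "y \<in> carrier M" "fmem (check y) N q" "fval M K h y c q"
    and s: "fval M K h (a \<odot>\<^bsub>M\<^esub> y) c'' q"
  shows "c'' = a \<odot>\<^bsub>C\<^esub> c"
proof -
  note Pq = le_P(1)[OF q]
  obtain J J'' where J: "fcoset M K (check y) J q" "fapp h J (check c) q"
      "fcoset M K (check (a \<odot>\<^bsub>M\<^esub> y)) J'' q" "fapp h J'' (check c'') q"
    using y(3) s unfolding fval_def by blast
  have 1: "fsmult R M (check a) (check y) (check (a \<odot>\<^bsub>M\<^esub> y)) q" using fsmult_check[OF Pq sm(1,2) a y(1)] Pq by simp
  have 2: "fmem (check a) (check (vset (carrier R))) q" using a sm(2) Pq by simp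
  from fisoD(7)[OF iso q 2 y(2) 1 J(1,3,2,4)]
  have "feq (check c'') (check (a \<odot>\<^bsub>C\<^esub> c)) q"
    using fsmult_check[OF Pq sm(3,2) a fval_carrier[OF q y(3)]] by blast
  then show ?thesis by simp
qed

text \<open>The preimage of c is a coset in the extension, but its representatives are elements of
  the ground-model module M, so one of them can be decided.\<close>

lemma fval_surj:
  assumes q: "q \<preceq> p" and c: "c \<in> carrier C"
  shows "\<exists>q' y. q' \<preceq> q \<and> y \<in> carrier M \<and> fmem (check y) N q' \<and> fval M K h y c q'"
proof -
  note Pq = le_P(1)[OF q]
  have "fmem (check c) (fcarrier C) q" unfolding fcarrier_def using c sm(3) Pq by simp
  from fexD[OF fisoD(5)[OF iso q this] Pq] obtain q1 J where q1: "q1 \<preceq> q" "fapp h J (check c) q1" by blast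
  note q1p = le_trans[OF q1(1) q]
  have "fmem J Q q1" using ffunction_dom[OF fisoD(2)[OF iso q1p] le_P(1)[OF q1(1)] q1(2)] .
  then have "(\<^bold>\<exists>a. a \<^bold>\<in> N \<^bold>\<and> fcoset M K a J) q1" using fisoD(1)[OF iso q1p] by blast
  from fexD[OF this le_P(1)[OF q1(1)]] obtain q2 a where q2: "q2 \<preceq> q1" "fmem a N q2" "fcoset M K a J q2"
    unfolding fand_iff by blast
  have "fmem a (check (vset (carrier M))) q2"
    using fsubmoduleD(1)[OF N le_trans[OF q2(1) q1p] q2(2)] unfolding fcarrier_def .
  from fmem_checkD[OF this le_P(1)[OF q2(1)]] obtain q3 y where q3: "q3 \<preceq> q2" "y \<in> carrier M" "feq a (check y) q3"
    using sm(1) by auto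
  have "fmem (check y) N q3" using fcongD[OF fcong_fmem1 q3(3) fmem_mono[OF q2(2) q3(1)]] .
  moreover have "fcoset M K (check y) J q3"
    using fcongD[OF fcong_derived2(3) q3(3) stable_mono[OF stable_derived2(2) q2(3) q3(1)]] .
  moreover have "fapp h J (check c) q3" using stable_mono[OF stable_fapp q1(2) le_trans[OF q3(1) q2(1)]] .
  ultimately show ?thesis
    unfolding fval_def using q3(2) le_trans[OF q3(1) le_trans[OF q2(1) q1(1)]] by blast
qed

text \<open>Both directions compare the coset of y with that of zero, which is K itself; one uses
  that h is a function, the other that it is injective. The value d at zero is kept general because
  it is identified with the zero of C only later.\<close>

lemma fval_kernel:
  assumes q: "q \<preceq> p" and y: "y \<in> carrier M" "fval M K h y c q" and z: "fval M K h \<zero>\<^bsub>M\<^esub> d q"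
  shows "fmem (check y) K q \<longleftrightarrow> c = d"
proof -
  interpret M: left_module R M by (rule M)
  note Pq = le_P(1)[OF q] and Kq = stable_mono[OF stable_derived2(1) K q]
  obtain J J0 where J: "fcoset M K (check y) J q" "fapp h J (check c) q" "fcoset M K (check \<zero>\<^bsub>M\<^esub>) J0 q" "fapp h J0 (check d) q"
    using y(2) z unfolding fval_def by blast
  have zK: "fmem (check \<zero>\<^bsub>M\<^esub>) K q" using fsubmoduleD(2)[OF K q] .
  have J0K: "feq J0 K q" using fcoset_in_submodule[OF Kq M sm(1,2) Pq M.M.zero_closed zK J(3)] .
  show ?thesis
  proof
    assume "fmem (check y) K q"
    then have "feq J K q" using fcoset_in_submodule[OF Kq M sm(1,2) Pq y(1) _ J(1)] by blast
    then have "feq J0 J q" using J0K feq_sym feq_trans by blast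
    then have "fapp h J (check d) q" using fcongD[OF fcong_fapp(2) _ J(4)] by blast
    from ffunction_unique[OF fisoD(2)[OF iso q] Pq J(2) this] show "c = d" by simp
  next
    assume "c = d"
    then have "feq J J0 q" using fisoD(4)[OF iso q J(2)] J(4) by blast
    then have JK: "feq J K q" using J0K feq_trans by blast
    have "fadd M (check y) (check \<zero>\<^bsub>M\<^esub>) (check y) q" using fadd_check[OF Pq sm(1) y(1)] y(1) Pq by simp
    then have "(\<^bold>\<exists>n. n \<^bold>\<in> K \<^bold>\<and> fadd M (check y) n (check y)) q"
      using zK Pq by (intro fexI[where \<tau> = "check \<zero>\<^bsub>M\<^esub>"] stable_intros) (auto simp: fand_iff)
    then have "fmem (check y) J q" using fcosetD[OF J(1) le_refl[OF Pq]] by blast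
    then show "fmem (check y) K q" using fcongD[OF fcong_fmem2 JK] by blast
  qed
qed

end

end

section \<open>Locating an element in the forced filtration\<close>

context forced_filtration
begin

text \<open>Forced minimality of the index i, phrased with all stronger conditions so that it
  persists.\<close>

definition unreached :: "'v \<Rightarrow> 'v \<Rightarrow> 'v \<Rightarrow> bool"
  where "unreached x i q \<longleftrightarrow> (\<forall>q' j N. q' \<preceq> q \<longrightarrow> fmem j i q' \<longrightarrow> fapp f j N q' \<longrightarrow> \<not> fmem x N q')"

lemma unreached_mono: "unreached x i q \<Longrightarrow> q' \<preceq> q \<Longrightarrow> unreached x i q'"
  unfolding unreached_def using le_trans by blast

lemma unreachedD: "unreached x i q \<Longrightarrow> q' \<preceq> q \<Longrightarrow> fmem j i q' \<Longrightarrow> fapp f j N q' \<Longrightarrow> fmem x N q' \<Longrightarrow> False"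
  unfolding unreached_def by blast

text \<open>The least-element principle by induction on the name i: a failure of minimality gives a
  smaller index, which a stronger condition identifies with a named element of i.\<close>

lemma least_index:
  assumes "q \<in> P" "fapp f i N q" "fmem x N q"
  shows "\<exists>q' i' N'. q' \<preceq> q \<and> fapp f i' N' q' \<and> fmem x N' q' \<and> unreached x i' q'"
  using assms
proof (induction i arbitrary: q N rule: name_induct)
  case (step i)
  show ?case
  proof (cases "unreached x i q")
    case True
    then show ?thesis using step.prems le_refl by blast
  next
    case False
    then obtain q1 j N1 where q1: "q1 \<preceq> q" "fmem j i q1" "fapp f j N1 q1" "fmem x N1 q1"
      unfolding unreached_def by blast
    obtain q2 \<rho> t where q2: "q2 \<preceq> q1" "opair \<rho> t \<in> elts i" "feq j \<rho> q2"
      using q1(2) le_refl[OF le_P(1)[OF q1(1)]] unfolding fmem_def by blast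
    have "fapp f \<rho> N1 q2" using fcongD[OF fcong_fapp(2) q2(3) stable_mono[OF stable_fapp q1(3) q2(1)]] .
    from step.IH[OF q2(2) le_P(1)[OF q2(1)] this fmem_mono[OF q1(4) q2(1)]]
    show ?thesis using le_trans[OF _ le_trans[OF q2(1) q1(1)]] by blast
  qed
qed

text \<open>
  In the extension, \<open>i\<close> is the least index with \<open>x \<in> f i\<close>, it is the successor of \<open>k\<close>, and
  \<open>h\<close> is an isomorphism from \<open>Q = f i / f k\<close> onto \<open>C\<close>.
\<close>

definition located ::
    "'v \<Rightarrow> 'v \<Rightarrow> 'v \<Rightarrow> 'v \<Rightarrow> 'v \<Rightarrow> ('v, 'v) module \<Rightarrow> 'v \<Rightarrow> 'v \<Rightarrow> 'v \<Rightarrow> bool"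
  where "located x i N k K C Q h q \<longleftrightarrow> q \<preceq> p1 \<and> fapp f i N q \<and> fmem (check x) N q \<and> unreached (check x) i q \<and>
    fsucc i k q \<and> fapp f k K q \<and> C \<in> \<C> \<and> fiso R M N K C Q h q"

lemma located_mono: "located x i N k K C Q h q \<Longrightarrow> q' \<preceq> q \<Longrightarrow> located x i N k K C Q h q'"
  unfolding located_def
  using le_trans stable_mono[OF stable_fapp] fmem_mono unreached_mono stable_mono[OF stable_derived(6)]
    stable_mono[OF stable_fiso] by meson

lemma locatedD:
  assumes "located x i N k K C Q h q"
  shows "q \<preceq> p1" "q \<in> P" "fapp f i N q" "fmem (check x) N q" "unreached (check x) i q" "fsucc i k q" "fapp f k K q"
    "C \<in> \<C>" "fiso R M N K C Q h q" "fmem k i q" "fsubset K N q" "ford i q" "fsubmodule R M N q" "fsubmodule R M K q"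
proof -
  show 1: "q \<preceq> p1" "fapp f i N q" "fmem (check x) N q" "unreached (check x) i q" "fsucc i k q" "fapp f k K q"
    "C \<in> \<C>" "fiso R M N K C Q h q" using assms unfolding located_def by blast+
  show P: "q \<in> P" using le_P(1)[OF 1(1)] .
  show k: "fmem k i q" using fsuccD(1)[OF 1(5) P] .
  show "fsubset K N q" using f_mono[OF 1(1) k 1(6,2)] .
  show "ford i q" using ford_elem[OF ford_eta[OF 1(1)] ffunction_dom[OF fun_f[OF 1(1)] P 1(2)] P] .
  show "fsubmodule R M N q" "fsubmodule R M K q" using f_submodule 1 by blast+
qed

text \<open>The least index for a nonzero x is forced to be a successor: the zero clause excludes
  the empty index, and at a limit x would already belong to an earlier member. The remaining names
  are witnesses found below successively stronger conditions.\<close>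

lemma located_exists:
  assumes q: "q \<preceq> p1" and x: "x \<in> carrier M" "x \<noteq> \<zero>\<^bsub>M\<^esub>"
  shows "\<exists>q' i N k K C Q h. q' \<preceq> q \<and> located x i N k K C Q h q'"
proof -
  note Pq = le_P(1)[OF q]
  have "fmem (check x) (fcarrier M) q" unfolding fcarrier_def using x smM Pq by simp
  from fexD[OF f_cover[OF q this] Pq] obtain q1 i0 where q1: "q1 \<preceq> q" "(\<^bold>\<exists>N. fapp f i0 N \<^bold>\<and> check x \<^bold>\<in> N) q1" by blast
  from fexD[OF q1(2) le_P(1)[OF q1(1)]] obtain q2 N0 where q2: "q2 \<preceq> q1" "fapp f i0 N0 q2" "fmem (check x) N0 q2"
    unfolding fand_iff by blast
  from least_index[OF le_P(1)[OF q2(1)] q2(2,3)] obtain q3 i N where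
    q3: "q3 \<preceq> q2" "fapp f i N q3" "fmem (check x) N q3" "unreached (check x) i q3" by blast
  have q3q: "q3 \<preceq> q" using le_trans[OF q3(1) le_trans[OF q2(1) q1(1)]] .
  note q3p = le_trans[OF q3q q]
  have nonempty: "(\<^bold>\<not> fempty i) q3"
    unfolding fnot_iff
  proof (intro allI impI notI)
    fix q' assume q': "q' \<preceq> q3" "fempty i q'"
    from f_zero[OF le_trans[OF q'(1) q3p] stable_mono[OF stable_fapp q3(2) q'(1)] q'(2) fmem_mono[OF q3(3) q'(1)]]
    show False using x(2) by simp
  qed
  have "\<not> (\<^bold>\<not> (\<^bold>\<exists>k. fsucc i k)) q3"
  proof
    assume "(\<^bold>\<not> (\<^bold>\<exists>k. fsucc i k)) q3"
    from fexD[OF f_limit[OF q3p q3(2) nonempty this q3(3)] le_P(1)[OF q3(1)]]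
    obtain q' j where q': "q' \<preceq> q3" "(\<^bold>\<exists>N. j \<^bold>\<in> i \<^bold>\<and> fapp f j N \<^bold>\<and> check x \<^bold>\<in> N) q'" by blast
    from fexD[OF q'(2) le_P(1)[OF q'(1)]] obtain q'' N' where
      q'': "q'' \<preceq> q'" "fmem j i q''" "fapp f j N' q''" "fmem (check x) N' q''"
      unfolding fand_iff by blast
    from unreachedD[OF q3(4) le_trans[OF q''(1) q'(1)] q''(2-)] show False .
  qed
  then obtain q4' where q4': "q4' \<preceq> q3" "(\<^bold>\<exists>k. fsucc i k) q4'" unfolding fnot_iff by blast
  from fexD[OF q4'(2) le_P(1)[OF q4'(1)]] obtain q4 k where q4'': "q4 \<preceq> q4'" and k: "fsucc i k q4" by blast
  have q4: "q4 \<preceq> q3" using le_trans[OF q4'' q4'(1)] .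
  note q4p = le_trans[OF q4 q3p] and P4 = le_P(1)[OF q4]
  have fi: "fapp f i N q4" using stable_mono[OF stable_fapp q3(2) q4] .
  have "fmem k \<eta> q4"
    using fsubsetD[OF ford_trans[OF ford_eta[OF q4p] ffunction_dom[OF fun_f[OF q4p] P4 fi] P4] fsuccD(1)[OF k P4] P4] .
  from ffunction_total[OF fun_f[OF q4p] P4 this] obtain q5 K where q5: "q5 \<preceq> q4" "fapp f k K q5" by blast
  note q5p = le_trans[OF q5(1) q4p] and k5 = stable_mono[OF stable_derived(6) k q5(1)]
  have "fex_ground \<C> (\<lambda>C. fquotient_iso R M N K C) q5"
    using f_quotient[OF q5p k5 q5(2) stable_mono[OF stable_fapp fi q5(1)]] .
  then obtain q6 C where q6: "q6 \<preceq> q5" "C \<in> \<C>" "(\<^bold>\<exists>Q h. fiso R M N K C Q h) q6"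
    using le_refl[OF le_P(1)[OF q5(1)]] unfolding fex_ground_iff fquotient_iso_fiso by blast
  from fexD[OF q6(3) le_P(1)[OF q6(1)]] obtain q7 Q where q7: "q7 \<preceq> q6" "(\<^bold>\<exists>h. fiso R M N K C Q h) q7" by blast
  from fexD[OF q7(2) le_P(1)[OF q7(1)]] obtain q8 h where q8: "q8 \<preceq> q7" "fiso R M N K C Q h q8" by blast
  have 85: "q8 \<preceq> q5" using le_trans[OF q8(1) le_trans[OF q7(1) q6(1)]] .
  have 84: "q8 \<preceq> q4" using le_trans[OF 85 q5(1)] .
  have 83: "q8 \<preceq> q3" using le_trans[OF 84 q4] .
  have "located x i N k K C Q h q8"
    unfolding located_def
    using le_trans[OF 83 q3p] stable_mono[OF stable_fapp q3(2) 83] fmem_mono[OF q3(3) 83] unreached_mono[OF q3(4) 83]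
      stable_mono[OF stable_derived(6) k 84] stable_mono[OF stable_fapp q5(2) 85] q6(2) q8(2) by blast
  then show ?thesis using le_trans[OF 83 q3q] by blast
qed

lemma fsubset_pred:
  assumes q: "q \<preceq> p1" and k: "fsucc i k q" "fapp f k K q" and k': "fmem k' i q" "fapp f k' K' q"
  shows "fsubset K' K q"
proof (rule fdisjE[OF fsuccD(2)[OF k(1) le_P(1)[OF q] k'(1)] le_P(1)[OF q] stable_derived(1)])
  fix q1 assume q1: "q1 \<preceq> q"
  note m = stable_mono[OF stable_fapp k(2) q1] stable_mono[OF stable_fapp k'(2) q1]
  show "fsubset K' K q1" if "fmem k' k q1" using f_mono[OF le_trans[OF q1 q] that m(2,1)] .
  show "fsubset K' K q1" if "feq k' k q1"
  proof -
    have "fapp f k K' q1" using fcongD[OF fcong_fapp(2) that m(2)] .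
    from feq_fsubset[OF ffunction_unique[OF fun_f[OF le_trans[OF q1 q]] le_P(1)[OF q1] this m(1)]] show ?thesis .
  qed
qed

context
  fixes x y i N k K C Q h i' N' k' K' C' Q' h' q
  assumes x: "located x i N k K C Q h q" and y: "located y i' N' k' K' C' Q' h' q"
begin

text \<open>This lemma and the two after it are forced versions of the three clauses of
  \<open>indexed_filtration\<close> relating x and y. All of them compare the two least indices by
  \<open>ford_linear\<close>.\<close>

lemma located_below:
  assumes "fmem (check y) K q"
  shows "fmem i' i q" "fsubset N' K q"
proof -
  note X = locatedD[OF x] and Y = locatedD[OF y]
  show i: "fmem i' i q"
  proof (rule ftriE[OF ford_linear[OF X(2) Y(12) X(12)] X(2) stable_fmem])
    fix q1 assume q1: "q1 \<preceq> q"
    note yK = fmem_mono[OF assms q1] and kK = stable_mono[OF stable_fapp X(7) q1] and ki = fmem_mono[OF X(10) q1]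
    show "fmem i' i q1" if "feq i' i q1"
      using unreachedD[OF Y(5) q1 fcongD[OF fcong_fmem2 feq_sym[OF that] ki] kK yK] ..
    show "fmem i' i q1" if "fmem i i' q1"
      using unreachedD[OF Y(5) q1 fsubsetD[OF ford_trans[OF locatedD(12)[OF located_mono[OF y q1]] that le_P(1)[OF q1]] ki le_P(1)[OF q1]] kK yK] ..
  qed
  show "fsubset N' K q" using fsubset_pred[OF X(1,6,7) i Y(3)] .
qed

lemma located_above:
  assumes ny: "\<And>q'. q' \<preceq> q \<Longrightarrow> \<not> fmem (check y) N q'"
  shows "fmem (check x) K' q"
proof -
  note X = locatedD[OF x] and Y = locatedD[OF y]
  have "fmem i i' q"
  proof (rule ftriE[OF ford_linear[OF X(2) Y(12) X(12)] X(2) stable_fmem])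
    fix q1 assume q1: "q1 \<preceq> q"
    note X1 = locatedD[OF located_mono[OF x q1]] and Y1 = locatedD[OF located_mono[OF y q1]]
    show "fmem i i' q1" if "fmem i' i q1"
      using fsubsetD[OF f_mono[OF X1(1) that Y1(3) X1(3)] Y1(4) X1(2)] ny[OF q1] by blast
    show "fmem i i' q1" if "feq i' i q1"
    proof -
      have "fapp f i N' q1" using fcongD[OF fcong_fapp(2) that Y1(3)] .
      from ffunction_unique[OF fun_f[OF X1(1)] X1(2) this X1(3)]
      show ?thesis using fcongD[OF fcong_fmem2 _ Y1(4)] ny[OF q1] by blast
    qed
  qed
  from fsubsetD[OF fsubset_pred[OF X(1) Y(6,7) this X(3)] X(4,2)] show ?thesis .
qed

lemma located_same:
  assumes yN: "fmem (check y) N q" and ny: "\<And>q'. q' \<preceq> q \<Longrightarrow> \<not> fmem (check y) K q'"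
  shows "feq N' N q" "feq K' K q"
proof -
  note X = locatedD[OF x] and Y = locatedD[OF y]
  have i: "feq i' i q"
  proof (rule ftriE[OF ford_linear[OF X(2) Y(12) X(12)] X(2) stable_feq])
    fix q1 assume q1: "q1 \<preceq> q"
    note X1 = locatedD[OF located_mono[OF x q1]] and Y1 = locatedD[OF located_mono[OF y q1]]
    show "feq i' i q1" if "fmem i' i q1"
      using fsubsetD[OF fsubset_pred[OF X1(1,6,7) that Y1(3)] Y1(4,2)] ny[OF q1] by blast
    show "feq i' i q1" if "fmem i i' q1"
      using unreachedD[OF Y(5) q1 that X1(3) fmem_mono[OF yN q1]] ..
  qed
  have "fapp f i N' q" using fcongD[OF fcong_fapp(2) i Y(3)] .
  from ffunction_unique[OF fun_f[OF X(1)] X(2) this X(3)] show "feq N' N q" .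
  have 1: "fsubset K' K q" using fsubset_pred[OF X(1,6,7) fcongD[OF fcong_fmem2 i Y(10)] Y(7)] .
  have 2: "fsubset K K' q" using fsubset_pred[OF X(1) Y(6,7) fcongD[OF fcong_fmem2 feq_sym[OF i] X(10)] X(7)] .
  show "feq K' K q"
  proof (rule feq_ext[OF X(2)])
    fix u q' assume q': "q' \<preceq> q"
    show "fmem u K' q' \<longleftrightarrow> fmem u K q'"
      using fsubsetD[OF stable_mono[OF stable_derived(1) 1 q'] _ le_P(1)[OF q']]
        fsubsetD[OF stable_mono[OF stable_derived(1) 2 q'] _ le_P(1)[OF q']] by blast
  qed
qed

end

end


section \<open>Reading L and U off a countably directed set of conditions\<close>

text \<open>The assumptions list what must be decided for each nonzero x with fixed names:
  membership in the two members around x, values of the isomorphism, and preimages. Preimages are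
  demanded only for a generating set of \<open>C x\<close>, which keeps the requirements few without
  a bound on the size of \<open>C x\<close>.\<close>

locale generic_filtration = forced_filtration P r R M \<C> p1 \<eta> f
  for P :: "'v::zfc set" and r and R :: "'v ring" and M :: "('v, 'v) module" and \<C> p1 \<eta> f +
  fixes g :: "'v set" and I N k K Q h :: "'v \<Rightarrow> 'v" and C :: "'v \<Rightarrow> ('v, 'v) module"
  assumes g_lower: "\<And>B. B \<subseteq> g \<Longrightarrow> countable B \<Longrightarrow> \<exists>q \<in> g. \<forall>b \<in> B. q \<preceq> b"
    and g_located: "\<And>x. x \<in> carrier M - {\<zero>\<^bsub>M\<^esub>} \<Longrightarrow> \<exists>q \<in> g. located x (I x) (N x) (k x) (K x) (C x) (Q x) (h x) q"
    and g_upper: "\<And>x y. x \<in> carrier M - {\<zero>\<^bsub>M\<^esub>} \<Longrightarrow> y \<in> carrier M \<Longrightarrow>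
      \<exists>q \<in> g. (\<forall>q'. q' \<preceq> q \<longrightarrow> \<not> fmem (check y) (N x) q') \<or>
        fmem (check y) (N x) q \<and> (\<exists>c. fval M (K x) (h x) y c q)"
    and g_lower_part: "\<And>x y. x \<in> carrier M - {\<zero>\<^bsub>M\<^esub>} \<Longrightarrow> y \<in> carrier M \<Longrightarrow>
      \<exists>q \<in> g. (\<forall>q'. q' \<preceq> q \<longrightarrow> \<not> fmem (check y) (K x) q') \<or> fmem (check y) (K x) q"
    and g_onto: "\<And>x. x \<in> carrier M - {\<zero>\<^bsub>M\<^esub>} \<Longrightarrow> \<exists>E. E \<subseteq> carrier (C x) \<and> span R (C x) E = carrier (C x) \<and>
      (\<forall>c \<in> E. \<exists>q \<in> g. \<exists>y \<in> carrier M. fmem (check y) (N x) q \<and> fval M (K x) (h x) y c q)"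
begin

text \<open>Ground-model traces, as decided by g, of the first member of the filtration that
  contains x and, below, of its predecessor.\<close>

definition "U x = {y \<in> carrier M. \<exists>q \<in> g. fmem (check y) (N x) q}"
definition "L x = {y \<in> carrier M. \<exists>q \<in> g. fmem (check y) (K x) q}"

lemma g_P: "g \<subseteq> P"
proof
  fix q assume "q \<in> g"
  then obtain s where "s \<preceq> q" using g_lower[of "{q}"] by auto
  then show "q \<in> P" using le_P by blast
qed

lemma directed: "q \<in> g \<Longrightarrow> q' \<in> g \<Longrightarrow> \<exists>s \<in> g. s \<preceq> q \<and> s \<preceq> q'"
  using g_lower[of "{q, q'}"] by auto

lemma directed3: "q \<in> g \<Longrightarrow> q' \<in> g \<Longrightarrow> q'' \<in> g \<Longrightarrow> \<exists>s \<in> g. s \<preceq> q \<and> s \<preceq> q' \<and> s \<preceq> q''"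
  using g_lower[of "{q, q', q''}"] by auto

abbreviation loc where "loc x q \<equiv> located x (I x) (N x) (k x) (K x) (C x) (Q x) (h x) q"

context
  fixes x assumes x: "x \<in> carrier M - {\<zero>\<^bsub>M\<^esub>}"
begin

lemma submodule_U: "submodule (U x) R M" and submodule_L: "submodule (L x) R M"
proof -
  obtain q where q: "q \<in> g" "loc x q" using g_located[OF x] by blast
  show "submodule (U x) R M" unfolding U_def
    by (rule fsubmodule_ground[OF locatedD(13)[OF q(2)] left_module_axioms smM smR q(1) g_P directed])
  show "submodule (L x) R M" unfolding L_def
    by (rule fsubmodule_ground[OF locatedD(14)[OF q(2)] left_module_axioms smM smR q(1) g_P directed])
qed

text \<open>Each alternative comes with a condition that also locates x. In particular nonmembership
  is witnessed by a condition below which membership is never forced, and so can be used in forcing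
  arguments.\<close>

lemma U_cases:
  assumes y: "y \<in> carrier M"
  obtains q c where "q \<in> g" "loc x q" "y \<in> U x" "fmem (check y) (N x) q" "fval M (K x) (h x) y c q"
  | q where "q \<in> g" "loc x q" "y \<notin> U x" "\<And>q'. q' \<preceq> q \<Longrightarrow> \<not> fmem (check y) (N x) q'"
proof -
  obtain q where q: "q \<in> g" "loc x q" using g_located[OF x] by blast
  obtain q1 where q1: "q1 \<in> g" "(\<forall>q'. q' \<preceq> q1 \<longrightarrow> \<not> fmem (check y) (N x) q') \<or>
        fmem (check y) (N x) q1 \<and> (\<exists>c. fval M (K x) (h x) y c q1)" using g_upper[OF x y] by blast
  obtain s where s: "s \<in> g" "s \<preceq> q" "s \<preceq> q1" using directed q(1) q1(1) by blast
  note loc = located_mono[OF q(2) s(2)]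
  from q1(2) show thesis
  proof
    assume n: "\<forall>q'. q' \<preceq> q1 \<longrightarrow> \<not> fmem (check y) (N x) q'"
    have "y \<notin> U x"
    proof
      assume "y \<in> U x"
      then obtain q2 where q2: "q2 \<in> g" "fmem (check y) (N x) q2" unfolding U_def by blast
      then show False using directed[OF q2(1) q1(1)] n fmem_mono[OF q2(2)] by blast
    qed
    then show thesis using that(2)[OF s(1) loc] n le_trans[OF _ s(3)] by blast
  next
    assume n: "fmem (check y) (N x) q1 \<and> (\<exists>c. fval M (K x) (h x) y c q1)"
    then have "y \<in> U x" unfolding U_def using q1(1) y by blast
    then show thesis using that(1)[OF s(1) loc] n fmem_mono[OF _ s(3)] fval_mono[OF _ s(3)] by blast
  qed
qed

lemma L_cases:
  assumes y: "y \<in> carrier M"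
  obtains q where "q \<in> g" "loc x q" "y \<in> L x" "fmem (check y) (K x) q"
  | q where "q \<in> g" "loc x q" "y \<notin> L x" "\<And>q'. q' \<preceq> q \<Longrightarrow> \<not> fmem (check y) (K x) q'"
proof -
  obtain q where q: "q \<in> g" "loc x q" using g_located[OF x] by blast
  obtain q1 where q1: "q1 \<in> g" "(\<forall>q'. q' \<preceq> q1 \<longrightarrow> \<not> fmem (check y) (K x) q') \<or> fmem (check y) (K x) q1"
    using g_lower_part[OF x y] by blast
  obtain s where s: "s \<in> g" "s \<preceq> q" "s \<preceq> q1" using directed q(1) q1(1) by blast
  note loc = located_mono[OF q(2) s(2)]
  from q1(2) show thesis
  proof
    assume n: "\<forall>q'. q' \<preceq> q1 \<longrightarrow> \<not> fmem (check y) (K x) q'"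
    have "y \<notin> L x"
    proof
      assume "y \<in> L x"
      then obtain q2 where q2: "q2 \<in> g" "fmem (check y) (K x) q2" unfolding L_def by blast
      then show False using directed[OF q2(1) q1(1)] n fmem_mono[OF q2(2)] by blast
    qed
    then show thesis using that(2)[OF s(1) loc] n le_trans[OF _ s(3)] by blast
  next
    assume n: "fmem (check y) (K x) q1"
    then have "y \<in> L x" unfolding L_def using q1(1) y by blast
    then show thesis using that(1)[OF s(1) loc] n fmem_mono[OF _ s(3)] by blast
  qed
qed

lemma L_subset_U: "L x \<subseteq> U x"
proof
  fix y assume y: "y \<in> L x"
  then have yM: "y \<in> carrier M" unfolding L_def by blast
  from L_cases[OF yM] y obtain q where "q \<in> g" "loc x q" "fmem (check y) (K x) q" by metis
  then show "y \<in> U x" unfolding U_def using fsubsetD[OF locatedD(11) _ locatedD(2)] yM by blast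
qed

lemma in_U: "x \<in> U x" and notin_L: "x \<notin> L x"
proof -
  obtain q where q: "q \<in> g" "loc x q" using g_located[OF x] by blast
  show "x \<in> U x" unfolding U_def using q locatedD(4)[OF q(2)] x by blast
  show "x \<notin> L x"
  proof
    assume "x \<in> L x"
    then obtain q2 where q2: "q2 \<in> g" "fmem (check x) (K x) q2" unfolding L_def by blast
    then obtain s where s: "s \<in> g" "s \<preceq> q" "s \<preceq> q2" using directed q(1) by blast
    note S = locatedD[OF located_mono[OF q(2) s(2)]]
    show False using unreachedD[OF S(5) le_refl[OF S(2)] S(10,7) fmem_mono[OF q2(2) s(3)]] .
  qed
qed

definition "\<phi> y = (SOME c. \<exists>q \<in> g. fval M (K x) (h x) y c q)"

lemma fval_\<phi>:
  assumes y: "y \<in> U x"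
  shows "\<exists>q \<in> g. loc x q \<and> fmem (check y) (N x) q \<and> fval M (K x) (h x) y (\<phi> y) q"
proof -
  have yM: "y \<in> carrier M" using y unfolding U_def by blast
  from U_cases[OF yM] y obtain q c where q: "q \<in> g" "loc x q" "fmem (check y) (N x) q" "fval M (K x) (h x) y c q" by metis
  have "\<exists>q \<in> g. fval M (K x) (h x) y (\<phi> y) q" unfolding \<phi>_def by (rule someI_ex) (use q in blast)
  then obtain q1 where q1: "q1 \<in> g" "fval M (K x) (h x) y (\<phi> y) q1" by blast
  obtain s where s: "s \<in> g" "s \<preceq> q" "s \<preceq> q1" using directed q(1) q1(1) by blast
  show ?thesis
    using s(1) located_mono[OF q(2) s(2)] fmem_mono[OF q(3) s(2)] fval_mono[OF q1(2) s(3)] by blast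
qed

lemma C_module: "left_module R (C x)" "small (carrier (C x))"
  using g_located[OF x] \<C> locatedD(8) unfolding is_module_def by blast+

text \<open>Each identity is checked below a common lower bound of the finitely many conditions
  involved. Surjectivity follows since the image of \<phi> is a submodule containing generators of
  \<open>C x\<close>.\<close>

lemma quot_iso_\<phi>: "quot_iso R M (U x) (L x) (C x) \<phi>"
proof -
  interpret C: left_module R "C x" by (rule C_module)
  note sms = smM smR C_module(2) and UD = submoduleD[OF submodule_U]
  note rules = locatedD(9,14,13)
  have \<phi>C: "\<phi> y \<in> carrier (C x)" if y: "y \<in> U x" for y
  proof -
    obtain q where q: "loc x q" "fval M (K x) (h x) y (\<phi> y) q" using fval_\<phi>[OF y] by blast
    from fval_carrier[OF rules[OF q(1)] left_module_axioms C_module(1) sms le_refl[OF locatedD(2)[OF q(1)]] q(2)] show ?thesis .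
  qed
  have add: "\<phi> (y \<oplus>\<^bsub>M\<^esub> z) = \<phi> y \<oplus>\<^bsub>C x\<^esub> \<phi> z" if y: "y \<in> U x" "z \<in> U x" for y z
  proof -
    obtain q1 q2 q3 where q: "q1 \<in> g" "q2 \<in> g" "q3 \<in> g" "loc x q1" "fmem (check y) (N x) q1" "fval M (K x) (h x) y (\<phi> y) q1"
      "fmem (check z) (N x) q2" "fval M (K x) (h x) z (\<phi> z) q2" "fval M (K x) (h x) (y \<oplus>\<^bsub>M\<^esub> z) (\<phi> (y \<oplus>\<^bsub>M\<^esub> z)) q3"
      using fval_\<phi>[OF y(1)] fval_\<phi>[OF y(2)] fval_\<phi>[OF UD(3)[OF y]] by blast
    obtain s where s: "s \<preceq> q1" "s \<preceq> q2" "s \<preceq> q3" using directed3[OF q(1-3)] by blast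
    show ?thesis
      by (rule fval_add[OF rules[OF q(4)] left_module_axioms C_module(1) sms s(1) _ fmem_mono[OF q(5) s(1)] fval_mono[OF q(6) s(1)]
            _ fmem_mono[OF q(7) s(2)] fval_mono[OF q(8) s(2)] fval_mono[OF q(9) s(3)]])
        (use y UD(1) in blast)+
  qed
  have smult: "\<phi> (a \<odot>\<^bsub>M\<^esub> y) = a \<odot>\<^bsub>C x\<^esub> \<phi> y" if a: "a \<in> carrier R" and y: "y \<in> U x" for a y
  proof -
    obtain q1 q2 where q: "q1 \<in> g" "q2 \<in> g" "loc x q1" "fmem (check y) (N x) q1" "fval M (K x) (h x) y (\<phi> y) q1"
      "fval M (K x) (h x) (a \<odot>\<^bsub>M\<^esub> y) (\<phi> (a \<odot>\<^bsub>M\<^esub> y)) q2"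
      using fval_\<phi>[OF y] fval_\<phi>[OF UD(4)[OF a y]] by blast
    obtain s where s: "s \<preceq> q1" "s \<preceq> q2" using directed[OF q(1-2)] by blast
    show ?thesis
      by (rule fval_smult[OF rules[OF q(3)] left_module_axioms C_module(1) sms s(1) a _ fmem_mono[OF q(4) s(1)] fval_mono[OF q(5) s(1)]
            fval_mono[OF q(6) s(2)]])
        (use y UD(1) in blast)
  qed
  have zero: "\<phi> \<zero>\<^bsub>M\<^esub> = \<zero>\<^bsub>C x\<^esub>"
    using smult[OF R.zero_closed UD(2)] \<phi>C[OF UD(2)] add[OF UD(2,2)] by simp
  have ker: "\<phi> y = \<zero>\<^bsub>C x\<^esub> \<longleftrightarrow> y \<in> L x" if y: "y \<in> U x" for y
  proof -
    have yM: "y \<in> carrier M" using y UD(1) by blast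
    obtain q1 q2 where q: "q1 \<in> g" "q2 \<in> g" "loc x q1" "fval M (K x) (h x) y (\<phi> y) q1" "fval M (K x) (h x) \<zero>\<^bsub>M\<^esub> (\<phi> \<zero>\<^bsub>M\<^esub>) q2"
      using fval_\<phi>[OF y] fval_\<phi>[OF UD(2)] by blast
    obtain s where s: "s \<in> g" "s \<preceq> q1" "s \<preceq> q2" using directed[OF q(1-2)] by blast
    have *: "fmem (check y) (K x) t \<longleftrightarrow> \<phi> y = \<zero>\<^bsub>C x\<^esub>" if t: "t \<preceq> s" for t
      using fval_kernel[OF rules[OF q(3)] left_module_axioms C_module(1) sms le_trans[OF t s(2)] yM
          fval_mono[OF q(4) le_trans[OF t s(2)]] fval_mono[OF q(5) le_trans[OF t s(3)]]] zero by simp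
    show ?thesis
    proof
      assume "\<phi> y = \<zero>\<^bsub>C x\<^esub>"
      then show "y \<in> L x" unfolding L_def using *[OF le_refl[OF le_P(1)[OF s(2)]]] s(1) yM by blast
    next
      assume "y \<in> L x"
      then obtain q3 where q3: "q3 \<in> g" "fmem (check y) (K x) q3" unfolding L_def by blast
      then obtain t where "t \<preceq> s" "t \<preceq> q3" using directed[OF s(1)] by blast
      then show "\<phi> y = \<zero>\<^bsub>C x\<^esub>" using * fmem_mono[OF q3(2)] by blast
    qed
  qed
  have "submodule (\<phi> ` U x) R (C x)"
  proof (rule C.submoduleI)
    show "\<phi> ` U x \<subseteq> carrier (C x)" using \<phi>C by blast
    show "\<zero>\<^bsub>C x\<^esub> \<in> \<phi> ` U x" using zero UD(2) by (metis imageI)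
  next
    fix c d assume "c \<in> \<phi> ` U x" "d \<in> \<phi> ` U x"
    then obtain y z where y: "y \<in> U x" "c = \<phi> y" and z: "z \<in> U x" "d = \<phi> z" by blast
    show "c \<oplus>\<^bsub>C x\<^esub> d \<in> \<phi> ` U x" unfolding y(2) z(2) add[OF y(1) z(1), symmetric] by (rule imageI[OF UD(3)[OF y(1) z(1)]])
  next
    fix a c assume a: "a \<in> carrier R" and "c \<in> \<phi> ` U x"
    then obtain y where y: "y \<in> U x" "c = \<phi> y" by blast
    show "a \<odot>\<^bsub>C x\<^esub> c \<in> \<phi> ` U x" unfolding y(2) smult[OF a y(1), symmetric] by (rule imageI[OF UD(4)[OF a y(1)]])
  qed
  moreover obtain E where E: "E \<subseteq> carrier (C x)" "span R (C x) E = carrier (C x)"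
    "\<And>c. c \<in> E \<Longrightarrow> \<exists>q \<in> g. \<exists>y \<in> carrier M. fmem (check y) (N x) q \<and> fval M (K x) (h x) y c q"
    using g_onto[OF x] by blast
  have "E \<subseteq> \<phi> ` U x"
  proof
    fix c assume "c \<in> E"
    then obtain q1 y where q1: "q1 \<in> g" "y \<in> carrier M" "fmem (check y) (N x) q1" "fval M (K x) (h x) y c q1" using E(3) by blast
    then have yU: "y \<in> U x" unfolding U_def by blast
    obtain q2 where q2: "q2 \<in> g" "loc x q2" "fval M (K x) (h x) y (\<phi> y) q2" using fval_\<phi>[OF yU] by blast
    obtain s where s: "s \<preceq> q1" "s \<preceq> q2" using directed[OF q1(1) q2(1)] by blast
    have "c = \<phi> y"
      by (rule fval_unique[OF rules[OF q2(2)] left_module_axioms C_module(1) sms s(2) fval_mono[OF q1(4) s(1)] fval_mono[OF q2(3) s(2)]])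
    then show "c \<in> \<phi> ` U x" using yU by blast
  qed
  ultimately have "carrier (C x) \<subseteq> \<phi> ` U x" using C.span_least[of "\<phi> ` U x" E] E(2) by blast
  then show ?thesis unfolding quot_iso_def using \<phi>C add smult ker by blast
qed

end

lemma U_cong: "q \<in> g \<Longrightarrow> feq (N y) (N x) q \<Longrightarrow> U y = U x"
  and L_cong: "q \<in> g \<Longrightarrow> feq (K y) (K x) q \<Longrightarrow> L y = L x"
proof -
  have *: "\<exists>q \<in> g. fmem z B q" if "q \<in> g" "feq A B q" "\<exists>q \<in> g. fmem z A q" for A B q z
    using that directed fmem_mono feq_mono fcongD[OF fcong_fmem2] by meson
  show "q \<in> g \<Longrightarrow> feq (N y) (N x) q \<Longrightarrow> U y = U x" unfolding U_def using *[OF _ feq_sym] * by blast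
  show "q \<in> g \<Longrightarrow> feq (K y) (K x) q \<Longrightarrow> L y = L x" unfolding L_def using *[OF _ feq_sym] * by blast
qed

lemma indexed_filtration: "indexed_filtration R \<C> M (carrier M) L U"
  unfolding indexed_filtration_def
proof (intro conjI ballI impI)
  fix x assume x: "x \<in> carrier M - {\<zero>\<^bsub>M\<^esub>}"
  show "submodule (L x) R M" "submodule (U x) R M" "L x \<subseteq> U x" "x \<in> U x" "x \<notin> L x"
    using submodule_L submodule_U L_subset_U in_U notin_L x by blast+
  show "U x \<subseteq> carrier M" unfolding U_def by blast
  show "\<exists>C\<in>\<C>. \<exists>\<phi>. quot_iso R M (U x) (L x) C \<phi>"
    using quot_iso_\<phi>[OF x] g_located[OF x] locatedD(8) by blast
  fix y assume y: "y \<in> carrier M - {\<zero>\<^bsub>M\<^esub>}"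
  have yM: "y \<in> carrier M" using y by blast
  obtain q0 where q0: "q0 \<in> g" "loc y q0" using g_located[OF y] by blast
  show "U y \<subseteq> L x" if "y \<in> L x"
  proof -
    from L_cases[OF x yM] that obtain q where q: "q \<in> g" "loc x q" "fmem (check y) (K x) q" by metis
    obtain s where s: "s \<in> g" "s \<preceq> q" "s \<preceq> q0" using directed[OF q(1) q0(1)] by blast
    note sub = located_below(2)[OF located_mono[OF q(2) s(2)] located_mono[OF q0(2) s(3)] fmem_mono[OF q(3) s(2)]]
    show ?thesis
    proof
      fix z assume "z \<in> U y"
      then obtain q1 where q1: "q1 \<in> g" "z \<in> carrier M" "fmem (check z) (N y) q1" unfolding U_def by blast
      obtain t where t: "t \<in> g" "t \<preceq> s" "t \<preceq> q1" using directed[OF s(1) q1(1)] by blast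
      show "z \<in> L x" unfolding L_def
        using fsubsetD[OF stable_mono[OF stable_derived(1) sub t(2)] fmem_mono[OF q1(3) t(3)] le_P(1)[OF t(2)]] t(1) q1(2) by blast
    qed
  qed
  show "U y = U x" "L y = L x" if yU: "y \<in> U x" and yL: "y \<notin> L x"
  proof -
    from L_cases[OF x yM] yL obtain q where q: "q \<in> g" "loc x q" "\<And>q'. q' \<preceq> q \<Longrightarrow> \<not> fmem (check y) (K x) q'" by metis
    from yU obtain q1 where q1: "q1 \<in> g" "fmem (check y) (N x) q1" unfolding U_def by blast
    obtain s where s: "s \<in> g" "s \<preceq> q" "s \<preceq> q0" "s \<preceq> q1" using directed3[OF q(1) q0(1) q1(1)] by blast
    have n: "\<not> fmem (check y) (K x) q'" if "q' \<preceq> s" for q' using q(3)[OF le_trans[OF that s(2)]] .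
    note eq = located_same[OF located_mono[OF q(2) s(2)] located_mono[OF q0(2) s(3)] fmem_mono[OF q1(2) s(4)] n]
    show "U y = U x" using U_cong[OF s(1) eq(1)] .
    show "L y = L x" using L_cong[OF s(1) eq(2)] .
  qed
  show "x \<in> L y" if "y \<notin> U x"
  proof -
    from U_cases[OF x yM] that obtain q where q: "q \<in> g" "loc x q" "\<And>q'. q' \<preceq> q \<Longrightarrow> \<not> fmem (check y) (N x) q'" by metis
    obtain s where s: "s \<in> g" "s \<preceq> q" "s \<preceq> q0" using directed[OF q(1) q0(1)] by blast
    have n: "\<not> fmem (check y) (N x) q'" if "q' \<preceq> s" for q' using q(3)[OF le_trans[OF that s(2)]] .
    show ?thesis unfolding L_def
      using located_above[OF located_mono[OF q(2) s(2)] located_mono[OF q0(2) s(3)] n] s(1) x by blast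
  qed
next
  \<comment> \<open>A descending sequence yields decreasing indices, each decrease forced by some
    condition in g. Countable directedness gives one condition forcing all of them, contrary to
    foundation in the extension.\<close>
  show "wf {(y, x). x \<in> carrier M - {\<zero>\<^bsub>M\<^esub>} \<and> y \<in> carrier M - {\<zero>\<^bsub>M\<^esub>} \<and> y \<in> L x}"
    unfolding wf_iff_no_infinite_down_chain
  proof
    assume "\<exists>\<xi>. \<forall>n. (\<xi> (Suc n), \<xi> n) \<in> {(y, x). x \<in> carrier M - {\<zero>\<^bsub>M\<^esub>} \<and> y \<in> carrier M - {\<zero>\<^bsub>M\<^esub>} \<and> y \<in> L x}"
    then obtain \<xi> where \<xi>: "\<And>n :: nat. \<xi> n \<in> carrier M - {\<zero>\<^bsub>M\<^esub>}" "\<And>n. \<xi> (Suc n) \<in> L (\<xi> n)" by blast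
    have "\<exists>q \<in> g. fmem (I (\<xi> (Suc n))) (I (\<xi> n)) q" for n
    proof -
      have "\<xi> (Suc n) \<in> carrier M" using \<xi>(1) by blast
      from L_cases[OF \<xi>(1)[of n] this] \<xi>(2) obtain q where
        q: "q \<in> g" "loc (\<xi> n) q" "fmem (check (\<xi> (Suc n))) (K (\<xi> n)) q" by metis
      obtain q0 where q0: "q0 \<in> g" "loc (\<xi> (Suc n)) q0" using g_located[OF \<xi>(1)] by blast
      obtain s where s: "s \<in> g" "s \<preceq> q" "s \<preceq> q0" using directed[OF q(1) q0(1)] by blast
      show ?thesis
        using located_below(1)[OF located_mono[OF q(2) s(2)] located_mono[OF q0(2) s(3)] fmem_mono[OF q(3) s(2)]] s(1) by blast
    qed
    then obtain q where q: "\<And>n. q n \<in> g" "\<And>n. fmem (I (\<xi> (Suc n))) (I (\<xi> n)) (q n)" by metis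
    obtain s where s: "s \<in> g" "\<And>n. s \<preceq> q n" using g_lower[of "range q"] q(1) by blast
    show False
      by (rule no_infinite_descent[of s "\<lambda>n. I (\<xi> n)"]) (rule le_P(1)[OF s(2)] fmem_mono[OF q(2) s(2)])+
  qed
qed

end


context forced_filtration
begin

text \<open>Three requirements are bundled: the position of y relative to N with its value, the
  position of y relative to K, and a preimage of c. A single family of dense sets then suffices once
  x is located.\<close>

definition decided :: "'v \<Rightarrow> 'v \<Rightarrow> 'v \<Rightarrow> 'v \<Rightarrow> 'v \<Rightarrow> 'v \<Rightarrow> bool"
  where "decided y c N K h q \<longleftrightarrow>
    ((\<forall>q'. q' \<preceq> q \<longrightarrow> \<not> fmem (check y) N q') \<or> fmem (check y) N q \<and> (\<exists>c. fval M K h y c q)) \<and>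
    ((\<forall>q'. q' \<preceq> q \<longrightarrow> \<not> fmem (check y) K q') \<or> fmem (check y) K q) \<and>
    (\<exists>z \<in> carrier M. fmem (check z) N q \<and> fval M K h z c q)"

text \<open>Needed because the requirements met by \<open>omega1_generic\<close> must persist to
  stronger conditions.\<close>

lemma decided_mono: "decided y c N K h q \<Longrightarrow> q' \<preceq> q \<Longrightarrow> decided y c N K h q'"
  unfolding decided_def using le_trans[of _ q' q] fmem_mono[of _ _ q q'] fval_mono[of M K h _ _ q q'] by meson

lemma decided_dense:
  assumes loc: "located x i N k K C Q h q" and C: "is_module R C" and y: "y \<in> carrier M" and c: "c \<in> carrier C" and q': "q' \<preceq> q"
  shows "\<exists>q''. q'' \<preceq> q' \<and> decided y c N K h q''"
proof -
  have C': "left_module R C" "small (carrier C)" using C unfolding is_module_def by blast+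
  note X = locatedD(9,14,13)[OF loc] and ctx = left_module_axioms C'(1) smM smR C'(2)
  have "\<exists>q1. q1 \<preceq> q' \<and> ((\<forall>q'. q' \<preceq> q1 \<longrightarrow> \<not> fmem (check y) N q') \<or> fmem (check y) N q1 \<and> (\<exists>c. fval M K h y c q1))"
  proof (cases "\<exists>q1. q1 \<preceq> q' \<and> fmem (check y) N q1")
    case True
    then obtain q1 where q1: "q1 \<preceq> q'" "fmem (check y) N q1" by blast
    from fval_exists[OF X ctx le_trans[OF q1(1) q'] y q1(2)] obtain q2 c where "q2 \<preceq> q1" "fval M K h y c q2" by blast
    then show ?thesis using le_trans[OF _ q1(1)] fmem_mono[OF q1(2)] by blast
  next
    case False
    then show ?thesis using le_refl[OF le_P(1)[OF q']] by blast
  qed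
  then obtain q1 where q1: "q1 \<preceq> q'"
    "(\<forall>q'. q' \<preceq> q1 \<longrightarrow> \<not> fmem (check y) N q') \<or> fmem (check y) N q1 \<and> (\<exists>c. fval M K h y c q1)" by blast
  have "\<exists>q2. q2 \<preceq> q1 \<and> ((\<forall>q'. q' \<preceq> q2 \<longrightarrow> \<not> fmem (check y) K q') \<or> fmem (check y) K q2)"
    using le_refl[OF le_P(1)[OF q1(1)]] by blast
  then obtain q2 where q2: "q2 \<preceq> q1" "(\<forall>q'. q' \<preceq> q2 \<longrightarrow> \<not> fmem (check y) K q') \<or> fmem (check y) K q2" by blast
  have 2: "q2 \<preceq> q" using le_trans[OF q2(1) le_trans[OF q1(1) q']] .
  from fval_surj[OF X ctx 2 c] obtain q3 z where
    q3: "q3 \<preceq> q2" "z \<in> carrier M" "fmem (check z) N q3" "fval M K h z c q3" by blast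
  have 31: "q3 \<preceq> q1" using le_trans[OF q3(1) q2(1)] .
  have "(\<forall>q'. q' \<preceq> q3 \<longrightarrow> \<not> fmem (check y) N q') \<or> fmem (check y) N q3 \<and> (\<exists>c. fval M K h y c q3)"
    using q1(2) le_trans[OF _ 31] fmem_mono[OF _ 31] fval_mono[OF _ 31] by meson
  moreover have "(\<forall>q'. q' \<preceq> q3 \<longrightarrow> \<not> fmem (check y) K q') \<or> fmem (check y) K q3"
    using q2(2) le_trans[OF _ q3(1)] fmem_mono[OF _ q3(1)] by meson
  ultimately have "decided y c N K h q3" unfolding decided_def using q3 by blast
  then show ?thesis using le_trans[OF 31 q1(1)] by blast
qed

text \<open>The bound on the size of M keeps the number of requirements at aleph_1, which is what a
  chain of length omega_1 can meet.\<close>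

lemma indexed_filtration_exists:
  assumes sc: "sigma_closed P r" and card: "|carrier M| \<le>o aleph1"
    and cp: "\<And>C. C \<in> \<C> \<Longrightarrow> countably_presented R C"
  shows "\<exists>L U. indexed_filtration R \<C> M (carrier M) L U"
proof -
  define E where "E C = (SOME E. countable E \<and> E \<subseteq> carrier C \<and> span R C E = carrier C)" for C :: "('v, 'v) module"
  have E: "countable (E C)" "E C \<subseteq> carrier C" "span R C (E C) = carrier C" if "C \<in> \<C>" for C
  proof -
    have "left_module R C" using \<C>[OF that] unfolding is_module_def by blast
    from someI_ex[OF countably_presented_generated[OF this cp[OF that]]]
    show "countable (E C)" "E C \<subseteq> carrier C" "span R C (E C) = carrier C" unfolding E_def by blast+
  qed
  \<comment> \<open>Zero is inserted so that the enumerated set is nonempty and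
    \<open>from_nat_into\<close> always gives an element of it.\<close>
  define e where "e C n = from_nat_into (insert \<zero>\<^bsub>C\<^esub> (E C)) n" for C :: "('v, 'v) module" and n
  have eC: "e C n \<in> carrier C" if C: "C \<in> \<C>" for C n
  proof -
    interpret C: left_module R C using \<C>[OF C] unfolding is_module_def by blast
    have "e C n \<in> insert \<zero>\<^bsub>C\<^esub> (E C)" unfolding e_def by (rule from_nat_into) simp
    then show ?thesis using E(2)[OF C] by auto
  qed
  have eE: "\<exists>n. e C n = c" if "C \<in> \<C>" "c \<in> E C" for C c
    unfolding e_def using from_nat_into_surj[of "insert \<zero>\<^bsub>C\<^esub> (E C)" c] E(1) that by auto
  define good where "good x d q \<longleftrightarrow> (case d of (i, N, k, K, C, Q, h) \<Rightarrow> located x i N k K C Q h q)" for x d q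
  define dec where "dec y n d q \<longleftrightarrow> (case d of (i :: 'v, N, k :: 'v, K, C, Q :: 'v, h) \<Rightarrow> decided y (e C n) N K h q)" for y n d q
  \<comment> \<open>Relative to q: if q already locates x, decide y and a preimage of the n-th
    generator for the data chosen from q; if not, locate x. This is the reason for the parameter q
    in \<open>omega1_generic\<close>.\<close>
  define D where "D q t q' \<longleftrightarrow> (case t of (x, y, n) \<Rightarrow> x \<noteq> \<zero>\<^bsub>M\<^esub> \<longrightarrow>
    (if \<exists>d. good x d q then dec y n (SOME d. good x d q) q' else \<exists>d. good x d q'))" for q t q'
  let ?T = "carrier M \<times> carrier M \<times> (UNIV :: nat set)"
  have card_nat: "|UNIV :: nat set| \<le>o aleph1" by (rule countable_ordLeq_aleph1) simp
  have T: "|?T| \<le>o aleph1" by (intro ordLeq_aleph1_Times card card_nat)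
  have Tne: "?T \<noteq> {}" using M.zero_closed by blast
  have dense: "\<exists>q''. q'' \<preceq> q' \<and> D q t q''" if q: "q \<preceq> p1" and t: "t \<in> ?T" and q': "q' \<preceq> q" for q t q'
  proof -
    obtain x y n where t': "t = (x, y, n)" "x \<in> carrier M" "y \<in> carrier M" using t by blast
    show ?thesis
    proof (cases "x = \<zero>\<^bsub>M\<^esub>")
      case True
      then show ?thesis using t' le_refl[OF le_P(1)[OF q']] unfolding D_def by auto
    next
      case x: False
      show ?thesis
      proof (cases "\<exists>d. good x d q")
        case True
        obtain i N k K C Q h where d: "(SOME d. good x d q) = (i, N, k, K, C, Q, h)" using prod_cases7 by blast
        have loc: "located x i N k K C Q h q" using someI_ex[OF True] unfolding d by (simp add: good_def)
        have C: "C \<in> \<C>" using locatedD(8)[OF loc] .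
        have "D q t q''" if "decided y (e C n) N K h q''" for q''
          unfolding D_def t'(1) prod.case if_P[OF True] d dec_def using that by blast
        then show ?thesis using decided_dense[OF loc \<C>[OF C] t'(3) eC[OF C] q', of n] by blast
      next
        case False
        from located_exists[OF le_trans[OF q' q] t'(2) x] obtain q'' i N k K C Q h where
          "q'' \<preceq> q'" "located x i N k K C Q h q''" by blast
        then have "q'' \<preceq> q'" "\<exists>d. good x d q''" unfolding good_def by (blast, intro exI[of _ "(i, N, k, K, C, Q, h)"]) simp
        then show ?thesis unfolding D_def t'(1) prod.case if_not_P[OF False] by blast
      qed
    qed
  qed
  have opn: "D q t q''" if "D q t q'" "q'' \<preceq> q'" for q t q' q''
  proof -
    have 1: "good x d q''" if "good x d q'" for x d using that located_mono[OF _ \<open>q'' \<preceq> q'\<close>] by (auto simp: good_def)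
    have 2: "dec y n d q''" if "dec y n d q'" for y n d using that decided_mono[OF _ \<open>q'' \<preceq> q'\<close>] by (auto simp: dec_def)
    obtain x y n where t: "t = (x, y, n)" using prod_cases3 by blast
    show ?thesis
    proof (cases "\<exists>d. good x d q")
      case True
      show ?thesis using \<open>D q t q'\<close> 2[of y n "SOME d. good x d q"] unfolding D_def t prod.case if_P[OF True] by blast
    next
      case False
      show ?thesis using \<open>D q t q'\<close> 1[of x] unfolding D_def t prod.case if_not_P[OF False] by blast
    qed
  qed
  have "\<exists>g. (\<forall>q \<in> g. q \<preceq> p1) \<and> (\<forall>B \<subseteq> g. countable B \<longrightarrow> (\<exists>q \<in> g. \<forall>b \<in> B. q \<preceq> b)) \<and>
    (\<forall>q \<in> g. \<forall>t \<in> ?T. \<exists>q' \<in> g. D q t q')"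
    by (rule omega1_generic[OF sc p1 T Tne dense opn])
  then obtain g where g': "(\<forall>q \<in> g. q \<preceq> p1) \<and> (\<forall>B \<subseteq> g. countable B \<longrightarrow> (\<exists>q \<in> g. \<forall>b \<in> B. q \<preceq> b)) \<and>
    (\<forall>q \<in> g. \<forall>t \<in> ?T. \<exists>q' \<in> g. D q t q')" by (rule exE)
  have g: "\<exists>q \<in> g. \<forall>b \<in> B. q \<preceq> b" if "B \<subseteq> g" "countable B" for B
    using conjunct1[OF conjunct2[OF g'], THEN spec[of _ B]] that by (rule_tac mp) simp_all
  have gD: "\<exists>q' \<in> g. D q t q'" if "q \<in> g" "t \<in> ?T" for q t
    by (rule bspec[OF bspec[OF conjunct2[OF conjunct2[OF g']] that(1)] that(2)])
  obtain q0 where q0: "q0 \<in> g" using g[of "{}"] by auto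
  \<comment> \<open>A first requirement puts into g a condition locating x. With that condition kept
    as parameter, all later decisions concern the same names d.\<close>
  have "\<exists>d. \<exists>q \<in> g. good x d q \<and> (\<forall>y \<in> carrier M. \<forall>n. \<exists>q' \<in> g. dec y n d q')" if x: "x \<in> carrier M - {\<zero>\<^bsub>M\<^esub>}" for x
  proof -
    have "\<exists>q \<in> g. \<exists>d. good x d q" using gD[OF q0, of "(x, x, 0)"] q0 x
      unfolding D_def prod.case by (cases "\<exists>d. good x d q0") (blast, simp only: if_False, blast)
    then obtain q where q: "q \<in> g" "\<exists>d. good x d q" by blast
    have "\<exists>q' \<in> g. dec y n (SOME d. good x d q) q'" if "y \<in> carrier M" for y n
      using gD[OF q(1), of "(x, y, n)"] x that unfolding D_def prod.case if_P[OF q(2)] by blast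
    then show ?thesis using someI_ex[OF q(2)] q(1) by blast
  qed
  then obtain d where d: "\<And>x. x \<in> carrier M - {\<zero>\<^bsub>M\<^esub>} \<Longrightarrow> \<exists>q \<in> g. good x (d x) q"
      "\<And>x y n. x \<in> carrier M - {\<zero>\<^bsub>M\<^esub>} \<Longrightarrow> y \<in> carrier M \<Longrightarrow> \<exists>q' \<in> g. dec y n (d x) q'" by metis
  define I N k K C Q h where dd: "I x = fst (d x)" "N x = fst (snd (d x))" "k x = fst (snd (snd (d x)))"
    "K x = fst (snd (snd (snd (d x))))" "C x = fst (snd (snd (snd (snd (d x)))))"
    "Q x = fst (snd (snd (snd (snd (snd (d x))))))" "h x = snd (snd (snd (snd (snd (snd (d x))))))" for x
  have loc: "\<exists>q \<in> g. located x (I x) (N x) (k x) (K x) (C x) (Q x) (h x) q" if "x \<in> carrier M - {\<zero>\<^bsub>M\<^esub>}" for x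
    using d(1)[OF that] by (simp add: good_def dd case_prod_unfold)
  have dec: "\<exists>q \<in> g. decided y (e (C x) n) (N x) (K x) (h x) q" if "x \<in> carrier M - {\<zero>\<^bsub>M\<^esub>}" "y \<in> carrier M" for x y n
    using d(2)[OF that] by (simp add: dec_def dd case_prod_unfold)
  interpret generic_filtration P r R M \<C> p1 \<eta> f g I N k K Q h C
  proof
    fix x assume x: "x \<in> carrier M - {\<zero>\<^bsub>M\<^esub>}"
    show "\<exists>q \<in> g. located x (I x) (N x) (k x) (K x) (C x) (Q x) (h x) q" by (rule loc[OF x])
    have C: "C x \<in> \<C>" using loc[OF x] locatedD(8) by blast
    have hit: "\<exists>q \<in> g. \<exists>y \<in> carrier M. fmem (check y) (N x) q \<and> fval M (K x) (h x) y c q" if c: "c \<in> E (C x)" for c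
      using eE[OF C c] dec[OF x, of "\<zero>\<^bsub>M\<^esub>"] M.zero_closed unfolding decided_def by blast
    show "\<exists>E. E \<subseteq> carrier (C x) \<and> span R (C x) E = carrier (C x) \<and>
      (\<forall>c \<in> E. \<exists>q \<in> g. \<exists>y \<in> carrier M. fmem (check y) (N x) q \<and> fval M (K x) (h x) y c q)"
      by (rule exI[of _ "E (C x)"]) (use E(2,3)[OF C] hit in blast)
    fix y assume y: "y \<in> carrier M"
    show "\<exists>q \<in> g. (\<forall>q'. q' \<preceq> q \<longrightarrow> \<not> fmem (check y) (N x) q') \<or>
        fmem (check y) (N x) q \<and> (\<exists>c. fval M (K x) (h x) y c q)"
      using dec[OF x y] unfolding decided_def by blast
    show "\<exists>q \<in> g. (\<forall>q'. q' \<preceq> q \<longrightarrow> \<not> fmem (check y) (K x) q') \<or> fmem (check y) (K x) q"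
      using dec[OF x y] unfolding decided_def by blast
  qed (rule g)
  show ?thesis using indexed_filtration by blast
qed

end

context forcing_poset
begin

text \<open>Strengthening the condition twice fixes names for the index ordinal and for the
  filtration.\<close>

lemma ffiltered_indexed_filtration:
  assumes sc: "sigma_closed P r" and M: "is_module R M" "|carrier M| \<le>o aleph1" and R: "small (carrier R)"
    and \<C>: "\<And>C. C \<in> \<C> \<Longrightarrow> is_module R C \<and> countably_presented R C"
    and filt: "ffiltered R \<C> M p0" "p0 \<in> P"
  shows "\<exists>L U. indexed_filtration R \<C> M (carrier M) L U"
proof -
  interpret left_module R M using M(1) unfolding is_module_def by blast
  from fexD[OF filt(1)[unfolded ffiltered_ffiltration] filt(2)] obtain p \<eta> where
    p: "p \<preceq> p0" "(\<^bold>\<exists>f. ffiltration R \<C> M \<eta> f) p" by blast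
  from fexD[OF p(2) le_P(1)[OF p(1)]] obtain p1 f where f: "p1 \<preceq> p" and forced: "ffiltration R \<C> M \<eta> f p1" by blast
  have sm: "small (carrier M)" using M(1) unfolding is_module_def by blast
  have mod: "is_module R C" and cp: "countably_presented R C" if "C \<in> \<C>" for C using \<C>[OF that] by blast+
  interpret forced_filtration P r R M \<C> p1 \<eta> f
    by unfold_locales (rule sm R mod le_P(1)[OF f] forced | assumption)+
  show ?thesis using indexed_filtration_exists[OF sc M(2) cp] .
qed

end

lemma indexed_filtration_of_forced:
  assumes M: "is_module R M" "|carrier M| \<le>o aleph1" and R: "small (carrier R)"
    and \<C>: "\<And>C. C \<in> \<C> \<Longrightarrow> is_module R C \<and> countably_presented R C"
    and filt: "sigma_closed_potentially_filtered R \<C> M"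
  shows "\<exists>L U. indexed_filtration R \<C> M (carrier M) L U"
proof -
  obtain P r where P: "forcing_poset P r" "sigma_closed P r" "\<And>p. p \<in> P \<Longrightarrow> forcing_poset.ffiltered P r R \<C> M p"
    using filt unfolding sigma_closed_potentially_filtered_def by blast
  interpret forcing_poset P r by (rule P(1))
  obtain p0 where p0: "p0 \<in> P" using nonempty by blast
  show ?thesis by (rule ffiltered_indexed_filtration[OF P(2) M R \<C> P(3)[OF p0] p0])
qed

text \<open>Restricting the carrier to N changes neither the operations nor zero, and submodules of
  the restricted module are submodules of M.\<close>

lemma indexed_filtration_submodule:
  assumes M: "left_module R M" and N: "submodule N R M"
    and filt: "indexed_filtration R \<C> (M\<lparr>carrier := N\<rparr>) N L U"
  shows "indexed_filtration R \<C> M N L U"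
proof -
  interpret M: left_module R M by fact
  have z: "\<zero>\<^bsub>M\<lparr>carrier := N\<rparr>\<^esub> = \<zero>\<^bsub>M\<^esub>" by simp
  have q: "quot_iso R (M\<lparr>carrier := N\<rparr>) = quot_iso R M" unfolding quot_iso_def by (intro ext) simp
  note f = filt[unfolded indexed_filtration_def z q]
  show ?thesis
    unfolding indexed_filtration_def
  proof (intro conjI)
    show "\<forall>x \<in> N - {\<zero>\<^bsub>M\<^esub>}. submodule (L x) R M \<and> submodule (U x) R M \<and> L x \<subseteq> U x \<and> U x \<subseteq> N \<and>
       x \<in> U x \<and> x \<notin> L x \<and> (\<exists>C \<in> \<C>. \<exists>\<phi>. quot_iso R M (U x) (L x) C \<phi>)"
      using conjunct1[OF f] M.submodule_update_iff[OF N] by meson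
  qed (use f in blast)+
qed

section \<open>Clubs generated by finitary functions\<close>

text \<open>When e chooses supersets in a cofinal family, the value at F contains F and the values
  at all proper subsets, which makes the function monotone on finite sets. Infinite arguments get a
  dummy value.\<close>

function monotone_hull :: "('a set \<Rightarrow> 'a set) \<Rightarrow> 'a set \<Rightarrow> 'a set"
  where "monotone_hull e F = (if finite F then e (F \<union> (\<Union>G \<in> {G. G \<subset> F}. monotone_hull e G)) else {})"
  by auto
termination
  by (relation "measure (\<lambda>(e, F). card F)") (auto intro: psubset_card_mono)

declare monotone_hull.simps [simp del]

text \<open>A finite set has only finitely many proper subsets and I is closed under binary unions,
  so the recursion of \<open>monotone_hull\<close> never leaves I.\<close>

lemma monotone_cofinal_function:
  assumes fin: "\<And>F. finite F \<Longrightarrow> F \<subseteq> A \<Longrightarrow> F \<in> I" and Un: "\<And>B C. B \<in> I \<Longrightarrow> C \<in> I \<Longrightarrow> B \<union> C \<in> I"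
    and D: "D \<subseteq> I" and cof: "\<And>B. B \<in> I \<Longrightarrow> \<exists>C \<in> D. B \<subseteq> C"
  shows "\<exists>d. (\<forall>F. finite F \<longrightarrow> F \<subseteq> A \<longrightarrow> d F \<in> D \<and> F \<subseteq> d F) \<and> (\<forall>F G. finite F \<longrightarrow> G \<subseteq> F \<longrightarrow> d G \<subseteq> d F)"
proof -
  \<comment> \<open>The default \<open>UNIV\<close> outside I makes \<open>B \<subseteq> e B\<close>
    hold for every B.\<close>
  define e where "e B = (if B \<in> I then SOME C. C \<in> D \<and> B \<subseteq> C else UNIV)" for B
  have e: "e B \<in> D" if "B \<in> I" for B
    unfolding e_def using someI_ex[of "\<lambda>C. C \<in> D \<and> B \<subseteq> C"] cof[OF that] that by auto
  have sup: "B \<subseteq> e B" for B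
    unfolding e_def using someI_ex[of "\<lambda>C. C \<in> D \<and> B \<subseteq> C"] cof by auto
  let ?d = "monotone_hull e"
  have D': "?d F \<in> D \<and> F \<subseteq> ?d F" if "finite F" "F \<subseteq> A" for F
    using that
  proof (induction F rule: finite_psubset_induct)
    case (psubset F)
    have "finite G \<Longrightarrow> (\<And>G'. G' \<in> G \<Longrightarrow> G' \<subset> F) \<Longrightarrow> F \<union> (\<Union>G' \<in> G. ?d G') \<in> I" for G
    proof (induction G rule: finite_induct)
      case empty
      then show ?case using fin psubset.hyps psubset.prems by simp
    next
      case (insert G' G)
      have "?d G' \<in> I" using psubset.IH[of G'] insert.prems[of G'] psubset.prems D by blast
      moreover have "F \<union> (\<Union>(?d ` G)) \<in> I" using insert by blast
      ultimately show ?case using Un[of "F \<union> (\<Union>(?d ` G))" "?d G'"] by (simp add: ac_simps)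
    qed
    from this[of "{G. G \<subset> F}"] have "F \<union> (\<Union>G \<in> {G. G \<subset> F}. ?d G) \<in> I"
      using finite_subset[of "{G. G \<subset> F}", OF _ finite_Collect_subsets[OF psubset.hyps]] by blast
    then show ?case using e sup monotone_hull.simps[of e F] psubset.hyps by (metis Un_subset_iff)
  qed
  have "?d G \<subseteq> ?d F" if "finite F" "G \<subseteq> F" for F G
  proof (cases "G = F")
    case False
    then have "?d G \<subseteq> F \<union> (\<Union>G \<in> {G. G \<subset> F}. ?d G)" using that(2) by blast
    then have "?d G \<subseteq> e (F \<union> (\<Union>G \<in> {G. G \<subset> F}. ?d G))" by (rule order_trans[OF _ sup])
    then show ?thesis using monotone_hull.simps[of e F] that(1) by simp
  qed simp
  then show ?thesis using D' by blast
qed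

text \<open>Transfers a sequence indexed by \<open>nat\<close> to one indexed by the ordinal
  \<open>omega\<close>, as the definition of \<open>club\<close> demands.\<close>

lemma club_Union_omega:
  fixes c :: "nat \<Rightarrow> 'v::zfc set"
  assumes club: "club \<kappa> \<P> D" and \<kappa>: "|elts (omega :: 'v)| <o \<kappa>" and c: "\<And>n. c n \<in> D" "\<And>n. c n \<subseteq> c (Suc n)"
  shows "(\<Union>n. c n) \<in> D"
proof -
  define W where "W i = c (inv_into UNIV nat_ord i)" for i :: 'v
  have W: "W (nat_ord n) = c n" for n unfolding W_def by (simp add: inv_f_f inj_def)
  have "Ord (omega :: 'v)" by (rule Ord_omega)
  moreover have "elts (omega :: 'v) \<noteq> {}" by simp
  moreover have "\<forall>i \<in> elts omega. W i \<in> D" using c(1) W by auto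
  moreover have "\<forall>j \<in> elts omega. \<forall>i \<in> elts j. W i \<subseteq> W j"
    using lift_Suc_mono_le[of c, OF c(2)] by (auto simp: W elts_nat_ord)
  ultimately have "(\<Union>i \<in> elts omega. W i) \<in> D" using club \<kappa> unfolding club_def by blast
  then show ?thesis by (simp add: W)
qed

context
  fixes \<kappa> and \<P> D :: "'v::zfc set set" and A :: "'v set" and d :: "'v set \<Rightarrow> 'v set"
  assumes club: "club \<kappa> \<P> D" and \<kappa>: "|elts (omega :: 'v)| <o \<kappa>"
    and d: "\<And>F. finite F \<Longrightarrow> F \<subseteq> A \<Longrightarrow> d F \<in> D" and d_mono: "\<And>F G. finite F \<Longrightarrow> G \<subseteq> F \<Longrightarrow> d G \<subseteq> d F"
begin

text \<open>Initial pieces of an enumeration of B form a chain cofinal among its finite subsets, so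
  the union is that of an \<omega>-chain in D.\<close>

lemma Union_finite_in_club:
  assumes B: "countable B" "B \<subseteq> A"
  shows "(\<Union>F \<in> {F. finite F \<and> F \<subseteq> B}. d F) \<in> D"
proof (cases "B = {}")
  case True
  then have "{F. finite F \<and> F \<subseteq> B} = {{}}" by auto
  then show ?thesis using d[of "{}"] by simp
next
  case False
  define F where "F n = from_nat_into B ` {..<n}" for n
  have r: "range (from_nat_into B) = B" using range_from_nat_into[OF False B(1)] .
  have F: "finite (F n)" "F n \<subseteq> B" for n unfolding F_def using r by auto
  have "(\<Union>n. d (F n)) \<in> D"
  proof (rule club_Union_omega[OF club \<kappa>])
    show "d (F n) \<in> D" for n using d[OF F(1) order_trans[OF F(2) B(2)]] .
    show "d (F n) \<subseteq> d (F (Suc n))" for n by (rule d_mono[OF F(1)]) (auto simp: F_def)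
  qed
  moreover have "(\<Union>n. d (F n)) = (\<Union>F \<in> {F. finite F \<and> F \<subseteq> B}. d F)"
  proof
    show "(\<Union>n. d (F n)) \<subseteq> (\<Union>F \<in> {F. finite F \<and> F \<subseteq> B}. d F)" using F by blast
    have cof: "\<exists>n. G \<subseteq> F n" if "finite G" "G \<subseteq> B" for G
    proof -
      obtain N where N: "finite N" "G = from_nat_into B ` N"
        using finite_subset_image[OF \<open>finite G\<close>, of "from_nat_into B" UNIV] r \<open>G \<subseteq> B\<close> by auto
      then have "N \<subseteq> {..<Suc (Max N)}" using Max_ge less_Suc_eq_le by blast
      then show ?thesis using N(2) unfolding F_def by blast
    qed
    show "(\<Union>F \<in> {F. finite F \<and> F \<subseteq> B}. d F) \<subseteq> (\<Union>n. d (F n))"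
    proof (rule UN_least)
      fix G assume "G \<in> {F. finite F \<and> F \<subseteq> B}"
      then obtain n where "G \<subseteq> F n" using cof by blast
      from d_mono[OF F(1) this] show "d G \<subseteq> (\<Union>n. d (F n))" by blast
    qed
  qed
  ultimately show ?thesis by simp
qed

text \<open>A set of size \<open>\<aleph>\<^sub>1\<close> closed under \<open>d\<close> is the union of an \<open>\<omega>\<^sub>1\<close>-chain of countably generated members of \<open>D\<close>.\<close>

lemma closed_in_club:
  assumes \<kappa>1: "|omega1 :: 'v set| <o \<kappa>" and N: "N \<subseteq> A" "|N| \<le>o aleph1" "N \<noteq> {}"
    and closed: "\<And>F. finite F \<Longrightarrow> F \<subseteq> N \<Longrightarrow> F \<subseteq> d F \<and> d F \<subseteq> N"
  shows "N \<in> D"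
proof -
  obtain x :: "'v \<Rightarrow> 'v" where x: "x ` omega1 = N" using enumerate_aleph1[OF N(2,3)] by blast
  define W where "W \<alpha> = (\<Union>F \<in> {F. finite F \<and> F \<subseteq> x ` elts \<alpha>}. d F)" for \<alpha> :: 'v
  have e: "elts (vset omega1 :: 'v) = omega1" by (rule elts_vset[OF small_omega1])
  have sub: "x ` elts \<alpha> \<subseteq> N" if "\<alpha> \<in> omega1" for \<alpha> using x omega1_small_elts[OF that] by blast
  have "W \<alpha> \<in> D" if "\<alpha> \<in> omega1" for \<alpha>
    unfolding W_def by (rule Union_finite_in_club) (use sub[OF that] N(1) that in \<open>auto simp: omega1_def\<close>)
  moreover have "W \<beta> \<subseteq> W \<alpha>" if "\<alpha> \<in> omega1" "\<beta> \<in> elts \<alpha>" for \<alpha> \<beta>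
  proof -
    have "elts \<beta> \<subseteq> elts \<alpha>" using that by (auto simp: omega1_def Ord_def)
    from image_mono[OF this, of x] have "{F. finite F \<and> F \<subseteq> x ` elts \<beta>} \<subseteq> {F. finite F \<and> F \<subseteq> x ` elts \<alpha>}" by auto
    then show ?thesis unfolding W_def by (rule UN_mono[OF _ order_refl])
  qed
  moreover have "omega1 \<noteq> ({} :: 'v set)" using N(3) x by blast
  ultimately have "Ord (vset omega1 :: 'v) \<and> elts (vset omega1 :: 'v) \<noteq> {} \<and> |elts (vset omega1 :: 'v)| <o \<kappa> \<and>
      (\<forall>i \<in> elts (vset omega1). W i \<in> D) \<and> (\<forall>j \<in> elts (vset omega1). \<forall>i \<in> elts j. W i \<subseteq> W j)"
    unfolding e using \<kappa>1 Ord_omega1 by blast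
  then have "(\<Union>\<alpha> \<in> elts (vset omega1). W \<alpha>) \<in> D" using club unfolding club_def by blast
  moreover have "(\<Union>\<alpha> \<in> omega1. W \<alpha>) = N"
  proof
    show "(\<Union>\<alpha> \<in> omega1. W \<alpha>) \<subseteq> N"
    proof (rule UN_least)
      fix \<alpha> :: 'v assume "\<alpha> \<in> omega1"
      then have "d F \<subseteq> N" if "finite F" "F \<subseteq> x ` elts \<alpha>" for F
        using closed[OF that(1) order_trans[OF that(2) sub]] by (rule_tac conjunct2)
      then show "W \<alpha> \<subseteq> N" unfolding W_def by blast
    qed
    show "N \<subseteq> (\<Union>\<alpha> \<in> omega1. W \<alpha>)"
    proof
      fix y assume y: "y \<in> N"
      then obtain \<beta> where \<beta>: "\<beta> \<in> omega1" "y = x \<beta>" using x by blast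
      have "{y} \<subseteq> x ` elts (vsucc \<beta>)" using \<beta> by simp
      moreover have "y \<in> d {y}" using closed[of "{y}"] y by simp
      ultimately have "y \<in> W (vsucc \<beta>)" unfolding W_def by blast
      then show "y \<in> (\<Union>\<alpha> \<in> omega1. W \<alpha>)" using omega1_vsucc[OF \<beta>(1)] by blast
    qed
  qed
  ultimately show ?thesis using e by simp
qed

end

lemma countable_closure:
  assumes a: "countable a" "a \<subseteq> N"
    and \<Phi>: "\<And>F. finite F \<Longrightarrow> F \<subseteq> N \<Longrightarrow> countable (\<Phi> F) \<and> \<Phi> F \<subseteq> N"
  shows "\<exists>b. countable b \<and> a \<subseteq> b \<and> b \<subseteq> N \<and> (\<forall>F. finite F \<longrightarrow> F \<subseteq> b \<longrightarrow> \<Phi> F \<subseteq> b)"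
proof -
  define c where "c = rec_nat a (\<lambda>_ b. b \<union> (\<Union>F \<in> {F. finite F \<and> F \<subseteq> b}. \<Phi> F))"
  have c: "c 0 = a" "c (Suc n) = c n \<union> (\<Union>F \<in> {F. finite F \<and> F \<subseteq> c n}. \<Phi> F)" for n
    by (simp_all add: c_def)
  have cN: "countable (c n) \<and> c n \<subseteq> N" for n
  proof (induction n)
    case (Suc n)
    have "countable {F. finite F \<and> F \<subseteq> c n}" using countable_Collect_finite_subset Suc by blast
    moreover have "countable (\<Phi> F) \<and> \<Phi> F \<subseteq> N" if "finite F" "F \<subseteq> c n" for F
      by (rule \<Phi>[OF that(1) order_trans[OF that(2) conjunct2[OF Suc]]])
    ultimately show ?case unfolding c(2) using Suc by (auto intro!: countable_UN)
  qed (use a c in simp)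
  have mono: "c m \<subseteq> c n" if "m \<le> n" for m n using lift_Suc_mono_le[of c m n] c(2) that by blast
  have fin: "\<exists>n. F \<subseteq> c n" if "finite F" "F \<subseteq> (\<Union>n. c n)" for F
    using that
  proof (induction F rule: finite_induct)
    case (insert x F)
    then obtain m n where "F \<subseteq> c m" "x \<in> c n" by blast
    then have "insert x F \<subseteq> c (max m n)" using mono[of m "max m n"] mono[of n "max m n"] by auto
    then show ?case by blast
  qed simp
  have "\<Phi> F \<subseteq> (\<Union>n. c n)" if F: "finite F" "F \<subseteq> (\<Union>n. c n)" for F
  proof -
    obtain n where "F \<subseteq> c n" using fin[OF F] by blast
    then have "\<Phi> F \<subseteq> c (Suc n)" unfolding c(2) using F(1) by blast
    then show ?thesis by blast
  qed
  moreover have "countable (\<Union>n. c n)" "(\<Union>n. c n) \<subseteq> N" using cN by auto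
  moreover have "a \<subseteq> (\<Union>n. c n)" using c(1) by blast
  ultimately show ?thesis by blast
qed


lemma omega_less_aleph1: "|elts (omega :: 'v::zfc)| <o aleph1"
  by (simp add: ordLess_aleph1)

lemma omega_less_aleph2: "|elts (omega :: 'v::zfc)| <o aleph2"
  by (simp add: ordLess_aleph2 countable_ordLeq_aleph1)

lemma club_P_omega2_function:
  assumes "club aleph2 (P_omega2 A) D"
  shows "\<exists>d. (\<forall>F. finite F \<longrightarrow> F \<subseteq> A \<longrightarrow> d F \<in> D \<and> F \<subseteq> d F) \<and> (\<forall>F G. finite F \<longrightarrow> G \<subseteq> F \<longrightarrow> d G \<subseteq> d F)"
proof (rule monotone_cofinal_function[where I = "P_omega2 A"])
  show "F \<in> P_omega2 A" if "finite F" "F \<subseteq> A" for F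
    using that unfolding P_omega2_def ordLess_aleph2 by (simp add: countable_ordLeq_aleph1 countable_finite)
  show "B \<union> C \<in> P_omega2 A" if "B \<in> P_omega2 A" "C \<in> P_omega2 A" for B C
    using that unfolding P_omega2_def ordLess_aleph2 by (simp add: ordLeq_aleph1_Un)
qed (use assms in \<open>auto simp: club_def\<close>)

lemma ctbl_subsets_superset:
  assumes "infinite A" "countable B" "B \<subseteq> A"
  shows "\<exists>C \<in> ctbl_subsets A. B \<subseteq> C"
proof -
  obtain C where "countable C" "infinite C" "C \<subseteq> A" using infinite_countable_subset'[OF assms(1)] by blast
  then have "B \<union> C \<in> ctbl_subsets A" using assms by (simp add: ctbl_subsets_def)
  then show ?thesis by blast
qed

text \<open>Finite sets are not in \<open>ctbl_subsets A\<close>, whose members are infinite. The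
  construction therefore starts from the ideal of all countable subsets, each of which is contained
  in an infinite countable one.\<close>

lemma club_ctbl_subsets_function:
  assumes club: "club aleph1 (ctbl_subsets A) D" and inf: "infinite A"
  shows "\<exists>d. (\<forall>F. finite F \<longrightarrow> F \<subseteq> A \<longrightarrow> d F \<in> D \<and> F \<subseteq> d F) \<and> (\<forall>F G. finite F \<longrightarrow> G \<subseteq> F \<longrightarrow> d G \<subseteq> d F)"
proof (rule monotone_cofinal_function[where I = "{B. countable B \<and> B \<subseteq> A}"])
  show "D \<subseteq> {B. countable B \<and> B \<subseteq> A}" using club by (auto simp: club_def ctbl_subsets_def)
  show "\<exists>C \<in> D. B \<subseteq> C" if "B \<in> {B. countable B \<and> B \<subseteq> A}" for B
  proof -
    obtain C where "C \<in> ctbl_subsets A" "B \<subseteq> C" using ctbl_subsets_superset[OF inf] \<open>B \<in> _\<close> by blast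
    then show ?thesis using club unfolding club_def by (meson order_trans)
  qed
qed (auto intro: countable_finite)

section \<open>Reflection\<close>

text \<open>A countable language has no room for aleph_1 many values of g at one argument, so these
  are listed by an additional argument in \<open>omega1\<close>. The submodel contains
  \<open>omega1\<close> and hence all the values.\<close>

lemma RP_internal_closed:
  fixes X :: "'v::zfc" and g :: "'v set \<Rightarrow> 'v set"
  assumes RP: "RP_internal TYPE('v)" and X: "uncountable (elts X)" and S: "stationary (elts X) (elts ` S)"
    and g: "\<And>Z. finite Z \<Longrightarrow> |g Z| \<le>o aleph1 \<and> g Z \<subseteq> elts X"
  shows "\<exists>W. |W| =o aleph1 \<and> (\<forall>Z. finite Z \<longrightarrow> Z \<subseteq> W \<longrightarrow> g Z \<subseteq> W) \<and>
    stationary (W \<inter> elts X) (elts ` (S \<inter> W) \<inter> ctbl_subsets (W \<inter> elts X))"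
proof -
  obtain \<theta> :: 'v where \<theta>: "regular_cardinal \<theta>" "X \<in> H \<theta>" using ex_regular_cardinal by blast
  obtain x0 where x0: "x0 \<in> elts X" using X by (metis countable_empty all_not_in_conv)
  define \<epsilon> :: "'v set \<Rightarrow> 'v \<Rightarrow> 'v" where "\<epsilon> B = (SOME f. f ` omega1 = B)" for B
  have \<epsilon>: "\<epsilon> (insert x0 (g Z)) ` omega1 = insert x0 (g Z)" if "finite Z" for Z
  proof -
    have "insert x0 (g Z) = {x0} \<union> g Z" by simp
    then have "|insert x0 (g Z)| \<le>o aleph1" using g[OF that] ordLeq_aleph1_Un[of "{x0}" "g Z"] countable_ordLeq_aleph1[of "{x0}"] by simp
    from enumerate_aleph1[OF this] show ?thesis unfolding \<epsilon>_def by (rule someI2_ex) auto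
  qed
  \<comment> \<open>The first argument is the index \<alpha>, and the remaining ones list the finite
    set Z. Without arguments, symbol 0 has to denote X. The element x0 of X is a default value, and
    inserting it makes the enumerated set nonempty.\<close>
  define F where "F n xs = (case xs of [] \<Rightarrow> if n = 0 then X else x0
    | \<alpha> # ys \<Rightarrow> if \<alpha> \<in> omega1 then \<epsilon> (insert x0 (g (set ys))) \<alpha> else x0)" for n :: nat and xs
  \<comment> \<open>The unary and the binary relation can be told apart by arity alone.\<close>
  define P where "P n xs = (case xs of [x] \<Rightarrow> x \<in> S | [x, y] \<Rightarrow> x \<in> elts y | _ \<Rightarrow> False)" for n :: nat and xs
  have FX: "F n xs = X \<or> F n xs \<in> elts X" for n xs
  proof (cases xs)
    case (Cons \<alpha> ys)
    have "\<epsilon> (insert x0 (g (set ys))) \<alpha> \<in> insert x0 (g (set ys))" if "\<alpha> \<in> omega1"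
      using \<epsilon>[of "set ys"] that by (metis List.finite_set imageI)
    then show ?thesis using g[of "set ys"] x0 Cons by (auto simp: F_def)
  qed (use x0 in \<open>simp add: F_def\<close>)
  have "fo_structure (H \<theta>) F" unfolding fo_structure_def using FX \<theta>(2) H_elts by (metis empty_iff)
  moreover have "F 0 [] = X" by (simp add: F_def)
  moreover have "\<forall>x \<in> H \<theta>. \<forall>y \<in> H \<theta>. P 0 [x, y] \<longleftrightarrow> x \<in> elts y" "\<forall>x \<in> H \<theta>. P 1 [x] \<longleftrightarrow> x \<in> S" by (simp_all add: P_def)
  ultimately have "\<exists>W. elementary_substructure W (H \<theta>) F P \<and> |W| =o aleph1 \<and> omega1 \<subseteq> W \<and>
      stationary (W \<inter> elts X) (elts ` (S \<inter> W) \<inter> ctbl_subsets (W \<inter> elts X))"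
    by (intro RP[unfolded RP_internal_def, THEN spec, THEN spec, THEN spec, THEN spec, THEN spec, THEN mp] conjI X S \<theta>)
  then obtain W where W: "elementary_substructure W (H \<theta>) F P" "|W| =o aleph1" "omega1 \<subseteq> W"
    "stationary (W \<inter> elts X) (elts ` (S \<inter> W) \<inter> ctbl_subsets (W \<inter> elts X))"
    by blast
  have "g Z \<subseteq> W" if Z: "finite Z" "Z \<subseteq> W" for Z
  proof
    fix y assume "y \<in> g Z"
    then obtain \<alpha> where \<alpha>: "\<alpha> \<in> omega1" "y = \<epsilon> (insert x0 (g Z)) \<alpha>" using \<epsilon>[OF Z(1)] by blast
    obtain ys where ys: "set ys = Z" using finite_list[OF Z(1)] by blast
    have "F 0 (\<alpha> # ys) \<in> W"
      using W(1,3) \<alpha>(1) Z(2) ys unfolding elementary_substructure_def fo_structure_def by auto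
    then show "y \<in> W" using \<alpha> ys by (simp add: F_def)
  qed
  then show ?thesis using W(2,4) by blast
qed

section \<open>Bad countable sets and the reflection argument\<close>

definition extensions ::
    "'v::zfc ring \<Rightarrow> ('v, 'v) module set \<Rightarrow> ('v, 'v) module \<Rightarrow> 'v set \<Rightarrow> 'v set set"
  where "extensions R \<C> M a = {b \<in> ctbl_subsets (carrier M). a \<subseteq> b \<and> fext R \<C> M (span R M a) (span R M b)}"

context
  fixes R :: "'v::zfc ring" and M :: "('v, 'v) module" and \<C> :: "('v, 'v) module set" and D :: "'v set set"
  assumes RP: "RP_internal TYPE('v)" and smR: "small (carrier R)" and cardR: "|carrier R| \<le>o aleph1"
    and \<C>: "\<And>C. C \<in> \<C> \<Longrightarrow> is_module R C \<and> countably_presented R C"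
    and M: "is_module R M" and uncountable: "uncountable (carrier M)"
    and club: "club aleph2 (P_omega2 (carrier M)) D"
    and D: "\<And>W. W \<in> D \<Longrightarrow> is_module R (M\<lparr>carrier := span R M W\<rparr>) \<and>
      sigma_closed_potentially_filtered R \<C> (M\<lparr>carrier := span R M W\<rparr>)"
begin

interpretation left_module R M
  using M unfolding is_module_def by blast

definition "bad a \<longleftrightarrow> a \<in> ctbl_subsets (carrier M) \<and> \<not> stationary (carrier M) (extensions R \<C> M a)"

lemma span_empty: "span R M {} = {\<zero>\<^bsub>M\<^esub>}"
  using span_least[OF submodule_zero] submoduleD(2)[OF submodule_span[of "{}"]] by fastforce

lemma card_smult: "|(\<lambda>(a, x). a \<odot>\<^bsub>M\<^esub> x) ` (carrier R \<times> Z)| \<le>o aleph1" if "finite Z"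
proof -
  have "|Z| \<le>o aleph1" using that by (simp add: countable_ordLeq_aleph1 countable_finite)
  then have "|carrier R \<times> Z| \<le>o aleph1" by (rule ordLeq_aleph1_Times[OF cardR])
  then show ?thesis using card_of_image ordLeq_transitive by blast
qed

text \<open>N is the reflected module and T the reflected stationary set; for a bad a, the function
  \<open>e a\<close> generates a club avoiding the extensions of a. Stationarity provides an a in T
  closed under the Hill function. Were it bad, a countable b in N containing a and closed under both
  functions would lie in \<open>E a\<close> and yet extend a.\<close>

lemma closed_set_reflects:
  assumes N: "submodule N R M" "N \<in> D" and a: "|N| \<le>o aleph1" and T: "stationary N T"
    and e: "\<And>a F. a \<in> T \<Longrightarrow> bad a \<Longrightarrow> finite F \<Longrightarrow> F \<subseteq> N \<Longrightarrow> F \<subseteq> e a F \<and> e a F \<subseteq> N"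
    and E: "\<And>a F. bad a \<Longrightarrow> finite F \<Longrightarrow> F \<subseteq> carrier M \<Longrightarrow> e a F \<in> E a"
    and e_mono: "\<And>a F G. bad a \<Longrightarrow> finite F \<Longrightarrow> G \<subseteq> F \<Longrightarrow> e a G \<subseteq> e a F"
    and E_club: "\<And>a. bad a \<Longrightarrow> club aleph1 (ctbl_subsets (carrier M)) (E a)"
    and E_disj: "\<And>a. bad a \<Longrightarrow> extensions R \<C> M a \<inter> E a = {}"
  shows "\<exists>a \<in> T. fext R \<C> M {\<zero>\<^bsub>M\<^esub>} (span R M a) \<and> \<not> bad a"
proof -
  have NM: "N \<subseteq> carrier M" using submoduleD(1)[OF N(1)] .
  have "span R M N = N" using span_submodule[OF N(1)] .
  \<comment> \<open>Since N is in D and spans itself, the hypothesis on D makes N potentially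
    filtered, and the bound on its size lets the name be interpreted.\<close>
  then have "\<exists>L U. indexed_filtration R \<C> (M\<lparr>carrier := N\<rparr>) N L U"
    using indexed_filtration_of_forced[of R "M\<lparr>carrier := N\<rparr>" \<C>] D[OF N(2)] a smR \<C> by simp
  then obtain L U where filt: "indexed_filtration R \<C> M N L U"
    using indexed_filtration_submodule[OF left_module_axioms N(1)] by blast
  have mods: "left_module R C \<and> countably_presented R C" if "C \<in> \<C>" for C using \<C>[OF that] unfolding is_module_def by blast
  from hill_lemma[OF left_module_axioms filt N(1) mods] obtain h where
    hill: "(\<forall>x \<in> N. countable (h x) \<and> h x \<subseteq> N) \<and>
    (\<forall>a b. a \<subseteq> b \<longrightarrow> b \<subseteq> N \<longrightarrow> countable b \<longrightarrow> (\<forall>x \<in> a. h x \<subseteq> a) \<longrightarrow> (\<forall>x \<in> b. h x \<subseteq> b) \<longrightarrow>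
      fext R \<C> M (span R M a) (span R M b))"
    by (rule exE)
  have h: "\<And>x. x \<in> N \<Longrightarrow> countable (h x) \<and> h x \<subseteq> N" and ext: "\<And>a b. a \<subseteq> b \<Longrightarrow> b \<subseteq> N \<Longrightarrow> countable b \<Longrightarrow> (\<forall>x \<in> a. h x \<subseteq> a) \<Longrightarrow> (\<forall>x \<in> b. h x \<subseteq> b) \<Longrightarrow>
      fext R \<C> M (span R M a) (span R M b)"
    using hill by simp_all
  have hF: "countable (\<Union>x \<in> F. h x) \<and> (\<Union>x \<in> F. h x) \<subseteq> N" if "finite F" "F \<subseteq> N" for F
  proof
    show "countable (\<Union>x \<in> F. h x)" using h that(2) by (intro countable_UN countable_finite[OF that(1)]) auto
    show "(\<Union>x \<in> F. h x) \<subseteq> N" using h that(2) by auto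
  qed
  let ?K = "{a \<in> ctbl_subsets N. \<forall>x \<in> a. h x \<subseteq> a}"
  have "club aleph1 (ctbl_subsets N) ?K"
    unfolding club_def
  proof (intro conjI ballI allI impI)
    fix A assume "A \<in> ctbl_subsets N"
    then have A: "countable A" "A \<subseteq> N" "infinite A" by (auto simp: ctbl_subsets_def)
    from countable_closure[OF A(1,2), of "\<lambda>F. \<Union>x \<in> F. h x", OF hF]
    obtain b where b: "countable b" "A \<subseteq> b" "b \<subseteq> N" "\<And>F. finite F \<Longrightarrow> F \<subseteq> b \<Longrightarrow> (\<Union>x \<in> F. h x) \<subseteq> b" by blast
    have "h x \<subseteq> b" if "x \<in> b" for x using b(4)[of "{x}"] that by simp
    then have "b \<in> ?K" using b(1-3) A(3) finite_subset[OF b(2)] by (auto simp: ctbl_subsets_def)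
    then show "\<exists>B \<in> ?K. A \<subseteq> B" using b(2) by blast
  next
    fix \<alpha> W assume W: "Ord \<alpha> \<and> elts \<alpha> \<noteq> {} \<and> |elts \<alpha>| <o aleph1 \<and> (\<forall>i \<in> elts \<alpha>. W i \<in> ?K) \<and>
      (\<forall>j \<in> elts \<alpha>. \<forall>i \<in> elts j. W i \<subseteq> W j)"
    then obtain i where i: "i \<in> elts \<alpha>" by blast
    have "countable (\<Union>i \<in> elts \<alpha>. W i)" using W by (auto simp: ordLess_aleph1 ctbl_subsets_def intro: countable_UN)
    moreover have "infinite (\<Union>i \<in> elts \<alpha>. W i)" using W i infinite_super[of "W i" "\<Union>i \<in> elts \<alpha>. W i"] by (auto simp: ctbl_subsets_def)
    ultimately show "(\<Union>i \<in> elts \<alpha>. W i) \<in> ?K" using W by (auto simp: ctbl_subsets_def)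
  qed auto
  then obtain a where a: "a \<in> T" "a \<in> ctbl_subsets N" "\<And>x. x \<in> a \<Longrightarrow> h x \<subseteq> a" using T unfolding stationary_def by blast
  have a': "countable a" "a \<subseteq> N" using a(2) by (auto simp: ctbl_subsets_def)
  \<comment> \<open>The empty set is closed and spans zero, so extension from zero is a special case
    of the Hill lemma.\<close>
  have "fext R \<C> M (span R M {}) (span R M a)" using ext[of "{}" a] a' a(3) by blast
  moreover have "\<not> bad a"
  proof
    assume bad: "bad a"
    have Ea: "F \<subseteq> e a F \<and> countable (e a F) \<and> e a F \<subseteq> N" if "finite F" "F \<subseteq> N" for F
    proof -
      have "e a F \<in> ctbl_subsets (carrier M)"
        using E[OF bad that(1) order_trans[OF that(2) NM]] E_club[OF bad] unfolding club_def by blast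
      then show ?thesis using e[OF a(1) bad that] unfolding ctbl_subsets_def by blast
    qed
    have "countable (e a F \<union> (\<Union>x \<in> F. h x)) \<and> e a F \<union> (\<Union>x \<in> F. h x) \<subseteq> N" if "finite F" "F \<subseteq> N" for F
      using Ea[OF that] hF[OF that] by simp
    from countable_closure[OF a', of "\<lambda>F. e a F \<union> (\<Union>x \<in> F. h x)", OF this]
    obtain b where b: "countable b" "a \<subseteq> b" "b \<subseteq> N" and b': "\<forall>F. finite F \<longrightarrow> F \<subseteq> b \<longrightarrow> e a F \<union> (\<Union>x \<in> F. h x) \<subseteq> b"
      by auto
    have hb: "h x \<subseteq> b" if "x \<in> b" for x using b'[THEN spec, of "{x}"] that by simp
    have "(\<Union>F \<in> {F. finite F \<and> F \<subseteq> b}. e a F) \<in> E a"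
      by (rule Union_finite_in_club[OF E_club[OF bad] omega_less_aleph1 E[OF bad] e_mono[OF bad] b(1) order_trans[OF b(3) NM]])
    moreover have "(\<Union>F \<in> {F. finite F \<and> F \<subseteq> b}. e a F) = b"
    proof
      show "(\<Union>F \<in> {F. finite F \<and> F \<subseteq> b}. e a F) \<subseteq> b" using b' by blast
      show "b \<subseteq> (\<Union>F \<in> {F. finite F \<and> F \<subseteq> b}. e a F)"
      proof
        fix x assume x: "x \<in> b"
        then have "x \<in> e a {x}" using Ea[of "{x}"] b(3) by auto
        then show "x \<in> (\<Union>F \<in> {F. finite F \<and> F \<subseteq> b}. e a F)" using x by blast
      qed
    qed
    ultimately have "b \<in> E a" by simp
    moreover have "b \<in> extensions R \<C> M a"
    proof -
      have "b \<in> ctbl_subsets (carrier M)"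
        using b a(2) NM finite_subset[OF b(2)] by (auto simp: ctbl_subsets_def)
      then show ?thesis unfolding extensions_def using ext[OF b(2,3,1)] a(3) hb b(2) by blast
    qed
    ultimately show False using E_disj[OF bad] by blast
  qed
  ultimately show ?thesis using a(1) span_empty by auto
qed

text \<open>Otherwise the countable sets violating either half of the sufficient condition meet
  every club. They are then stationary, and reflecting them produces one that violates neither
  half.\<close>

lemma club_of_extendable:
  "\<exists>Q. club aleph1 (ctbl_subsets (carrier M)) Q \<and>
    (\<forall>a \<in> Q. fext R \<C> M {\<zero>\<^bsub>M\<^esub>} (span R M a) \<and> stationary (carrier M) (extensions R \<C> M a))"
proof (rule ccontr)
  assume contr: "\<nexists>Q. club aleph1 (ctbl_subsets (carrier M)) Q \<and>
    (\<forall>a \<in> Q. fext R \<C> M {\<zero>\<^bsub>M\<^esub>} (span R M a) \<and> stationary (carrier M) (extensions R \<C> M a))"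
  let ?A = "carrier M"
  let ?B = "{a \<in> ctbl_subsets ?A. \<not> (fext R \<C> M {\<zero>\<^bsub>M\<^esub>} (span R M a) \<and> stationary ?A (extensions R \<C> M a))}"
  have stat: "stationary ?A ?B"
    unfolding stationary_def[of ?A ?B]
  proof (intro conjI allI impI)
    show "?B \<subseteq> ctbl_subsets ?A" by blast
    fix Q assume Q: "club aleph1 (ctbl_subsets ?A) Q"
    then obtain a where "a \<in> Q" "\<not> (fext R \<C> M {\<zero>\<^bsub>M\<^esub>} (span R M a) \<and> stationary ?A (extensions R \<C> M a))" using contr by blast
    moreover have "Q \<subseteq> ctbl_subsets ?A" using Q by (simp add: club_def)
    ultimately show "?B \<inter> Q \<noteq> {}" by blast
  qed
  have inf: "infinite ?A" using uncountable countable_finite by blast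
  have smM: "small ?A" using M unfolding is_module_def by blast
  define \<Psi> where "\<Psi> a E e \<longleftrightarrow> club aleph1 (ctbl_subsets ?A) E \<and> extensions R \<C> M a \<inter> E = {} \<and>
    (\<forall>F. finite F \<longrightarrow> F \<subseteq> ?A \<longrightarrow> e F \<in> E \<and> F \<subseteq> e F) \<and> (\<forall>F G. finite F \<longrightarrow> G \<subseteq> F \<longrightarrow> e G \<subseteq> e F)" for a E e
  have "\<exists>E e. \<Psi> a E e" if bad: "bad a" for a
  proof -
    have "extensions R \<C> M a \<subseteq> ctbl_subsets ?A" unfolding extensions_def by blast
    then obtain E where E: "club aleph1 (ctbl_subsets ?A) E" "extensions R \<C> M a \<inter> E = {}"
      using bad unfolding bad_def stationary_def by blast
    from club_ctbl_subsets_function[OF E(1) inf] obtain e where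
      "(\<forall>F. finite F \<longrightarrow> F \<subseteq> ?A \<longrightarrow> e F \<in> E \<and> F \<subseteq> e F) \<and> (\<forall>F G. finite F \<longrightarrow> G \<subseteq> F \<longrightarrow> e G \<subseteq> e F)" by (rule exE)
    with E show ?thesis unfolding \<Psi>_def by (intro exI[of _ E] exI[of _ e] conjI) simp_all
  qed
  then obtain E e where Ee: "\<And>a. bad a \<Longrightarrow> \<Psi> a (E a) (e a)" by metis
  note \<Psi> = Ee[unfolded \<Psi>_def]
  note E = conjunct1[OF \<Psi>] conjunct1[OF conjunct2[OF \<Psi>]]
  have e: "e a F \<in> E a \<and> F \<subseteq> e a F" if "bad a" "finite F" "F \<subseteq> ?A" for a F
    using conjunct1[OF conjunct2[OF conjunct2[OF \<Psi>[OF that(1)]]], THEN spec[of _ F]] that(2,3) by (rule_tac mp[OF mp])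
  have e_mono: "e a G \<subseteq> e a F" if "bad a" "finite F" "G \<subseteq> F" for a F G
    using conjunct2[OF conjunct2[OF conjunct2[OF \<Psi>[OF that(1)]]], THEN spec[of _ F], THEN spec[of _ G]] that(2,3)
    by (rule_tac mp[OF mp])
  have e_ctbl: "countable (e a F) \<and> e a F \<subseteq> ?A" if "bad a" "finite F" "F \<subseteq> ?A" for a F
  proof -
    have "e a F \<in> ctbl_subsets ?A"
      using E(1)[OF that(1), unfolded club_def, THEN conjunct1] conjunct1[OF e[OF that]] by (rule subsetD)
    then show ?thesis by (simp add: ctbl_subsets_def)
  qed
  obtain d where d': "(\<forall>F. finite F \<longrightarrow> F \<subseteq> ?A \<longrightarrow> d F \<in> D \<and> F \<subseteq> d F) \<and> (\<forall>F G. finite F \<longrightarrow> G \<subseteq> F \<longrightarrow> d G \<subseteq> d F)"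
    using club_P_omega2_function[OF club] by (rule exE)
  have d: "d F \<in> D" "F \<subseteq> d F" if "finite F" "F \<subseteq> ?A" for F
    using conjunct1[OF d', THEN spec[of _ F]] that by simp_all
  have d_mono: "d G \<subseteq> d F" if "finite F" "G \<subseteq> F" for F G
    using conjunct2[OF d', THEN spec[of _ F], THEN spec[of _ G]] that by simp
  have d_card: "|d F| \<le>o aleph1 \<and> d F \<subseteq> ?A" if "finite F" "F \<subseteq> ?A" for F
  proof -
    have "d F \<in> P_omega2 ?A"
      using club[unfolded club_def, THEN conjunct1] d(1)[OF that] by (rule subsetD)
    then show ?thesis unfolding P_omega2_def ordLess_aleph2 by simp
  qed
  \<comment> \<open>Everything the submodel must be closed under is collected in one function. In
    its last part b ranges over the members of Z whose extension is a bad set, which is why a bad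
    set must be an element of the submodel for its own function to act there.\<close>
  define g where "g Z = {\<zero>\<^bsub>M\<^esub>} \<union> (\<lambda>(x, y). x \<oplus>\<^bsub>M\<^esub> y) ` ((Z \<inter> ?A) \<times> (Z \<inter> ?A)) \<union>
    (\<lambda>(a, x). a \<odot>\<^bsub>M\<^esub> x) ` (carrier R \<times> (Z \<inter> ?A)) \<union> d (Z \<inter> ?A) \<union>
    (\<Union>b \<in> {b \<in> Z. bad (elts b)}. e (elts b) (Z \<inter> ?A))" for Z
  have g: "|g Z| \<le>o aleph1 \<and> g Z \<subseteq> elts (vset ?A)" if Z: "finite Z" for Z
  proof
    have f: "finite (Z \<inter> ?A)" "Z \<inter> ?A \<subseteq> ?A" using Z by auto
    have "countable (\<Union>b \<in> {b \<in> Z. bad (elts b)}. e (elts b) (Z \<inter> ?A))"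
      by (rule countable_UN[OF countable_finite]) (use Z e_ctbl[OF _ f] in auto)
    then show "|g Z| \<le>o aleph1"
      unfolding g_def using Z d_card[OF f] card_smult[OF f(1)]
      by (intro ordLeq_aleph1_Un) (auto intro!: countable_ordLeq_aleph1 countable_finite)
    have "(\<Union>b \<in> {b \<in> Z. bad (elts b)}. e (elts b) (Z \<inter> ?A)) \<subseteq> ?A" using e_ctbl[OF _ f] by blast
    then show "g Z \<subseteq> elts (vset ?A)"
      unfolding g_def using d_card[OF f] smM smult_closed by auto
  qed
  let ?S = "{x. elts x \<in> ?B}"
  have "elts ` ?S = ?B"
  proof
    show "?B \<subseteq> elts ` ?S"
    proof
      fix a assume a: "a \<in> ?B"
      then have "elts (vset a) = a" by (intro elts_vset small_countable) (auto simp: ctbl_subsets_def)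
      then show "a \<in> elts ` ?S" using a by (metis (mono_tags, lifting) imageI mem_Collect_eq)
    qed
  qed blast
  moreover have X: "elts (vset ?A) = ?A" by (rule elts_vset[OF smM])
  ultimately obtain W where W: "|W| =o aleph1" "\<And>Z. finite Z \<Longrightarrow> Z \<subseteq> W \<Longrightarrow> g Z \<subseteq> W"
    and T: "stationary (W \<inter> ?A) (elts ` (?S \<inter> W) \<inter> ctbl_subsets (W \<inter> ?A))"
    using RP_internal_closed[OF RP, of "vset ?A" ?S g] g uncountable stat by auto
  let ?N = "W \<inter> ?A"
  have N: "submodule ?N R M"
  proof (rule submoduleI)
    show "\<zero>\<^bsub>M\<^esub> \<in> ?N" using W(2)[of "{}"] by (auto simp: g_def)
    show "x \<oplus>\<^bsub>M\<^esub> y \<in> ?N" if "x \<in> ?N" "y \<in> ?N" for x y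
      using W(2)[of "{x, y}"] that by (force simp: g_def)
    show "a \<odot>\<^bsub>M\<^esub> x \<in> ?N" if "a \<in> carrier R" "x \<in> ?N" for a x
      using W(2)[of "{x}"] that smult_closed by (force simp: g_def)
  qed auto
  have card: "|?N| \<le>o aleph1" using ordLeq_aleph1_subset[of W ?N] ordIso_imp_ordLeq[OF W(1)] by blast
  have "?N \<in> D"
  proof (rule closed_in_club[OF club omega_less_aleph2 _ d_mono, of ?A])
    show "|omega1 :: 'v set| <o aleph2" using card_of_omega1 unfolding ordLess_aleph2 by (rule ordIso_imp_ordLeq)
    show "?N \<noteq> {}" using submoduleD(2)[OF N] by blast
    show "F \<subseteq> d F \<and> d F \<subseteq> ?N" if F: "finite F" "F \<subseteq> ?N" for F
    proof -
      have "F \<inter> ?A = F" using F(2) by blast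
      then show ?thesis using W(2)[of F] F d[of F] d_card[of F] by (auto simp: g_def)
    qed
  qed (use d card in auto)
  \<comment> \<open>Every member of the reflected set violates one of the two halves; the one found
    here satisfies both.\<close>
  have "\<exists>a \<in> elts ` (?S \<inter> W) \<inter> ctbl_subsets ?N. fext R \<C> M {\<zero>\<^bsub>M\<^esub>} (span R M a) \<and> \<not> bad a"
  proof (rule closed_set_reflects[OF N \<open>?N \<in> D\<close> card T, of e E])
    fix a F assume a: "a \<in> elts ` (?S \<inter> W) \<inter> ctbl_subsets ?N" "bad a" and F: "finite F" "F \<subseteq> ?N"
    then obtain b where b: "b \<in> W" "a = elts b" by blast
    \<comment> \<open>Including the code b in the argument activates the function of a. As b may
      itself be an element of M, the set \<open>?Z \<inter> ?A\<close> may be larger than F;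
      monotonicity absorbs the difference.\<close>
    let ?Z = "insert b F"
    have "e a F \<subseteq> e a (?Z \<inter> ?A)" by (rule e_mono[OF a(2)]) (use F in auto)
    also have "\<dots> \<subseteq> g ?Z" unfolding g_def using a(2) b(2) by blast
    also have "\<dots> \<subseteq> W" using W(2)[of ?Z] b(1) F by blast
    finally show "F \<subseteq> e a F \<and> e a F \<subseteq> ?N" using e[OF a(2) F(1)] e_ctbl[OF a(2) F(1)] F(2) by blast
  qed (rule conjunct1[OF e] e_mono E | assumption)+
  then show False unfolding bad_def by blast
qed

end


theorem theorem5p2:
  fixes R :: "'v::zfc ring" and \<C> :: "('v, 'v) module set"
  assumes "RP_internal TYPE('v)"
    and "ring R" and "small (carrier R)" and "|carrier R| \<le>o aleph1"
    and "\<forall>C \<in> \<C>. is_module R C \<and> countably_presented R C"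
  shows "aleph2_club_compact R
           {M. is_module R M \<and> sigma_closed_potentially_filtered R \<C> M}"
  unfolding aleph2_club_compact_def
proof (intro allI impI, elim exE conjE)
  fix M :: "('v, 'v) module" and D
  assume M: "is_module R M" and club: "club aleph2 (P_omega2 (carrier M)) D"
    and sub: "D \<subseteq> {W \<in> P_omega2 (carrier M). M\<lparr>carrier := span R M W\<rparr> \<in>
      {M. is_module R M \<and> sigma_closed_potentially_filtered R \<C> M}}"
  interpret left_module R M using M unfolding is_module_def by blast
  have smM: "small (carrier M)" using M unfolding is_module_def by blast
  have D: "is_module R (M\<lparr>carrier := span R M W\<rparr>) \<and> sigma_closed_potentially_filtered R \<C> (M\<lparr>carrier := span R M W\<rparr>)"
    if "W \<in> D" for W using subsetD[OF sub that] by simp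
  have \<C>: "is_module R C \<and> countably_presented R C" if "C \<in> \<C>" for C using assms(5) that by blast
  have "sigma_closed_potentially_filtered R \<C> M"
  proof (cases "|carrier M| \<le>o aleph1")
    \<comment> \<open>In this case M is itself a member of \<open>P_omega2\<close>, and cofinality
      of D puts its whole carrier into D.\<close>
    case True
    then have "carrier M \<in> P_omega2 (carrier M)" unfolding P_omega2_def ordLess_aleph2 by simp
    then obtain W where W: "W \<in> D" "carrier M \<subseteq> W" using club unfolding club_def by blast
    moreover have "W \<subseteq> carrier M" using subsetD[OF sub W(1)] unfolding P_omega2_def by simp
    ultimately have "span R M W = carrier M" using span_submodule[OF submodule_carrier] by simp
    then show ?thesis using D[OF W(1)] by simp
  next
    case False
    then have unc: "uncountable (carrier M)" using countable_ordLeq_aleph1 by blast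
    then have inf: "infinite (carrier M)" using countable_finite by blast
    let ?A = "carrier M"
    let ?ext = "extensions R \<C> M"
    obtain Q where Q: "club aleph1 (ctbl_subsets ?A) Q"
      "\<And>a. a \<in> Q \<Longrightarrow> fext R \<C> M {\<zero>\<^bsub>M\<^esub>} (span R M a) \<and> stationary ?A (?ext a)"
      using club_of_extendable[OF assms(1,3,4) \<C> M unc club D] by blast
    have Qsub: "Q \<subseteq> ctbl_subsets ?A" and Qcof: "\<And>a. a \<in> ctbl_subsets ?A \<Longrightarrow> \<exists>b \<in> Q. a \<subseteq> b"
      using Q(1) unfolding club_def by blast+
    show ?thesis
    proof (rule sigma_closed_potentially_filteredI[OF left_module_axioms smM assms(3), of \<C> Q])
      show "is_module R C" if "C \<in> \<C>" for C using \<C>[OF that] ..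
      show "Q \<noteq> {}" using Qcof ctbl_subsets_superset[OF inf, of "{}"] by blast
      show "b \<subseteq> ?A" if "b \<in> Q" for b using subsetD[OF Qsub that] by (simp add: ctbl_subsets_def)
      show "fext R \<C> M {\<zero>\<^bsub>M\<^esub>} (span R M b)" if "b \<in> Q" for b using Q(2)[OF that] ..
      show "(\<Union>n. b n) \<in> Q" if "\<And>n. b n \<in> Q" "\<And>n. b n \<subseteq> b (Suc n)" for b :: "nat \<Rightarrow> 'v set"
        by (rule club_Union_omega[OF Q(1) omega_less_aleph1]) (rule that)+
      fix b x assume b: "b \<in> Q" and x: "x \<in> ?A"
      \<comment> \<open>The stationary set of extensions of b is intersected with this club, giving
        an extension of b that stays in Q and contains the prescribed x.\<close>
      have "club aleph1 (ctbl_subsets ?A) {c \<in> Q. x \<in> c}"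
        unfolding club_def
      proof (intro conjI ballI allI impI)
        show "{c \<in> Q. x \<in> c} \<subseteq> ctbl_subsets ?A" using Qsub by blast
        fix a assume "a \<in> ctbl_subsets ?A"
        then have "insert x a \<in> ctbl_subsets ?A" using x by (simp add: ctbl_subsets_def)
        from Qcof[OF this] show "\<exists>B \<in> {c \<in> Q. x \<in> c}. a \<subseteq> B" by blast
      next
        fix \<alpha> :: 'v and W
        assume W: "Ord \<alpha> \<and> elts \<alpha> \<noteq> {} \<and> |elts \<alpha>| <o aleph1 \<and> (\<forall>i \<in> elts \<alpha>. W i \<in> {c \<in> Q. x \<in> c}) \<and>
          (\<forall>j \<in> elts \<alpha>. \<forall>i \<in> elts j. W i \<subseteq> W j)"
        then have "Ord \<alpha> \<and> elts \<alpha> \<noteq> {} \<and> |elts \<alpha>| <o aleph1 \<and> (\<forall>i \<in> elts \<alpha>. W i \<in> Q) \<and>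
          (\<forall>j \<in> elts \<alpha>. \<forall>i \<in> elts j. W i \<subseteq> W j)" by simp
        then have "(\<Union>i \<in> elts \<alpha>. W i) \<in> Q"
          by (rule Q(1)[unfolded club_def, THEN conjunct2, THEN conjunct2, THEN spec, THEN spec, THEN mp])
        moreover obtain i where "i \<in> elts \<alpha>" "x \<in> W i" using W by blast
        ultimately show "(\<Union>i \<in> elts \<alpha>. W i) \<in> {c \<in> Q. x \<in> c}" by blast
      qed
      from conjunct2[OF conjunct2[OF Q(2)[OF b], unfolded stationary_def], THEN spec, THEN mp, OF this]
      obtain c where "c \<in> ?ext b" "c \<in> {c \<in> Q. x \<in> c}" unfolding ex_in_conv[symmetric] by (elim exE IntE)
      then show "\<exists>c \<in> Q. b \<subseteq> c \<and> x \<in> c \<and> fext R \<C> M (span R M b) (span R M c)"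
        unfolding extensions_def by blast
    qed
  qed
  then show "M \<in> {M. is_module R M \<and> sigma_closed_potentially_filtered R \<C> M}" using M by simp
qed

end
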